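(* Let $\mathbf k$ be a commutative domain with field of fractions $\mathbb K$ and suppose that $R_n(\mathbf k[x])$ is a deformed cyclotomic KLR algebra with a graded content system $(\mathsf c,\mathsf r)$ with values in $\mathbf k[x]$. Then the algebra $R_n(\mathbb K[x^{\pm}])$ is a split semisimple algebra over $\mathbb K[x^{\pm}]$ (that is, isomorphic to a direct sum of matrix algebras over $\mathbb K[x^\pm]$) and $\{V_\lambda:\lambda\in\mathcal P_n\}$ is a complete set of pairwise non-isomorphic irreducible graded $R_n(\mathbb K[x^{\pm}])$-modules.
   Context: Quiver. $\Gamma$ has type $A^{(1)}_{e-1}$ ($e\ge2$) or $C^{(1)}_{e-1}$ ($e\ge3$), vertex set $I=\{0,\dots,e-1\}$, Cartan matrix $(c_{ij})$, symmetrisers $d_i$. Type $A$: all $d_i=1$; for $e\ge3$ arrows $i\to i+1$ (mod $e$) and $c_{ij}=-1$ for adjacent $i,j$; for $e=2$, $0\leftrightarrows1$ and $c_{01}=c_{10}=-2$. Type $C$: $0\Rightarrow1\to2\to\cdots\to e-2\Leftarrow e-1$ with $d_0=d_{e-1}=2$, other $d_i=1$, $c_{01}=c_{e-1,e-2}=-1$, $c_{10}=c_{e-2,e-1}=-2$ and $c_{ij}=-1$ for the other adjacent pairs. Always $c_{ii}=2$, and $c_{ij}=0$ for distinct non-adjacent $i,j$. Simple roots $\alpha_i$, fundamental weights $\Lambda_i$, $Q^+_n$ = elements of height $n$ of $\bigoplus_i\mathbb N\alpha_i$; $(\alpha_i|\alpha_j)=d_ic_{ij}$. Cyclotomic KLR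 algebras. Let $K$ be a $\mathbb Z$-graded commutative domain. $Q$-polynomials over $K$ are $Q_{ij}(u,v)=\sum_{p,q}t_{ij;pq}u^pv^q\in K[u,v]$ with $Q_{ij}(u,v)=Q_{ji}(v,u)$, $Q_{ii}=0$ and, for $i\ne j$, $t_{ij;pq}$ homogeneous (or zero) of degree $-2(\alpha_i|\alpha_j)-p(\alpha_i|\alpha_i)-q(\alpha_j|\alpha_j)$ and $t_{ij;-c_{ij},0}$ a unit of degree $0$. Weight polynomials are monic $W_i(u)\in K[u]$, homogeneous when $\deg u=2d_i$; put $l_i=\deg_uW_i$, $\Lambda=\sum_il_i\Lambda_i$, $\ell=\sum_il_i\ge1$. Put $Q_{ijk}(u,v,w)=\delta_{ik}\frac{Q_{ij}(u,v)-Q_{jk}(v,w)}{u-w}$. For $\alpha\in Q^+_n$ let $I^\alpha=\{\mathbf i\in I^n:\sum_k\alpha_{i_k}=\alpha\}$; $R_\alpha$ is the unital $K$-algebra generated by $1_{\mathbf i}$ ($\mathbf i\in I^\alpha$), $\psi_1,\dots,\psi_{n-1}$, $y_1,\dots,y_n$ with relations: $1_{\mathbf i}1_{\mathbf j}=\delta_{\mathbf i\mathbf j}1_{\mathbf i}$; $\sum1_{\mathbf i}=1$; $y_k1_{\mathbf i}=1_{\mathbf i}y_k$; $y_ky_m=y_my_k$; $\psi_ky_m=y_m\psi_k$ ($m\ne k,k+1$); $\psi_k\psi_m=\psi_m\psi_k$ ($|k-m|>1$); $\psi_k1_{\mathbf i}=1_{\sigma_k\mathbf i}\psi_k$ ($\sigma_k=(k,k+1)$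 acts by place permutation); $(\psi_ky_{k+1}-y_k\psi_k)1_{\mathbf i}=\delta_{i_ki_{k+1}}1_{\mathbf i}=(y_{k+1}\psi_k-\psi_ky_k)1_{\mathbf i}$; $\psi_k^21_{\mathbf i}=Q_{i_ki_{k+1}}(y_k,y_{k+1})1_{\mathbf i}$; $(\psi_{k+1}\psi_k\psi_{k+1}-\psi_k\psi_{k+1}\psi_k)1_{\mathbf i}=Q_{i_ki_{k+1}i_{k+2}}(y_k,y_{k+1},y_{k+2})1_{\mathbf i}$; $W_{i_1}(y_1)1_{\mathbf i}=0$. Grading: $\deg1_{\mathbf i}=0$, $\deg y_m1_{\mathbf i}=2d_{i_m}$, $\deg\psi_k1_{\mathbf i}=-(\alpha_{i_k}|\alpha_{i_{k+1}})$. $R_n=\bigoplus_{\alpha\in Q^+_n}R_\alpha$. Deformation and content system. $\mathbf k$ is in degree $0$, $x$ is an indeterminate of degree $1$, and $R_n(\mathbf k[x])$ is the algebra above over $K=\mathbf k[x]$ for given $Q_{ij},W_i$ over $\mathbf k[x]$; $R_n(L)=L\otimes_{\mathbf k[x]}R_n(\mathbf k[x])$. Fix $\rho\in I^\ell$ with $\Lambda=\sum_l\Lambda_{\rho_l}$. A graded content system with values in $\mathbf k[x]$ is a pair of maps $\mathsf c:\{1,\dots,\ell\}\times\mathbb Z\to\mathbf k[x]$, $\mathsf r:\{1,\dots,\ell\}\times\mathbb Z\to I$ with (a) $\mathsf r(l,0)=\rho_l$ and $W_i(u)=\prod_{l:\rho_l=i}(u-\mathsf c(l,0))$; (b) for all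 $(k,a)$ and $j\in\{\mathsf r(k,a-1),\mathsf r(k,a+1)\}$ there is $\epsilon\in\mathbf k^\times$ with $Q_{\mathsf r(k,a),j}(\mathsf c(k,a),v)=\epsilon\prod_{b\in\{a-1,a+1\},\,\mathsf r(k,b)=j}(\mathsf c(k,b)-v)$; (c) for $-n<a,b<n$, $(\mathsf r(k,a),\mathsf c(k,a))=(\mathsf r(l,b),\mathsf c(l,b))$ iff $(k,a)=(l,b)$; (graded) $\mathsf c(k,a)$ is zero or homogeneous of degree $2d_{\mathsf r(k,a)}$. Tableaux. $\mathcal P_n$ is the set of $\ell$-partitions $\lambda=(\lambda^{(1)}|\dots|\lambda^{(\ell)})$ of $n$, identified with $\{(k,r,c):1\le c\le\lambda^{(k)}_r\}$. $\lambda\trianglerighteq\mu$ if $\sum_{c<k}|\lambda^{(c)}|+\sum_{r\le s}\lambda^{(k)}_r\ge\sum_{c<k}|\mu^{(c)}|+\sum_{r\le s}\mu^{(k)}_r$ for all $k,s$. $\mathrm{Std}(\lambda)$ is the set of bijections $t:\lambda\to\{1,\dots,n\}$ increasing along rows and down columns of each component; $t_{\downarrow m}$ is the restriction to entries $\le m$; $s\trianglerighteq t$ if the shape of $s_{\downarrow m}$ dominates that of $t_{\downarrow m}$ for all $m$, and $s\triangleright t$ if also $s\ne t$. If $t^{-1}(m)=(k,r,c)$ then $\mathsf c_m(t)=\mathsf c(k,c-r)$, $\mathsf r_m(t)=\mathsf r(k,c-r)$; $\mathsf r(t)=(\mathsf r_1(t),\dots,\mathsf r_n(t))$. $\mathfrak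 S_n$ acts on tableaux by permuting entries. The modules $V_\lambda$. For a standard tableau $t$ and $1\le m<n$ put $Q_m(t)=Q_{\mathsf r_m(t),\mathsf r_{m+1}(t)}(\mathsf c_m(t),\mathsf c_{m+1}(t))-\dfrac{\delta_{\mathsf r_m(t),\mathsf r_{m+1}(t)}}{(\mathsf c_{m+1}(t)-\mathsf c_m(t))^2}$, and, when $t,\sigma_mt$ are standard, $\beta_m(t)=1$ if $\sigma_mt\triangleright t$ and $\beta_m(t)=Q_m(\sigma_mt)$ if $t\triangleright\sigma_mt$. $V_\lambda$ is the graded $R_n(\mathbb K[x^\pm])$-module that is $\mathbb K[x^\pm]$-free with homogeneous basis $\{v_t:t\in\mathrm{Std}(\lambda)\}$ and action $1_{\mathbf i}v_t=\delta_{\mathbf i,\mathsf r(t)}v_t$, $y_mv_t=\mathsf c_m(t)v_t$, $\psi_mv_t=\beta_m(t)v_{\sigma_mt}+\dfrac{\delta_{\mathsf r_m(t),\mathsf r_{m+1}(t)}}{\mathsf c_{m+1}(t)-\mathsf c_m(t)}v_t$, where $v_s=0$ if $s$ is not standard. An irreducible graded module is a nonzero graded module with no proper nonzero graded submodules; isomorphisms are homogeneous of degree $0$. *)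

theory Defs
  imports
    "HOL-Library.Poly_Mapping"
    "HOL-Library.FuncSet"
    "HOL-Library.Multiset"
    "HOL-Computational_Algebra.Polynomial_Factorial"
    "HOL-Combinatorics.Permutations"
    "HOL-Algebra.QuotRing"
    "HOL-Algebra.Generated_Groups"
    "Jordan_Normal_Form.Matrix"
begin

section \<open>Algebras over a commutative ring\<close>

text \<open>
  Algebras, possibly noncommutative, are records of type \<open>('s, 'a) module\<close>: the
  ring fields give the ring, \<open>smult\<close> the action of the scalars.  The scalars form a
  type.
\<close>

subsection \<open>Free algebras, quotients, direct sums, matrices\<close>

text \<open>
  The free monoid, written additively so that \<open>'g word \<Rightarrow>\<^sub>0 'a\<close> with the
  convolution product of \<open>Poly_Mapping\<close> is the free associative algebra on \<open>'g\<close>.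
\<close>

datatype 'g word = Word (letters: "'g list")

instantiation word :: (type) monoid_add
begin
definition zero_word :: "'a word" where "zero_word = Word []"
definition plus_word :: "'a word \<Rightarrow> 'a word \<Rightarrow> 'a word"
  where "plus_word v w = Word (letters v @ letters w)"
instance by standard (auto simp: zero_word_def plus_word_def)
end

definition fconst :: "'a \<Rightarrow> ('g word \<Rightarrow>\<^sub>0 'a::comm_ring_1)"
  where "fconst c = Poly_Mapping.single 0 c"

definition fgen :: "'g \<Rightarrow> ('g word \<Rightarrow>\<^sub>0 'a::comm_ring_1)"
  where "fgen g = Poly_Mapping.single (Word [g]) 1"

definition free_alg :: "'g set \<Rightarrow> ('a::comm_ring_1, 'g word \<Rightarrow>\<^sub>0 'a) module"
  where "free_alg X =
    \<lparr>carrier = {f. \<forall>w\<in>Poly_Mapping.keys f. set (letters w) \<subseteq> X},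
     mult = (*), one = 1, zero = 0, add = (+), smult = (\<lambda>c f. fconst c * f)\<rparr>"

definition quot_alg :: "('s, 'a) module \<Rightarrow> 'a set \<Rightarrow> ('s, 'a set) module"
  where "quot_alg A J =
    \<lparr>carrier = carrier (A Quot J), mult = mult (A Quot J), one = one (A Quot J),
     zero = zero (A Quot J), add = add (A Quot J),
     smult = (\<lambda>c X. \<Union>x\<in>X. J +>\<^bsub>A\<^esub> (c \<odot>\<^bsub>A\<^esub> x))\<rparr>"

text \<open>For finite index sets, which is all that is used, this is the direct sum.\<close>

definition prod_alg :: "'i set \<Rightarrow> ('i \<Rightarrow> ('s, 'a) module) \<Rightarrow> ('s, 'i \<Rightarrow> 'a) module"
  where "prod_alg J A =
    \<lparr>carrier = (\<Pi>\<^sub>E i\<in>J. carrier (A i)),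
     mult = (\<lambda>f g. \<lambda>i\<in>J. f i \<otimes>\<^bsub>A i\<^esub> g i), one = (\<lambda>i\<in>J. \<one>\<^bsub>A i\<^esub>),
     zero = (\<lambda>i\<in>J. \<zero>\<^bsub>A i\<^esub>), add = (\<lambda>f g. \<lambda>i\<in>J. f i \<oplus>\<^bsub>A i\<^esub> g i),
     smult = (\<lambda>c f. \<lambda>i\<in>J. c \<odot>\<^bsub>A i\<^esub> f i)\<rparr>"

definition alg_iso :: "('s, 'a) module \<Rightarrow> ('s, 'b) module \<Rightarrow> ('a \<Rightarrow> 'b) set"
  where "alg_iso A B =
    {h \<in> ring_iso A B. \<forall>c. \<forall>x\<in>carrier A. h (c \<odot>\<^bsub>A\<^esub> x) = c \<odot>\<^bsub>B\<^esub> h x}"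

definition split_semisimple :: "('s::comm_ring_1, 'a) module \<Rightarrow> bool"
  where "split_semisimple A \<longleftrightarrow>
    (\<exists>ds. (\<forall>d\<in>set ds. 0 < d) \<and>
      alg_iso A (prod_alg {..<length ds} (\<lambda>i. module_mat TYPE('s) (ds ! i) (ds ! i))) \<noteq> {})"

subsection \<open>Extension of scalars\<close>

text \<open>
  For a ring homomorphism \<open>\<phi>\<close> from the scalars of \<open>A\<close> to \<open>'l\<close>, the tensor product of
  \<open>'l\<close> and \<open>A\<close> over the scalars is the free abelian group on \<open>'l \<times> A\<close> modulo the
  subgroup generated by the bilinearity relations.  The free abelian group carries the
  bilinear product with \<open>(l, a) (l', a') = (l l', a a')\<close>, and the subgroup is a two-sided
  ideal, so that the quotient is a ring; its product is
  \<open>(l \<otimes> a) (l' \<otimes> a') = l l' \<otimes> a a'\<close>.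
\<close>

definition pair_alg :: "('s, 'a) module \<Rightarrow> ('l::comm_ring_1, ('l \<times> 'a) \<Rightarrow>\<^sub>0 int) module"
  where "pair_alg A =
    (let prd = (\<lambda>f g. \<Sum>p\<in>Poly_Mapping.keys f. \<Sum>q\<in>Poly_Mapping.keys g.
            Poly_Mapping.single (fst p * fst q, snd p \<otimes>\<^bsub>A\<^esub> snd q)
              (Poly_Mapping.lookup f p * Poly_Mapping.lookup g q))
     in \<lparr>carrier = {f. \<forall>p\<in>Poly_Mapping.keys f. snd p \<in> carrier A},
         mult = prd, one = Poly_Mapping.single (1, \<one>\<^bsub>A\<^esub>) 1, zero = 0, add = (+),
         smult = (\<lambda>l f. prd (Poly_Mapping.single (l, \<one>\<^bsub>A\<^esub>) 1) f)\<rparr>)"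

definition bilinear_rels ::
    "('s \<Rightarrow> 'l::comm_ring_1) \<Rightarrow> ('s, 'a) module \<Rightarrow> (('l \<times> 'a) \<Rightarrow>\<^sub>0 int) set"
  where "bilinear_rels \<phi> A =
    (let pr = (\<lambda>l a. Poly_Mapping.single (l, a) (1::int)) in
      {pr (l + l') a - pr l a - pr l' a | l l' a. a \<in> carrier A} \<union>
      {pr l (a \<oplus>\<^bsub>A\<^esub> b) - pr l a - pr l b | l a b. a \<in> carrier A \<and> b \<in> carrier A} \<union>
      {pr (l * \<phi> s) a - pr l (s \<odot>\<^bsub>A\<^esub> a) | l s a. a \<in> carrier A})"

definition tensor_kernel ::
    "('s \<Rightarrow> 'l::comm_ring_1) \<Rightarrow> ('s, 'a) module \<Rightarrow> (('l \<times> 'a) \<Rightarrow>\<^sub>0 int) set"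
  where "tensor_kernel \<phi> A = generate (add_monoid (pair_alg A)) (bilinear_rels \<phi> A)"

definition tensor_alg ::
    "('s \<Rightarrow> 'l::comm_ring_1) \<Rightarrow> ('s, 'a) module \<Rightarrow> ('l, (('l \<times> 'a) \<Rightarrow>\<^sub>0 int) set) module"
  where "tensor_alg \<phi> A = quot_alg (pair_alg A) (tensor_kernel \<phi> A)"

definition tensor ::
    "('s \<Rightarrow> 'l::comm_ring_1) \<Rightarrow> ('s, 'a) module \<Rightarrow> 'l \<Rightarrow> 'a \<Rightarrow> (('l \<times> 'a) \<Rightarrow>\<^sub>0 int) set"
  where "tensor \<phi> A l a = tensor_kernel \<phi> A +>\<^bsub>pair_alg A\<^esub> Poly_Mapping.single (l, a) 1"

subsection \<open>Graded algebras and graded modules\<close>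

text \<open>
  The grading of \<open>A\<close> determined by the degrees of a set of homogeneous algebra generators:
  \<open>(a, d) \<in> S\<close> says that \<open>a\<close> has degree \<open>d\<close>.
\<close>

inductive homogeneous_elt :: "('s, 'a) module \<Rightarrow> ('a \<times> int) set \<Rightarrow> int \<Rightarrow> 'a \<Rightarrow> bool"
  for A :: "('s, 'a) module" and S :: "('a \<times> int) set"
  where
    zero: "homogeneous_elt A S d \<zero>\<^bsub>A\<^esub>"
  | one: "homogeneous_elt A S 0 \<one>\<^bsub>A\<^esub>"
  | gen: "(a, d) \<in> S \<Longrightarrow> homogeneous_elt A S d a"
  | minus: "homogeneous_elt A S d a \<Longrightarrow> homogeneous_elt A S d (\<ominus>\<^bsub>A\<^esub> a)"
  | add: "homogeneous_elt A S d a \<Longrightarrow> homogeneous_elt A S d b \<Longrightarrow>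
      homogeneous_elt A S d (a \<oplus>\<^bsub>A\<^esub> b)"
  | mult: "homogeneous_elt A S d a \<Longrightarrow> homogeneous_elt A S d' b \<Longrightarrow>
      homogeneous_elt A S (d + d') (a \<otimes>\<^bsub>A\<^esub> b)"

definition gen_grading :: "('s, 'a) module \<Rightarrow> ('a \<times> int) set \<Rightarrow> int \<Rightarrow> 'a set"
  where "gen_grading A S d = {a. homogeneous_elt A S d a}"

text \<open>
  Left modules over a noncommutative ring (the library locale \<open>module\<close> requires a
  commutative one), with homogeneous components \<open>hcomp M d\<close>.  As in the library, the fields
  \<open>mult\<close> and \<open>one\<close> of a module record have no meaning.
\<close>

record ('r, 'm) gmodule = "('r, 'm) module" +
  hcomp :: "int \<Rightarrow> 'm set"

definition left_module :: "('s, 'r) module \<Rightarrow> ('r, 'm) gmodule \<Rightarrow> bool"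
  where "left_module R M \<longleftrightarrow> ring R \<and> abelian_group M \<and>
    (\<forall>a\<in>carrier R. \<forall>x\<in>carrier M. a \<odot>\<^bsub>M\<^esub> x \<in> carrier M) \<and>
    (\<forall>a\<in>carrier R. \<forall>x\<in>carrier M. \<forall>y\<in>carrier M.
      a \<odot>\<^bsub>M\<^esub> (x \<oplus>\<^bsub>M\<^esub> y) = a \<odot>\<^bsub>M\<^esub> x \<oplus>\<^bsub>M\<^esub> a \<odot>\<^bsub>M\<^esub> y) \<and>
    (\<forall>a\<in>carrier R. \<forall>b\<in>carrier R. \<forall>x\<in>carrier M.
      (a \<oplus>\<^bsub>R\<^esub> b) \<odot>\<^bsub>M\<^esub> x = a \<odot>\<^bsub>M\<^esub> x \<oplus>\<^bsub>M\<^esub> b \<odot>\<^bsub>M\<^esub> x) \<and>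
    (\<forall>a\<in>carrier R. \<forall>b\<in>carrier R. \<forall>x\<in>carrier M.
      (a \<otimes>\<^bsub>R\<^esub> b) \<odot>\<^bsub>M\<^esub> x = a \<odot>\<^bsub>M\<^esub> (b \<odot>\<^bsub>M\<^esub> x)) \<and>
    (\<forall>x\<in>carrier M. \<one>\<^bsub>R\<^esub> \<odot>\<^bsub>M\<^esub> x = x)"

definition homogeneous_decomposition ::
    "('r, 'm) gmodule \<Rightarrow> (int \<Rightarrow> 'm) \<Rightarrow> 'm \<Rightarrow> bool"
  where "homogeneous_decomposition M f x \<longleftrightarrow>
    (\<forall>d. f d \<in> hcomp M d) \<and> finite {d. f d \<noteq> \<zero>\<^bsub>M\<^esub>} \<and>
    x = (\<Oplus>\<^bsub>M\<^esub>d\<in>{d. f d \<noteq> \<zero>\<^bsub>M\<^esub>}. f d)"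

definition graded_module ::
    "('s, 'r) module \<Rightarrow> (int \<Rightarrow> 'r set) \<Rightarrow> ('r, 'm) gmodule \<Rightarrow> bool"
  where "graded_module R G M \<longleftrightarrow> left_module R M \<and>
    (\<forall>d. subgroup (hcomp M d) (add_monoid M)) \<and>
    (\<forall>x\<in>carrier M. \<exists>!f. homogeneous_decomposition M f x) \<and>
    (\<forall>d d'. \<forall>a\<in>G d. \<forall>x\<in>hcomp M d'. a \<odot>\<^bsub>M\<^esub> x \<in> hcomp M (d + d'))"

definition graded_submodule :: "('s, 'r) module \<Rightarrow> ('r, 'm) gmodule \<Rightarrow> 'm set \<Rightarrow> bool"
  where "graded_submodule R M N \<longleftrightarrow> subgroup N (add_monoid M) \<and>
    (\<forall>a\<in>carrier R. \<forall>x\<in>N. a \<odot>\<^bsub>M\<^esub> x \<in> N) \<and>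
    (\<forall>x\<in>N. \<exists>f. homogeneous_decomposition M f x \<and> (\<forall>d. f d \<in> N))"

definition irreducible_graded_module ::
    "('s, 'r) module \<Rightarrow> (int \<Rightarrow> 'r set) \<Rightarrow> ('r, 'm) gmodule \<Rightarrow> bool"
  where "irreducible_graded_module R G M \<longleftrightarrow> graded_module R G M \<and>
    carrier M \<noteq> {\<zero>\<^bsub>M\<^esub>} \<and>
    (\<forall>N. graded_submodule R M N \<longrightarrow> N = {\<zero>\<^bsub>M\<^esub>} \<or> N = carrier M)"

definition graded_isomorphic ::
    "('s, 'r) module \<Rightarrow> ('r, 'm) gmodule \<Rightarrow> ('r, 'n) gmodule \<Rightarrow> bool"
  where "graded_isomorphic R M N \<longleftrightarrow> (\<exists>h. bij_betw h (carrier M) (carrier N) \<and>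
    (\<forall>x\<in>carrier M. \<forall>y\<in>carrier M. h (x \<oplus>\<^bsub>M\<^esub> y) = h x \<oplus>\<^bsub>N\<^esub> h y) \<and>
    (\<forall>a\<in>carrier R. \<forall>x\<in>carrier M. h (a \<odot>\<^bsub>M\<^esub> x) = a \<odot>\<^bsub>N\<^esub> h x) \<and>
    (\<forall>d. h ` hcomp M d \<subseteq> hcomp N d))"


section \<open>Laurent polynomials\<close>

text \<open>
  Laurent polynomials form the group ring of the integers.  The variable \<open>x\<close> has degree 1,
  so the elements of degree \<open>d\<close> are the \<open>single d a\<close>.
\<close>

type_synonym 'a laurent = "int \<Rightarrow>\<^sub>0 'a"

definition to_laurent :: "'k::idom poly \<Rightarrow> 'k fract laurent"
  where "to_laurent p = (\<Sum>m\<le>degree p. Poly_Mapping.single (int m) (to_fract (coeff p m)))"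

text \<open>Only used for units; \<open>'k fract laurent\<close> is a domain.\<close>

definition laurent_inverse :: "'k::idom fract laurent \<Rightarrow> 'k fract laurent"
  where "laurent_inverse a = (THE b. a * b = 1)"

text \<open>Zero, or homogeneous of degree \<open>d\<close>.\<close>

definition homogeneous_poly :: "int \<Rightarrow> 'k::zero poly \<Rightarrow> bool"
  where "homogeneous_poly d p \<longleftrightarrow> (\<forall>m. coeff p m \<noteq> 0 \<longrightarrow> int m = d)"


section \<open>Cartan data\<close>

text \<open>The vertex set is \<open>{..<e}\<close>; the types stand for \<open>A\<^sup>(\<^sup>1\<^sup>)\<^sub>e\<^sub>-\<^sub>1\<close> and \<open>C\<^sup>(\<^sup>1\<^sup>)\<^sub>e\<^sub>-\<^sub>1\<close>.\<close>

datatype cartan_type = TypeA | TypeC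

definition admissible_rank :: "cartan_type \<Rightarrow> nat \<Rightarrow> bool"
  where "admissible_rank ty e \<longleftrightarrow> (case ty of TypeA \<Rightarrow> 2 \<le> e | TypeC \<Rightarrow> 3 \<le> e)"

definition cartan :: "cartan_type \<Rightarrow> nat \<Rightarrow> nat \<Rightarrow> nat \<Rightarrow> int"
  where "cartan ty e i j = (if i = j then 2 else
    (case ty of
      TypeA \<Rightarrow>
        if e = 2 then -2
        else if j = (i + 1) mod e \<or> i = (j + 1) mod e then -1 else 0
    | TypeC \<Rightarrow>
        if (i, j) = (1, 0) \<or> (i, j) = (e - 2, e - 1) then -2
        else if j = i + 1 \<or> i = j + 1 then -1 else 0))"

definition symmetriser :: "cartan_type \<Rightarrow> nat \<Rightarrow> nat \<Rightarrow> int"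
  where "symmetriser ty e i = (case ty of TypeA \<Rightarrow> 1
    | TypeC \<Rightarrow> if i = 0 \<or> i = e - 1 then 2 else 1)"

definition root_form :: "cartan_type \<Rightarrow> nat \<Rightarrow> nat \<Rightarrow> nat \<Rightarrow> int"
  where "root_form ty e i j = symmetriser ty e i * cartan ty e i j"

text \<open>An element of \<open>Q\<^sup>+\<close> is the multiset of its simple roots.\<close>

definition Qplus :: "nat \<Rightarrow> nat \<Rightarrow> nat multiset set"
  where "Qplus e n = {\<alpha>. set_mset \<alpha> \<subseteq> {..<e} \<and> size \<alpha> = n}"

definition seqs :: "nat \<Rightarrow> nat \<Rightarrow> nat list set"
  where "seqs e n = {is. set is \<subseteq> {..<e} \<and> length is = n}"

definition root_seqs :: "nat multiset \<Rightarrow> nat list set"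
  where "root_seqs \<alpha> = {is. mset is = \<alpha>}"

text \<open>Sequences are indexed from 1: \<open>entry is k\<close> is \<open>i\<^sub>k\<close>.\<close>

definition entry :: "nat list \<Rightarrow> nat \<Rightarrow> nat"
  where "entry is k = is ! (k - 1)"

definition swap_places :: "nat \<Rightarrow> nat list \<Rightarrow> nat list"
  where "swap_places k is = permute_list (transpose (k - 1) k) is"


section \<open>Cyclotomic KLR algebras\<close>

text \<open>
  A polynomial in \<open>u, v\<close> has type \<open>'a poly poly\<close> and one in \<open>u, v, w\<close> type
  \<open>'a poly poly poly\<close>, with \<open>u\<close> the outermost variable: the coefficient of \<open>u\<^sup>p v\<^sup>q\<close>
  in \<open>Q\<close> is \<open>coeff (coeff Q p) q\<close>.
\<close>

definition Q_polynomials ::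
    "cartan_type \<Rightarrow> nat \<Rightarrow> (nat \<Rightarrow> nat \<Rightarrow> 'k::idom poly poly poly) \<Rightarrow> bool"
  where "Q_polynomials ty e Q \<longleftrightarrow>
    (\<forall>i<e. Q i i = 0) \<and>
    (\<forall>i<e. \<forall>j<e. \<forall>p q. coeff (coeff (Q i j) p) q = coeff (coeff (Q j i) q) p) \<and>
    (\<forall>i<e. \<forall>j<e. i \<noteq> j \<longrightarrow>
      (\<forall>p q. homogeneous_poly
        (- 2 * root_form ty e i j - int p * root_form ty e i i - int q * root_form ty e j j)
        (coeff (coeff (Q i j) p) q)) \<and>
      coeff (coeff (Q i j) (nat (- cartan ty e i j))) 0 dvd 1)"

definition weight_polynomials ::
    "cartan_type \<Rightarrow> nat \<Rightarrow> (nat \<Rightarrow> 'k::idom poly poly) \<Rightarrow> bool"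
  where "weight_polynomials ty e W \<longleftrightarrow>
    (\<forall>i<e. lead_coeff (W i) = 1 \<and>
      (\<forall>p. homogeneous_poly
        (2 * symmetriser ty e i * (int (degree (W i)) - int p)) (coeff (W i) p)))"

definition level :: "nat \<Rightarrow> (nat \<Rightarrow> 'a::zero poly) \<Rightarrow> nat"
  where "level e W = (\<Sum>i<e. degree (W i))"

definition Q3 :: "(nat \<Rightarrow> nat \<Rightarrow> 'a::idom poly poly) \<Rightarrow> nat \<Rightarrow> nat \<Rightarrow> nat \<Rightarrow> 'a poly poly poly"
  where "Q3 Q i j k = (if i = k then
    (THE P. ([:0, 1:] - [:[:[:0, 1:]:]:]) * P
      = map_poly (map_poly (\<lambda>a. [:a:])) (Q i j) - [:Q j k:]) else 0)"

text \<open>Substitution of elements of a free algebra, with the variables in the order \<open>u, v, w\<close>.\<close>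

definition fsubst1 ::
    "'a::comm_ring_1 poly \<Rightarrow> ('g word \<Rightarrow>\<^sub>0 'a) \<Rightarrow> ('g word \<Rightarrow>\<^sub>0 'a)"
  where "fsubst1 P f = (\<Sum>p\<le>degree P. fconst (coeff P p) * f ^ p)"

definition fsubst2 ::
    "'a::comm_ring_1 poly poly \<Rightarrow> ('g word \<Rightarrow>\<^sub>0 'a) \<Rightarrow> ('g word \<Rightarrow>\<^sub>0 'a) \<Rightarrow> ('g word \<Rightarrow>\<^sub>0 'a)"
  where "fsubst2 P f g = (\<Sum>p\<le>degree P. f ^ p * fsubst1 (coeff P p) g)"

definition fsubst3 ::
    "'a::comm_ring_1 poly poly poly \<Rightarrow> ('g word \<Rightarrow>\<^sub>0 'a) \<Rightarrow> ('g word \<Rightarrow>\<^sub>0 'a) \<Rightarrow>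
      ('g word \<Rightarrow>\<^sub>0 'a) \<Rightarrow> ('g word \<Rightarrow>\<^sub>0 'a)"
  where "fsubst3 P f g h = (\<Sum>p\<le>degree P. f ^ p * fsubst2 (coeff P p) g h)"

datatype klr_gen = E "nat list" | Psi nat | Y nat

definition klr_gens :: "nat multiset \<Rightarrow> klr_gen set"
  where "klr_gens \<alpha> = E ` root_seqs \<alpha> \<union> Psi ` {1..<size \<alpha>} \<union> Y ` {1..size \<alpha>}"

definition klr_rels ::
    "(nat \<Rightarrow> nat \<Rightarrow> 'a::idom poly poly) \<Rightarrow> (nat \<Rightarrow> 'a poly) \<Rightarrow> nat multiset \<Rightarrow>
      (klr_gen word \<Rightarrow>\<^sub>0 'a) set"
  where "klr_rels Q W \<alpha> =
    (let n = size \<alpha>; I = root_seqs \<alpha>;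
         e = (\<lambda>is. fgen (E is)); \<psi> = (\<lambda>k. fgen (Psi k)); y = (\<lambda>k. fgen (Y k));
         \<delta> = (\<lambda>i j. if i = j then 1 else 0)
     in
      {e is * e js - (if is = js then e is else 0) | is js. is \<in> I \<and> js \<in> I} \<union>
      {(\<Sum>is\<in>I. e is) - 1} \<union>
      {y k * e is - e is * y k | k is. k \<in> {1..n} \<and> is \<in> I} \<union>
      {y k * y m - y m * y k | k m. k \<in> {1..n} \<and> m \<in> {1..n}} \<union>
      {\<psi> k * y m - y m * \<psi> k | k m.
        k \<in> {1..<n} \<and> m \<in> {1..n} \<and> m \<noteq> k \<and> m \<noteq> k + 1} \<union>
      {\<psi> k * \<psi> m - \<psi> m * \<psi> k | k m.
        k \<in> {1..<n} \<and> m \<in> {1..<n} \<and> 1 < \<bar>int k - int m\<bar>} \<union>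
      {\<psi> k * e is - e (swap_places k is) * \<psi> k | k is. k \<in> {1..<n} \<and> is \<in> I} \<union>
      {(\<psi> k * y (k + 1) - y k * \<psi> k) * e is - \<delta> (entry is k) (entry is (k + 1)) * e is | k is.
        k \<in> {1..<n} \<and> is \<in> I} \<union>
      {(y (k + 1) * \<psi> k - \<psi> k * y k) * e is - \<delta> (entry is k) (entry is (k + 1)) * e is | k is.
        k \<in> {1..<n} \<and> is \<in> I} \<union>
      {\<psi> k * \<psi> k * e is - fsubst2 (Q (entry is k) (entry is (k + 1))) (y k) (y (k + 1)) * e is | k is.
        k \<in> {1..<n} \<and> is \<in> I} \<union>
      {(\<psi> (k + 1) * \<psi> k * \<psi> (k + 1) - \<psi> k * \<psi> (k + 1) * \<psi> k) * e is
        - fsubst3 (Q3 Q (entry is k) (entry is (k + 1)) (entry is (k + 2)))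
            (y k) (y (k + 1)) (y (k + 2)) * e is | k is.
        1 \<le> k \<and> k + 1 < n \<and> is \<in> I} \<union>
      {fsubst1 (W (entry is 1)) (y 1) * e is | is. 1 \<le> n \<and> is \<in> I})"

definition klr_ideal ::
    "(nat \<Rightarrow> nat \<Rightarrow> 'a::idom poly poly) \<Rightarrow> (nat \<Rightarrow> 'a poly) \<Rightarrow> nat multiset \<Rightarrow>
      (klr_gen word \<Rightarrow>\<^sub>0 'a) set"
  where "klr_ideal Q W \<alpha> = Idl\<^bsub>free_alg (klr_gens \<alpha>)\<^esub> (klr_rels Q W \<alpha>)"

definition klr_block ::
    "(nat \<Rightarrow> nat \<Rightarrow> 'a::idom poly poly) \<Rightarrow> (nat \<Rightarrow> 'a poly) \<Rightarrow> nat multiset \<Rightarrow>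
      ('a, (klr_gen word \<Rightarrow>\<^sub>0 'a) set) module"
  where "klr_block Q W \<alpha> = quot_alg (free_alg (klr_gens \<alpha>)) (klr_ideal Q W \<alpha>)"

definition klr_alg ::
    "nat \<Rightarrow> nat \<Rightarrow> (nat \<Rightarrow> nat \<Rightarrow> 'a::idom poly poly) \<Rightarrow> (nat \<Rightarrow> 'a poly) \<Rightarrow>
      ('a, nat multiset \<Rightarrow> (klr_gen word \<Rightarrow>\<^sub>0 'a) set) module"
  where "klr_alg e n Q W = prod_alg (Qplus e n) (klr_block Q W)"

text \<open>
  The generators of the direct sum.  The idempotent of a sequence lies in one block;
  \<open>\<psi>\<^sub>k\<close> and \<open>y\<^sub>k\<close> are the sums of the generators of that name over all blocks.
\<close>

definition klr_elt ::
    "nat \<Rightarrow> nat \<Rightarrow> (nat \<Rightarrow> nat \<Rightarrow> 'a::idom poly poly) \<Rightarrow> (nat \<Rightarrow> 'a poly) \<Rightarrow> klr_gen \<Rightarrow>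
      nat multiset \<Rightarrow> (klr_gen word \<Rightarrow>\<^sub>0 'a) set"
  where "klr_elt e n Q W g = (\<lambda>\<alpha>\<in>Qplus e n.
    if g \<in> klr_gens \<alpha> then klr_ideal Q W \<alpha> +>\<^bsub>free_alg (klr_gens \<alpha>)\<^esub> fgen g
    else \<zero>\<^bsub>klr_block Q W \<alpha>\<^esub>)"

definition klr_grading ::
    "cartan_type \<Rightarrow> nat \<Rightarrow> nat \<Rightarrow> (nat \<Rightarrow> nat \<Rightarrow> 'k::idom poly poly poly) \<Rightarrow>
      (nat \<Rightarrow> 'k poly poly) \<Rightarrow> int \<Rightarrow> (nat multiset \<Rightarrow> (klr_gen word \<Rightarrow>\<^sub>0 'k poly) set) set"
  where "klr_grading ty e n Q W =
    (let A = klr_alg e n Q W; g = klr_elt e n Q W in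
     gen_grading A
      ({(p \<odot>\<^bsub>A\<^esub> \<one>\<^bsub>A\<^esub>, d) | p d. homogeneous_poly d p} \<union>
       {(g (E is), 0) | is. is \<in> seqs e n} \<union>
       {(g (Y m) \<otimes>\<^bsub>A\<^esub> g (E is), 2 * symmetriser ty e (entry is m)) | m is.
         m \<in> {1..n} \<and> is \<in> seqs e n} \<union>
       {(g (Psi k) \<otimes>\<^bsub>A\<^esub> g (E is), - root_form ty e (entry is k) (entry is (k + 1))) | k is.
         k \<in> {1..<n} \<and> is \<in> seqs e n}))"

subsection \<open>Scalar extension to Laurent polynomials\<close>

type_synonym 'k klr_laurent_elt =
  "(('k fract laurent \<times> (nat multiset \<Rightarrow> (klr_gen word \<Rightarrow>\<^sub>0 'k poly) set)) \<Rightarrow>\<^sub>0 int) set"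

definition klr_laurent ::
    "nat \<Rightarrow> nat \<Rightarrow> (nat \<Rightarrow> nat \<Rightarrow> 'k::idom poly poly poly) \<Rightarrow> (nat \<Rightarrow> 'k poly poly) \<Rightarrow>
      ('k fract laurent, 'k klr_laurent_elt) module"
  where "klr_laurent e n Q W = tensor_alg to_laurent (klr_alg e n Q W)"

definition klr_laurent_elt ::
    "nat \<Rightarrow> nat \<Rightarrow> (nat \<Rightarrow> nat \<Rightarrow> 'k::idom poly poly poly) \<Rightarrow> (nat \<Rightarrow> 'k poly poly) \<Rightarrow>
      klr_gen \<Rightarrow> 'k klr_laurent_elt"
  where "klr_laurent_elt e n Q W g =
    tensor to_laurent (klr_alg e n Q W) 1 (klr_elt e n Q W g)"

definition klr_laurent_grading ::
    "cartan_type \<Rightarrow> nat \<Rightarrow> nat \<Rightarrow> (nat \<Rightarrow> nat \<Rightarrow> 'k::idom poly poly poly) \<Rightarrow>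
      (nat \<Rightarrow> 'k poly poly) \<Rightarrow> int \<Rightarrow> 'k klr_laurent_elt set"
  where "klr_laurent_grading ty e n Q W = gen_grading (klr_laurent e n Q W)
    {(tensor to_laurent (klr_alg e n Q W) (Poly_Mapping.single d b) a, d + d') | d b d' a.
      a \<in> klr_grading ty e n Q W d'}"


section \<open>Graded content systems\<close>

text \<open>The value \<open>P(a, v)\<close>, a polynomial in \<open>v\<close>, is \<open>poly P [:a:]\<close>.\<close>

definition graded_content_system ::
    "cartan_type \<Rightarrow> nat \<Rightarrow> nat \<Rightarrow> (nat \<Rightarrow> nat \<Rightarrow> 'k::idom poly poly poly) \<Rightarrow>
      (nat \<Rightarrow> 'k poly poly) \<Rightarrow> (nat \<Rightarrow> nat) \<Rightarrow>
      (nat \<Rightarrow> int \<Rightarrow> 'k poly) \<Rightarrow> (nat \<Rightarrow> int \<Rightarrow> nat) \<Rightarrow> bool"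
  where "graded_content_system ty e n Q W \<rho> c r \<longleftrightarrow>
    (let K = {1..level e W} in
      (\<forall>k\<in>K. \<forall>a. r k a < e) \<and>
      (\<forall>l\<in>K. r l 0 = \<rho> l) \<and>
      (\<forall>i<e. W i = (\<Prod>l\<in>{l\<in>K. \<rho> l = i}. [:- c l 0, 1:])) \<and>
      (\<forall>k\<in>K. \<forall>a. \<forall>j\<in>{r k (a - 1), r k (a + 1)}. \<exists>\<epsilon>. \<epsilon> dvd 1 \<and>
        poly (Q (r k a) j) [:c k a:] =
          [:[:\<epsilon>:]:] * (\<Prod>b\<in>{b\<in>{a - 1, a + 1}. r k b = j}. [:c k b, - 1:])) \<and>
      (\<forall>k\<in>K. \<forall>l\<in>K. \<forall>a b. - int n < a \<and> a < int n \<and> - int n < b \<and> b < int n \<longrightarrow>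
        ((r k a, c k a) = (r l b, c l b) \<longleftrightarrow> (k, a) = (l, b))) \<and>
      (\<forall>k\<in>K. \<forall>a. homogeneous_poly (2 * symmetriser ty e (r k a)) (c k a)))"


section \<open>Multipartitions and tableaux\<close>

text \<open>
  \<open>\<nu> k r\<close> is the length of row \<open>r\<close> of component \<open>k\<close>, with components and rows numbered
  from 1 and zeros elsewhere.
\<close>

type_synonym multipartition = "nat \<Rightarrow> nat \<Rightarrow> nat"
type_synonym node = "nat \<times> nat \<times> nat"
type_synonym tableau = "node \<Rightarrow> nat"

definition component_size :: "(nat \<Rightarrow> nat) \<Rightarrow> nat"
  where "component_size \<kappa> = (\<Sum>r | \<kappa> r \<noteq> 0. \<kappa> r)"

definition multipartitions :: "nat \<Rightarrow> nat \<Rightarrow> multipartition set"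
  where "multipartitions l n = {\<nu>.
    (\<forall>k r. k \<notin> {1..l} \<or> r = 0 \<longrightarrow> \<nu> k r = 0) \<and>
    (\<forall>k. finite {r. \<nu> k r \<noteq> 0}) \<and>
    (\<forall>k. \<forall>r\<ge>1. \<nu> k (r + 1) \<le> \<nu> k r) \<and>
    (\<Sum>k=1..l. component_size (\<nu> k)) = n}"

definition diagram :: "multipartition \<Rightarrow> node set"
  where "diagram \<nu> = {(k, r, c). 1 \<le> k \<and> 1 \<le> r \<and> 1 \<le> c \<and> c \<le> \<nu> k r}"

definition dominates :: "nat \<Rightarrow> multipartition \<Rightarrow> multipartition \<Rightarrow> bool"
  where "dominates l \<nu> \<mu> \<longleftrightarrow> (\<forall>k\<in>{1..l}. \<forall>s.
    (\<Sum>c=1..<k. component_size (\<mu> c)) + (\<Sum>r=1..s. \<mu> k r)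
      \<le> (\<Sum>c=1..<k. component_size (\<nu> c)) + (\<Sum>r=1..s. \<nu> k r))"

text \<open>Tableaux take the value \<open>undefined\<close> off the diagram, so that they are functions on it.\<close>

definition Std :: "nat \<Rightarrow> multipartition \<Rightarrow> tableau set"
  where "Std n \<nu> = {t. t \<in> extensional (diagram \<nu>) \<and> bij_betw t (diagram \<nu>) {1..n} \<and>
    (\<forall>k r c. (k, r, c) \<in> diagram \<nu> \<longrightarrow>
      ((k, r, c + 1) \<in> diagram \<nu> \<longrightarrow> t (k, r, c) < t (k, r, c + 1)) \<and>
      ((k, r + 1, c) \<in> diagram \<nu> \<longrightarrow> t (k, r, c) < t (k, r + 1, c)))}"

definition shape_upto :: "multipartition \<Rightarrow> tableau \<Rightarrow> nat \<Rightarrow> multipartition"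
  where "shape_upto \<nu> t m = (\<lambda>k r. card {c. (k, r, c) \<in> diagram \<nu> \<and> t (k, r, c) \<le> m})"

definition tab_strictly_dominates ::
    "nat \<Rightarrow> multipartition \<Rightarrow> tableau \<Rightarrow> tableau \<Rightarrow> bool"
  where "tab_strictly_dominates l \<nu> s t \<longleftrightarrow>
    (\<forall>m. dominates l (shape_upto \<nu> s m) (shape_upto \<nu> t m)) \<and> s \<noteq> t"

definition swap_entries :: "multipartition \<Rightarrow> nat \<Rightarrow> tableau \<Rightarrow> tableau"
  where "swap_entries \<nu> m t = restrict (transpose m (m + 1) \<circ> t) (diagram \<nu>)"

definition on_content :: "(nat \<Rightarrow> int \<Rightarrow> 'b) \<Rightarrow> multipartition \<Rightarrow> tableau \<Rightarrow> nat \<Rightarrow> 'b"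
  where "on_content f \<nu> t m =
    (case inv_into (diagram \<nu>) t m of (k, r, c) \<Rightarrow> f k (int c - int r))"

definition residue_seq :: "nat \<Rightarrow> (nat \<Rightarrow> int \<Rightarrow> nat) \<Rightarrow> multipartition \<Rightarrow> tableau \<Rightarrow> nat list"
  where "residue_seq n r \<nu> t = map (on_content r \<nu> t) [1..<n + 1]"


section \<open>The modules \<open>V\<^sub>\<nu>\<close>\<close>

definition content_quotient ::
    "nat \<Rightarrow> (nat \<Rightarrow> int \<Rightarrow> 'k::idom poly) \<Rightarrow> (nat \<Rightarrow> int \<Rightarrow> nat) \<Rightarrow> multipartition \<Rightarrow> tableau \<Rightarrow>
      nat \<Rightarrow> 'k fract laurent"
  where "content_quotient i c r \<nu> t m =
    (if on_content r \<nu> t m = on_content r \<nu> t (m + 1)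
     then laurent_inverse
       ((to_laurent (on_content c \<nu> t (m + 1)) - to_laurent (on_content c \<nu> t m)) ^ i)
     else 0)"

definition Q_coeff ::
    "(nat \<Rightarrow> nat \<Rightarrow> 'k::idom poly poly poly) \<Rightarrow> (nat \<Rightarrow> int \<Rightarrow> 'k poly) \<Rightarrow>
      (nat \<Rightarrow> int \<Rightarrow> nat) \<Rightarrow> multipartition \<Rightarrow> tableau \<Rightarrow> nat \<Rightarrow> 'k fract laurent"
  where "Q_coeff Q c r \<nu> t m =
    to_laurent (poly (poly (Q (on_content r \<nu> t m) (on_content r \<nu> t (m + 1)))
      [:on_content c \<nu> t m:]) (on_content c \<nu> t (m + 1)))
    - content_quotient 2 c r \<nu> t m"

text \<open>Only used when \<open>t\<close> and \<open>\<sigma>\<^sub>m t\<close> are standard; one of the two then dominates the other.\<close>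

definition beta_coeff ::
    "nat \<Rightarrow> (nat \<Rightarrow> nat \<Rightarrow> 'k::idom poly poly poly) \<Rightarrow> (nat \<Rightarrow> int \<Rightarrow> 'k poly) \<Rightarrow>
      (nat \<Rightarrow> int \<Rightarrow> nat) \<Rightarrow> multipartition \<Rightarrow> tableau \<Rightarrow> nat \<Rightarrow> 'k fract laurent"
  where "beta_coeff l Q c r \<nu> t m =
    (if tab_strictly_dominates l \<nu> (swap_entries \<nu> m t) t then 1
     else Q_coeff Q c r \<nu> (swap_entries \<nu> m t) m)"

text \<open>
  \<open>M\<close> is a graded module \<open>V\<^sub>\<nu>\<close>.  Its elements are the finitely supported functions on the
  standard tableaux, and the basis vector \<open>v\<^sub>t\<close> is \<open>single t 1\<close>.  The generators determine
  the action; the degrees of the \<open>v\<^sub>t\<close> are only required to make \<open>M\<close> graded, which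
  determines them up to a common shift.
\<close>

definition is_V ::
    "cartan_type \<Rightarrow> nat \<Rightarrow> nat \<Rightarrow> (nat \<Rightarrow> nat \<Rightarrow> 'k::idom poly poly poly) \<Rightarrow>
      (nat \<Rightarrow> 'k poly poly) \<Rightarrow> (nat \<Rightarrow> int \<Rightarrow> 'k poly) \<Rightarrow> (nat \<Rightarrow> int \<Rightarrow> nat) \<Rightarrow>
      multipartition \<Rightarrow> ('k klr_laurent_elt, tableau \<Rightarrow>\<^sub>0 'k fract laurent) gmodule \<Rightarrow> bool"
  where "is_V ty e n Q W c r \<nu> M \<longleftrightarrow>
    (let R = klr_laurent e n Q W; g = klr_laurent_elt e n Q W;
         v = (\<lambda>t. Poly_Mapping.single t (1 :: 'k fract laurent))
     in
      graded_module R (klr_laurent_grading ty e n Q W) M \<and>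
      carrier M = {f. Poly_Mapping.keys f \<subseteq> Std n \<nu>} \<and> add M = (+) \<and> zero M = 0 \<and>
      (\<forall>a. \<forall>f\<in>carrier M. \<forall>t. Poly_Mapping.lookup ((a \<odot>\<^bsub>R\<^esub> \<one>\<^bsub>R\<^esub>) \<odot>\<^bsub>M\<^esub> f) t = a * Poly_Mapping.lookup f t) \<and>
      (\<forall>t\<in>Std n \<nu>.
        (\<exists>d. v t \<in> hcomp M d) \<and>
        (\<forall>is\<in>seqs e n. g (E is) \<odot>\<^bsub>M\<^esub> v t = (if is = residue_seq n r \<nu> t then v t else 0)) \<and>
        (\<forall>m\<in>{1..n}. g (Y m) \<odot>\<^bsub>M\<^esub> v t
          = Poly_Mapping.single t (to_laurent (on_content c \<nu> t m))) \<and>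
        (\<forall>m\<in>{1..<n}. g (Psi m) \<odot>\<^bsub>M\<^esub> v t
          = (if swap_entries \<nu> m t \<in> Std n \<nu>
             then Poly_Mapping.single (swap_entries \<nu> m t) (beta_coeff (level e W) Q c r \<nu> t m)
             else 0)
            + Poly_Mapping.single t (content_quotient 1 c r \<nu> t m))))"

end

theory Submission
 imports Defs
begin

text \<open>
 Over the field of fractions the differences of distinct contents of equal residue are
 invertible, so in any algebra satisfying the relations the joint generalised eigenspaces of
 the \<open>y\<^sub>m\<close> split into honest eigenspaces.  The relations and the content system force the
 residue and content sequence of a nonzero eigenvector to be that of a standard tableau
 (an induction on the number of strands), so \<open>1\<close> is the sum of explicit idempotents \<open>F\<^sub>t\<close>,
 which are Lagrange interpolation polynomials in the \<open>y\<^sub>m\<close> times \<open>1\<^sub>i\<close>.  The intertwiners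
 \<open>\<psi>\<^sub>m - \<delta>/(c\<^sub>m\<^sub>+\<^sub>1 - c\<^sub>m)\<close> move between the eigenspaces, satisfy the braid relations, and are invertible
 when both tableaux are standard; therefore \<open>R F\<^sub>t\<close> is spanned by one vector for each standard
 tableau of the shape of \<open>t\<close>.  The module \<open>V\<^sub>\<nu>\<close> shows that these vectors are linearly
 independent, so that the matrix coefficients of all \<open>V\<^sub>\<nu>\<close> give the isomorphism with a sum of
 matrix algebras.  A graded irreducible module has a homogeneous \<open>v = F\<^sub>t v \<noteq> 0\<close>; since
 homogeneous scalars are units, its annihilator is that of \<open>v\<^sub>t\<close>, and the module is \<open>V\<^sub>\<nu>\<close>.
 The degree of \<open>v\<^sub>t\<close> is a sum of the \<open>(\<alpha>\<^sub>i|\<alpha>\<^sub>j)\<close> over the inversions of \<open>t\<close>.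
\<close>

text \<open>The scalars \<open>K[x,x^-1]\<close> are not a field, so only homogeneous elements may
  be divided by: a nonzero one is a monomial, hence a unit. Differences of contents of equal residue
  are of this kind, but the content system separates contents only in absolute value below
  \<open>n\<close>; hence the bounds on contents beside the invertibility claims. The content system
  prescribes \<open>Q\<close> only at the residues beside a content. That \<open>Q\<close> is
  invertible at all remaining residues follows from degrees: comparing degrees recovers the Cartan
  integers, and the neighbours found in this way already exhaust those of the vertex. The delicate
  case of the induction on strands is a content beside the last one to which no addable node
  belongs. The quadratic relation does not exclude it; the braid relation does, once the removable
  node of that content has been carried next to the last strand. The relations bound the algebra
  only from above. That it does not collapse rests on the modules V: their relations have to be
  checked and then carried through blocks, ideals and the tensor product.\<close>

abbreviation single :: "'a \<Rightarrow> 'b \<Rightarrow> 'a \<Rightarrow>\<^sub>0 'b::zero" where "single \<equiv> Poly_Mapping.single"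
abbreviation keys :: "('a \<Rightarrow>\<^sub>0 'b::zero) \<Rightarrow> 'a set" where "keys \<equiv> Poly_Mapping.keys"
abbreviation lookup :: "('a \<Rightarrow>\<^sub>0 'b::zero) \<Rightarrow> 'a \<Rightarrow> 'b" where "lookup \<equiv> Poly_Mapping.lookup"
type_synonym 'a klr_free = "klr_gen word \<Rightarrow>\<^sub>0 'a"

section \<open>Young diagrams, addable nodes and contents\<close>

definition young :: "nat \<Rightarrow> node set \<Rightarrow> bool"
 where "young l D \<longleftrightarrow> finite D \<and> (\<forall>k r c. (k, r, c) \<in> D \<longrightarrow>
  1 \<le> k \<and> k \<le> l \<and> 1 \<le> r \<and> 1 \<le> c \<and>
  (1 < r \<longrightarrow> (k, r - 1, c) \<in> D) \<and> (1 < c \<longrightarrow> (k, r, c - 1) \<in> D))"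

definition addable :: "nat \<Rightarrow> node set \<Rightarrow> node set"
 where "addable l D = {A. A \<notin> D \<and> young l (insert A D)}"

definition cont :: "node \<Rightarrow> nat \<times> int"
 where "cont A = (case A of (k, r, c) \<Rightarrow> (k, int c - int r))"

lemma cont_simp [simp]: "cont (k, r, c) = (k, int c - int r)"
 by (simp add: cont_def)

text \<open>Equality is included, so that one statement about addable nodes excludes both coinciding
  and neighbouring contents.\<close>

definition near :: "nat \<times> int \<Rightarrow> nat \<times> int \<Rightarrow> bool"
 where "near p q \<longleftrightarrow> fst p = fst q \<and> \<bar>snd p - snd q\<bar> \<le> 1"

definition adj :: "node \<Rightarrow> node \<Rightarrow> bool"
 where "adj A B \<longleftrightarrow> (case A of (k, r, c) \<Rightarrow> B = (k, r, c + 1) \<or> B = (k, r + 1, c))"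

lemma young_empty [simp]: "young l {}"
 by (simp add: young_def)

lemma young_finite: "young l D \<Longrightarrow> finite D"
 by (simp add: young_def)

lemma young_Un: "young l D \<Longrightarrow> young l D' \<Longrightarrow> young l (D \<union> D')"
 by (fastforce simp: young_def)

lemma young_up: "young l D \<Longrightarrow> (k, r, c) \<in> D \<Longrightarrow> 1 < r \<Longrightarrow> (k, r - 1, c) \<in> D"
 and young_left: "young l D \<Longrightarrow> (k, r, c) \<in> D \<Longrightarrow> 1 < c \<Longrightarrow> (k, r, c - 1) \<in> D"
 by (simp_all add: young_def)

lemma young_row:
 assumes "young l D" and "(k, r, c) \<in> D" and "1 \<le> c'" and "c' \<le> c"
 shows "(k, r, c') \<in> D"
 using assms(4,2,3)
proof (induction rule: inc_induct)
 case (step m)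
 then have "(k, r, Suc m) \<in> D" "1 \<le> m" by auto
 with assms(1) show ?case unfolding young_def
  by (metis diff_Suc_1 less_Suc_eq_le)
qed auto

lemma young_col:
 assumes "young l D" and "(k, r, c) \<in> D" and "1 \<le> r'" and "r' \<le> r"
 shows "(k, r', c) \<in> D"
 using assms(4,2,3)
proof (induction rule: inc_induct)
 case (step m)
 then have "(k, Suc m, c) \<in> D" "1 \<le> m" by auto
 with assms(1) show ?case unfolding young_def
  by (metis diff_Suc_1 less_Suc_eq_le)
qed auto

lemma young_closed:
 assumes "young l D" and "(k, r, c) \<in> D" and "1 \<le> r'" and "r' \<le> r" and "1 \<le> c'" and "c' \<le> c"
 shows "(k, r', c') \<in> D"
 using assms by (meson young_row young_col)

lemma young_pos: "young l D \<Longrightarrow> (k, r, c) \<in> D \<Longrightarrow> 1 \<le> k \<and> k \<le> l \<and> 1 \<le> r \<and> 1 \<le> c"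
 by (simp add: young_def)

lemma young_card:
 assumes "young l D" and "(k, r, c) \<in> D"
 shows "r \<le> card D" and "c \<le> card D"
proof -
 have "{k} \<times> {1..r} \<times> {c} \<subseteq> D" "{k} \<times> {r} \<times> {1..c} \<subseteq> D"
  using young_col[OF assms] young_row[OF assms] by auto
 then show "r \<le> card D" "c \<le> card D"
  using card_mono[OF young_finite[OF assms(1)], of "{k} \<times> {1..r} \<times> {c}"]
   card_mono[OF young_finite[OF assms(1)], of "{k} \<times> {r} \<times> {1..c}"] by auto
qed

lemma young_content_bound:
 assumes "young l D" and "A \<in> D"
 shows "\<bar>snd (cont A)\<bar> < int (card D)"
proof -
 obtain k r c where A: "A = (k, r, c)" by (cases A)
 show ?thesis
  using young_card[of l D k r c] young_pos[of l D k r c] assms unfolding A by auto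
qed

text \<open>Addable nodes of one component never share a row, and the lower one lies strictly
  further left. Row and column therefore push the contents apart in the same direction, by at least
  2 in total.\<close>

lemma addable_far:
 assumes D: "young l D" and A: "A \<in> addable l D" and B: "B \<in> addable l D" and "A \<noteq> B"
 shows "\<not> near (cont A) (cont B)"
proof -
 have main: "\<not> near (cont (k, r, c)) (cont (k, r', c'))"
  if A: "(k, r, c) \<in> addable l D" and B: "(k, r', c') \<in> addable l D"
   and ne: "(r, c) \<noteq> (r', c')" and "r \<le> r'" for k r c r' c'
 proof -
  have yA: "young l (insert (k, r, c) D)" and yB: "young l (insert (k, r', c') D)"
   and nA: "(k, r, c) \<notin> D" and nB: "(k, r', c') \<notin> D"
   using A B by (auto simp: addable_def)
  have rc: "1 \<le> r" "1 \<le> c" "1 \<le> r'" "1 \<le> c'"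
   using young_pos[OF yA, of k r c] young_pos[OF yB, of k r' c'] by auto
  show ?thesis
 proof (cases "r = r'")
  case True
  have "c \<le> c' \<Longrightarrow> (k, r, c) \<in> D"
   using young_row[OF yB, of k r' c' c] rc True ne by auto
  moreover have "c' \<le> c \<Longrightarrow> (k, r', c') \<in> D"
   using young_row[OF yA, of k r c c'] rc True ne by auto
  ultimately show ?thesis using nA nB by linarith
 next
  case False
  have "(k, r, c') \<in> D"
   using young_col[OF yB, of k r' c' r] False \<open>r \<le> r'\<close> rc by auto
  then have "c' < c" using young_row[OF D, of k r c' c] nA rc by (meson not_le)
  then show ?thesis using False \<open>r \<le> r'\<close> by (auto simp: near_def)
 qed
 qed
 obtain k r c where A': "A = (k, r, c)" by (cases A)
 obtain k' r' c' where B': "B = (k', r', c')" by (cases B)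
 show ?thesis
 proof (cases "k = k'")
  case True
  then show ?thesis
   using main[of k r c r' c'] main[of k r' c' r c] A B \<open>A \<noteq> B\<close> unfolding A' B'
   by (cases "r \<le> r'") (auto simp: near_def)
 qed (simp add: A' B' near_def)
qed

lemma adj_near: "adj A B \<Longrightarrow> near (cont A) (cont B) \<and> cont A \<noteq> cont B"
 by (cases A) (auto simp: adj_def near_def)

text \<open>Without \<open>A\<close>, closure under going up and left can fail at \<open>B\<close>
  only if \<open>A\<close> is the missing predecessor of \<open>B\<close>.\<close>

lemma addable_insert_cases:
 assumes D: "young l D" and A: "A \<in> addable l D" and B: "B \<in> addable l (insert A D)"
 shows "B \<in> addable l D \<or> adj A B"
proof (rule disjCI)
 assume "\<not> adj A B"
 obtain k r c where B': "B = (k, r, c)" by (cases B)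
 have y: "young l (insert B (insert A D))" and "B \<notin> insert A D" using B by (auto simp: addable_def)
 have "young l (insert B D)"
  unfolding young_def
 proof (intro conjI allI impI)
  show "finite (insert B D)" using D by (simp add: young_finite)
  fix k' r' c' assume C: "(k', r', c') \<in> insert B D"
  then have C': "(k', r', c') \<in> insert B (insert A D)" by auto
  from young_pos[OF y C'] show "1 \<le> k'" "k' \<le> l" "1 \<le> r'" "1 \<le> c'" by auto
  show "(k', r' - 1, c') \<in> insert B D" if "1 < r'"
  proof -
   have "B = (k', r', c') \<Longrightarrow> A \<noteq> (k', r' - 1, c')" using \<open>\<not> adj A B\<close> that by (auto simp: adj_def)
   then show ?thesis using young_up[OF y C' that] young_up[OF D _ that, of k' c'] C by auto
  qed
  show "(k', r', c' - 1) \<in> insert B D" if "1 < c'"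
  proof -
   have "B = (k', r', c') \<Longrightarrow> A \<noteq> (k', r', c' - 1)" using \<open>\<not> adj A B\<close> that by (auto simp: adj_def)
   then show ?thesis using young_left[OF y C' that] young_left[OF D _ that, of k' r'] C by auto
  qed
 qed
 then show "B \<in> addable l D" using \<open>B \<notin> insert A D\<close> by (simp add: addable_def)
qed

lemma adj_not_addable:
 assumes "A \<notin> D" and "adj A B" and "A \<in> addable l D'"
 shows "B \<notin> addable l D"
proof
 assume B: "B \<in> addable l D"
 obtain k r c where A: "A = (k, r, c)" by (cases A)
 have "1 \<le> r" "1 \<le> c" using assms(3) young_pos[of l "insert A D'" k r c] by (auto simp: addable_def A)
 then have "A \<in> insert B D" using B assms(2) unfolding addable_def young_def A adj_def
  by fastforce
 then show False using assms(1,2) by (auto simp: adj_def A)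
qed

lemma addable_insert:
 assumes "A \<in> addable l D" and "B \<in> addable l D" and "A \<noteq> B"
 shows "B \<in> addable l (insert A D)"
 using young_Un[of l "insert A D" "insert B D"] assms
 by (auto simp: addable_def insert_commute)

text \<open>Among the two nodes that could follow \<open>A\<close>, the one of content
  \<open>q\<close> is blocked by a missing node diagonally beside it. That gap exposes the node of
  \<open>D\<close> just above or just left of \<open>A\<close> as a removable corner, and this
  corner has content \<open>q\<close>.\<close>

lemma missing_corner:
 assumes D: "young l D" and A: "A \<in> addable l D" and q: "near (cont A) q" "q \<noteq> cont A"
  and no: "q \<notin> cont ` addable l (insert A D)"
 obtains B where "B \<in> D" "cont B = q" "young l (D - {B})"
proof -
 obtain k r c where A': "A = (k, r, c)" by (cases A)
 have yA: "young l (insert A D)" and AD: "A \<notin> D" using A by (auto simp: addable_def)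
 have rc: "1 \<le> k" "k \<le> l" "1 \<le> r" "1 \<le> c" using young_pos[OF yA, of k r c] by (auto simp: A')
 consider "q = (k, int c - int r + 1)" | "q = (k, int c - int r - 1)"
  using q unfolding A' near_def cont_simp by (cases q) force
 then show thesis
 proof cases
  case 1
  have nD: "(k, r, c + 1) \<notin> insert A D"
   using young_row[OF D, of k r "c + 1" c] AD rc unfolding A' by auto
  have "(k, r, c + 1) \<notin> addable l (insert A D)"
   using no 1 by (force simp: image_iff)
  then have "\<not> young l (insert (k, r, c + 1) (insert A D))" using nD by (simp add: addable_def)
  then have r: "1 < r \<and> (k, r - 1, c + 1) \<notin> insert A D"
   using yA rc unfolding young_def A' by auto
  \<comment> \<open>Removable because its right neighbour is missing and the node below it is
    \<open>A\<close>, which is outside \<open>D\<close>.\<close>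
  let ?B = "(k, r - 1, c)"
  have B: "?B \<in> D" using young_up[OF yA, of k r c] r A' by auto
  have "young l (D - {?B})" unfolding young_def
  proof (intro conjI allI impI)
   show "finite (D - {?B})" using D by (simp add: young_finite)
   fix k' r' c' assume C: "(k', r', c') \<in> D - {?B}"
   then show "1 \<le> k'" "k' \<le> l" "1 \<le> r'" "1 \<le> c'" using young_pos[OF D] by auto
   show "(k', r' - 1, c') \<in> D - {?B}" if "1 < r'"
   proof -
    have "(k', r', c') \<in> D" using C by simp
    moreover from young_up[OF D this that] have "(k', r' - 1, c') \<in> D" .
    moreover have "r' - 1 = r - 1 \<Longrightarrow> 1 < r \<Longrightarrow> r' = r" "r' - 1 = r \<Longrightarrow> r' = r + 1" using that by linarith+
    ultimately show ?thesis using AD r unfolding A' by auto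
   qed
   show "(k', r', c' - 1) \<in> D - {?B}" if "1 < c'"
   proof -
    have "(k', r', c') \<in> D" using C by simp
    moreover from young_left[OF D this that] have "(k', r', c' - 1) \<in> D" .
    moreover have "c' - 1 = c - 1 \<Longrightarrow> 1 < c \<Longrightarrow> c' = c" "c' - 1 = c \<Longrightarrow> c' = c + 1" using that by linarith+
    ultimately show ?thesis using AD r unfolding A' by auto
   qed
  qed
  with B 1 r show thesis by (intro that[of ?B]) auto
 next
  case 2
  have nD: "(k, r + 1, c) \<notin> insert A D"
   using young_col[OF D, of k "r + 1" c r] AD rc unfolding A' by auto
  have "(k, r + 1, c) \<notin> addable l (insert A D)"
   using no 2 by (force simp: image_iff)
  then have "\<not> young l (insert (k, r + 1, c) (insert A D))" using nD by (simp add: addable_def)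
  then have r: "1 < c \<and> (k, r + 1, c - 1) \<notin> insert A D"
   using yA rc unfolding young_def A' by auto
  \<comment> \<open>The mirror image: the node below is missing and the right neighbour is
    \<open>A\<close>.\<close>
  let ?B = "(k, r, c - 1)"
  have B: "?B \<in> D" using young_left[OF yA, of k r c] r A' by auto
  have "young l (D - {?B})" unfolding young_def
  proof (intro conjI allI impI)
   show "finite (D - {?B})" using D by (simp add: young_finite)
   fix k' r' c' assume C: "(k', r', c') \<in> D - {?B}"
   then show "1 \<le> k'" "k' \<le> l" "1 \<le> r'" "1 \<le> c'" using young_pos[OF D] by auto
   show "(k', r' - 1, c') \<in> D - {?B}" if "1 < r'"
   proof -
    have "(k', r', c') \<in> D" using C by simp
    moreover from young_up[OF D this that] have "(k', r' - 1, c') \<in> D" .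
    moreover have "r' - 1 = r - 1 \<Longrightarrow> 1 < r \<Longrightarrow> r' = r" "r' - 1 = r \<Longrightarrow> r' = r + 1" using that by linarith+
    ultimately show ?thesis using AD r unfolding A' by auto
   qed
   show "(k', r', c' - 1) \<in> D - {?B}" if "1 < c'"
   proof -
    have "(k', r', c') \<in> D" using C by simp
    moreover from young_left[OF D this that] have "(k', r', c' - 1) \<in> D" .
    moreover have "c' - 1 = c - 1 \<Longrightarrow> 1 < c \<Longrightarrow> c' = c" "c' - 1 = c \<Longrightarrow> c' = c + 1" using that by linarith+
    ultimately show ?thesis using AD r unfolding A' by auto
   qed
  qed
  with B 2 r show thesis by (intro that[of ?B]) auto
 qed
qed

section \<open>Standard tableaux as lists of nodes\<close>

definition stdl :: "nat \<Rightarrow> node list \<Rightarrow> bool"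
 where "stdl l xs \<longleftrightarrow> (\<forall>m<length xs. xs ! m \<in> addable l (set (take m xs)))"

text \<open>A standard tableau is handled as the list of its nodes in the order of their entries. A
  simple transposition then becomes a swap of list positions, which makes sense also when the result
  is not standard.\<close>

definition sw :: "nat \<Rightarrow> 'a list \<Rightarrow> 'a list"
 where "sw p xs = xs[p := xs ! Suc p, Suc p := xs ! p]"

lemma length_sw [simp]: "length (sw p xs) = length xs"
 by (simp add: sw_def)

lemma nth_sw: "Suc p < length xs \<Longrightarrow> i < length xs \<Longrightarrow>
  sw p xs ! i = (if i = p then xs ! Suc p else if i = Suc p then xs ! p else xs ! i)"
 by (simp add: sw_def nth_list_update)

lemma sw_sw [simp]: "Suc p < length xs \<Longrightarrow> sw p (sw p xs) = xs"
 by (rule nth_equalityI) (auto simp: nth_sw)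

lemma sw_commute: "Suc p < length xs \<Longrightarrow> Suc q < length xs \<Longrightarrow> Suc p < q \<or> Suc q < p \<Longrightarrow>
  sw p (sw q xs) = sw q (sw p xs)"
 by (rule nth_equalityI) (auto simp: nth_sw)

lemma sw_braid: "Suc (Suc p) < length xs \<Longrightarrow>
  sw p (sw (Suc p) (sw p xs)) = sw (Suc p) (sw p (sw (Suc p) xs))"
 by (rule nth_equalityI) (auto simp: nth_sw)

lemma map_sw: "Suc p < length xs \<Longrightarrow> map f (sw p xs) = sw p (map f xs)"
 by (rule nth_equalityI) (auto simp: nth_sw)

lemma mset_sw [simp]: "Suc p < length xs \<Longrightarrow> mset (sw p xs) = mset xs"
 using mset_swap[of "Suc p" xs p] by (simp add: sw_def list_update_swap)

lemma set_sw [simp]: "Suc p < length xs \<Longrightarrow> set (sw p xs) = set xs"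
 by (rule mset_eq_setD) simp

lemma take_sw: "Suc p < m \<Longrightarrow> take m (sw p xs) = sw p (take m xs)"
 by (cases "m \<le> length xs") (auto simp: sw_def take_update_swap)

lemma take_sw_low: "m \<le> p \<Longrightarrow> take m (sw p xs) = take m xs"
 by (simp add: sw_def)

lemma drop_sw: "Suc p < m \<Longrightarrow> drop m (sw p xs) = drop m xs"
 by (simp add: sw_def)

lemma stdl_take: "stdl l xs \<Longrightarrow> stdl l (take m xs)"
 by (auto simp: stdl_def min_def)

lemma stdl_append: "stdl l (xs @ ys) \<Longrightarrow> stdl l xs"
 using stdl_take[of l "xs @ ys" "length xs"] by simp

lemma stdl_Nil [simp]: "stdl l []"
 by (simp add: stdl_def)

lemma stdl_snoc: "stdl l (xs @ [A]) \<longleftrightarrow> stdl l xs \<and> A \<in> addable l (set xs)"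
 by (auto simp: stdl_def less_Suc_eq nth_append)

lemma stdl_young: "stdl l xs \<Longrightarrow> young l (set xs)"
proof (induction xs rule: rev_induct)
 case (snoc A xs)
 then show ?case by (simp add: stdl_snoc addable_def)
qed simp

lemma stdl_distinct: "stdl l xs \<Longrightarrow> distinct xs"
proof (induction xs rule: rev_induct)
 case (snoc A xs)
 then show ?case by (simp add: stdl_snoc addable_def)
qed simp

lemma stdl_nth: "stdl l xs \<Longrightarrow> m < length xs \<Longrightarrow> xs ! m \<in> addable l (set (take m xs))"
 by (simp add: stdl_def)

lemma stdl_nth_Suc:
 assumes "stdl l xs" and "Suc p < length xs"
 shows "xs ! Suc p \<in> addable l (insert (xs ! p) (set (take p xs)))"
 using stdl_nth[OF assms] assms(2) by (simp add: take_Suc_conv_app_nth)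

lemma addable_commute:
 assumes D: "young l D" and A: "A \<in> addable l D" and B: "B \<in> addable l (insert A D)"
  and "\<not> adj A B"
 shows "B \<in> addable l D" and "A \<in> addable l (insert B D)" and "\<not> near (cont A) (cont B)"
proof -
 show B': "B \<in> addable l D" using addable_insert_cases[OF D A B] assms(4) by blast
 have "A \<noteq> B" using B by (auto simp: addable_def)
 then show "A \<in> addable l (insert B D)" "\<not> near (cont A) (cont B)"
  using addable_insert[OF B' A] addable_far[OF D A B'] by auto
qed

text \<open>Only the shape after \<open>p + 1\<close> nodes changes, and the second node can be
  added before the first unless it rests on it.\<close>

lemma stdl_sw_iff:
 assumes xs: "stdl l xs" and p: "Suc p < length xs"
 shows "stdl l (sw p xs) \<longleftrightarrow> \<not> adj (xs ! p) (xs ! Suc p)"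
proof
 let ?A = "xs ! p" and ?B = "xs ! Suc p" and ?D = "set (take p xs)"
 have D: "young l ?D" using stdl_young[OF stdl_take[OF xs]] .
 have A: "?A \<in> addable l ?D" using stdl_nth[OF xs] p by simp
 have B: "?B \<in> addable l (insert ?A ?D)" using stdl_nth_Suc[OF xs p] .
 show "\<not> adj ?A ?B" if "stdl l (sw p xs)"
 proof
  assume "adj ?A ?B"
  moreover have "?A \<notin> ?D" using A by (simp add: addable_def)
  ultimately have "?B \<notin> addable l ?D" using adj_not_addable A by blast
  moreover have "?B \<in> addable l ?D"
   using stdl_nth[OF that, of p] p by (simp add: nth_sw take_sw_low)
  ultimately show False by simp
 qed
 assume nadj: "\<not> adj ?A ?B"
 show "stdl l (sw p xs)" unfolding stdl_def
 proof (intro allI impI)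
  fix m assume m: "m < length (sw p xs)"
  consider "m < p" | "m = p" | "m = Suc p" | "Suc p < m" by linarith
  then show "sw p xs ! m \<in> addable l (set (take m (sw p xs)))"
  proof cases
   case 1
   then show ?thesis using stdl_nth[OF xs, of m] m p by (simp add: nth_sw take_sw_low)
  next
   case 2
   then show ?thesis using addable_commute[OF D A B nadj] p by (simp add: nth_sw take_sw_low)
  next
   case 3
   have "set (take (Suc p) (sw p xs)) = insert ?B ?D"
    using p by (simp add: take_Suc_conv_app_nth nth_sw take_sw_low)
   then show ?thesis using addable_commute[OF D A B nadj] p 3 by (simp add: nth_sw)
  next
   case 4
   then show ?thesis using stdl_nth[OF xs, of m] m p by (simp add: nth_sw take_sw)
  qed
 qed
qed

text \<open>Two consecutive nodes are either adjacent, with contents differing by 1, or both addable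
  to the same diagram and then far apart.\<close>

lemma stdl_cont_neq:
 assumes xs: "stdl l xs" and p: "Suc p < length xs"
 shows "cont (xs ! p) \<noteq> cont (xs ! Suc p)"
  and "near (cont (xs ! p)) (cont (xs ! Suc p)) \<longleftrightarrow> adj (xs ! p) (xs ! Suc p)"
proof -
 have D: "young l (set (take p xs))" using stdl_young[OF stdl_take[OF xs]] .
 have A: "xs ! p \<in> addable l (set (take p xs))" using stdl_nth[OF xs] p by simp
 have B: "xs ! Suc p \<in> addable l (insert (xs ! p) (set (take p xs)))" using stdl_nth_Suc[OF xs p] .
 show 2: "near (cont (xs ! p)) (cont (xs ! Suc p)) \<longleftrightarrow> adj (xs ! p) (xs ! Suc p)"
  using addable_commute[OF D A B] adj_near by blast
 show "cont (xs ! p) \<noteq> cont (xs ! Suc p)"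
 proof
  assume "cont (xs ! p) = cont (xs ! Suc p)"
  then have "near (cont (xs ! p)) (cont (xs ! Suc p))" by (simp add: near_def)
  with 2 adj_near \<open>cont (xs ! p) = cont (xs ! Suc p)\<close> show False by blast
 qed
qed

text \<open>If two nodes lie on one diagonal, both nodes that complete the square at the upper one,
  to its right and below it, must be added between them. There is room for only one node in
  between.\<close>

lemma stdl_cont_neq3:
 assumes xs: "stdl l xs" and p: "Suc (Suc p) < length xs"
 shows "cont (xs ! p) \<noteq> cont (xs ! Suc (Suc p))"
proof
 let ?A = "xs ! p" and ?B = "xs ! Suc p" and ?C = "xs ! Suc (Suc p)" and ?D = "set (take p xs)"
 assume eq: "cont ?A = cont ?C"
 obtain k r c where A: "?A = (k, r, c)" by (cases ?A)
 obtain k' r' c' where C: "?C = (k', r', c')" by (cases ?C)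
 have kk: "k' = k" and d: "int c - int r = int c' - int r'" using eq A C by auto
 have D: "young l ?D" using stdl_young[OF stdl_take[OF xs]] .
 have AD: "?A \<in> addable l ?D" using stdl_nth[OF xs] p by simp
 have CD: "?C \<in> addable l (insert ?B (insert ?A ?D))"
  using stdl_nth[OF xs p] p by (simp add: take_Suc_conv_app_nth insert_commute)
 have yC: "young l (insert ?C (insert ?B (insert ?A ?D)))" using CD by (simp add: addable_def)
 have yA: "young l (insert ?A ?D)" using AD by (simp add: addable_def)
 have pos: "1 \<le> r" "1 \<le> c" using young_pos[OF yA, of k r c] A by auto
 have "?C \<noteq> ?A" using stdl_distinct[OF xs] p by (simp add: nth_eq_iff_index_eq)
 then have "r \<noteq> r'" using d kk A C by auto
 have r: "r < r'"
 proof (rule ccontr)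
  assume "\<not> r < r'"
  then have "r' < r" "c' < c" using \<open>r \<noteq> r'\<close> d by auto
  moreover have "1 \<le> r'" "1 \<le> c'" using young_pos[OF yC, of k' r' c'] C by auto
  ultimately have "?C \<in> insert ?A ?D"
   using young_closed[OF yA, of k r c r' c'] A C kk by auto
  then show False using CD by (simp add: addable_def)
 qed
 then have c: "c < c'" using d by linarith
 have E: "(k, r, c + 1) \<in> insert ?C (insert ?B (insert ?A ?D))"
  "(k, r + 1, c) \<in> insert ?C (insert ?B (insert ?A ?D))"
  using young_closed[OF yC, of k' r' c' r "c + 1"] young_closed[OF yC, of k' r' c' "r + 1" c]
   C kk r c pos by auto
 have "(k, r, c + 1) \<notin> ?D" "(k, r + 1, c) \<notin> ?D"
  using young_closed[OF D, of k r "c + 1" r c] young_closed[OF D, of k "r + 1" c r c] AD A pos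
  by (auto simp: addable_def)
 then have "?B = (k, r, c + 1)" "?B = (k, r + 1, c)"
  using E A C r c by auto
 then show False by simp
qed

text \<open>A node that can be removed at the end supports no later node, so it may be delayed past
  its successor.\<close>

lemma stdl_move_right:
 assumes xs: "stdl l xs" and p: "Suc p < m" "m \<le> length xs"
  and rem: "young l (set (take m xs) - {xs ! p})"
 shows "stdl l (sw p xs)"
proof -
 have "\<not> adj (xs ! p) (xs ! Suc p)"
 proof
  assume a: "adj (xs ! p) (xs ! Suc p)"
  obtain k r c where A: "xs ! p = (k, r, c)" by (cases "xs ! p")
  have "xs ! p \<noteq> xs ! Suc p" using stdl_distinct[OF xs] p by (simp add: nth_eq_iff_index_eq)
  moreover have "xs ! Suc p \<in> set (take m xs)" using p nth_mem[of "Suc p" "take m xs"] by simp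
  ultimately have B: "xs ! Suc p \<in> set (take m xs) - {xs ! p}" by simp
  have "xs ! p \<in> set (take m xs)" using p nth_mem[of p "take m xs"] by simp
  then have "1 \<le> r" "1 \<le> c"
   using young_pos[OF stdl_young[OF stdl_take[OF xs]]] A by metis+
  then have "xs ! p \<in> set (take m xs) - {xs ! p}"
   using a B rem A unfolding adj_def young_def by fastforce
  then show False by simp
 qed
 then show ?thesis using stdl_sw_iff[OF xs] p by simp
qed

text \<open>A node with maximal \<open>r + c\<close> supports no other node.\<close>

lemma young_removable:
 assumes D: "young l D" and "D \<noteq> {}"
 obtains B where "B \<in> D" "young l (D - {B})"
proof -
 let ?f = "\<lambda>(k, r, c). r + c :: nat"
 have fin: "finite D" using D by (rule young_finite)
 obtain B where B: "B \<in> D" "?f B = Max (?f ` D)"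
  using Max_in[of "?f ` D"] fin assms(2) by fastforce
 then have max: "?f C \<le> ?f B" if "C \<in> D" for C using Max_ge[of "?f ` D" "?f C"] fin that by simp
 obtain k r c where B': "B = (k, r, c)" by (cases B)
 have "young l (D - {B})" unfolding young_def
 proof (intro conjI allI impI)
  show "finite (D - {B})" using fin by simp
  fix k' r' c' assume C: "(k', r', c') \<in> D - {B}"
  then show "1 \<le> k'" "k' \<le> l" "1 \<le> r'" "1 \<le> c'" using young_pos[OF D] by auto
  show "(k', r' - 1, c') \<in> D - {B}" if "1 < r'"
   using C that D max[of "(k', r', c')"] unfolding young_def B' by auto
  show "(k', r', c' - 1) \<in> D - {B}" if "1 < c'"
   using C that D max[of "(k', r', c')"] unfolding young_def B' by auto
 qed
 with B show thesis using that by blast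
qed

lemma stdl_exists:
 assumes "young l D"
 shows "\<exists>xs. stdl l xs \<and> set xs = D"
 using assms
proof (induction "card D" arbitrary: D)
 case 0
 then have "D = {}" using young_finite by auto
 then show ?case by (intro exI[of _ "[]"]) simp
next
 case (Suc m)
 then have "D \<noteq> {}" by auto
 then obtain B where B: "B \<in> D" "young l (D - {B})" using young_removable Suc.prems by blast
 moreover have "m = card (D - {B})" using Suc.hyps(2) B young_finite[OF Suc.prems] by simp
 ultimately obtain xs where "stdl l xs" "set xs = D - {B}" using Suc.hyps(1)[of "D - {B}"] by auto
 then have "stdl l (xs @ [B])" "set (xs @ [B]) = D"
  using B Suc.prems by (auto simp: stdl_snoc addable_def insert_absorb)
 then show ?case by blast
qed

text \<open>If a further strand follows, this bound leaves room for the neighbouring contents to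
  stay in the range where the content system separates contents.\<close>

lemma addable_Suc_content_bound:
 assumes "stdl l xs" and "A \<in> addable l (set xs)"
 shows "\<bar>snd (cont A)\<bar> \<le> int (length xs)"
proof -
 have "stdl l (xs @ [A])" using assms by (simp add: stdl_snoc)
 from young_content_bound[OF stdl_young[OF this], of A] stdl_distinct[OF this]
 show ?thesis by (simp add: distinct_card[symmetric])
qed

lemma finite_addable:
 assumes "stdl l xs"
 shows "finite (addable l (set xs))"
proof -
 have "addable l (set xs) \<subseteq> {..l} \<times> {..length xs + 1} \<times> {..length xs + 1}"
 proof
  fix A assume A: "A \<in> addable l (set xs)"
  obtain k r c where A': "A = (k, r, c)" by (cases A)
  have s: "stdl l (xs @ [A])" using A assms by (simp add: stdl_snoc)
  have y: "young l (insert A (set xs))" using A by (simp add: addable_def)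
  have "card (insert A (set xs)) \<le> length xs + 1"
   using card_length[of "A # xs"] by simp
  with young_card[OF y, of k r c] young_pos[OF y, of k r c] A'
  show "A \<in> {..l} \<times> {..length xs + 1} \<times> {..length xs + 1}" by auto
 qed
 then show ?thesis by (rule finite_subset) simp
qed

lemma finite_stdl: "finite {xs. stdl l xs \<and> length xs = n}"
proof -
 have "{xs. stdl l xs \<and> length xs = n} \<subseteq> {xs. set xs \<subseteq> {..l} \<times> {..n} \<times> {..n} \<and> length xs = n}"
 proof (rule subsetI)
  fix xs assume "xs \<in> {xs. stdl l xs \<and> length xs = n}"
  then have xs: "stdl l xs" "length xs = n" by auto
  have y: "young l (set xs)" using xs by (simp add: stdl_young)
  have "(k, r, c) \<in> {..l} \<times> {..n} \<times> {..n}" if A: "(k, r, c) \<in> set xs" for k r c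
   using young_card[OF y A] young_pos[OF y A] card_length[of xs] xs by auto
  then have "set xs \<subseteq> {..l} \<times> {..n} \<times> {..n}" by auto
  then show "xs \<in> {xs. set xs \<subseteq> {..l} \<times> {..n} \<times> {..n} \<and> length xs = n}" using xs by simp
 qed
 moreover have "finite {xs. set xs \<subseteq> {..l} \<times> {..n} \<times> {..n} \<and> length xs = n}"
  by (rule finite_lists_length_eq) simp
 ultimately show ?thesis by (rule finite_subset)
qed

section \<open>Induction in free algebras\<close>

lemma poly_mapping_sum_single:
 fixes f :: "'a \<Rightarrow>\<^sub>0 'b::comm_monoid_add"
 shows "f = (\<Sum>k\<in>keys f. single k (lookup f k))"
 by (rule poly_mapping_eqI)
  (auto simp: lookup_sum lookup_single when_def in_keys_iff sum.delta if_distrib cong: if_cong)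

lemma poly_mapping_add_induct [case_names zero single add]:
 fixes f :: "'a \<Rightarrow>\<^sub>0 'b::comm_monoid_add"
 assumes "P 0" and "\<And>k v. P (single k v)" and "\<And>f g. P f \<Longrightarrow> P g \<Longrightarrow> P (f + g)"
 shows "P f"
proof -
 have "P (\<Sum>k\<in>A. single k (lookup f k))" if "finite A" for A
  using that by induction (auto intro: assms)
 then show ?thesis using poly_mapping_sum_single[of f] finite_keys by metis
qed

lemma fconst_0 [simp]: "fconst 0 = 0" and fconst_1 [simp]: "fconst 1 = 1"
 and fconst_add: "fconst (a + b) = fconst a + fconst b"
 and fconst_uminus: "fconst (- a) = - fconst a"
 and fconst_diff: "fconst (a - b) = fconst a - fconst b"
 and fconst_mult: "fconst (a * b) = fconst a * fconst b"
 by (simp_all add: fconst_def single_add single_uminus single_diff mult_single)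

lemma fconst_commute: "f * fconst a = fconst a * f"
proof (induction f rule: poly_mapping_add_induct)
 case (single k v)
 then show ?case by (simp add: fconst_def mult_single mult.commute)
qed (simp_all add: algebra_simps)

lemma fconst_mult': "fconst (a * b) = fconst b * fconst a"
 by (simp add: fconst_mult[symmetric] mult.commute)

lemma fconst_left_commute: "f * (fconst a * g) = fconst a * (f * g)"
 by (metis fconst_commute mult.assoc)

lemma word_single_Cons:
 "single (Word (g # gs)) (1::'a::comm_ring_1) = fgen g * single (Word gs) 1"
 by (simp add: fgen_def mult_single plus_word_def)

lemma single_fconst: "single w c = fconst c * single w (1::'a::comm_ring_1)"
 by (simp add: fconst_def mult_single)

lemma word_Nil_single: "single (Word []) (1::'a::comm_ring_1) = 1"
 by (simp add: zero_word_def[symmetric])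

text \<open>Words grow on the left, so it is enough that the property survives left multiplication.
  This fits statements about left ideals and left modules.\<close>

lemma free_alg_induct [case_names one gen const add]:
 assumes "P 1" and gen: "\<And>g f. P f \<Longrightarrow> P (fgen g * f)"
  and const: "\<And>c f. P f \<Longrightarrow> P (fconst c * f)" and "\<And>f g. P f \<Longrightarrow> P g \<Longrightarrow> P (f + g)"
 shows "P (f :: 'g word \<Rightarrow>\<^sub>0 'a::comm_ring_1)"
proof (induction f rule: poly_mapping_add_induct)
 case zero
 then show ?case using const[OF assms(1), of 0] by simp
next
 case (single w c)
 obtain gs where w: "w = Word gs" by (cases w)
 have "P (single (Word gs) 1)"
  by (induction gs) (simp_all add: word_Nil_single assms(1) word_single_Cons gen)
 then show ?case using const single_fconst[of w c] w by metis
qed (rule assms(4))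

subsection \<open>Substitution into polynomials\<close>

lemma fsubst1_extend:
 assumes "degree P \<le> N"
 shows "fsubst1 P f = (\<Sum>p\<le>N. fconst (coeff P p) * f ^ p)"
 unfolding fsubst1_def
 by (rule sum.mono_neutral_left) (use assms in \<open>auto simp: coeff_eq_0\<close>)

lemma fsubst1_0 [simp]: "fsubst1 0 f = 0"
 by (simp add: fsubst1_def)

lemma fsubst1_add: "fsubst1 (P + R) f = fsubst1 P f + fsubst1 R f"
proof -
 let ?N = "max (degree P) (degree R)"
 have "degree (P + R) \<le> ?N" by (rule degree_add_le) auto
 then show ?thesis
  by (simp add: fsubst1_extend[of _ ?N] fconst_add distrib_right sum.distrib)
qed

lemma fsubst1_pCons: "fsubst1 (pCons a P) f = fconst a + f * fsubst1 P f"
proof -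
 have "fsubst1 (pCons a P) f = (\<Sum>p\<le>Suc (degree P). fconst (coeff (pCons a P) p) * f ^ p)"
  by (rule fsubst1_extend) (simp add: degree_pCons_le)
 also have "\<dots> = fconst a + (\<Sum>p\<le>degree P. fconst (coeff P p) * f ^ Suc p)"
  by (simp only: sum.atMost_Suc_shift) simp
 also have "(\<Sum>p\<le>degree P. fconst (coeff P p) * f ^ Suc p) = f * fsubst1 P f"
  by (simp add: fsubst1_def sum_distrib_left fconst_left_commute)
 finally show ?thesis .
qed

lemma fsubst1_smult: "fsubst1 (Polynomial.smult a P) f = fconst a * fsubst1 P f"
 by (induction P) (simp_all add: fsubst1_pCons fconst_mult distrib_left fconst_left_commute)

lemma fsubst1_mult: "fsubst1 (P * R) f = fsubst1 P f * fsubst1 R f"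
 by (induction P) (simp_all add: fsubst1_pCons fsubst1_add fsubst1_smult distrib_right mult.assoc)

lemma fsubst1_1 [simp]: "fsubst1 1 f = 1"
 by (simp add: one_pCons fsubst1_pCons)

lemma fsubst1_linear: "fsubst1 [:a, b:] f = fconst a + fconst b * f"
 by (simp add: fsubst1_pCons fconst_commute)

lemma fsubst2_0 [simp]: "fsubst2 0 f g = 0"
 by (simp add: fsubst2_def)

lemma fsubst2_pCons: "fsubst2 (pCons p P) f g = fsubst1 p g + f * fsubst2 P f g"
proof -
 have ext: "fsubst2 R f g = (\<Sum>p\<le>N. f ^ p * fsubst1 (coeff R p) g)" if "degree R \<le> N" for R N
  unfolding fsubst2_def by (rule sum.mono_neutral_left) (use that in \<open>auto simp: coeff_eq_0\<close>)
 have "fsubst2 (pCons p P) f g = (\<Sum>k\<le>Suc (degree P). f ^ k * fsubst1 (coeff (pCons p P) k) g)"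
  by (rule ext) (simp add: degree_pCons_le)
 also have "\<dots> = fsubst1 p g + (\<Sum>k\<le>degree P. f ^ Suc k * fsubst1 (coeff P k) g)"
  by (simp only: sum.atMost_Suc_shift) simp
 also have "(\<Sum>k\<le>degree P. f ^ Suc k * fsubst1 (coeff P k) g) = f * fsubst2 P f g"
  by (simp add: fsubst2_def sum_distrib_left mult.assoc)
 finally show ?thesis .
qed

lemma fsubst3_0 [simp]: "fsubst3 0 f g h = 0"
 by (simp add: fsubst3_def)

lemma fsubst3_pCons: "fsubst3 (pCons p P) f g h = fsubst2 p g h + f * fsubst3 P f g h"
proof -
 have ext: "fsubst3 R f g h = (\<Sum>p\<le>N. f ^ p * fsubst2 (coeff R p) g h)" if "degree R \<le> N" for R N
  unfolding fsubst3_def by (rule sum.mono_neutral_left) (use that in \<open>auto simp: coeff_eq_0\<close>)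
 have "fsubst3 (pCons p P) f g h = (\<Sum>k\<le>Suc (degree P). f ^ k * fsubst2 (coeff (pCons p P) k) g h)"
  by (rule ext) (simp add: degree_pCons_le)
 also have "\<dots> = fsubst2 p g h + (\<Sum>k\<le>degree P. f ^ Suc k * fsubst2 (coeff P k) g h)"
  by (simp only: sum.atMost_Suc_shift) simp
 also have "(\<Sum>k\<le>degree P. f ^ Suc k * fsubst2 (coeff P k) g h) = f * fsubst3 P f g h"
  by (simp add: fsubst3_def sum_distrib_left mult.assoc)
 finally show ?thesis .
qed

definition poly2 :: "'a::comm_ring_1 poly poly \<Rightarrow> 'a \<Rightarrow> 'a \<Rightarrow> 'a"
 where "poly2 P a b = poly (poly P [:a:]) b"

definition poly3 :: "'a::comm_ring_1 poly poly poly \<Rightarrow> 'a \<Rightarrow> 'a \<Rightarrow> 'a \<Rightarrow> 'a"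
 where "poly3 P a b c = poly2 (poly P [:[:a:]:]) b c"

lemma poly2_0 [simp]: "poly2 0 a b = 0"
 by (simp add: poly2_def)

lemma poly2_pCons: "poly2 (pCons p P) a b = poly p b + a * poly2 P a b"
 by (simp add: poly2_def)

lemma poly3_pCons: "poly3 (pCons p P) a b c = poly2 p b c + a * poly3 P a b c"
 by (simp add: poly3_def poly2_def)

text \<open>One-sidedness is deliberate: annihilators of vectors, in a quotient of the free algebra
  as well as in a module, are only left ideals. Membership of \<open>f - fconst a\<close> then
  expresses that \<open>f\<close> has eigenvalue \<open>a\<close>.\<close>

locale left_ideal =
 fixes N :: "('g word \<Rightarrow>\<^sub>0 'a::comm_ring_1) set"
 assumes N_0: "0 \<in> N" and N_add: "f \<in> N \<Longrightarrow> g \<in> N \<Longrightarrow> f + g \<in> N"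
  and N_mult: "g \<in> N \<Longrightarrow> f * g \<in> N"
begin

lemma fsubst1_value:
 assumes "f - fconst a \<in> N"
 shows "fsubst1 P f - fconst (poly P a) \<in> N"
proof (induction P)
 case (pCons c P)
 have "fsubst1 (pCons c P) f - fconst (poly (pCons c P) a)
  = f * (fsubst1 P f - fconst (poly P a)) + fconst (poly P a) * (f - fconst a)"
  by (simp add: fsubst1_pCons fconst_add fconst_mult'[of a] right_diff_distrib left_diff_distrib fconst_commute[of f])
 then show ?case using pCons assms by (simp only:) (intro N_add N_mult)
qed (simp add: N_0)

lemma fsubst2_value:
 assumes "f - fconst a \<in> N" and "g - fconst b \<in> N"
 shows "fsubst2 P f g - fconst (poly2 P a b) \<in> N"
proof (induction P)
 case (pCons p P)
 have "fsubst2 (pCons p P) f g - fconst (poly2 (pCons p P) a b)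
  = (fsubst1 p g - fconst (poly p b)) + (f * (fsubst2 P f g - fconst (poly2 P a b))
   + fconst (poly2 P a b) * (f - fconst a))"
  by (simp add: fsubst2_pCons poly2_pCons fconst_add fconst_mult'[of a] right_diff_distrib left_diff_distrib fconst_commute[of f])
 then show ?case using pCons assms fsubst1_value by (simp only:) (intro N_add N_mult)
qed (simp add: N_0)

lemma fsubst3_value:
 assumes "f - fconst a \<in> N" and "g - fconst b \<in> N" and "h - fconst c \<in> N"
 shows "fsubst3 P f g h - fconst (poly3 P a b c) \<in> N"
proof (induction P)
 case (pCons p P)
 have "fsubst3 (pCons p P) f g h - fconst (poly3 (pCons p P) a b c)
  = (fsubst2 p g h - fconst (poly2 p b c)) + (f * (fsubst3 P f g h - fconst (poly3 P a b c))
   + fconst (poly3 P a b c) * (f - fconst a))"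
  by (simp add: fsubst3_pCons poly3_pCons fconst_add fconst_mult'[of a] right_diff_distrib left_diff_distrib fconst_commute[of f])
 then show ?case using pCons assms fsubst2_value by (simp only:) (intro N_add N_mult)
qed (simp add: N_0 poly3_def poly2_def)

text \<open>Only \<open>f\<close> is replaced by a value; \<open>g\<close> stays an operator. A left
  ideal need not absorb powers of \<open>g\<close> on the right, so the hypothesis asks for all
  polynomials in \<open>g\<close> in advance.\<close>

lemma fsubst2_half_value:
 assumes "\<And>R. (f - fconst a) * fsubst1 R g \<in> N"
 shows "fsubst2 P f g - fsubst1 (poly P [:a:]) g \<in> N"
proof (induction P)
 case (pCons p P)
 have "fsubst2 (pCons p P) f g - fsubst1 (poly (pCons p P) [:a:]) g
  = f * (fsubst2 P f g - fsubst1 (poly P [:a:]) g) + (f - fconst a) * fsubst1 (poly P [:a:]) g"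
  by (simp add: fsubst2_pCons fsubst1_add fsubst1_smult algebra_simps)
 then show ?case using pCons(2) assms by (simp only:) (rule N_add[OF N_mult])
qed (simp add: N_0)

end

text \<open>The value is determined only at units; Laurent polynomials offer no division
  operation.\<close>

definition uinv :: "'a::comm_ring_1 \<Rightarrow> 'a"
 where "uinv a = (THE b. a * b = 1)"

lemma uinv_mult: "a dvd 1 \<Longrightarrow> a * uinv a = 1"
 unfolding uinv_def
proof (rule theI')
 assume "a dvd 1"
 then obtain b where b: "1 = a * b" by (auto simp: dvd_def)
 show "\<exists>!b. a * b = 1"
 proof (rule ex1I[of _ b])
  fix b' assume "a * b' = 1"
  then have "b * (a * b') = b" by simp
  then show "b' = b" using b by (metis mult.commute mult.left_commute mult_1)
 qed (use b in simp)
qed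

lemma uinv_mult_left: "a dvd 1 \<Longrightarrow> uinv a * a = 1"
 using uinv_mult[of a] by (simp add: mult.commute)

lemma uinv_unique: "(a::'a::comm_ring_1) * b = 1 \<Longrightarrow> uinv a = b"
 by (metis dvdI mult.assoc mult.commute mult_1 uinv_mult)

lemma uinv_uminus: "a dvd 1 \<Longrightarrow> uinv (- a) = - uinv a"
 by (rule uinv_unique) (simp add: uinv_mult)

lemma uinv_unit: "a dvd 1 \<Longrightarrow> uinv a dvd 1"
 using uinv_mult[of a] by (metis dvd_triv_right)

text \<open>Generators and positions are numbered from 0 here, so that \<open>y p\<close> is \<open>y\<^sub>p\<^sub>+\<^sub>1\<close>.\<close>

abbreviation ee :: "nat list \<Rightarrow> klr_gen word \<Rightarrow>\<^sub>0 'l::comm_ring_1" where "ee i \<equiv> fgen (E i)"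
abbreviation yy :: "nat \<Rightarrow> klr_gen word \<Rightarrow>\<^sub>0 'l::comm_ring_1" where "yy p \<equiv> fgen (Y (Suc p))"
abbreviation ps :: "nat \<Rightarrow> klr_gen word \<Rightarrow>\<^sub>0 'l::comm_ring_1" where "ps p \<equiv> fgen (Psi (Suc p))"

lemma fgen_fconst: "fgen g * (fconst a * v) = fconst a * (fgen g * v)"
 by (rule fconst_left_commute)

lemma fconst_fconst: "fconst a * (fconst b * v) = fconst (a * b) * v"
 by (simp add: fconst_mult mult.assoc)

lemmas fc_simps = fgen_fconst fconst_fconst

section \<open>Scalars attached to pairs of contents\<close>

locale content_data =
 fixes e n l :: nat and C :: "nat \<times> int \<Rightarrow> 'l::idom" and res :: "nat \<times> int \<Rightarrow> nat"
  and QL :: "nat \<Rightarrow> nat \<Rightarrow> 'l poly poly" and Q3L :: "nat \<Rightarrow> nat \<Rightarrow> nat \<Rightarrow> 'l poly poly poly"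
  and WL :: "nat \<Rightarrow> 'l poly"
 assumes res_less: "fst p \<in> {1..l} \<Longrightarrow> res p < e"
  and C_unit: "\<lbrakk>fst p \<in> {1..l}; fst q \<in> {1..l}; \<bar>snd p\<bar> < int n; \<bar>snd q\<bar> < int n;
   res p = res q; p \<noteq> q\<rbrakk> \<Longrightarrow> C p - C q dvd 1"
  and res_near: "fst p \<in> {1..l} \<Longrightarrow> near p q \<Longrightarrow> p \<noteq> q \<Longrightarrow> res p \<noteq> res q"
  and QL_value: "\<lbrakk>fst p \<in> {1..l}; j < e; j \<noteq> res p\<rbrakk> \<Longrightarrow> \<exists>\<epsilon>. \<epsilon> dvd 1 \<and>
   poly (QL (res p) j) [:C p:] =
    [:\<epsilon>:] * (\<Prod>q\<in>{q. near p q \<and> q \<noteq> p \<and> res q = j}. [:C q, -1:])"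
  and QL_same: "i < e \<Longrightarrow> QL i i = 0"
  and QL_sym: "fst p \<in> {1..l} \<Longrightarrow> fst q \<in> {1..l} \<Longrightarrow>
   poly2 (QL (res p) (res q)) (C p) (C q) = poly2 (QL (res q) (res p)) (C q) (C p)"
  and Q3_diff: "i \<noteq> k \<Longrightarrow> Q3L i j k = 0"
  and Q3_value: "\<lbrakk>fst p \<in> {1..l}; fst q \<in> {1..l}; fst r \<in> {1..l}; res r = res p\<rbrakk> \<Longrightarrow>
   (C p - C r) * poly3 (Q3L (res p) (res q) (res p)) (C p) (C q) (C r)
    = poly2 (QL (res p) (res q)) (C p) (C q) - poly2 (QL (res q) (res p)) (C q) (C r)"
  and Q3_unit: "\<lbrakk>fst p \<in> {1..l}; near p q; p \<noteq> q; \<bar>snd p\<bar> < int n; \<bar>snd q\<bar> + 1 < int n\<rbrakk> \<Longrightarrow>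
   poly3 (Q3L (res p) (res q) (res p)) (C p) (C q) (C p) dvd 1"
  and WL_value: "i < e \<Longrightarrow>
   WL i = (\<Prod>k\<in>{k\<in>{1..l}. res (k, 0) = i}. [:- C (k, 0), 1:])"
begin

definition dd :: "nat \<times> int \<Rightarrow> nat \<times> int \<Rightarrow> 'l"
 where "dd p q = (if res p = res q then uinv (C q - C p) else 0)"

text \<open>The scalar \<open>Q_m(t)\<close> of a tableau with contents \<open>p\<close>,
  \<open>q\<close> at the places \<open>m\<close>, \<open>m + 1\<close>; \<open>dd p q\<close> is
  the diagonal coefficient of \<open>psi_m\<close> there.\<close>

definition Qc :: "nat \<times> int \<Rightarrow> nat \<times> int \<Rightarrow> 'l"
 where "Qc p q = poly2 (QL (res p) (res q)) (C p) (C q) - dd p q * dd p q"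

definition okc :: "nat \<times> int \<Rightarrow> bool"
 where "okc p \<longleftrightarrow> fst p \<in> {1..l} \<and> \<bar>snd p\<bar> < int n"

definition Cset :: "(nat \<times> int) set"
 where "Cset = Collect okc"

lemma finite_Cset: "finite Cset"
proof -
 have "Cset \<subseteq> {1..l} \<times> {- int n..int n}" by (auto simp: Cset_def okc_def)
 then show ?thesis by (rule finite_subset) simp
qed

lemma C_unit': "okc p \<Longrightarrow> okc q \<Longrightarrow> res p = res q \<Longrightarrow> p \<noteq> q \<Longrightarrow> C p - C q dvd 1"
 by (rule C_unit) (auto simp: okc_def)

lemma near_sym: "near p q \<longleftrightarrow> near q p"
 by (auto simp: near_def)

lemma dd_sym:
 assumes "okc p" and "okc q" and "p \<noteq> q"
 shows "dd q p = - dd p q"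
proof (cases "res p = res q")
 case True
 then show ?thesis using uinv_uminus[OF C_unit'[OF assms(2,1)]] assms by (simp add: dd_def)
qed (simp add: dd_def)

lemma dd_mult:
 assumes "okc p" and "okc q" and "p \<noteq> q"
 shows "dd p q * (C q - C p) = (if res p = res q then 1 else 0)"
proof (cases "res p = res q")
 case True
 then show ?thesis using uinv_mult_left[OF C_unit'[OF assms(2,1)]] assms by (simp add: dd_def)
qed (simp add: dd_def)

text \<open>Partial fractions: \<open>1/(ab) = (1/a + 1/b)/(a + b)\<close>.\<close>

lemma dd_braid:
 assumes "okc p" and "okc q" and "okc r" and "p \<noteq> q" and "q \<noteq> r" and "p \<noteq> r"
 shows "dd p q * dd q r = dd p r * (dd p q + dd q r)"
proof -
 consider "res p = res q \<and> res q = res r" | "res p \<noteq> res q \<or> res q \<noteq> res r" by blast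
 then show ?thesis
 proof cases
  case 1
  let ?a = "C q - C p" and ?b = "C r - C q"
  have a: "dd p q * ?a = 1" and b: "dd q r * ?b = 1" and c: "dd p r * (?a + ?b) = 1"
   using dd_mult assms 1 by (simp_all add: algebra_simps)
  have "dd p q * dd q r = dd p q * dd q r * (dd p r * (?a + ?b))" using c by simp
  also have "\<dots> = dd p r * (dd q r * (dd p q * ?a) + dd p q * (dd q r * ?b))" by (simp add: algebra_simps)
  also have "\<dots> = dd p r * (dd q r + dd p q)" using a b by simp
  finally show ?thesis by (simp add: add.commute)
 qed (auto simp: dd_def)
qed

lemma Qc_sym:
 assumes "okc p" and "okc q" and "p \<noteq> q"
 shows "Qc p q = Qc q p"
 using QL_sym[of p q] assms dd_sym[OF assms] by (simp add: Qc_def okc_def)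

lemma QL_near:
 assumes "okc p" and "fst q \<in> {1..l}" and "near p q" and "p \<noteq> q"
 shows "poly2 (QL (res p) (res q)) (C p) (C q) = 0"
proof -
 have "finite {q'. near p q' \<and> q' \<noteq> p \<and> res q' = res q}"
 proof (rule finite_subset)
  show "{q'. near p q' \<and> q' \<noteq> p \<and> res q' = res q} \<subseteq> {fst p} \<times> {snd p - 1..snd p + 1}"
   by (auto simp: near_def)
 qed simp
 then have "(\<Prod>q'\<in>{q'. near p q' \<and> q' \<noteq> p \<and> res q' = res q}. C q' - C q) = 0"
  using assms by (intro prod_zero bexI[of _ q]) auto
 moreover obtain \<epsilon> where "poly (QL (res p) (res q)) [:C p:] =
   [:\<epsilon>:] * (\<Prod>q'\<in>{q'. near p q' \<and> q' \<noteq> p \<and> res q' = res q}. [:C q', -1:])"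
  using QL_value[of p "res q"] res_near[of p q] res_less[of q] assms by (auto simp: okc_def)
 ultimately show ?thesis by (simp add: poly2_def poly_prod)
qed

lemma Qc_near:
 assumes "okc p" and "okc q" and "near p q" and "p \<noteq> q"
 shows "Qc p q = 0"
 using QL_near[of p q] assms res_near[of p q] by (simp add: Qc_def dd_def okc_def)

lemma finite_near: "finite {q'. near p q' \<and> q' \<noteq> p \<and> P q'}"
proof (rule finite_subset)
 show "{q'. near p q' \<and> q' \<noteq> p \<and> P q'} \<subseteq> {fst p} \<times> {snd p - 1..snd p + 1}"
  by (auto simp: near_def)
qed simp

text \<open>For equal residues \<open>Qc\<close> is minus the square of a unit. Otherwise it is a
  unit times the differences \<open>C q' - C q\<close> over the neighbours \<open>q'\<close> of
  \<open>p\<close> of the same residue as \<open>q\<close>; the bound on \<open>p\<close> keeps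
  every \<open>q'\<close> in the separated range, and \<open>q\<close> is none of them.\<close>

lemma Qc_unit:
 assumes p: "okc p" and q: "okc q" and "\<not> near p q" and b: "\<bar>snd p\<bar> + 1 < int n"
 shows "Qc p q dvd 1"
proof (cases "res p = res q")
 case True
 have "p \<noteq> q" using assms(3) by (auto simp: near_def)
 then have "uinv (C q - C p) dvd 1" using uinv_unit C_unit'[OF q p] True by simp
 then have "dd p q * dd p q dvd 1" using True mult_dvd_mono[of "dd p q" 1 "dd p q" 1] by (simp add: dd_def)
 then show ?thesis using True QL_same[of "res p"] res_less[of p] p by (simp add: Qc_def okc_def)
next
 case False
 let ?S = "{q'. near p q' \<and> q' \<noteq> p \<and> res q' = res q}"
 obtain \<epsilon> where e: "\<epsilon> dvd 1" "poly (QL (res p) (res q)) [:C p:] =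
   [:\<epsilon>:] * (\<Prod>q'\<in>?S. [:C q', -1:])"
  using QL_value[of p "res q"] res_less[of q] p q False by (auto simp: okc_def)
 have u: "C q' - C q dvd 1" if "q' \<in> ?S" for q'
  using that p q b assms(3) by (intro C_unit') (auto simp: okc_def near_def)
 have "(\<Prod>q'\<in>?S. C q' - C q) dvd (\<Prod>q'\<in>?S. 1)" by (rule prod_dvd_prod) (use u in auto)
 then have "(\<Prod>q'\<in>?S. C q' - C q) dvd 1" by simp
 then have "\<epsilon> * (\<Prod>q'\<in>?S. C q' - C q) dvd 1"
  using e(1) mult_dvd_mono[of \<epsilon> 1 "\<Prod>q'\<in>?S. C q' - C q" 1] by simp
 then show ?thesis using e(2) False by (simp add: Qc_def dd_def poly2_def poly_prod)
qed

lemma okc_cont: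
 assumes "stdl l xs" and "length xs \<le> n" and "A \<in> set xs"
 shows "okc (cont A)"
proof -
 have "\<bar>snd (cont A)\<bar> < int (card (set xs))"
  using young_content_bound[OF stdl_young[OF assms(1)] assms(3)] .
 also have "\<dots> \<le> int n" using card_length[of xs] assms(2) by linarith
 finally have "\<bar>snd (cont A)\<bar> < int n" .
 moreover have "fst (cont A) \<in> {1..l}"
  using stdl_young[OF assms(1)] assms(3) by (cases A) (auto simp: young_def)
 ultimately show ?thesis by (simp add: okc_def)
qed

lemma okc_addable:
 assumes "stdl l xs" and "length xs < n" and "A \<in> addable l (set xs)"
 shows "okc (cont A)"
 using okc_cont[of "xs @ [A]" A] assms by (simp add: stdl_snoc)

lemma Qc_unit_stdl:
 assumes xs: "stdl l xs" and n: "length xs \<le> n" and p: "Suc p < length xs"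
  and "\<not> adj (xs ! p) (xs ! Suc p)"
 shows "Qc (cont (xs ! p)) (cont (xs ! Suc p)) dvd 1"
proof (rule Qc_unit)
 show "okc (cont (xs ! p))" "okc (cont (xs ! Suc p))"
  using okc_cont[OF xs n] p by auto
 show "\<not> near (cont (xs ! p)) (cont (xs ! Suc p))"
  using stdl_cont_neq(2)[OF xs p] assms(4) by simp
 have "\<bar>snd (cont (xs ! p))\<bar> \<le> int (length (take p xs))"
  using addable_Suc_content_bound[OF stdl_take[OF xs] stdl_nth[OF xs]] p by simp
 then show "\<bar>snd (cont (xs ! p))\<bar> + 1 < int n" using p n by simp
qed

lemma Qc_zero_stdl:
 assumes xs: "stdl l xs" and n: "length xs \<le> n" and p: "Suc p < length xs"
  and "adj (xs ! p) (xs ! Suc p)"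
 shows "Qc (cont (xs ! p)) (cont (xs ! Suc p)) = 0"
 using Qc_near[of "cont (xs ! p)" "cont (xs ! Suc p)"] okc_cont[OF xs n] p
  stdl_cont_neq[OF xs p] assms(4) by auto

end

section \<open>Quotients of one free algebra by the KLR relations\<close>

locale klr_quotient = content_data e n l C res QL Q3L WL
 for e n l :: nat and C :: "nat \<times> int \<Rightarrow> 'l::idom" and res and QL and Q3L and WL +
 fixes J :: "('l klr_free) set"
 assumes J_0: "0 \<in> J" and J_add: "f \<in> J \<Longrightarrow> g \<in> J \<Longrightarrow> f + g \<in> J"
  and J_lmult: "g \<in> J \<Longrightarrow> f * g \<in> J" and J_rmult: "f \<in> J \<Longrightarrow> f * g \<in> J"
  and rel_gen: "x \<notin> E ` seqs e n \<union> Psi ` {1..<n} \<union> Y ` {1..n} \<Longrightarrow> fgen x \<in> J"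
  and rel_ee: "\<lbrakk>i \<in> seqs e n; j \<in> seqs e n\<rbrakk> \<Longrightarrow> ee i * ee j - (if i = j then ee i else 0) \<in> J"
  and rel_sum: "(\<Sum>i\<in>seqs e n. ee i) - 1 \<in> J"
  and rel_ye: "\<lbrakk>p < n; i \<in> seqs e n\<rbrakk> \<Longrightarrow> yy p * ee i - ee i * yy p \<in> J"
  and rel_yy: "\<lbrakk>p < n; q < n\<rbrakk> \<Longrightarrow> yy p * yy q - yy q * yy p \<in> J"
  and rel_py: "\<lbrakk>Suc p < n; q < n; q \<noteq> p; q \<noteq> Suc p\<rbrakk> \<Longrightarrow> ps p * yy q - yy q * ps p \<in> J"
  and rel_pp: "\<lbrakk>Suc p < n; Suc q < n; Suc p < q \<or> Suc q < p\<rbrakk> \<Longrightarrow> ps p * ps q - ps q * ps p \<in> J"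
  and rel_pe: "\<lbrakk>Suc p < n; i \<in> seqs e n\<rbrakk> \<Longrightarrow> ps p * ee i - ee (sw p i) * ps p \<in> J"
  and rel_py1: "\<lbrakk>Suc p < n; i \<in> seqs e n\<rbrakk> \<Longrightarrow>
   (ps p * yy (Suc p) - yy p * ps p) * ee i - (if i ! p = i ! Suc p then 1 else 0) * ee i \<in> J"
  and rel_yp1: "\<lbrakk>Suc p < n; i \<in> seqs e n\<rbrakk> \<Longrightarrow>
   (yy (Suc p) * ps p - ps p * yy p) * ee i - (if i ! p = i ! Suc p then 1 else 0) * ee i \<in> J"
  and rel_p2: "\<lbrakk>Suc p < n; i \<in> seqs e n\<rbrakk> \<Longrightarrow>
   ps p * ps p * ee i - fsubst2 (QL (i ! p) (i ! Suc p)) (yy p) (yy (Suc p)) * ee i \<in> J"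
  and rel_braid: "\<lbrakk>Suc (Suc p) < n; i \<in> seqs e n\<rbrakk> \<Longrightarrow>
   (ps (Suc p) * ps p * ps (Suc p) - ps p * ps (Suc p) * ps p) * ee i
    - fsubst3 (Q3L (i ! p) (i ! Suc p) (i ! Suc (Suc p))) (yy p) (yy (Suc p)) (yy (Suc (Suc p))) * ee i \<in> J"
  and rel_cyc: "\<lbrakk>0 < n; i \<in> seqs e n\<rbrakk> \<Longrightarrow> fsubst1 (WL (i ! 0)) (yy 0) * ee i \<in> J"
begin

text \<open>All blocks are treated at once: the relations range over all of \<open>seqs e n\<close>,
  and generators out of range vanish. Calculating with congruences keeps the ring operations of the
  type instead of those of a record.\<close>

definition cg :: "('l klr_free) \<Rightarrow> ('l klr_free) \<Rightarrow> bool"  (infix "\<triangleq>" 50)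
 where "f \<triangleq> g \<longleftrightarrow> f - g \<in> J"

lemma J_uminus: "f \<in> J \<Longrightarrow> - f \<in> J"
 using J_lmult[of f "-1"] by simp

lemma cg_refl [simp, intro]: "f \<triangleq> f"
 by (simp add: cg_def J_0)

lemma cg_sym: "f \<triangleq> g \<Longrightarrow> g \<triangleq> f"
 unfolding cg_def using J_uminus by fastforce

lemma cg_trans [trans]: "f \<triangleq> g \<Longrightarrow> g \<triangleq> h \<Longrightarrow> f \<triangleq> h"
 unfolding cg_def using J_add by fastforce

lemma eq_cg_trans [trans]: "f = g \<Longrightarrow> g \<triangleq> h \<Longrightarrow> f \<triangleq> h"
 and cg_eq_trans [trans]: "f \<triangleq> g \<Longrightarrow> g = h \<Longrightarrow> f \<triangleq> h"
 by simp_all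

lemma cg_add: "f \<triangleq> g \<Longrightarrow> f' \<triangleq> g' \<Longrightarrow> f + f' \<triangleq> g + g'"
 unfolding cg_def using J_add[of "f - g" "f' - g'"] by (simp add: algebra_simps)

lemma cg_uminus: "f \<triangleq> g \<Longrightarrow> - f \<triangleq> - g"
 unfolding cg_def using J_uminus[of "f - g"] by (simp add: algebra_simps)

lemma cg_diff: "f \<triangleq> g \<Longrightarrow> f' \<triangleq> g' \<Longrightarrow> f - f' \<triangleq> g - g'"
 using cg_add[OF _ cg_uminus] by fastforce

lemma cg_lmult: "f \<triangleq> g \<Longrightarrow> h * f \<triangleq> h * g"
 unfolding cg_def using J_lmult[of "f - g" h] by (simp add: algebra_simps)

lemma cg_rmult: "f \<triangleq> g \<Longrightarrow> f * h \<triangleq> g * h"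
 unfolding cg_def using J_rmult[of "f - g" h] by (simp add: algebra_simps)

lemma cg_sum: "(\<And>x. x \<in> A \<Longrightarrow> f x \<triangleq> g x) \<Longrightarrow> sum f A \<triangleq> sum g A"
 by (induction A rule: infinite_finite_induct) (auto intro: cg_add)

lemma cg_0_iff: "f \<triangleq> 0 \<longleftrightarrow> f \<in> J"
 by (simp add: cg_def)

lemma J_cg: "f - g \<in> J \<Longrightarrow> f \<triangleq> g"
 by (simp add: cg_def)

lemma unit_cg_0:
 assumes "a dvd 1" and "fconst a * v \<triangleq> 0"
 shows "v \<triangleq> 0"
proof -
 have "fconst (uinv a) * (fconst a * v) \<triangleq> fconst (uinv a) * 0" using assms(2) by (rule cg_lmult)
 then show ?thesis
  by (simp add: mult.assoc[symmetric] fconst_mult[symmetric] uinv_mult_left[OF assms(1)])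
qed

text \<open>Through this left ideal the substitution lemmas become statements about eigenvectors
  modulo \<open>J\<close>.\<close>

lemma ann_left_ideal: "left_ideal {f. f * v \<triangleq> 0}"
 by standard (auto simp: cg_0_iff J_0 J_add J_lmult distrib_right mult.assoc)

lemma ann_iff: "f - g \<in> {f. f * v \<triangleq> 0} \<longleftrightarrow> f * v \<triangleq> g * v"
 by (simp add: cg_def left_diff_distrib)

lemma fsubst1_eigen: "f * v \<triangleq> fconst a * v \<Longrightarrow> fsubst1 P f * v \<triangleq> fconst (poly P a) * v"
 using left_ideal.fsubst1_value[OF ann_left_ideal] unfolding ann_iff by blast

lemma fsubst2_eigen: "f * v \<triangleq> fconst a * v \<Longrightarrow> g * v \<triangleq> fconst b * v \<Longrightarrow>
  fsubst2 P f g * v \<triangleq> fconst (poly2 P a b) * v"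
 using left_ideal.fsubst2_value[OF ann_left_ideal] unfolding ann_iff by blast

lemma fsubst3_eigen: "f * v \<triangleq> fconst a * v \<Longrightarrow> g * v \<triangleq> fconst b * v \<Longrightarrow> h * v \<triangleq> fconst c * v \<Longrightarrow>
  fsubst3 P f g h * v \<triangleq> fconst (poly3 P a b c) * v"
 using left_ideal.fsubst3_value[OF ann_left_ideal] unfolding ann_iff by blast

text \<open>An operator that intertwines \<open>g\<close> and \<open>f\<close> intertwines polynomials in them.\<close>

lemma fsubst1_intertwine:
 assumes U: "\<And>u. u \<in> U \<Longrightarrow> g * u \<in> U" and fh: "\<And>u. u \<in> U \<Longrightarrow> f * (h * u) \<triangleq> h * (g * u)"
  and v: "v \<in> U"
 shows "fsubst1 P f * (h * v) \<triangleq> h * (fsubst1 P g * v)"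
 using v
proof (induction P arbitrary: v)
 case (pCons a P)
 have comm: "f * fsubst1 P f = fsubst1 P f * f" "g * fsubst1 P g = fsubst1 P g * g"
  using fsubst1_mult[of "[:0, 1:]" P f] fsubst1_mult[of P "[:0, 1:]" f]
   fsubst1_mult[of "[:0, 1:]" P g] fsubst1_mult[of P "[:0, 1:]" g]
  by (simp_all add: fsubst1_linear mult.commute)
 have "fsubst1 (pCons a P) f * (h * v) = fconst a * (h * v) + fsubst1 P f * (f * (h * v))"
  by (simp add: fsubst1_pCons comm distrib_right mult.assoc)
 also have "\<dots> \<triangleq> fconst a * (h * v) + fsubst1 P f * (h * (g * v))"
  by (intro cg_add cg_refl cg_lmult fh pCons.prems)
 also have "\<dots> \<triangleq> fconst a * (h * v) + h * (fsubst1 P g * (g * v))"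
  by (intro cg_add cg_refl pCons.IH U pCons.prems)
 also have "\<dots> = h * (fsubst1 (pCons a P) g * v)"
  by (simp add: fsubst1_pCons comm distrib_right distrib_left mult.assoc fconst_left_commute)
 finally show ?case .
qed simp

text \<open>The residues of all strands are fixed, but the contents only of the first
  \<open>length cs\<close>; the induction on strands lengthens \<open>cs\<close> by one content at a
  time.\<close>

definition wt :: "nat list \<Rightarrow> (nat \<times> int) list \<Rightarrow> ('l klr_free) \<Rightarrow> bool"
 where "wt i cs v \<longleftrightarrow> i \<in> seqs e n \<and> length cs \<le> n \<and> map res cs = take (length cs) i \<and>
  ee i * v \<triangleq> v \<and> (\<forall>m<length cs. yy m * v \<triangleq> fconst (C (cs ! m)) * v)"

lemma wtD:
 assumes "wt i cs v"
 shows "i \<in> seqs e n" and "length cs \<le> n" and "m < length cs \<Longrightarrow> i ! m = res (cs ! m)"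
  and "ee i * v \<triangleq> v" and "m < length cs \<Longrightarrow> yy m * v \<triangleq> fconst (C (cs ! m)) * v"
  and "length i = n"
proof -
 show *: "i \<in> seqs e n" "length cs \<le> n" "ee i * v \<triangleq> v" "length i = n"
  "m < length cs \<Longrightarrow> yy m * v \<triangleq> fconst (C (cs ! m)) * v"
  using assms by (auto simp: wt_def seqs_def)
 assume m: "m < length cs"
 have "take (length cs) i ! m = map res cs ! m" using assms by (simp add: wt_def)
 then show "i ! m = res (cs ! m)" using m by simp
qed

lemma wt_take: "wt i cs v \<Longrightarrow> wt i (take m cs) v"
 by (auto simp: wt_def take_map[symmetric] min_def)

lemma wt_cong: "wt i cs v \<Longrightarrow> v \<triangleq> w \<Longrightarrow> wt i cs w"
 unfolding wt_def by (meson cg_lmult cg_sym cg_trans)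

lemma wt_rmult: "wt i cs v \<Longrightarrow> wt i cs (v * w)"
 unfolding wt_def using cg_rmult[of _ _ w] by (auto simp: mult.assoc[symmetric])

lemma wt_add: "wt i cs v \<Longrightarrow> wt i cs w \<Longrightarrow> wt i cs (v + w)"
 unfolding wt_def by (auto simp: distrib_left intro: cg_add)

lemma wt_fconst: "wt i cs v \<Longrightarrow> wt i cs (fconst a * v)"
 using wt_rmult[of i cs v "fconst a"] by (simp add: fconst_commute)

lemma wt_0: "i \<in> seqs e n \<Longrightarrow> length cs \<le> n \<Longrightarrow> map res cs = take (length cs) i \<Longrightarrow> wt i cs 0"
 by (auto simp: wt_def)

lemma wt_commute:
 assumes v: "wt i cs v" and e: "x * ee i \<triangleq> ee i * x" and y: "\<And>m. m < length cs \<Longrightarrow> x * yy m \<triangleq> yy m * x"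
 shows "wt i cs (x * v)"
 unfolding wt_def
proof (intro conjI allI impI)
 show "i \<in> seqs e n" "length cs \<le> n" "map res cs = take (length cs) i" using v by (auto simp: wt_def)
 have "ee i * (x * v) \<triangleq> x * ee i * v" using cg_rmult[OF cg_sym[OF e], of v] by (simp add: mult.assoc)
 also have "\<dots> \<triangleq> x * v" using cg_lmult[OF wtD(4)[OF v], of x] by (simp add: mult.assoc)
 finally show "ee i * (x * v) \<triangleq> x * v" .
 fix m assume m: "m < length cs"
 have "yy m * (x * v) \<triangleq> x * yy m * v" using cg_rmult[OF cg_sym[OF y[OF m]], of v] by (simp add: mult.assoc)
 also have "\<dots> \<triangleq> x * (fconst (C (cs ! m)) * v)" using cg_lmult[OF wtD(5)[OF v m], of x] by (simp add: mult.assoc)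
 finally show "yy m * (x * v) \<triangleq> fconst (C (cs ! m)) * (x * v)" by (simp add: fconst_left_commute)
qed

lemma fsubst1_yy_commute:
 assumes "x * yy m \<triangleq> yy m * x"
 shows "fsubst1 P (yy m) * x \<triangleq> x * fsubst1 P (yy m)"
 using fsubst1_intertwine[of UNIV "yy m" "yy m" x 1 P] cg_rmult[OF cg_sym[OF assms]]
 by (simp add: mult.assoc)

lemma wt_fsubst1:
 assumes v: "wt i cs v" and m: "m < n"
 shows "wt i cs (fsubst1 P (yy m) * v)"
proof (rule wt_commute[OF v])
 show "fsubst1 P (yy m) * ee i \<triangleq> ee i * fsubst1 P (yy m)"
  using cg_sym[OF J_cg[OF rel_ye[OF m wtD(1)[OF v]]]] by (rule fsubst1_yy_commute)
 show "fsubst1 P (yy m) * yy k \<triangleq> yy k * fsubst1 P (yy m)" if "k < length cs" for k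
  using J_cg[OF rel_yy[of k m]] that m wtD(2)[OF v] by (intro fsubst1_yy_commute) simp
qed

lemma wt_snoc:
 "wt i cs v \<Longrightarrow> length cs < n \<Longrightarrow> i ! length cs = res q \<Longrightarrow>
  yy (length cs) * v \<triangleq> fconst (C q) * v \<Longrightarrow> wt i (cs @ [q]) v"
 by (auto simp: wt_def nth_append less_Suc_eq take_Suc_conv_app_nth seqs_def)

text \<open>On a vector of content sequence \<open>\<dots>p, q\<dots>\<close>, the intertwiner at the place of \<open>p\<close>.\<close>

definition phi :: "nat \<Rightarrow> nat \<times> int \<Rightarrow> nat \<times> int \<Rightarrow> ('l klr_free) \<Rightarrow> 'l klr_free"
 where "phi k p q v = ps k * v - fconst (dd p q) * v"

lemma phi_cong: "v \<triangleq> w \<Longrightarrow> phi k p q v \<triangleq> phi k p q w"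
 unfolding phi_def by (intro cg_diff cg_lmult)

lemma phi_fconst: "phi k p q (fconst a * v) = fconst a * phi k p q v"
 by (simp add: phi_def fc_simps right_diff_distrib mult.commute)

lemma seqs_sw: "i \<in> seqs e n \<Longrightarrow> Suc k < n \<Longrightarrow> sw k i \<in> seqs e n"
 by (auto simp: seqs_def)

lemma sw_same: "length i = n \<Longrightarrow> Suc k < n \<Longrightarrow> i ! k = i ! Suc k \<Longrightarrow> sw k i = i"
 by (rule nth_equalityI) (auto simp: nth_sw)

lemma ps_ee:
 assumes "i \<in> seqs e n" and "Suc k < n" and "ee i * v \<triangleq> v"
 shows "ee (sw k i) * (ps k * v) \<triangleq> ps k * v"
proof -
 have "ee (sw k i) * (ps k * v) \<triangleq> ps k * (ee i * v)"
  using cg_rmult[OF cg_sym[OF J_cg[OF rel_pe[OF assms(2,1)]]], of v] by (simp add: mult.assoc)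
 also have "\<dots> \<triangleq> ps k * v" using assms(3) by (rule cg_lmult)
 finally show ?thesis .
qed

lemma rel_apply:
 assumes "x * ee i - x' * ee i \<in> J" and "ee i * v \<triangleq> v"
 shows "x * v \<triangleq> x' * v"
proof -
 have "x * v \<triangleq> x * (ee i * v)" using cg_lmult[OF cg_sym[OF assms(2)]] .
 also have "\<dots> \<triangleq> x' * (ee i * v)"
  using cg_rmult[OF J_cg[OF assms(1)], of v] by (simp add: mult.assoc)
 also have "\<dots> \<triangleq> x' * v" using cg_lmult[OF assms(2)] .
 finally show ?thesis .
qed

lemma ps_yy_Suc:
 assumes "i \<in> seqs e n" and "Suc k < n" and "ee i * v \<triangleq> v"
 shows "yy k * (ps k * v) \<triangleq> ps k * (yy (Suc k) * v) - (if i ! k = i ! Suc k then v else 0)"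
proof -
 have "ps k * (yy (Suc k) * v) - yy k * (ps k * v) \<triangleq> (if i ! k = i ! Suc k then v else 0)"
  using rel_apply[OF rel_py1[OF assms(2,1)] assms(3)] by (simp add: left_diff_distrib mult.assoc split: if_splits)
 from cg_diff[OF cg_refl[of "ps k * (yy (Suc k) * v)"] this] show ?thesis by simp
qed

lemma ps_yy:
 assumes "i \<in> seqs e n" and "Suc k < n" and "ee i * v \<triangleq> v"
 shows "yy (Suc k) * (ps k * v) \<triangleq> ps k * (yy k * v) + (if i ! k = i ! Suc k then v else 0)"
proof -
 have "yy (Suc k) * (ps k * v) - ps k * (yy k * v) \<triangleq> (if i ! k = i ! Suc k then v else 0)"
  using rel_apply[OF rel_yp1[OF assms(2,1)] assms(3)] by (simp add: left_diff_distrib mult.assoc split: if_splits)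
 from cg_add[OF cg_refl[of "ps k * (yy k * v)"] this] show ?thesis by simp
qed

lemma ps_yy_far:
 assumes "Suc k < n" and "m < n" and "m \<noteq> k" and "m \<noteq> Suc k" and "yy m * v \<triangleq> fconst a * v"
 shows "yy m * (ps k * v) \<triangleq> fconst a * (ps k * v)"
proof -
 have "yy m * (ps k * v) \<triangleq> ps k * (yy m * v)"
  using cg_rmult[OF cg_sym[OF J_cg[OF rel_py[OF assms(1-4)]]], of v] by (simp add: mult.assoc)
 also have "\<dots> \<triangleq> ps k * (fconst a * v)" using assms(5) by (rule cg_lmult)
 finally show ?thesis by (simp add: fconst_left_commute)
qed

lemma ps_wt_low:
 assumes v: "wt i cs v" and k: "length cs \<le> k" "Suc k < n"
 shows "wt (sw k i) cs (ps k * v)"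
 using ps_ee[OF wtD(1)[OF v] k(2) wtD(4)[OF v]] ps_yy_far[OF k(2)] wtD[OF v] k seqs_sw[of i k]
 by (auto simp: wt_def take_sw_low v[unfolded wt_def])

text \<open>For equal residues the subtracted multiple of \<open>v\<close> cancels the Kronecker
  term in the relation between \<open>psi\<close> and \<open>y\<close>; for different residues there
  is neither.\<close>

lemma phi_wt:
 assumes v: "wt i cs v" and k: "Suc k < length cs" and p: "cs ! k = p" and q: "cs ! Suc k = q"
  and ok: "okc p" "okc q" "p \<noteq> q"
 shows "wt (sw k i) (sw k cs) (phi k p q v)"
proof -
 note D = wtD[OF v]
 have kn: "Suc k < n" using D(2) k by simp
 let ?d = "dd p q"
 have i: "i ! k = res p" "i ! Suc k = res q" using D(3)[of k] D(3)[of "Suc k"] k p q by auto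
 \<comment> \<open>The correction term is still supported on \<open>i\<close> rather than on the
   swapped sequence, but it is present only if the two residues agree.\<close>
 have same: "?d = 0 \<or> sw k i = i"
  using sw_same[OF D(6) kn] i by (auto simp: dd_def)
 have E: "ee (sw k i) * phi k p q v \<triangleq> phi k p q v"
 proof (cases "?d = 0")
  case False
  then show ?thesis using same ps_ee[OF D(1) kn D(4)] D(4)
   by (auto simp: phi_def right_diff_distrib fgen_fconst intro!: cg_diff cg_lmult)
 qed (use ps_ee[OF D(1) kn D(4)] in \<open>simp add: phi_def\<close>)
 have Yk: "yy k * v \<triangleq> fconst (C p) * v" and YSk: "yy (Suc k) * v \<triangleq> fconst (C q) * v"
  using D(5)[of k] D(5)[of "Suc k"] k p q by auto
 have dm: "?d * (C q - C p) = (if res p = res q then 1 else 0)" using dd_mult[OF ok] .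
 have Y1: "yy k * phi k p q v \<triangleq> fconst (C q) * phi k p q v"
 proof -
  have "yy k * phi k p q v = yy k * (ps k * v) - fconst ?d * (yy k * v)"
   by (simp add: phi_def right_diff_distrib fgen_fconst)
  also have "\<dots> \<triangleq> (ps k * (yy (Suc k) * v) - (if i ! k = i ! Suc k then v else 0)) - fconst ?d * (fconst (C p) * v)"
   by (intro cg_diff ps_yy_Suc D(1,4) kn cg_lmult Yk)
  also have "\<dots> \<triangleq> (ps k * (fconst (C q) * v) - (if i ! k = i ! Suc k then v else 0)) - fconst ?d * (fconst (C p) * v)"
   by (intro cg_diff cg_refl cg_lmult YSk)
  \<comment> \<open>In this form the Kronecker term replaces \<open>C p\<close> by
    \<open>C q\<close> in the correction term.\<close>
  also have "(if i ! k = i ! Suc k then v else 0) = fconst (?d * (C q - C p)) * v"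
   using dm i by simp
  finally show ?thesis
   by (simp add: phi_def right_diff_distrib fc_simps fconst_diff left_diff_distrib mult.commute)
 qed
 have Y2: "yy (Suc k) * phi k p q v \<triangleq> fconst (C p) * phi k p q v"
 proof -
  have "yy (Suc k) * phi k p q v = yy (Suc k) * (ps k * v) - fconst ?d * (yy (Suc k) * v)"
   by (simp add: phi_def right_diff_distrib fgen_fconst)
  also have "\<dots> \<triangleq> (ps k * (yy k * v) + (if i ! k = i ! Suc k then v else 0)) - fconst ?d * (fconst (C q) * v)"
   by (intro cg_diff ps_yy D(1,4) kn cg_lmult YSk)
  also have "\<dots> \<triangleq> (ps k * (fconst (C p) * v) + (if i ! k = i ! Suc k then v else 0)) - fconst ?d * (fconst (C q) * v)"
   by (intro cg_diff cg_add cg_refl cg_lmult Yk)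
  also have "(if i ! k = i ! Suc k then v else 0) = fconst (?d * (C q - C p)) * v"
   using dm i by simp
  finally show ?thesis
   by (simp add: phi_def right_diff_distrib fc_simps fconst_diff left_diff_distrib mult.commute)
 qed
 have Y3: "yy m * phi k p q v \<triangleq> fconst (C (cs ! m)) * phi k p q v" if "m < length cs" "m \<noteq> k" "m \<noteq> Suc k" for m
 proof -
  have "yy m * phi k p q v = yy m * (ps k * v) - fconst ?d * (yy m * v)"
   by (simp add: phi_def right_diff_distrib fgen_fconst)
  also have "\<dots> \<triangleq> fconst (C (cs ! m)) * (ps k * v) - fconst ?d * (fconst (C (cs ! m)) * v)"
   using that D(2) by (intro cg_diff cg_lmult ps_yy_far kn D(5)) auto
  finally show ?thesis by (simp add: phi_def right_diff_distrib fc_simps mult.commute)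
 qed
 show ?thesis unfolding wt_def
 proof (intro conjI allI impI)
  show "sw k i \<in> seqs e n" using seqs_sw[OF D(1) kn] .
  show "length (sw k cs) \<le> n" using D(2) by simp
  show "map res (sw k cs) = take (length (sw k cs)) (sw k i)"
   using v k by (simp add: map_sw take_sw wt_def)
  show "ee (sw k i) * phi k p q v \<triangleq> phi k p q v" by (rule E)
  fix m assume "m < length (sw k cs)"
  then show "yy m * phi k p q v \<triangleq> fconst (C (sw k cs ! m)) * phi k p q v"
   using Y1 Y2 Y3[of m] k p q by (simp add: nth_sw)
 qed
qed

text \<open>\<open>dd\<close> is antisymmetric, so the terms linear in \<open>psi\<close> cancel;
  \<open>psi\<close> squared acts by the value of \<open>Q\<close>.\<close>

lemma phi_phi:
 assumes v: "wt i cs v" and k: "Suc k < length cs" and p: "cs ! k = p" and q: "cs ! Suc k = q"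
  and ok: "okc p" "okc q" "p \<noteq> q"
 shows "phi k q p (phi k p q v) \<triangleq> fconst (Qc p q) * v"
proof -
 note D = wtD[OF v]
 have kn: "Suc k < n" using D(2) k by simp
 have i: "i ! k = res p" "i ! Suc k = res q" using D(3)[of k] D(3)[of "Suc k"] k p q by auto
 have "ps k * ps k * v \<triangleq> fsubst2 (QL (res p) (res q)) (yy k) (yy (Suc k)) * v"
  using rel_apply[OF rel_p2[OF kn D(1)] D(4)] i by simp
 also have "\<dots> \<triangleq> fconst (poly2 (QL (res p) (res q)) (C p) (C q)) * v"
  using D(5)[of k] D(5)[of "Suc k"] k p q by (intro fsubst2_eigen) auto
 finally have "ps k * ps k * v - fconst (dd p q * dd p q) * v
   \<triangleq> fconst (poly2 (QL (res p) (res q)) (C p) (C q)) * v - fconst (dd p q * dd p q) * v"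
  by (intro cg_diff cg_refl)
 moreover have "phi k q p (phi k p q v) = ps k * ps k * v - fconst (dd p q * dd p q) * v"
  by (simp add: phi_def dd_sym[OF ok] fconst_uminus right_diff_distrib fc_simps mult.assoc)
 ultimately show ?thesis by (simp add: Qc_def fconst_diff left_diff_distrib)
qed

lemma phi_commute:
 assumes "Suc k < n" and "Suc k' < n" and "Suc k < k' \<or> Suc k' < k"
 shows "phi k p q (phi k' p' q' v) \<triangleq> phi k' p' q' (phi k p q v)"
proof -
 have "ps k * ps k' * v \<triangleq> ps k' * ps k * v" using cg_rmult[OF J_cg[OF rel_pp[OF assms]]] .
 moreover have "phi k p q (phi k' p' q' v) = ps k * ps k' * v - (fconst (dd p' q') * (ps k * v)
   + (fconst (dd p q) * (ps k' * v) - fconst (dd p q * dd p' q') * v))"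
  by (simp add: phi_def right_diff_distrib fc_simps mult.assoc mult.commute[of "dd p q"])
 moreover have "phi k' p' q' (phi k p q v) = ps k' * ps k * v - (fconst (dd p' q') * (ps k * v)
   + (fconst (dd p q) * (ps k' * v) - fconst (dd p q * dd p' q') * v))"
  by (simp add: phi_def right_diff_distrib fc_simps mult.assoc mult.commute[of "dd p q"])
 ultimately show ?thesis using cg_diff[OF _ cg_refl] by simp
qed

text \<open>Three parts of the difference vanish separately: the quadratic terms in the same
  \<open>psi\<close> combine with the defect of the braid relation by the definition of the divided
  difference, and the linear terms cancel by partial fractions.\<close>

lemma phi_braid:
 assumes v: "wt i cs v" and k: "Suc (Suc k) < length cs"
  and p: "cs ! k = p" and q: "cs ! Suc k = q" and r: "cs ! Suc (Suc k) = r"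
  and ok: "okc p" "okc q" "okc r" "p \<noteq> q" "q \<noteq> r" "p \<noteq> r"
 shows "phi k q r (phi (Suc k) p r (phi k p q v)) \<triangleq> phi (Suc k) p q (phi k p r (phi (Suc k) q r v))"
proof -
 note D = wtD[OF v]
 have kn: "Suc (Suc k) < n" using D(2) k by simp
 have i: "i ! k = res p" "i ! Suc k = res q" "i ! Suc (Suc k) = res r"
  using D(3)[of k] D(3)[of "Suc k"] D(3)[of "Suc (Suc k)"] k p q r by auto
 have Y: "yy k * v \<triangleq> fconst (C p) * v" "yy (Suc k) * v \<triangleq> fconst (C q) * v"
  "yy (Suc (Suc k)) * v \<triangleq> fconst (C r) * v"
  using D(5)[of k] D(5)[of "Suc k"] D(5)[of "Suc (Suc k)"] k p q r by auto
 let ?a = "ps k" and ?b = "ps (Suc k)"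
 let ?q1 = "poly2 (QL (res p) (res q)) (C p) (C q)" and ?q2 = "poly2 (QL (res q) (res r)) (C q) (C r)"
 let ?q3 = "poly3 (Q3L (res p) (res q) (res r)) (C p) (C q) (C r)"
 have "?b * ?a * ?b * v - ?a * ?b * ?a * v
   \<triangleq> fsubst3 (Q3L (res p) (res q) (res r)) (yy k) (yy (Suc k)) (yy (Suc (Suc k))) * v"
  using rel_apply[OF rel_braid[OF kn D(1)] D(4)] i by (simp add: left_diff_distrib)
 also have "\<dots> \<triangleq> fconst ?q3 * v" by (intro fsubst3_eigen Y)
 finally have B: "?b * ?a * ?b * v - ?a * ?b * ?a * v \<triangleq> fconst ?q3 * v" .
 have "?a * ?a * v \<triangleq> fsubst2 (QL (res p) (res q)) (yy k) (yy (Suc k)) * v"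
  using rel_apply[OF rel_p2[OF _ D(1)] D(4), of k] i kn by simp
 also have "\<dots> \<triangleq> fconst ?q1 * v" by (intro fsubst2_eigen Y)
 finally have A: "?a * ?a * v \<triangleq> fconst ?q1 * v" .
 have "?b * ?b * v \<triangleq> fsubst2 (QL (res q) (res r)) (yy (Suc k)) (yy (Suc (Suc k))) * v"
  using rel_apply[OF rel_p2[OF _ D(1)] D(4), of "Suc k"] i kn by simp
 also have "\<dots> \<triangleq> fconst ?q2 * v" by (intro fsubst2_eigen Y)
 finally have A': "?b * ?b * v \<triangleq> fconst ?q2 * v" .
 let ?d = "dd p q" and ?d' = "dd q r" and ?d'' = "dd p r"
 have exp: "phi k q r (phi (Suc k) p r (phi k p q v)) - phi (Suc k) p q (phi k p r (phi (Suc k) q r v))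
  = - (?b * ?a * ?b * v - ?a * ?b * ?a * v) - fconst ?d'' * (?a * ?a * v - ?b * ?b * v)
   + fconst (?d'' * (?d + ?d') - ?d * ?d') * (?a * v - ?b * v)"
  by (simp add: phi_def fconst_add fconst_diff right_diff_distrib left_diff_distrib
    distrib_left distrib_right fc_simps mult.assoc)
   (simp add: mult.commute mult.left_commute)
 have z: "?d'' * (?d + ?d') - ?d * ?d' = 0" using dd_braid[OF ok] by simp
 have "res p = res r \<Longrightarrow> ?d'' * (?q1 - ?q2) = - ?q3"
 proof -
  assume eq: "res p = res r"
  have "(C p - C r) * ?q3 = ?q1 - ?q2"
   using Q3_value[of p q r] eq ok by (simp add: okc_def)
  have "?d'' * (?q1 - ?q2) = - (?d'' * (C r - C p)) * ?q3"
   unfolding \<open>(C p - C r) * ?q3 = ?q1 - ?q2\<close>[symmetric] by (simp add: algebra_simps)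
  then show ?thesis using dd_mult[OF ok(1,3,6)] eq by simp
 qed
 moreover have "res p \<noteq> res r \<Longrightarrow> ?d'' = 0 \<and> ?q3 = 0"
  using Q3_diff by (simp add: dd_def poly3_def poly2_def)
 ultimately have q: "- ?q3 - ?d'' * (?q1 - ?q2) = 0" by (cases "res p = res r") auto
 have "phi k q r (phi (Suc k) p r (phi k p q v)) - phi (Suc k) p q (phi k p r (phi (Suc k) q r v))
  \<triangleq> - (fconst ?q3 * v) - fconst ?d'' * (fconst ?q1 * v - fconst ?q2 * v) + 0"
  unfolding exp z by (intro cg_add cg_diff cg_uminus cg_lmult A A' B) simp
 also have "\<dots> = fconst (- ?q3 - ?d'' * (?q1 - ?q2)) * v"
  by (simp add: fconst_uminus fconst_diff left_diff_distrib right_diff_distrib fc_simps)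
 finally show ?thesis using q by (simp add: cg_def)
qed

end

section \<open>The possible eigenvalues of the next strand\<close>

lemma addable_empty: "cont ` addable l {} = {1..l} \<times> {0}"
proof -
 have "addable l {} = {(k, r, c). 1 \<le> k \<and> k \<le> l \<and> r = 1 \<and> c = 1}"
  by (auto simp: addable_def young_def)
 then show ?thesis by (force simp: image_iff)
qed

lemma seqs_nth: "i \<in> seqs e n \<Longrightarrow> m < n \<Longrightarrow> i ! m < e"
 unfolding seqs_def using nth_mem[of m i] by blast

context klr_quotient
begin

text \<open>A substitute for a list of eigenvalues: no eigenvectors are known to exist yet, so the
  roots are recorded as an annihilating polynomial without repeated index.\<close>

definition kills :: "nat \<Rightarrow> (nat \<times> int) set \<Rightarrow> ('l klr_free) \<Rightarrow> bool"
 where "kills m S v \<longleftrightarrow> fsubst1 (\<Prod>q\<in>S. [:- C q, 1:]) (yy m) * v \<triangleq> 0"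

lemma kills_mono:
 assumes "finite T" and "S \<subseteq> T" and "kills m S v"
 shows "kills m T v"
proof -
 have "(\<Prod>q\<in>T. [:- C q, 1:]) = (\<Prod>q\<in>T - S. [:- C q, 1:]) * (\<Prod>q\<in>S. [:- C q, 1:])"
  using prod.subset_diff[OF assms(2,1)] .
 then show ?thesis
  using cg_lmult[OF assms(3)[unfolded kills_def]] by (simp add: kills_def fsubst1_mult mult.assoc)
qed

lemma kills_eigen:
 assumes "yy m * v \<triangleq> fconst (C q) * v" and "kills m S v"
  and "\<And>q'. q' \<in> S \<Longrightarrow> C q - C q' dvd 1"
 shows "v \<triangleq> 0"
proof (rule unit_cg_0)
 have "(\<Prod>q'\<in>S. C q - C q') dvd (\<Prod>q'\<in>S. 1)" by (rule prod_dvd_prod) (use assms(3) in auto)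
 then show "(\<Prod>q'\<in>S. C q - C q') dvd 1" by simp
 have "fconst (poly (\<Prod>q\<in>S. [:- C q, 1:]) (C q)) * v \<triangleq> fsubst1 (\<Prod>q\<in>S. [:- C q, 1:]) (yy m) * v"
  by (rule cg_sym[OF fsubst1_eigen[OF assms(1)]])
 also have "\<dots> \<triangleq> 0" using assms(2) by (simp add: kills_def)
 finally show "fconst (\<Prod>q'\<in>S. C q - C q') * v \<triangleq> 0" by (simp add: poly_prod)
qed

lemma lin_eigen: "fsubst1 [:- C q, 1:] (yy m) * w \<triangleq> 0 \<longleftrightarrow> yy m * w \<triangleq> fconst (C q) * w"
proof -
 have "fsubst1 [:- C q, 1:] (yy m) * w = yy m * w - fconst (C q) * w"
  by (simp add: fsubst1_linear fconst_uminus left_diff_distrib)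
 then show ?thesis by (simp add: cg_def)
qed

text \<open>Splitting off the factor of \<open>q\<close> leaves an eigenvector for
  \<open>C q\<close> of the same weight, which is zero by assumption; so this factor can be left
  out.\<close>

lemma kills_remove:
 assumes "finite S" and v: "wt i cs v" and m: "m < n" and k: "kills m S v" and "finite B"
  and B: "\<And>q w. q \<in> B \<Longrightarrow> wt i cs w \<Longrightarrow> yy m * w \<triangleq> fconst (C q) * w \<Longrightarrow> w \<triangleq> 0"
 shows "kills m (S - B) v"
 using \<open>finite B\<close> B
proof (induction B)
 case empty
 then show ?case using k by simp
next
 case (insert q B)
 then have IH: "kills m (S - B) v" by blast
 show ?case
 proof (cases "q \<in> S - B")
  case True
  let ?w = "fsubst1 (\<Prod>q\<in>S - insert q B. [:- C q, 1:]) (yy m) * v"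
  have "(\<Prod>q\<in>S - B. [:- C q, 1:]) = [:- C q, 1:] * (\<Prod>q\<in>(S - B) - {q}. [:- C q, 1:])"
   by (rule prod.remove) (use assms(1) True in auto)
  moreover have "(S - B) - {q} = S - insert q B" by auto
  ultimately have "fsubst1 [:- C q, 1:] (yy m) * ?w \<triangleq> 0"
   using IH by (simp only: kills_def fsubst1_mult mult.assoc)
  then have "?w \<triangleq> 0"
   using insert.prems wt_fsubst1[OF v m] unfolding lin_eigen by blast
  then show ?thesis by (simp add: kills_def)
 next
  case False
  then have "S - insert q B = S - B" by auto
  then show ?thesis using IH by simp
 qed
qed

definition nextc :: "node list \<Rightarrow> nat \<Rightarrow> (nat \<times> int) set"
 where "nextc xs j = {q \<in> cont ` addable l (set xs). res q = j}"

text \<open>The induction statement for strand \<open>m\<close>, numbered from 0. It quantifies over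
  all standard lists of length \<open>m\<close>, because the step applies it after strands have been
  interchanged.\<close>

definition addk :: "nat \<Rightarrow> bool"
 where "addk m \<longleftrightarrow> (\<forall>xs i v. stdl l xs \<and> length xs = m \<and> wt i (map cont xs) v \<longrightarrow>
  kills m (nextc xs (i ! m)) v)"

lemma finite_nextc: "stdl l xs \<Longrightarrow> finite (nextc xs j)"
 using finite_addable by (simp add: nextc_def)

lemma nextc_okc: "stdl l xs \<Longrightarrow> length xs < n \<Longrightarrow> q \<in> nextc xs j \<Longrightarrow> okc q \<and> res q = j"
 using okc_addable by (auto simp: nextc_def)

text \<open>The roots allowed by \<open>addk\<close> and \<open>q\<close> all have the residue of
  this strand, so the value of the annihilating polynomial at \<open>C q\<close> is a product of
  units.\<close>

lemma not_addable_vanish: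
 assumes "addk (length xs)" and n: "length xs < n" and xs: "stdl l xs"
  and v: "wt i (map cont xs @ [q]) v" and q: "okc q" "q \<notin> cont ` addable l (set xs)"
 shows "v \<triangleq> 0"
proof (rule kills_eigen)
 have v': "wt i (map cont xs) v" using wt_take[OF v, of "length xs"] by simp
 then show "kills (length xs) (nextc xs (i ! length xs)) v" using assms(1) xs by (simp add: addk_def)
 show "yy (length xs) * v \<triangleq> fconst (C q) * v" using wtD(5)[OF v, of "length xs"] by (simp add: nth_append)
 fix q' assume q': "q' \<in> nextc xs (i ! length xs)"
 then have "okc q'" "res q' = i ! length xs" using nextc_okc[OF xs n] by auto
 moreover have "q' \<noteq> q" using q' q by (auto simp: nextc_def)
 ultimately show "C q - C q' dvd 1"
  using wtD(3)[OF v, of "length xs"] q(1) by (intro C_unit') (auto simp: nth_append)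
qed

lemma near_not_addable:
 assumes "young l D" and "B \<in> addable l D" and "near q (cont B)" and "q \<noteq> cont B"
 shows "q \<notin> cont ` addable l D"
 using addable_far[OF assms(1) _ assms(2)] assms(3,4) by blast

text \<open>
 A vector whose content sequence ends in \<open>q, a, q\<close> with \<open>q\<close> and \<open>a\<close> adjacent is killed: both
 places where the braid relation could take it are empty, and its value there is a unit.
\<close>

lemma ghost_base:
 assumes ak: "addk (length us)" "addk (Suc (length us))" and n: "Suc (Suc (length us)) < n"
  and xs: "stdl l (us @ [B, A])" and nr: "near (cont A) (cont B)"
  and v: "wt i (map cont us @ [cont B, cont A, cont B]) v"
 shows "v \<triangleq> 0"
proof -
 let ?p = "length us" and ?q = "cont B" and ?a = "cont A"
 let ?cs = "map cont us @ [?q, ?a, ?q]"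
 note D = wtD[OF v]
 have uB: "stdl l (us @ [B])" using stdl_append[of l "us @ [B]" "[A]"] xs by simp
 have u: "stdl l us" using stdl_append[OF uB] .
 have B: "B \<in> addable l (set us)" using uB by (simp add: stdl_snoc)
 have A: "A \<in> addable l (set (us @ [B]))" using xs stdl_snoc[of l "us @ [B]" A] by simp
 have okB: "okc ?q" and okA: "okc ?a" using okc_cont[OF xs] n by auto
 have ne: "?a \<noteq> ?q" using stdl_cont_neq(1)[OF xs, of ?p] by (auto simp: nth_append)
 have nr': "near ?q ?a" using nr near_sym by blast
 have bA: "\<bar>snd ?a\<bar> + 1 < int n" using addable_Suc_content_bound[OF uB A] n by simp
 have rne: "res ?a \<noteq> res ?q" using res_near[OF _ nr ne] okA by (simp add: okc_def)
 then have d: "dd ?q ?a = 0" "dd ?a ?q = 0" by (auto simp: dd_def)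
 have s1: "sw ?p ?cs = map cont us @ [?a, ?q, ?q]" "sw (Suc ?p) ?cs = map cont us @ [?q, ?q, ?a]"
  by (auto simp: sw_def nth_append list_update_append)
 have "wt (sw ?p i) (sw ?p ?cs) (phi ?p ?q ?a v)"
  by (rule phi_wt[OF v]) (use okA okB ne in \<open>auto simp: nth_append\<close>)
 from wt_take[OF this, of "Suc ?p"]
 have "wt (sw ?p i) (map cont us @ [?a]) (ps ?p * v)" by (simp add: s1 phi_def d)
 then have v1: "ps ?p * v \<triangleq> 0"
  using near_not_addable[OF stdl_young[OF u] B nr ne] n okA u ak(1)
  by (intro not_addable_vanish[of us _ ?a]) auto
 have "wt (sw (Suc ?p) i) (sw (Suc ?p) ?cs) (phi (Suc ?p) ?a ?q v)"
  by (rule phi_wt[OF v]) (use okA okB ne in \<open>auto simp: nth_append\<close>)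
 from wt_take[OF this, of "Suc (Suc ?p)"]
 have "wt (sw (Suc ?p) i) (map cont (us @ [B]) @ [?q]) (ps (Suc ?p) * v)" by (simp add: s1 phi_def d)
 then have v2: "ps (Suc ?p) * v \<triangleq> 0"
  using near_not_addable[OF stdl_young[OF uB] A nr' ne[symmetric]] n okB uB ak(2)
  by (intro not_addable_vanish[of "us @ [B]" _ ?q]) auto
 have i: "i ! ?p = res ?q" "i ! Suc ?p = res ?a" "i ! Suc (Suc ?p) = res ?q"
  using D(3)[of ?p] D(3)[of "Suc ?p"] D(3)[of "Suc (Suc ?p)"] by (auto simp: nth_append)
 have "fconst (poly3 (Q3L (res ?q) (res ?a) (res ?q)) (C ?q) (C ?a) (C ?q)) * v
   \<triangleq> fsubst3 (Q3L (res ?q) (res ?a) (res ?q)) (yy ?p) (yy (Suc ?p)) (yy (Suc (Suc ?p))) * v"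
  using D(5)[of ?p] D(5)[of "Suc ?p"] D(5)[of "Suc (Suc ?p)"]
  by (intro cg_sym[OF fsubst3_eigen]) (auto simp: nth_append)
 also have "\<dots> \<triangleq> (ps (Suc ?p) * ps ?p * ps (Suc ?p) - ps ?p * ps (Suc ?p) * ps ?p) * v"
  using rel_apply[OF rel_braid[OF n D(1)] D(4)] i by (simp add: cg_sym)
 also have "\<dots> = ps (Suc ?p) * ps ?p * (ps (Suc ?p) * v) - ps ?p * ps (Suc ?p) * (ps ?p * v)"
  by (simp add: left_diff_distrib mult.assoc)
 also have "\<dots> \<triangleq> ps (Suc ?p) * ps ?p * 0 - ps ?p * ps (Suc ?p) * 0"
  by (intro cg_diff cg_lmult v1 v2)
 finally have F: "fconst (poly3 (Q3L (res ?q) (res ?a) (res ?q)) (C ?q) (C ?a) (C ?q)) * v \<triangleq> 0"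
  by simp
 show ?thesis
  by (rule unit_cg_0[OF Q3_unit F]) (use okA okB nr' ne bA in \<open>auto simp: okc_def\<close>)
qed

text \<open>\<open>B\<close> is carried to the right by intertwiners until it stands directly before
  \<open>A\<close>. Each of them can be undone up to a unit, so the vanishing of the final vector is
  inherited by the original one.\<close>

lemma ghost_aux:
 assumes ak: "\<And>m'. m' < m \<Longrightarrow> addk m'" and m: "m < n" and nr: "near (cont A) (cont B)"
 shows "stdl l (us @ [B] @ zs @ [A]) \<Longrightarrow> young l (set (us @ [B] @ zs) - {B}) \<Longrightarrow>
  length (us @ [B] @ zs @ [A]) = m \<Longrightarrow> wt i (map cont (us @ [B] @ zs @ [A]) @ [cont B]) v \<Longrightarrow> v \<triangleq> 0"
proof (induction zs arbitrary: us i v)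
 case Nil
 then show ?case using ghost_base[of us B A i v] ak m nr by simp
next
 case (Cons Z zs)
 let ?xs = "us @ [B] @ (Z # zs) @ [A]" and ?p = "length us"
 let ?cs = "map cont ?xs @ [cont B]"
 have sw: "sw ?p ?xs = (us @ [Z]) @ [B] @ zs @ [A]"
  by (auto simp: sw_def nth_append list_update_append)
 have swc: "sw ?p ?cs = map cont ((us @ [Z]) @ [B] @ zs @ [A]) @ [cont B]"
  by (auto simp: sw_def nth_append list_update_append)
 have xs': "stdl l (sw ?p ?xs)"
  by (rule stdl_move_right[OF Cons.prems(1), of _ "length us + 2 + length zs"])
   (use Cons.prems(2) in \<open>auto simp: nth_append\<close>)
 have nadj: "\<not> adj (?xs ! ?p) (?xs ! Suc ?p)"
  using stdl_sw_iff[OF Cons.prems(1), of ?p] xs' by simp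
 have ok: "okc (cont B)" "okc (cont Z)" using okc_cont[OF Cons.prems(1)] Cons.prems(3) m by auto
 have ne: "cont B \<noteq> cont Z" using stdl_cont_neq(1)[OF Cons.prems(1), of ?p] by (auto simp: nth_append)
 have w: "wt (sw ?p i) (sw ?p ?cs) (phi ?p (cont B) (cont Z) v)"
  by (rule phi_wt[OF Cons.prems(4)]) (use ok ne in \<open>auto simp: nth_append\<close>)
 have "phi ?p (cont B) (cont Z) v \<triangleq> 0"
 proof (rule Cons.IH)
  show "stdl l ((us @ [Z]) @ [B] @ zs @ [A])" using xs' sw by simp
  show "young l (set ((us @ [Z]) @ [B] @ zs) - {B})" using Cons.prems(2) by (simp add: insert_commute)
  show "length ((us @ [Z]) @ [B] @ zs @ [A]) = m" using Cons.prems(3) by simp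
  show "wt (sw ?p i) (map cont ((us @ [Z]) @ [B] @ zs @ [A]) @ [cont B]) (phi ?p (cont B) (cont Z) v)"
   using w swc by simp
 qed
 then have "phi ?p (cont Z) (cont B) (phi ?p (cont B) (cont Z) v) \<triangleq> phi ?p (cont Z) (cont B) 0"
  by (rule phi_cong)
 then have "phi ?p (cont Z) (cont B) (phi ?p (cont B) (cont Z) v) \<triangleq> 0" by (simp add: phi_def)
 moreover have "phi ?p (cont Z) (cont B) (phi ?p (cont B) (cont Z) v) \<triangleq> fconst (Qc (cont B) (cont Z)) * v"
  by (rule phi_phi[OF Cons.prems(4)]) (use ok ne in \<open>auto simp: nth_append\<close>)
 moreover have "Qc (cont B) (cont Z) dvd 1"
  using Qc_unit_stdl[OF Cons.prems(1) _ _ nadj] Cons.prems(3) m by (simp add: nth_append)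
 ultimately show ?case using unit_cg_0 cg_trans cg_sym by blast
qed

text \<open>A content beside that of the last node \<open>A\<close> which cannot be added after
  \<open>A\<close> already occurs at a removable node of the smaller diagram, and that node plays
  the part of \<open>B\<close>.\<close>

lemma ghost:
 assumes ak: "\<And>m'. m' < Suc (length ys) \<Longrightarrow> addk m'" and m: "Suc (length ys) < n"
  and xs: "stdl l (ys @ [A])" and q: "near (cont A) q" "q \<noteq> cont A"
  "q \<notin> cont ` addable l (set (ys @ [A]))" and v: "wt i (map cont (ys @ [A]) @ [q]) v"
 shows "v \<triangleq> 0"
proof -
 have "A \<in> addable l (set ys)" and ys: "stdl l ys" using xs by (auto simp: stdl_snoc)
 then obtain B where B: "B \<in> set ys" "cont B = q" "young l (set ys - {B})"
  using missing_corner[OF stdl_young[OF ys] _ q(1,2)] q(3) by auto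
 obtain us zs where "ys = us @ B # zs" using split_list[OF B(1)] by blast
 then show ?thesis
  using ghost_aux[of "Suc (length ys)" A B us zs i v] ak m xs B q v by simp
qed

text \<open>\<open>psi\<close> carries the new strand past \<open>A\<close>, where the induction
  hypothesis restricts its eigenvalues. Returning by \<open>psi\<close> squared multiplies by the
  value of \<open>Q\<close>, which adds the contents beside that of \<open>A\<close> as possible
  roots. Those belonging to no addable node are then discarded as ghosts.\<close>

lemma addk_step_diff:
 assumes ak: "\<And>m'. m' < Suc (length ys) \<Longrightarrow> addk m'" and m: "Suc (length ys) < n"
  and xs: "stdl l (ys @ [A])" and v: "wt i (map cont (ys @ [A])) v"
  and ne: "i ! Suc (length ys) \<noteq> res (cont A)"
 shows "kills (Suc (length ys)) (nextc (ys @ [A]) (i ! Suc (length ys))) v"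
proof -
 let ?p = "length ys" let ?m = "Suc ?p" and ?a = "cont A" and ?j = "i ! Suc (length ys)"
 note D = wtD[OF v]
 have ys: "stdl l ys" and A: "A \<in> addable l (set ys)" using xs by (auto simp: stdl_snoc)
 have okA: "okc ?a" using okc_cont[OF xs] m by simp
 have j: "?j < e" using seqs_nth[OF D(1) m] .
 have ip: "i ! ?p = res ?a" using D(3)[of ?p] by (simp add: nth_append)
 have vy: "wt i (map cont ys) v" using wt_take[OF v, of ?p] by simp
 let ?S = "nextc ys ?j" and ?T = "{q. near ?a q \<and> q \<noteq> ?a \<and> res q = ?j}"
 let ?P = "\<Prod>q\<in>?S. [:- C q, 1:]" and ?R = "\<Prod>q\<in>?T. [:- C q, 1:]"
 have "wt (sw ?p i) (map cont ys) (ps ?p * v)" using ps_wt_low[OF vy] m by simp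
 then have "kills ?p (nextc ys (sw ?p i ! ?p)) (ps ?p * v)" using ak[of ?p] ys by (simp add: addk_def)
 then have k1: "fsubst1 ?P (yy ?p) * (ps ?p * v) \<triangleq> 0"
  using D(6) m by (simp add: kills_def nth_sw)
 define w where "w = fsubst1 ?P (yy ?m) * v"
 have ww: "wt i (map cont (ys @ [A])) w" unfolding w_def by (rule wt_fsubst1[OF v m])
 \<comment> \<open>The residues differ, so \<open>psi\<close> interchanges the two \<open>y\<close>
   without a correction term, and \<open>psi\<close> kills \<open>w\<close>.\<close>
 have "fsubst1 ?P (yy ?p) * (ps ?p * v) \<triangleq> ps ?p * (fsubst1 ?P (yy ?m) * v)"
 proof (rule fsubst1_intertwine[where U = "{u. ee i * u \<triangleq> u}"])
  fix u assume "u \<in> {u. ee i * u \<triangleq> u}"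
  then have u: "ee i * u \<triangleq> u" by simp
  have "ee i * (yy ?m * u) \<triangleq> yy ?m * (ee i * u)"
   using cg_rmult[OF cg_sym[OF J_cg[OF rel_ye[OF m D(1)]]], of u] by (simp add: mult.assoc)
  then show "yy ?m * u \<in> {u. ee i * u \<triangleq> u}" using cg_lmult[OF u] cg_trans by blast
  show "yy ?p * (ps ?p * u) \<triangleq> ps ?p * (yy ?m * u)"
   using ps_yy_Suc[OF D(1) m u] ne ip by simp
 qed (use D(4) in simp)
 with k1 have "ps ?p * w \<triangleq> 0" unfolding w_def using cg_sym cg_trans by blast
 from cg_lmult[OF this, of "ps ?p"] have "ps ?p * ps ?p * w \<triangleq> 0" by (simp add: mult.assoc)
 moreover have "ps ?p * ps ?p * w \<triangleq> fsubst2 (QL (res ?a) ?j) (yy ?p) (yy ?m) * w"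
  using rel_apply[OF rel_p2[OF m D(1)] wtD(4)[OF ww]] ip by simp
 moreover have "fsubst2 (QL (res ?a) ?j) (yy ?p) (yy ?m) * w
   \<triangleq> fsubst1 (poly (QL (res ?a) ?j) [:C ?a:]) (yy ?m) * w"
 proof -
  have "(yy ?p - fconst (C ?a)) * fsubst1 R (yy ?m) \<in> {f. f * w \<triangleq> 0}" for R
   using wtD(5)[OF wt_fsubst1[OF ww m, of R], of ?p]
   by (simp add: nth_append cg_def left_diff_distrib mult.assoc)
  from left_ideal.fsubst2_half_value[OF ann_left_ideal this] show ?thesis unfolding ann_iff .
 qed
 ultimately have k2: "fsubst1 (poly (QL (res ?a) ?j) [:C ?a:]) (yy ?m) * w \<triangleq> 0"
  using cg_sym cg_trans by blast
 obtain \<epsilon> where e: "\<epsilon> dvd 1" "poly (QL (res ?a) ?j) [:C ?a:] = [:\<epsilon>:] * (\<Prod>q\<in>?T. [:C q, -1:])"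
  using QL_value[of ?a ?j] okA j ne by (auto simp: okc_def)
 have "(\<Prod>q\<in>?T. [:C q, -1:]) = (\<Prod>q\<in>?T. - [:- C q, 1:])" by simp
 also have "\<dots> = (-1) ^ card ?T * ?R" by (rule prod_uminus)
 also have "(-1) ^ card ?T = [:(-1) ^ card ?T :: 'l:]" by (simp add: poly_const_pow[symmetric] one_pCons)
 finally have "poly (QL (res ?a) ?j) [:C ?a:] = Polynomial.smult (\<epsilon> * (-1) ^ card ?T) ?R"
  using e(2) by (simp add: mult.commute)
 then have "fconst (\<epsilon> * (-1) ^ card ?T) * (fsubst1 ?R (yy ?m) * w) \<triangleq> 0"
  using k2 by (simp add: fsubst1_smult mult.assoc)
 moreover have "\<epsilon> * (-1) ^ card ?T dvd 1"
 proof -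
  have "(-1) ^ card ?T * (-1) ^ card ?T = (1 :: 'l)" by (simp add: power_mult_distrib[symmetric])
  then have "(-1 :: 'l) ^ card ?T dvd 1" by (rule dvdI[OF sym])
  from mult_dvd_mono[OF e(1) this] show ?thesis by simp
 qed
 ultimately have "fsubst1 ?R (yy ?m) * w \<triangleq> 0" using unit_cg_0 by blast
 then have "fsubst1 (?R * ?P) (yy ?m) * v \<triangleq> 0" by (simp add: w_def fsubst1_mult mult.assoc)
 \<comment> \<open>Contents beside an addable content are never addable, so the union has no double
   root and one product over it suffices.\<close>
 moreover have "?T \<inter> ?S = {}"
  using near_not_addable[OF stdl_young[OF ys] A] iffD1[OF near_sym] unfolding nextc_def by blast
 ultimately have k3: "kills ?m (?T \<union> ?S) v"
  by (simp add: kills_def prod.union_disjoint finite_near finite_nextc[OF ys])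
 let ?B = "{q \<in> ?T. q \<notin> cont ` addable l (set (ys @ [A]))}"
 have "kills ?m ((?T \<union> ?S) - ?B) v"
 proof (rule kills_remove[OF _ v m k3])
  show "finite (?T \<union> ?S)" "finite ?B" using finite_near finite_nextc[OF ys] by auto
  fix q w assume q: "q \<in> ?B" and w: "wt i (map cont (ys @ [A])) w" "yy ?m * w \<triangleq> fconst (C q) * w"
  have "wt i (map cont (ys @ [A]) @ [q]) w" using wt_snoc[OF w(1), of q] w(2) m q by simp
  then show "w \<triangleq> 0" using ghost[OF ak m xs, of q i w] q by auto
 qed
 moreover have "(?T \<union> ?S) - ?B \<subseteq> nextc (ys @ [A]) ?j"
 proof
  fix q assume q: "q \<in> (?T \<union> ?S) - ?B"
  show "q \<in> nextc (ys @ [A]) ?j"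
  proof (cases "q \<in> ?T")
   case False
   then obtain B where B: "B \<in> addable l (set ys)" "q = cont B" "res q = ?j"
    using q by (auto simp: nextc_def)
   then have "B \<noteq> A" using ne by auto
   then show ?thesis using addable_insert[OF A B(1)] B by (auto simp: nextc_def)
  qed (use q in \<open>auto simp: nextc_def\<close>)
 qed
 ultimately show ?thesis using kills_mono[OF finite_nextc[OF xs]] by blast
qed

text \<open>A nilHecke computation: with equal residues \<open>psi\<close> squared is zero, and this
  excludes the content of \<open>A\<close> itself as the next eigenvalue. The other addable nodes of
  this residue stay addable.\<close>

lemma addk_step_same:
 assumes ak: "addk (length ys)" and m: "Suc (length ys) < n"
  and xs: "stdl l (ys @ [A])" and v: "wt i (map cont (ys @ [A])) v"
  and same: "i ! Suc (length ys) = res (cont A)"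
 shows "kills (Suc (length ys)) (nextc (ys @ [A]) (i ! Suc (length ys))) v"
proof -
 let ?p = "length ys" let ?m = "Suc ?p" and ?a = "cont A" and ?j = "i ! Suc (length ys)"
 note D = wtD[OF v]
 have ys: "stdl l ys" and A: "A \<in> addable l (set ys)" using xs by (auto simp: stdl_snoc)
 have j: "?j < e" using seqs_nth[OF D(1) m] .
 have ip: "i ! ?p = ?j" using D(3)[of ?p] same by (simp add: nth_append)
 have vy: "wt i (map cont ys) v" using wt_take[OF v, of ?p] by simp
 let ?S = "nextc ys ?j" let ?H = "\<Prod>q\<in>?S - {?a}. [:- C q, 1:]"
 have aS: "?a \<in> ?S" using A same by (auto simp: nextc_def)
 have P: "(\<Prod>q\<in>?S. [:- C q, 1:]) = ?H * [:- C ?a, 1:]"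
  using prod.remove[OF finite_nextc[OF ys] aS, of "\<lambda>q. [:- C q, 1:]"] by (simp only: mult.commute)
 have "wt (sw ?p i) (map cont ys) (ps ?p * v)" using ps_wt_low[OF vy] m by simp
 then have "kills ?p (nextc ys (sw ?p i ! ?p)) (ps ?p * v)" using ak ys by (simp add: addk_def)
 then have "fsubst1 (?H * [:- C ?a, 1:]) (yy ?p) * (ps ?p * v) \<triangleq> 0"
  using D(6) m by (simp add: kills_def nth_sw P)
 then have k1: "fsubst1 ?H (yy ?p) * (yy ?p * (ps ?p * v) - fconst (C ?a) * (ps ?p * v)) \<triangleq> 0"
  by (simp only: fsubst1_mult mult.assoc) (simp add: fsubst1_linear fconst_uminus left_diff_distrib)
 \<comment> \<open>The operator \<open>(y_p - C a) psi\<close> after \<open>psi\<close> has been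
   moved to the left. It intertwines \<open>y_m\<close> with \<open>y_p\<close> on weight vectors,
   although \<open>psi\<close> alone does not.\<close>
 define h where "h = ps ?p * (yy ?m - fconst (C ?a)) - 1"
 have hu: "h * u = ps ?p * (yy ?m * u - fconst (C ?a) * u) - u" for u
  by (simp add: h_def left_diff_distrib right_diff_distrib mult.assoc)
 have psy: "yy ?p * (ps ?p * u) \<triangleq> ps ?p * (yy ?m * u) - u" if "ee i * u \<triangleq> u" for u
  using ps_yy_Suc[OF D(1) m that] ip by simp
 have "yy ?p * (ps ?p * v) - fconst (C ?a) * (ps ?p * v) \<triangleq> h * v"
  using cg_diff[OF psy[OF D(4)] cg_refl[of "fconst (C ?a) * (ps ?p * v)"]]
  by (simp add: hu right_diff_distrib fgen_fconst algebra_simps)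
 from cg_trans[OF cg_sym[OF cg_lmult[OF this]] k1]
 have k2: "fsubst1 ?H (yy ?p) * (h * v) \<triangleq> 0" .
 define w where "w = fsubst1 ?H (yy ?m) * v"
 have ww: "wt i (map cont (ys @ [A])) w" unfolding w_def by (rule wt_fsubst1[OF v m])
 have "fsubst1 ?H (yy ?p) * (h * v) \<triangleq> h * (fsubst1 ?H (yy ?m) * v)"
 proof (rule fsubst1_intertwine[where U = "{u. wt i (map cont (ys @ [A])) u}"])
  fix u assume "u \<in> {u. wt i (map cont (ys @ [A])) u}"
  then have u: "wt i (map cont (ys @ [A])) u" by simp
  have yu: "wt i (map cont (ys @ [A])) (yy ?m * u)"
   using wt_fsubst1[OF u m, of "[:0, 1:]"] by (simp add: fsubst1_linear)
  then show "yy ?m * u \<in> {u. wt i (map cont (ys @ [A])) u}" by simp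
  let ?u = "yy ?m * u - fconst (C ?a) * u"
  have "ee i * ?u \<triangleq> ?u" using wtD(4)[OF yu] wtD(4)[OF u]
   by (auto simp: right_diff_distrib fgen_fconst intro: cg_diff cg_lmult)
  from psy[OF this] have "yy ?p * (h * u) \<triangleq> (ps ?p * (yy ?m * ?u) - ?u) - fconst (C ?a) * u"
   unfolding hu right_diff_distrib[of "yy ?p" "ps ?p * _" u]
   using wtD(5)[OF u, of ?p] by (intro cg_diff) (auto simp: nth_append)
  also have "\<dots> = h * (yy ?m * u)" by (simp add: hu right_diff_distrib fgen_fconst)
  finally show "yy ?p * (h * u) \<triangleq> h * (yy ?m * u)" .
 qed (use v in simp)
 with k2 have "h * w \<triangleq> 0" unfolding w_def using cg_sym cg_trans by blast
 then have hw: "ps ?p * (yy ?m * w - fconst (C ?a) * w) \<triangleq> w" by (simp add: hu cg_def)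
 let ?x = "yy ?m * w - fconst (C ?a) * w"
 have yw: "wt i (map cont (ys @ [A])) (yy ?m * w)"
  using wt_fsubst1[OF ww m, of "[:0, 1:]"] by (simp add: fsubst1_linear)
 have ex: "ee i * ?x \<triangleq> ?x" using wtD(4)[OF yw] wtD(4)[OF ww]
  by (auto simp: right_diff_distrib fgen_fconst intro: cg_diff cg_lmult)
 \<comment> \<open>The equation \<open>h * w = 0\<close> says that \<open>w\<close> is in the image
   of \<open>psi\<close>, so \<open>psi\<close> kills it.\<close>
 have "ps ?p * w \<triangleq> ps ?p * (ps ?p * ?x)" using cg_lmult[OF cg_sym[OF hw]] .
 also have "\<dots> \<triangleq> fsubst2 (QL ?j ?j) (yy ?p) (yy ?m) * ?x"
  using rel_apply[OF rel_p2[OF m D(1)] ex] ip by (simp add: mult.assoc)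
 also have "\<dots> = 0" using QL_same[OF j] by simp
 finally have pw: "ps ?p * w \<triangleq> 0" .
 \<comment> \<open>The relation between \<open>y\<close> and \<open>psi\<close> expresses
   \<open>w\<close> itself through \<open>psi * w\<close>, since \<open>y_p\<close> acts on
   \<open>w\<close> by a scalar; hence \<open>w\<close> is zero.\<close>
 have "yy ?m * (ps ?p * w) \<triangleq> ps ?p * (yy ?p * w) + w"
  using ps_yy[OF D(1) m wtD(4)[OF ww]] ip by simp
 from cg_trans[OF cg_sym[OF this] cg_lmult[OF pw]] have s: "ps ?p * (yy ?p * w) + w \<triangleq> 0" by simp
 have "ps ?p * (yy ?p * w) \<triangleq> 0"
 proof -
  have "ps ?p * (yy ?p * w) \<triangleq> ps ?p * (fconst (C ?a) * w)"
   using wtD(5)[OF ww, of ?p] by (intro cg_lmult) (simp add: nth_append)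
  also have "\<dots> \<triangleq> fconst (C ?a) * 0" unfolding fgen_fconst by (rule cg_lmult[OF pw])
  finally show ?thesis by simp
 qed
 from cg_diff[OF s this] have "w \<triangleq> 0" by simp
 then have "kills ?m (?S - {?a}) v" by (simp add: w_def kills_def)
 moreover have "?S - {?a} \<subseteq> nextc (ys @ [A]) ?j"
  using addable_insert[OF A] by (auto simp: nextc_def)
 ultimately show ?thesis using kills_mono[OF finite_nextc[OF xs]] by blast
qed

lemma addk: "m < n \<Longrightarrow> addk m"
proof (induction m rule: less_induct)
 case (less m)
 show ?case unfolding addk_def
 proof (intro allI impI)
  fix xs i v assume a: "stdl l xs \<and> length xs = m \<and> wt i (map cont xs) v"
  show "kills m (nextc xs (i ! m)) v"
  proof (cases xs rule: rev_cases)
   case Nil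
   have i: "i \<in> seqs e n" "ee i * v \<triangleq> v" "length i = n" using a wtD by blast+
   have 0: "0 < n" using less.prems by simp
   have "fsubst1 (WL (i ! 0)) (yy 0) * v \<triangleq> 0 * v"
    using rel_apply[of "fsubst1 (WL (i ! 0)) (yy 0)" i 0] rel_cyc[OF 0 i(1)] i(2) by simp
   moreover have "WL (i ! 0) = (\<Prod>q\<in>nextc [] (i ! 0). [:- C q, 1:])"
   proof -
    have "nextc [] (i ! 0) = (\<lambda>k. (k, 0)) ` {k\<in>{1..l}. res (k, 0) = i ! 0}"
     by (auto simp: nextc_def addable_empty)
    moreover have "inj_on (\<lambda>k::nat. (k, 0::int)) S" for S by (auto simp: inj_on_def)
    moreover have "i ! 0 < e" using seqs_nth[OF i(1) 0] .
    ultimately show ?thesis using WL_value by (simp add: prod.reindex)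
   qed
   ultimately show ?thesis using Nil a by (simp add: kills_def)
  next
   case (snoc ys A)
   then show ?thesis
    using addk_step_same[of ys A i v] addk_step_diff[of ys A i v] less a
    by (cases "i ! m = res (cont A)") auto
  qed
 qed
qed

end

text \<open>At each step distinct addable nodes have distinct contents, so the contents determine
  which node was added.\<close>

lemma stdl_cont_inject:
 assumes "stdl l xs" and "stdl l zs" and "map cont xs = map cont zs"
 shows "xs = zs"
 using assms
proof (induction xs arbitrary: zs rule: rev_induct)
 case (snoc A xs)
 obtain ys B where zs: "zs = ys @ [B]"
  using snoc.prems(3) by (cases zs rule: rev_cases) auto
 have eq: "xs = ys" using snoc zs by (simp add: stdl_snoc)
 have "A \<in> addable l (set xs)" "B \<in> addable l (set xs)" "young l (set xs)"
  using snoc.prems zs eq by (auto simp: stdl_snoc stdl_young)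
 moreover have "near (cont A) (cont B)" using snoc.prems(3) zs by (simp add: near_def)
 ultimately have "A = B" using addable_far by blast
 then show ?case using eq zs by simp
qed simp

lemma fconst_cancel: "a dvd 1 \<Longrightarrow> fconst (uinv a) * (fconst a * v) = v"
 by (simp add: fconst_fconst uinv_mult_left)

section \<open>Interpolation projections\<close>

context content_data
begin

definition tabs :: "node list set"
 where "tabs = {xs. stdl l xs \<and> length xs = n}"

definition rs :: "node list \<Rightarrow> nat list"
 where "rs xs = map res (map cont xs)"

lemma finite_tabs: "finite tabs"
 unfolding tabs_def by (rule finite_stdl)

lemma tabs_okc: "xs \<in> tabs \<Longrightarrow> m < n \<Longrightarrow> okc (cont (xs ! m))"
 using okc_cont[of xs] by (auto simp: tabs_def)

lemma rs_seqs: "xs \<in> tabs \<Longrightarrow> rs xs \<in> seqs e n"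
 using okc_cont[of xs] res_less by (auto simp: seqs_def rs_def tabs_def okc_def)

lemma tabs_neq:
 assumes "xs \<in> tabs" and "zs \<in> tabs" and "xs \<noteq> zs"
 shows "\<exists>m<n. cont (xs ! m) \<noteq> cont (zs ! m)"
proof (rule ccontr)
 assume "\<not> (\<exists>m<n. cont (xs ! m) \<noteq> cont (zs ! m))"
 then have "map cont xs = map cont zs" using assms by (intro nth_equalityI) (auto simp: tabs_def)
 then show False using stdl_cont_inject assms by (auto simp: tabs_def)
qed

text \<open>Only contents of the residue of \<open>q\<close> enter: across different residues the
  differences need not be units, and the idempotents of the residue sequences separate those
  cases.\<close>

definition Lag :: "nat \<times> int \<Rightarrow> 'l poly"
 where "Lag q = (\<Prod>q'\<in>{q'\<in>Cset. q' \<noteq> q \<and> res q' = res q}.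
  Polynomial.smult (uinv (C q - C q')) [:- C q', 1:])"

lemma poly_Lag_same:
 assumes "okc q" shows "poly (Lag q) (C q) = 1"
proof -
 have "poly (Lag q) (C q) = (\<Prod>q'\<in>{q'\<in>Cset. q' \<noteq> q \<and> res q' = res q}. uinv (C q - C q') * (C q - C q'))"
  by (simp add: Lag_def poly_prod algebra_simps)
 also have "\<dots> = (\<Prod>q'\<in>{q'\<in>Cset. q' \<noteq> q \<and> res q' = res q}. 1)"
  using assms by (intro prod.cong refl uinv_mult_left C_unit') (auto simp: Cset_def)
 finally show ?thesis by simp
qed

lemma poly_Lag_other:
 assumes "okc q'" and "q' \<noteq> q" and "res q' = res q"
 shows "poly (Lag q) (C q') = 0"
proof -
 have "q' \<in> {q' \<in> Cset. q' \<noteq> q \<and> res q' = res q}" using assms by (simp add: Cset_def)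
 then show ?thesis unfolding Lag_def poly_prod using finite_Cset
  by (intro prod_zero bexI[of _ q']) auto
qed

text \<open>The projection onto the simultaneous eigenspace with the contents of \<open>xs\<close>.\<close>

definition FT :: "node list \<Rightarrow> 'l klr_free"
 where "FT xs = foldr (\<lambda>m f. fsubst1 (Lag (cont (xs ! m))) (yy m) * f) [0..<n] (ee (rs xs))"

text \<open>Stated for any left ideal in order to serve twice, for annihilators modulo
  \<open>J\<close> and for annihilators in V. If the residue sequences agree but the tableaux
  differ, some two contents of equal residue differ and their Lagrange factor vanishes.\<close>

lemma FT_value:
 assumes N: "left_ideal N" and xs: "xs \<in> tabs" and zs: "zs \<in> tabs"
  and y: "\<And>m. m < n \<Longrightarrow> yy m - fconst (C (cont (zs ! m))) \<in> N"
  and e: "ee (rs xs) - (if rs xs = rs zs then 1 else 0) \<in> N"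
 shows "FT xs - (if xs = zs then 1 else 0) \<in> N"
proof -
 interpret left_ideal N by (rule N)
 let ?v = "\<lambda>m. poly (Lag (cont (xs ! m))) (C (cont (zs ! m)))"
 let ?b = "if rs xs = rs zs then 1 else 0 :: 'l"
 have *: "foldr (\<lambda>m f. fsubst1 (Lag (cont (xs ! m))) (yy m) * f) ms (ee (rs xs))
   - fconst (prod_list (map ?v ms) * ?b) \<in> N" if "set ms \<subseteq> {..<n}" for ms
  using that
 proof (induction ms)
  case Nil
  then show ?case using e by (simp split: if_splits)
 next
  case (Cons m ms)
  let ?F = "foldr (\<lambda>m f. fsubst1 (Lag (cont (xs ! m))) (yy m) * f) ms (ee (rs xs))"
   and ?c = "prod_list (map ?v ms) * ?b"
  have 1: "fsubst1 (Lag (cont (xs ! m))) (yy m) * (?F - fconst ?c) \<in> N"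
   using Cons by (intro N_mult) auto
  have 2: "fconst ?c * (fsubst1 (Lag (cont (xs ! m))) (yy m) - fconst (?v m)) \<in> N"
   using Cons.prems by (intro N_mult fsubst1_value y) auto
  have "foldr (\<lambda>m f. fsubst1 (Lag (cont (xs ! m))) (yy m) * f) (m # ms) (ee (rs xs))
   - fconst (prod_list (map ?v (m # ms)) * ?b)
   = fsubst1 (Lag (cont (xs ! m))) (yy m) * (?F - fconst ?c)
    + fconst ?c * (fsubst1 (Lag (cont (xs ! m))) (yy m) - fconst (?v m))"
   by (simp only: foldr.simps comp_def list.map prod_list.Cons mult.assoc fconst_mult'[of "?v m"]
     right_diff_distrib fconst_commute[of _ ?c]) simp
  then show ?case using N_add[OF 1 2] by simp
 qed
 have "prod_list (map ?v [0..<n]) * ?b = (if xs = zs then 1 else 0)"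
 proof (cases "xs = zs")
  case True
  have "map ?v [0..<n] = map (\<lambda>_. 1) [0..<n]"
   using True poly_Lag_same tabs_okc[OF xs] by (intro map_cong) auto
  then show ?thesis using True by (simp add: prod_list_replicate map_replicate_const)
 next
  case False
  show ?thesis
  proof (cases "rs xs = rs zs")
   case True
   obtain m where m: "m < n" "cont (xs ! m) \<noteq> cont (zs ! m)" using tabs_neq[OF xs zs False] by auto
   have "rs xs ! m = rs zs ! m" using True by simp
   then have "res (cont (xs ! m)) = res (cont (zs ! m))"
    using m xs zs by (simp add: rs_def tabs_def)
   then have "?v m = 0" using poly_Lag_other[of "cont (zs ! m)" "cont (xs ! m)"] m tabs_okc[OF zs] by auto
   then have "0 \<in> set (map ?v [0..<n])" using m by force
   then show ?thesis using False by (simp add: prod_list_zero_iff)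
  qed (use False in auto)
 qed
 moreover have "set [0..<n] \<subseteq> {..<n}" by auto
 note *[OF this]
 ultimately show ?thesis unfolding FT_def by (auto split: if_splits)
qed

end

context klr_quotient
begin

definition wtn :: "node list \<Rightarrow> ('l klr_free) \<Rightarrow> bool"
 where "wtn xs v \<longleftrightarrow> wt (rs xs) (map cont xs) v"

lemma wtn_0: "xs \<in> tabs \<Longrightarrow> wtn xs 0"
 unfolding wtn_def using rs_seqs by (intro wt_0) (auto simp: tabs_def rs_def)

lemma ee_other:
 assumes "wt i cs v" and "j \<in> seqs e n" and "j \<noteq> i"
 shows "ee j * v \<triangleq> 0"
proof -
 have "ee j * v \<triangleq> ee j * ee i * v" using cg_lmult[OF cg_sym[OF wtD(4)[OF assms(1)]]] by (simp add: mult.assoc)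
 also have "\<dots> \<triangleq> 0 * v"
  using J_cg[OF rel_ee[OF assms(2) wtD(1)[OF assms(1)]]] assms(3) by (intro cg_rmult) simp
 finally show ?thesis by simp
qed

lemma FT_wtn:
 assumes xs: "xs \<in> tabs" and zs: "zs \<in> tabs" and v: "wtn zs v"
 shows "FT xs * v \<triangleq> (if xs = zs then v else 0)"
proof -
 note v' = v[unfolded wtn_def]
 have "FT xs - (if xs = zs then 1 else 0) \<in> {f. f * v \<triangleq> 0}"
 proof (rule FT_value[OF ann_left_ideal xs zs])
  show "ee (rs xs) - (if rs xs = rs zs then 1 else 0) \<in> {f. f * v \<triangleq> 0}"
   unfolding ann_iff using wtD(4)[OF v'] ee_other[OF v' rs_seqs[OF xs]] by auto
  fix m assume "m < n"
  then show "yy m - fconst (C (cont (zs ! m))) \<in> {f. f * v \<triangleq> 0}"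
   unfolding ann_iff using wtD(5)[OF v', of m] zs by (simp add: tabs_def)
 qed
 then show ?thesis unfolding ann_iff by (auto split: if_splits)
qed

text \<open>One root is peeled off at a time: the product over the remaining roots, divided by its
  value at \<open>C q\<close>, cuts out the component of eigenvalue \<open>C q\<close>.\<close>

lemma eigen_split:
 assumes "finite S" and m: "m < n" and v: "wt i cs v" and "kills m S v"
  and "\<And>q q'. q \<in> S \<Longrightarrow> q' \<in> S \<Longrightarrow> q \<noteq> q' \<Longrightarrow> C q - C q' dvd 1"
 shows "\<exists>u. (\<forall>q\<in>S. wt i cs (u q) \<and> yy m * u q \<triangleq> fconst (C q) * u q) \<and> v \<triangleq> (\<Sum>q\<in>S. u q)"
 using assms(1,3-5)
proof (induction S arbitrary: v)
 case empty
 then show ?case by (simp add: kills_def)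
next
 case (insert q S)
 let ?g = "\<Prod>q\<in>S. [:- C q, 1:]"
 let ?w = "fsubst1 ?g (yy m) * v" and ?a = "uinv (poly ?g (C q))"
 have u: "poly ?g (C q) dvd 1"
 proof -
  have "(\<Prod>q'\<in>S. C q - C q') dvd (\<Prod>q'\<in>S. 1)"
  proof (rule prod_dvd_prod)
   fix q' assume "q' \<in> S"
   then show "C q - C q' dvd 1" using insert.prems(3)[of q q'] insert.hyps by blast
  qed
  then show ?thesis by (simp add: poly_prod)
 qed
 have ww: "wt i cs ?w" using wt_fsubst1[OF insert.prems(1) m] .
 have "fsubst1 [:- C q, 1:] (yy m) * ?w \<triangleq> 0"
  using insert.prems(2)[unfolded kills_def prod.insert[OF insert.hyps]]
  by (simp only: fsubst1_mult mult.assoc)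
 then have eig: "yy m * ?w \<triangleq> fconst (C q) * ?w" unfolding lin_eigen .
 define v' where "v' = v - fconst ?a * ?w"
 have v': "wt i cs v'"
  using wt_add[OF insert.prems(1) wt_fconst[OF ww, of "- ?a"]] by (simp add: v'_def fconst_uminus)
 have "fsubst1 ?g (yy m) * v' = ?w - fconst ?a * (fsubst1 ?g (yy m) * ?w)"
  by (simp add: v'_def right_diff_distrib fconst_left_commute)
 also have "\<dots> \<triangleq> ?w - fconst ?a * (fconst (poly ?g (C q)) * ?w)"
  by (rule cg_diff[OF cg_refl cg_lmult[OF fsubst1_eigen[OF eig]]])
 finally have "fsubst1 ?g (yy m) * v' \<triangleq> ?w - ?w" unfolding fconst_cancel[OF u] .
 then have "kills m S v'" by (simp only: kills_def diff_self)
 moreover have "\<And>q q'. q \<in> S \<Longrightarrow> q' \<in> S \<Longrightarrow> q \<noteq> q' \<Longrightarrow> C q - C q' dvd 1"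
  using insert.prems(3) by blast
 ultimately obtain u where u: "\<forall>q\<in>S. wt i cs (u q) \<and> yy m * u q \<triangleq> fconst (C q) * u q"
  "v' \<triangleq> (\<Sum>q\<in>S. u q)" using insert.IH[OF v'] by blast
 let ?u = "u(q := fconst ?a * ?w)"
 have "v = fconst ?a * ?w + v'" by (simp add: v'_def)
 also have "\<dots> \<triangleq> fconst ?a * ?w + (\<Sum>q\<in>S. u q)" using u(2) by (intro cg_add cg_refl)
 also have "\<dots> = (\<Sum>q\<in>insert q S. ?u q)" using insert.hyps by (auto intro!: sum.cong)
 finally have "v \<triangleq> (\<Sum>q\<in>insert q S. ?u q)" .
 moreover have "yy m * (fconst ?a * ?w) \<triangleq> fconst (C q) * (fconst ?a * ?w)"
  using cg_lmult[OF eig, of "fconst ?a"] by (simp add: fc_simps mult.commute)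
 ultimately show ?case using u(1) wt_fconst[OF ww] by (intro exI[of _ ?u]) auto
qed

definition decomp :: "('l klr_free) \<Rightarrow> bool"
 where "decomp v \<longleftrightarrow> (\<exists>u. (\<forall>xs\<in>tabs. wtn xs (u xs)) \<and> v \<triangleq> (\<Sum>xs\<in>tabs. u xs))"

lemma decomp_0: "decomp 0"
 unfolding decomp_def by (intro exI[of _ "\<lambda>_. 0"]) (simp add: wtn_0)

lemma decomp_add:
 assumes "decomp v" and "decomp w" shows "decomp (v + w)"
proof -
 obtain u u' where u: "\<forall>xs\<in>tabs. wtn xs (u xs)" "v \<triangleq> (\<Sum>xs\<in>tabs. u xs)"
  "\<forall>xs\<in>tabs. wtn xs (u' xs)" "w \<triangleq> (\<Sum>xs\<in>tabs. u' xs)" using assms by (auto simp: decomp_def)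
 then show ?thesis unfolding decomp_def
  by (intro exI[of _ "\<lambda>xs. u xs + u' xs"]) (auto simp: wtn_def sum.distrib intro: wt_add cg_add)
qed

lemma decomp_cong: "v \<triangleq> w \<Longrightarrow> decomp w \<Longrightarrow> decomp v"
 unfolding decomp_def using cg_trans by blast

lemma decomp_sum: "(\<And>x. x \<in> A \<Longrightarrow> decomp (f x)) \<Longrightarrow> decomp (sum f A)"
 by (induction A rule: infinite_finite_induct) (auto intro: decomp_0 decomp_add)

text \<open>Strand by strand: \<open>addk\<close> bounds the eigenvalues of the next strand by
  addable contents, and each component then belongs to a longer standard list.\<close>

lemma wt_decomp:
 assumes "stdl l xs" and "length xs \<le> n" and "wt i (map cont xs) v"
 shows "decomp v"
 using assms
proof (induction "n - length xs" arbitrary: xs v)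
 case 0
 then have len: "length xs = n" by linarith
 then have xs: "xs \<in> tabs" using 0(2) by (simp add: tabs_def)
 then have "i = rs xs" using 0 wtD(6)[OF 0(4)] by (simp add: wt_def rs_def tabs_def)
 then have "wtn xs v" unfolding wtn_def using 0(4) by simp
 then show ?case unfolding decomp_def using xs wtn_0 finite_tabs
  by (intro exI[of _ "\<lambda>zs. if zs = xs then v else 0"]) auto
next
 case (Suc k)
 let ?m = "length xs" and ?S = "nextc xs (i ! length xs)"
 have m: "?m < n" using Suc.hyps(2) by simp
 have un: "C q - C q' dvd 1" if "q \<in> ?S" "q' \<in> ?S" "q \<noteq> q'" for q q'
  using nextc_okc[OF Suc.prems(1) m that(1)] nextc_okc[OF Suc.prems(1) m that(2)] that(3)
  by (intro C_unit') auto
 have "kills ?m ?S v" using addk[OF m] Suc.prems by (simp add: addk_def)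
 then obtain u where u: "\<forall>q\<in>?S. wt i (map cont xs) (u q) \<and> yy ?m * u q \<triangleq> fconst (C q) * u q"
  "v \<triangleq> (\<Sum>q\<in>?S. u q)"
  using eigen_split[OF finite_nextc[OF Suc.prems(1)] m Suc.prems(3)] un by blast
 have "decomp (u q)" if q: "q \<in> ?S" for q
 proof -
  obtain A where A: "A \<in> addable l (set xs)" "q = cont A" "res q = i ! ?m"
   using q by (auto simp: nextc_def)
  have "wt i (map cont xs @ [q]) (u q)"
  proof (rule wt_snoc)
   show "wt i (map cont xs) (u q)" using u(1) q by blast
   show "yy (length (map cont xs)) * u q \<triangleq> fconst (C q) * u q"
    unfolding length_map using u(1) q by blast
  qed (use m A in simp_all)
  then show ?thesis using Suc.hyps(1)[of "xs @ [A]" "u q"] Suc.hyps(2) Suc.prems A m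
   by (simp add: stdl_snoc)
 qed
 then show ?case using decomp_cong[OF u(2) decomp_sum] by blast
qed

text \<open>Some decomposition of 1 into weight vectors exists by \<open>wt_decomp\<close>.
  Multiplying it by \<open>FT xs\<close> singles out its component at \<open>xs\<close>, so this
  component is \<open>FT xs\<close> itself.\<close>

lemma FT_props:
 shows FT_sum: "(\<Sum>xs\<in>tabs. FT xs) \<triangleq> 1"
  and wtn_FT: "xs \<in> tabs \<Longrightarrow> wtn xs (FT xs)"
proof -
 have "decomp (\<Sum>i\<in>seqs e n. ee i)"
 proof (rule decomp_sum)
  fix i assume i: "i \<in> seqs e n"
  have "wt i (map cont []) (ee i)" using J_cg[OF rel_ee[OF i i]] i by (simp add: wt_def)
  then show "decomp (ee i)" using wt_decomp[of "[]"] by simp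
 qed
 then have "decomp 1" using decomp_cong[OF cg_sym[OF J_cg[OF rel_sum]]] by simp
 then obtain u where u: "\<forall>xs\<in>tabs. wtn xs (u xs)" "1 \<triangleq> (\<Sum>xs\<in>tabs. u xs)"
  by (auto simp: decomp_def)
 have F: "FT xs \<triangleq> u xs" if xs: "xs \<in> tabs" for xs
 proof -
  have "FT xs * 1 \<triangleq> FT xs * (\<Sum>zs\<in>tabs. u zs)" by (rule cg_lmult[OF u(2)])
  also have "\<dots> = (\<Sum>zs\<in>tabs. FT xs * u zs)" by (simp add: sum_distrib_left)
  also have "\<dots> \<triangleq> (\<Sum>zs\<in>tabs. if xs = zs then u zs else 0)"
   using u(1) by (intro cg_sum FT_wtn xs) auto
  finally show ?thesis using xs finite_tabs by simp
 qed
 show "(\<Sum>xs\<in>tabs. FT xs) \<triangleq> 1" using cg_trans[OF cg_sum[OF F] cg_sym[OF u(2)]] .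
 show "xs \<in> tabs \<Longrightarrow> wtn xs (FT xs)" using u(1) F wt_cong cg_sym unfolding wtn_def by blast
qed

subsection \<open>A basis of each projective module\<close>

abbreviation ph :: "nat \<Rightarrow> node list \<Rightarrow> ('l klr_free) \<Rightarrow> 'l klr_free"
 where "ph p s v \<equiv> phi p (cont (s ! p)) (cont (s ! Suc p)) v"

lemma tabs_cont_neq:
 assumes "s \<in> tabs" and "Suc p < n"
 shows "cont (s ! p) \<noteq> cont (s ! Suc p)"
 using stdl_cont_neq(1)[of l s p] assms by (simp add: tabs_def)

lemma rs_sw: "s \<in> tabs \<Longrightarrow> Suc p < n \<Longrightarrow> rs (sw p s) = sw p (rs s)"
 by (simp add: rs_def tabs_def map_sw)

lemma ph_wt:
 assumes s: "s \<in> tabs" and p: "Suc p < n" and v: "wtn s v"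
 shows "wt (rs (sw p s)) (map cont (sw p s)) (ph p s v)"
 using phi_wt[OF v[unfolded wtn_def], of p "cont (s ! p)" "cont (s ! Suc p)"]
  tabs_okc[OF s] tabs_cont_neq[OF s p] p s rs_sw[OF s p]
 by (simp add: tabs_def map_sw)

lemma ph_wtn:
 assumes "s \<in> tabs" and "Suc p < n" and "wtn s v"
 shows "wtn (sw p s) (ph p s v)"
 using ph_wt[OF assms] by (simp add: wtn_def)

lemma sw_tabs: "s \<in> tabs \<Longrightarrow> stdl l (sw p s) \<Longrightarrow> sw p s \<in> tabs"
 by (simp add: tabs_def)

lemma ph_inv:
 assumes s: "s \<in> tabs" and p: "Suc p < n" and v: "wtn s v"
 shows "ph p (sw p s) (ph p s v) \<triangleq> fconst (Qc (cont (s ! p)) (cont (s ! Suc p))) * v"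
proof -
 have "length s = n" using s by (simp add: tabs_def)
 then show ?thesis
  using phi_phi[OF v[unfolded wtn_def], of p "cont (s ! p)" "cont (s ! Suc p)"]
   tabs_okc[OF s] tabs_cont_neq[OF s p] p by (simp add: nth_sw)
qed

lemma Qc_unit_tabs:
 assumes "s \<in> tabs" and "Suc p < n" and "stdl l (sw p s)"
 shows "Qc (cont (s ! p)) (cont (s ! Suc p)) dvd 1"
 using Qc_unit_stdl[of s p] stdl_sw_iff[of l s p] assms by (simp add: tabs_def)

text \<open>The swap is obstructed by adjacency, so the image would carry, after \<open>p\<close>
  nodes, a content beside that of an addable node. Such a content is not addable.\<close>

lemma ph_zero:
 assumes s: "s \<in> tabs" and p: "Suc p < n" and v: "wtn s v" and ns: "\<not> stdl l (sw p s)"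
 shows "ph p s v \<triangleq> 0"
proof (rule not_addable_vanish)
 have sl: "stdl l s" "length s = n" using s by (auto simp: tabs_def)
 show "stdl l (take p s)" using stdl_take[OF sl(1)] .
 show "addk (length (take p s))" "length (take p s) < n" using addk p sl by simp_all
 have "take (Suc p) (sw p s) = take p s @ [s ! Suc p]"
  using p sl by (simp add: take_Suc_conv_app_nth nth_sw take_sw_low)
 then show "wt (rs (sw p s)) (map cont (take p s) @ [cont (s ! Suc p)]) (ph p s v)"
  using wt_take[OF ph_wt[OF s p v], of "Suc p"] by (simp add: take_map)
 show "okc (cont (s ! Suc p))" using tabs_okc[OF s p] .
 have "adj (s ! p) (s ! Suc p)" using stdl_sw_iff[of l s p] sl p ns by simp
 then have nr: "near (cont (s ! Suc p)) (cont (s ! p))" "cont (s ! Suc p) \<noteq> cont (s ! p)"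
  using adj_near[of "s ! p" "s ! Suc p"] near_sym[of "cont (s ! p)"] by (metis, metis)
 have "s ! p \<in> addable l (set (take p s))" using stdl_nth[OF sl(1)] p sl by simp
 then show "cont (s ! Suc p) \<notin> cont ` addable l (set (take p s))"
  using near_not_addable[OF stdl_young[OF stdl_take[OF sl(1)]] _ nr] by blast
qed

lemma ph_commute:
 assumes s: "s \<in> tabs" and "Suc p < n" and "Suc q < n" and "Suc p < q \<or> Suc q < p"
 shows "ph p (sw q s) (ph q s v) \<triangleq> ph q (sw p s) (ph p s v)"
proof -
 have "length s = n" using s by (simp add: tabs_def)
 then have "sw q s ! p = s ! p" "sw q s ! Suc p = s ! Suc p" "sw p s ! q = s ! q" "sw p s ! Suc q = s ! Suc q"
  using assms by (auto simp: nth_sw)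
 then show ?thesis using phi_commute[OF assms(2-4)] by simp
qed

lemma ph_braid:
 assumes s: "s \<in> tabs" and p: "Suc (Suc p) < n" and v: "wtn s v"
 shows "ph p (sw (Suc p) (sw p s)) (ph (Suc p) (sw p s) (ph p s v))
  \<triangleq> ph (Suc p) (sw p (sw (Suc p) s)) (ph p (sw (Suc p) s) (ph (Suc p) s v))"
proof -
 have l: "length s = n" "stdl l s" using s by (auto simp: tabs_def)
 then show ?thesis
  using phi_braid[OF v[unfolded wtn_def], of p "cont (s ! p)" "cont (s ! Suc p)" "cont (s ! Suc (Suc p))"]
   tabs_okc[OF s] stdl_cont_neq(1)[OF l(2), of p] stdl_cont_neq(1)[OF l(2), of "Suc p"]
   stdl_cont_neq3[OF l(2), of p] p
  by (simp add: nth_sw)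
qed

definition above :: "node list \<Rightarrow> nat \<Rightarrow> node list set"
 where "above xs m = {s \<in> tabs. set s = set xs \<and> drop m s = drop m xs}"

text \<open>A candidate basis for the tableaux that differ from \<open>xs\<close> only among the
  first \<open>m\<close> entries. The factor \<open>h\<close> records that each vector generates
  \<open>v\<close> again, which later makes coefficients computable.\<close>

definition family :: "node list \<Rightarrow> ('l klr_free) \<Rightarrow> nat \<Rightarrow> (node list \<Rightarrow> 'l klr_free) \<Rightarrow> bool"
 where "family xs v m f \<longleftrightarrow> f xs = v \<and> (\<forall>s\<in>above xs m. wtn s (f s) \<and>
  (\<exists>g. f s = g * v) \<and> (\<exists>h. h * f s \<triangleq> v) \<and>
  (\<forall>p. Suc p < m \<and> stdl l (sw p s) \<longrightarrow> (\<exists>a. ph p s (f s) \<triangleq> fconst a * f (sw p s))))"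

text \<open>Minimal coset representatives of one symmetric group in the next: the node
  \<open>xs ! m\<close>, now \<open>d\<close> places before its original position, is reached by
  intertwiners in a fixed order, so no choice of reduced words has to be compared.\<close>

primrec fam :: "nat \<Rightarrow> (node list \<Rightarrow> 'l klr_free) \<Rightarrow> nat \<Rightarrow> node list \<Rightarrow> 'l klr_free"
 where "fam m f 0 = f"
 | "fam m f (Suc d) = (\<lambda>s. ph (m - Suc d) (sw (m - Suc d) s) (fam m f d (sw (m - Suc d) s)))"

definition moved :: "node list \<Rightarrow> nat \<Rightarrow> nat \<Rightarrow> node list set"
 where "moved xs m d = {s \<in> above xs (Suc m). s ! (m - d) = xs ! m}"

context
 fixes xs v m f
 assumes xs: "xs \<in> tabs" and m: "m < n" and f: "family xs v m f"
begin

lemma above_take: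
 assumes "s \<in> above xs (Suc m)"
 shows "set (take (Suc m) s) = set (take (Suc m) xs)"
proof -
 have "distinct s" "distinct xs" using assms xs by (auto simp: above_def tabs_def stdl_distinct)
 then have "set (take (Suc m) s) = set s - set (drop (Suc m) s)"
  "set (take (Suc m) xs) = set xs - set (drop (Suc m) xs)"
  by (metis append_take_drop_id distinct_append Diff_disjoint Un_Diff Un_Diff_Int Diff_cancel set_append
    Diff_triv sup_bot_right inf_commute)+
 then show ?thesis using assms by (simp add: above_def)
qed

lemma above_remove:
 assumes "s \<in> above xs (Suc m)"
 shows "young l (set (take (Suc m) s) - {xs ! m})"
proof -
 have sx: "stdl l xs" "length xs = n" using xs by (auto simp: tabs_def)
 have "xs ! m \<notin> set (take m xs)" using stdl_nth[OF sx(1)] m sx by (auto simp: addable_def)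
 then have "set (take (Suc m) xs) - {xs ! m} = set (take m xs)"
  using m sx by (simp add: take_Suc_conv_app_nth)
 then show ?thesis using above_take[OF assms] stdl_young[OF stdl_take[OF sx(1)]] by metis
qed

lemma above_sw:
 assumes "s \<in> above xs (Suc m)" and "Suc p \<le> m" and "stdl l (sw p s)"
 shows "sw p s \<in> above xs (Suc m)"
 using assms m by (auto simp: above_def sw_tabs drop_sw tabs_def)

lemma moved_length: "s \<in> moved xs m d \<Longrightarrow> s \<in> tabs \<and> length s = n"
 by (auto simp: moved_def above_def tabs_def)

lemma moved_sw:
 assumes s: "s \<in> moved xs m d" and p: "Suc p \<le> m" and st: "stdl l (sw p s)"
 shows "Suc p < m - d \<or> m - d < p \<Longrightarrow> sw p s \<in> moved xs m d"
  and "p = m - Suc d \<Longrightarrow> Suc d \<le> m \<Longrightarrow> sw p s \<in> moved xs m (Suc d)"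
  and "d = Suc d' \<Longrightarrow> p = m - d \<Longrightarrow> d \<le> m \<Longrightarrow> sw p s \<in> moved xs m d'"
 using s above_sw[of s p] p st m moved_length[OF s] by (auto simp: moved_def nth_sw Suc_diff_Suc)

text \<open>\<open>xs ! m\<close> is removable from the shape of the first \<open>m + 1\<close>
  nodes, so it can return towards place \<open>m\<close> through standard tableaux.\<close>

lemma moved_right:
 assumes s: "s \<in> moved xs m (Suc d)" and d: "Suc d \<le> m"
 shows "sw (m - Suc d) s \<in> moved xs m d"
proof -
 have "stdl l (sw (m - Suc d) s)"
 proof (rule stdl_move_right)
  show "stdl l s" using s by (simp add: moved_def above_def tabs_def)
  show "Suc (m - Suc d) < Suc m" "Suc m \<le> length s" using d m moved_length[OF s] by auto
  show "young l (set (take (Suc m) s) - {s ! (m - Suc d)})"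
   using above_remove[of s] s by (simp add: moved_def)
 qed
 then show ?thesis using moved_sw(3)[OF s, of "m - Suc d" d] d by simp
qed

lemma moved_0: "s \<in> moved xs m 0 \<Longrightarrow> s \<in> above xs m"
 using m xs by (auto simp: moved_def above_def tabs_def Cons_nth_drop_Suc[symmetric])

text \<open>Each intertwiner between standard tableaux is undone by the opposite one up to the unit
  \<open>Qc\<close>, which yields the witness for recovering \<open>v\<close>.\<close>

lemma fam_props:
 "d \<le> m \<Longrightarrow> s \<in> moved xs m d \<Longrightarrow> wtn s (fam m f d s) \<and> (\<exists>g. fam m f d s = g * v) \<and> (\<exists>h. h * fam m f d s \<triangleq> v)"
proof (induction d arbitrary: s)
 case 0
 then show ?case using f moved_0 by (auto simp: family_def)
next
 case (Suc d)
 let ?a = "m - Suc d" let ?s = "sw ?a s"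
 have s': "?s \<in> moved xs m d" using moved_right Suc.prems by simp
 then have IH: "wtn ?s (fam m f d ?s)" "\<exists>g. fam m f d ?s = g * v" "\<exists>h. h * fam m f d ?s \<triangleq> v"
  using Suc by auto
 have t: "?s \<in> tabs" "s \<in> tabs" "length s = n" using moved_length s' Suc.prems by auto
 have a: "Suc ?a < n" using m Suc.prems by simp
 have ss: "sw ?a ?s = s" using a t by simp
 have W: "wtn s (fam m f (Suc d) s)" using ph_wtn[OF t(1) a IH(1)] ss by simp
 obtain g where g: "fam m f d ?s = g * v" using IH(2) by blast
 have G: "fam m f (Suc d) s = (ps ?a * g - fconst (dd (cont (?s ! ?a)) (cont (?s ! Suc ?a))) * g) * v"
  by (simp add: g phi_def left_diff_distrib mult.assoc)
 obtain h where h: "h * fam m f d ?s \<triangleq> v" using IH(3) by blast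
 let ?Q = "Qc (cont (?s ! ?a)) (cont (?s ! Suc ?a))"
 have Q: "?Q dvd 1" using Qc_unit_tabs[OF t(1) a] ss t by (simp add: tabs_def)
 have inv: "ph ?a s (fam m f (Suc d) s) \<triangleq> fconst ?Q * fam m f d ?s"
  using ph_inv[OF t(1) a IH(1)] ss by simp
 define d0 where "d0 = dd (cont (s ! ?a)) (cont (s ! Suc ?a))"
 have "(h * fconst (uinv ?Q) * (ps ?a - fconst d0)) * fam m f (Suc d) s
  = (h * fconst (uinv ?Q)) * ph ?a s (fam m f (Suc d) s)"
  by (simp only: phi_def d0_def mult.assoc left_diff_distrib)
 moreover have "(h * fconst (uinv ?Q)) * ph ?a s (fam m f (Suc d) s) \<triangleq> h * fam m f d ?s"
  using cg_lmult[OF inv, of "h * fconst (uinv ?Q)"] unfolding mult.assoc fconst_cancel[OF Q] .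
 ultimately have "\<exists>h. h * fam m f (Suc d) s \<triangleq> v" using cg_trans[OF _ h] by metis
 then show ?case using W G by blast
qed

text \<open>
 Moving the new node past the others one place at a time; the commutation and braid relations
 bring an intertwiner elsewhere back to the old ones.
\<close>

lemma fam_closed:
 assumes "d \<le> m" and "s \<in> moved xs m d" and "Suc p \<le> m" and "stdl l (sw p s)"
 shows "\<exists>a. \<exists>d'\<le>m. sw p s \<in> moved xs m d' \<and> ph p s (fam m f d s) \<triangleq> fconst a * fam m f d' (sw p s)
  \<and> (Suc p < m - d \<or> m - d < p \<longrightarrow> d' = d)"
 using assms
proof (induction d arbitrary: s p rule: less_induct)
 case (less d)
 note s = less.prems(2) and p = less.prems(3) and st = less.prems(4)
 have t: "s \<in> tabs" "length s = n" using moved_length[OF s] by auto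
 have pn: "Suc p < n" using p m by simp
 consider "Suc p = m - d" | "p = m - d" | "Suc p < m - d" | "m - d < p" by linarith
 then show ?case
 proof cases
  case 1
  then have d: "p = m - Suc d" "Suc d \<le> m" using less.prems(1) by auto
  have "ph p s (fam m f d s) = fconst 1 * fam m f (Suc d) (sw p s)"
   using t pn d(1) by simp
  then show ?thesis using moved_sw(2)[OF s p st d] d 1 by (intro exI[of _ 1] exI[of _ "Suc d"]) auto
 next
  case 2
  then obtain d' where d: "d = Suc d'" using p less.prems(1) by (cases d) auto
  have s': "sw p s \<in> moved xs m d'" using moved_sw(3)[OF s p st d] 2 less.prems(1) by simp
  have a: "p = m - Suc d'" using 2 d by simp
  have "ph p s (fam m f d s) = ph p (sw p (sw p s)) (ph p (sw p s) (fam m f d' (sw p s)))"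
   using t pn by (simp add: d a[symmetric])
  also have "\<dots> \<triangleq> fconst (Qc (cont (sw p s ! p)) (cont (sw p s ! Suc p))) * fam m f d' (sw p s)"
   using fam_props[of d' "sw p s"] s' less.prems(1) d pn moved_length[OF s'] by (intro ph_inv) auto
  finally have F: "ph p s (fam m f d s)
   \<triangleq> fconst (Qc (cont (sw p s ! p)) (cont (sw p s ! Suc p))) * fam m f d' (sw p s)" .
  have "d' \<le> m" "\<not> (Suc p < m - d \<or> m - d < p)" using d less.prems(1) 2 by auto
  then show ?thesis using F s' by blast
 next
  case 3
  have s': "sw p s \<in> moved xs m d" using moved_sw(1)[OF s p st] 3 by simp
  show ?thesis
  proof (cases d)
   case 0
   then have "\<exists>a. ph p s (f s) \<triangleq> fconst a * f (sw p s)"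
    using f moved_0[of s] s 3 st by (auto simp: family_def)
   then obtain a where "ph p s (f s) \<triangleq> fconst a * f (sw p s)" by blast
   then show ?thesis using s' 0 by (intro exI[of _ a] exI[of _ 0]) simp
  next
   case (Suc d')
   let ?a = "m - Suc d'" let ?s = "sw ?a s"
   have an: "Suc ?a < n" using m less.prems(1) Suc by simp
   have s1: "?s \<in> moved xs m d'" using moved_right[of s d'] s Suc less.prems(1) by simp
   have s2: "sw ?a (sw p s) \<in> moved xs m d'" using moved_right[of "sw p s" d'] s' Suc less.prems(1) by simp
   have far: "Suc p < ?a" using 3 Suc by simp
   have comm: "sw p ?s = sw ?a (sw p s)" using sw_commute[of p s ?a] t pn an far by simp
   have st': "stdl l (sw p ?s)" using s2 comm by (simp add: moved_def above_def tabs_def)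
   obtain c where c: "ph p ?s (fam m f d' ?s) \<triangleq> fconst c * fam m f d' (sw p ?s)"
    using less.IH[of d' ?s p] Suc s1 p st' far less.prems(1) by auto
   have "ph p s (fam m f d s) = ph p (sw ?a ?s) (ph ?a ?s (fam m f d' ?s))"
    using t an Suc by simp
   also have "\<dots> \<triangleq> ph ?a (sw p ?s) (ph p ?s (fam m f d' ?s))"
    using ph_commute[of ?s p ?a] moved_length[OF s1] pn an far by simp
   also have "\<dots> \<triangleq> ph ?a (sw p ?s) (fconst c * fam m f d' (sw p ?s))" by (rule phi_cong[OF c])
   also have "\<dots> = fconst c * fam m f d (sw p s)" by (simp add: phi_fconst Suc comm)
   finally show ?thesis using s' less.prems(1) by blast
  qed
 next
  case 4
  then obtain d' where d: "d = Suc d'" using p less.prems(1) by (cases d) auto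
  have s': "sw p s \<in> moved xs m d" using moved_sw(1)[OF s p st] 4 by simp
  let ?a = "m - Suc d'" let ?s = "sw ?a s"
  have an: "Suc ?a < n" using m less.prems(1) d by simp
  have s1: "?s \<in> moved xs m d'" using moved_right[of s d'] s d less.prems(1) by simp
  have s2: "sw ?a (sw p s) \<in> moved xs m d'" using moved_right[of "sw p s" d'] s' d less.prems(1) by simp
  show ?thesis
  proof (cases "Suc ?a < p")
   case True
   have comm: "sw p ?s = sw ?a (sw p s)" using sw_commute[of p s ?a] t pn an True by simp
   have st': "stdl l (sw p ?s)" using s2 comm by (simp add: moved_def above_def tabs_def)
   obtain c where c: "ph p ?s (fam m f d' ?s) \<triangleq> fconst c * fam m f d' (sw p ?s)"
    using less.IH[of d' ?s p] d s1 p st' True less.prems(1) by auto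
   have "ph p s (fam m f d s) = ph p (sw ?a ?s) (ph ?a ?s (fam m f d' ?s))"
    using t an d by simp
   also have "\<dots> \<triangleq> ph ?a (sw p ?s) (ph p ?s (fam m f d' ?s))"
    using ph_commute[of ?s p ?a] moved_length[OF s1] pn an True by simp
   also have "\<dots> \<triangleq> ph ?a (sw p ?s) (fconst c * fam m f d' (sw p ?s))" by (rule phi_cong[OF c])
   also have "\<dots> = fconst c * fam m f d (sw p s)" by (simp add: phi_fconst d comm)
   finally show ?thesis using s' less.prems(1) by blast
  next
   case False
   then have pa: "p = Suc ?a" using 4 d by simp
   then obtain d'' where d': "d' = Suc d''" using p less.prems(1) d by (cases d') auto
   have p': "p = m - Suc d''" using pa d' less.prems(1) d by simp
   let ?s2 = "sw p ?s"
   have s3: "?s2 \<in> moved xs m d''" using moved_right[of ?s d''] s1 d' p' less.prems(1) d by simp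
   have s4: "sw p (sw ?a (sw p s)) \<in> moved xs m d''"
    using moved_right[of "sw ?a (sw p s)" d''] s2 d' p' less.prems(1) d by simp
   have br: "sw ?a ?s2 = sw p (sw ?a (sw p s))"
    using sw_braid[of ?a s] t pn pa by simp
   have st': "stdl l (sw ?a ?s2)" using s4 br by (simp add: moved_def above_def tabs_def)
   have lt: "Suc ?a < m - d''" using pa p' p d' d less.prems(1) by simp
   let ?u = "fam m f d'' ?s2"
   obtain c where c: "ph ?a ?s2 ?u \<triangleq> fconst c * fam m f d'' (sw ?a ?s2)"
    using less.IH[of d'' ?s2 ?a] d d' s3 p st' lt less.prems(1) pa by auto
   have e1: "sw p ?s2 = ?s" "sw ?a ?s = s" using t pn an by simp_all
   have e2: "sw p (sw ?a ?s2) = sw ?a (sw p s)" using br t pn by simp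
   have "ph p s (fam m f d s) = ph p (sw ?a (sw p ?s2)) (ph ?a (sw p ?s2) (ph p ?s2 ?u))"
    using e1 by (simp add: d d' p'[symmetric])
   also have "\<dots> \<triangleq> ph ?a (sw p (sw ?a ?s2)) (ph p (sw ?a ?s2) (ph ?a ?s2 ?u))"
    using cg_sym[OF ph_braid[of ?s2 ?a ?u]] moved_length[OF s3] pn pa fam_props[OF _ s3] less.prems(1) d d' by simp
   also have "\<dots> \<triangleq> ph ?a (sw p (sw ?a ?s2)) (ph p (sw ?a ?s2) (fconst c * fam m f d'' (sw ?a ?s2)))"
    by (intro phi_cong c)
   also have "\<dots> = fconst c * fam m f d (sw p s)"
   proof -
    have "fam m f d (sw p s) = ph ?a (sw ?a (sw p s)) (fam m f d' (sw ?a (sw p s)))" by (simp add: d)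
    also have "fam m f d' (sw ?a (sw p s)) = ph p (sw ?a ?s2) (fam m f d'' (sw ?a ?s2))"
     unfolding br by (simp add: d' p'[symmetric])
    finally show ?thesis by (simp add: phi_fconst e2)
   qed
   finally show ?thesis using s' less.prems(1) by blast
  qed
 qed
qed

text \<open>Every tableau in question contains \<open>xs ! m\<close> among its first
  \<open>m + 1\<close> nodes exactly once; \<open>pos\<close> measures how far it has moved, and
  this selects the member of the new family.\<close>

lemma family_Suc: "\<exists>f'. family xs v (Suc m) f'"
proof -
 define pos where "pos s = (THE d. d \<le> m \<and> s ! (m - d) = xs ! m)" for s
 have pos: "pos s = d" if "d \<le> m" "s \<in> moved xs m d" for s d
  unfolding pos_def
 proof (rule the_equality)
  show "d \<le> m \<and> s ! (m - d) = xs ! m" using that by (simp add: moved_def)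
  fix d' assume d': "d' \<le> m \<and> s ! (m - d') = xs ! m"
  have "distinct s" "length s = n" using moved_length[OF that(2)] by (auto simp: tabs_def stdl_distinct)
  then have "m - d' = m - d" using d' that m by (simp add: moved_def nth_eq_iff_index_eq[symmetric])
  then show "d' = d" using d' that by linarith
 qed
 have ex: "\<exists>d\<le>m. s \<in> moved xs m d" if s: "s \<in> above xs (Suc m)" for s
 proof -
  have "xs ! m \<in> set (take (Suc m) s)"
   unfolding above_take[OF s] using m xs nth_mem[of m "take (Suc m) xs"] by (simp add: tabs_def)
  then obtain a where a: "a < Suc m" "s ! a = xs ! m" by (auto simp: in_set_conv_nth)
  then have "s \<in> moved xs m (m - a)" using s by (simp add: moved_def)
  then show ?thesis by (intro exI[of _ "m - a"]) simp
 qed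
 let ?f = "\<lambda>s. fam m f (pos s) s"
 have "xs \<in> moved xs m 0" using xs by (simp add: moved_def above_def)
 then have "?f xs = v" using pos[of 0 xs] f by (simp add: family_def)
 moreover have "wtn s (?f s) \<and> (\<exists>g. ?f s = g * v) \<and> (\<exists>h. h * ?f s \<triangleq> v) \<and>
  (\<forall>p. Suc p < Suc m \<and> stdl l (sw p s) \<longrightarrow> (\<exists>a. ph p s (?f s) \<triangleq> fconst a * ?f (sw p s)))"
  if s: "s \<in> above xs (Suc m)" for s
 proof -
  obtain d where d: "d \<le> m" "s \<in> moved xs m d" using ex[OF s] by blast
  have "\<exists>a. ph p s (?f s) \<triangleq> fconst a * ?f (sw p s)" if p: "Suc p < Suc m" "stdl l (sw p s)" for p
   using fam_closed[OF d, of p] p pos d by auto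
  then show ?thesis using fam_props[OF d] pos[OF d] by simp
 qed
 ultimately show ?thesis unfolding family_def by (intro exI[of _ ?f] conjI ballI) blast+
qed

end

lemma family_exists:
 assumes xs: "xs \<in> tabs" and v: "wtn xs v"
 shows "m \<le> n \<Longrightarrow> \<exists>f. family xs v m f"
proof (induction m)
 case 0
 have "above xs 0 = {xs}" using xs by (auto simp: above_def)
 moreover have "\<exists>g. v = g * v" "\<exists>h. h * v \<triangleq> v" by (rule exI[of _ 1], simp)+
 ultimately have "family xs v 0 (\<lambda>_. v)" using v by (simp add: family_def)
 then show ?case by blast
next
 case (Suc m)
 then obtain f where "family xs v m f" by auto
 then show ?case using family_Suc[OF xs] Suc by simp
qed

text \<open>The span of the family contains \<open>FT xs\<close> and is stable under every
  generator: idempotents and \<open>y\<close> act by scalars, and \<open>psi\<close> differs by a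
  scalar from an intertwiner, which leads to another member or to zero. Independence is not claimed
  here.\<close>

lemma projective_basis:
 assumes xs: "xs \<in> tabs"
 obtains f where "f xs = FT xs"
  and "\<And>s. s \<in> tabs \<Longrightarrow> set s = set xs \<Longrightarrow> wtn s (f s) \<and> (\<exists>g. f s = g * FT xs) \<and> (\<exists>h. h * f s \<triangleq> FT xs)"
  and "\<And>x. \<exists>a. x * FT xs \<triangleq> (\<Sum>s\<in>{s\<in>tabs. set s = set xs}. fconst (a s) * f s)"
proof -
 obtain f where f: "family xs (FT xs) n f" using family_exists[OF xs wtn_FT[OF xs]] by blast
 let ?S = "{s\<in>tabs. set s = set xs}"
 have ab: "above xs n = ?S" using xs by (auto simp: above_def tabs_def)
 have fin: "finite ?S" using finite_tabs by simp
 define span where "span = {u. \<exists>a. u \<triangleq> (\<Sum>s\<in>?S. fconst (a s) * f s)}"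
 have span_add: "u + w \<in> span" if uw: "u \<in> span" "w \<in> span" for u w
 proof -
  obtain a b where "u \<triangleq> (\<Sum>s\<in>?S. fconst (a s) * f s)" "w \<triangleq> (\<Sum>s\<in>?S. fconst (b s) * f s)"
   using uw unfolding span_def by blast
  from cg_add[OF this] show ?thesis unfolding span_def
   by (auto simp: sum.distrib[symmetric] distrib_right[symmetric] fconst_add[symmetric]
     intro!: exI[of _ "\<lambda>s. a s + b s"])
 qed
 have span_0: "0 \<in> span" unfolding span_def by (auto intro!: exI[of _ "\<lambda>_. 0"])
 have span_const: "fconst c * u \<in> span" if u: "u \<in> span" for u c
 proof -
  obtain a where "u \<triangleq> (\<Sum>s\<in>?S. fconst (a s) * f s)" using u unfolding span_def by blast
  from cg_lmult[OF this, of "fconst c"] show ?thesis unfolding span_def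
   by (auto simp: sum_distrib_left fconst_fconst intro!: exI[of _ "\<lambda>s. c * a s"])
 qed
 have span_cong: "w \<in> span" if "u \<in> span" "w \<triangleq> u" for u w
  using that cg_trans unfolding span_def by blast
 have span_sum: "sum g A \<in> span" if "\<And>x. x \<in> A \<Longrightarrow> g x \<in> span" for g and A :: "node list set"
  using that by (induction A rule: infinite_finite_induct) (auto intro: span_add span_0)
 have span_f: "f s \<in> span" if "s \<in> ?S" for s
 proof -
  have "(\<Sum>s'\<in>?S. fconst (if s' = s then 1 else 0) * f s') = (\<Sum>s'\<in>?S. if s' = s then f s' else 0)"
   by (rule sum.cong) auto
  then have "f s = (\<Sum>s'\<in>?S. fconst (if s' = s then 1 else 0) * f s')"
   using that fin by (simp add: sum.delta)
  then show ?thesis unfolding span_def by (auto intro!: exI[of _ "\<lambda>s'. if s' = s then 1 else 0"])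
 qed
 have gen: "fgen x * f s \<in> span" if s: "s \<in> ?S" for x s
 proof -
  have w: "wtn s (f s)" and t: "s \<in> tabs" "length s = n" using f s ab by (auto simp: family_def tabs_def)
  note w' = w[unfolded wtn_def]
  have z: "u \<triangleq> 0 \<Longrightarrow> u \<in> span" for u using span_cong span_0 by blast
  consider "x \<notin> E ` seqs e n \<union> Psi ` {1..<n} \<union> Y ` {1..n}" | i where "x = E i" "i \<in> seqs e n"
   | p where "x = Psi (Suc p)" "Suc p < n" | p where "x = Y (Suc p)" "p < n"
  proof (cases x)
   case (E i)
   then show ?thesis using that(1,2) by (cases "i \<in> seqs e n") auto
  next
   case (Psi k)
   show ?thesis
   proof (cases "k \<in> {1..<n}")
    case True
    then show ?thesis using that(3)[of "k - 1"] Psi by simp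
   next
    case False
    then have "x \<notin> E ` seqs e n \<union> Psi ` {1..<n} \<union> Y ` {1..n}" using Psi by blast
    then show ?thesis by (rule that(1))
   qed
  next
   case (Y k)
   show ?thesis
   proof (cases "k \<in> {1..n}")
    case True
    then have "x = Y (Suc (k - 1))" "k - 1 < n" using Y by auto
    then show ?thesis by (rule that(4))
   next
    case False
    then have "x \<notin> E ` seqs e n \<union> Psi ` {1..<n} \<union> Y ` {1..n}" using Y by blast
    then show ?thesis by (rule that(1))
   qed
  qed
  then show ?thesis
  proof cases
   case 1
   then have "fgen x \<triangleq> 0" using rel_gen by (simp add: cg_def)
   from cg_rmult[OF this, of "f s"] show ?thesis by (intro z) simp
  next
   case 2
   show ?thesis
   proof (cases "i = rs s")
    case True then show ?thesis using span_cong[OF span_f[OF s] wtD(4)[OF w']] 2 by simp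
   next
    case False then show ?thesis using z[OF ee_other[OF w' 2(2)]] 2 by simp
   qed
  next
   case 4
   then have "yy p * f s \<triangleq> fconst (C (cont (s ! p))) * f s" using wtD(5)[OF w', of p] t by simp
   then show ?thesis using span_cong[OF span_const[OF span_f[OF s]]] 4 by simp
  next
   case 3
   have "ph p s (f s) \<in> span"
   proof (cases "stdl l (sw p s)")
    case True
    then obtain a where "ph p s (f s) \<triangleq> fconst a * f (sw p s)"
     using f[unfolded family_def ab] s 3(2) by blast
    moreover have "sw p s \<in> ?S" using s sw_tabs[OF t(1) True] t 3 by simp
    ultimately show ?thesis using span_cong span_const span_f by blast
   qed (rule z, rule ph_zero[OF t(1) 3(2) w])
   then have "ph p s (f s) + fconst (dd (cont (s ! p)) (cont (s ! Suc p))) * f s \<in> span"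
    using span_add span_const span_f[OF s] by blast
   then show ?thesis using 3 by (simp add: phi_def)
  qed
 qed
 have gen': "fgen x * u \<in> span" if u: "u \<in> span" for x u
 proof -
  obtain a where "u \<triangleq> (\<Sum>s\<in>?S. fconst (a s) * f s)" using u by (auto simp: span_def)
  from cg_lmult[OF this, of "fgen x"]
  have "fgen x * u \<triangleq> (\<Sum>s\<in>?S. fconst (a s) * (fgen x * f s))"
   by (simp add: sum_distrib_left fgen_fconst)
  moreover have "(\<Sum>s\<in>?S. fconst (a s) * (fgen x * f s)) \<in> span"
   using gen by (intro span_sum span_const) auto
  ultimately show ?thesis using span_cong by blast
 qed
 have closed: "x * u \<in> span" if "u \<in> span" for x u
 proof (induction x rule: free_alg_induct)
  case one show ?case using that by simp
 next
  case (gen g x) then show ?case using gen' by (simp add: mult.assoc)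
 next
  case (const c x) then show ?case using span_const by (simp add: mult.assoc)
 next
  case (add x y) then show ?case using span_add by (simp add: distrib_right)
 qed
 have fx: "f xs = FT xs" using f by (simp add: family_def)
 have "xs \<in> ?S" using xs by simp
 then have "x * FT xs \<in> span" for x using closed[OF span_f[of xs], of x] fx by simp
 then have sp: "\<exists>a. x * FT xs \<triangleq> (\<Sum>s\<in>?S. fconst (a s) * f s)" for x unfolding span_def by blast
 show thesis
 proof (rule that[OF fx _ sp])
  fix s assume "s \<in> tabs" "set s = set xs"
  then show "wtn s (f s) \<and> (\<exists>g. f s = g * FT xs) \<and> (\<exists>h. h * f s \<triangleq> FT xs)"
   using f[unfolded family_def ab] by blast
 qed
qed

end

section \<open>Polynomials under a change of coefficients\<close>

locale ring_map =
 fixes f :: "'a::comm_ring_1 \<Rightarrow> 'b::comm_ring_1"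
 assumes map_0: "f 0 = 0" and map_1: "f 1 = 1"
  and map_add: "f (a + b) = f a + f b" and map_mult: "f (a * b) = f a * f b"
begin

lemma map_uminus: "f (- a) = - f a"
 using map_add[of a "- a"] map_0 by (simp add: eq_neg_iff_add_eq_0 add.commute)

lemma map_diff: "f (a - b) = f a - f b"
 using map_add[of a "- b"] by (simp add: map_uminus)

lemma map_prod: "f (prod g A) = (\<Prod>x\<in>A. f (g x))"
 by (induction A rule: infinite_finite_induct) (simp_all add: map_1 map_mult)

lemma map_dvd_1: "a dvd 1 \<Longrightarrow> f a dvd 1"
 unfolding dvd_def by (metis map_1 map_mult)

lemma map_pC: "map_poly f (pCons a p) = pCons (f a) (map_poly f p)"
 by (rule map_poly_pCons) (rule map_0)

lemma map_poly_plus: "map_poly f (p + q) = map_poly f p + map_poly f q"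
 by (rule poly_eqI) (simp add: coeff_map_poly map_0 map_add)

lemma map_poly_times: "map_poly f (p * q) = map_poly f p * map_poly f q"
 by (induction p) (simp_all add: map_pC map_poly_plus map_poly_smult map_0 map_mult)

lemma ring_map_poly: "ring_map (map_poly f)"
 by standard (simp_all add: map_poly_plus map_poly_times map_1 map_poly_1')

lemma poly_map: "poly (map_poly f p) (f a) = f (poly p a)"
 by (induction p) (simp_all add: map_pC map_0 map_add map_mult)

end

lemma poly2_map:
 assumes "ring_map f"
 shows "poly2 (map_poly (map_poly f) P) (f a) (f b) = f (poly2 P a b)"
proof -
 interpret ring_map f by fact
 interpret m: ring_map "map_poly f" by (rule ring_map_poly)
 have "poly (map_poly (map_poly f) P) [:f a:] = map_poly f (poly P [:a:])"
  using m.poly_map[of P "[:a:]"] by (simp add: map_pC)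
 then show ?thesis by (simp add: poly2_def poly_map)
qed

lemma poly3_map:
 assumes "ring_map f"
 shows "poly3 (map_poly (map_poly (map_poly f)) P) (f a) (f b) (f c) = f (poly3 P a b c)"
proof -
 interpret ring_map f by fact
 interpret m: ring_map "map_poly f" by (rule ring_map_poly)
 interpret mm: ring_map "map_poly (map_poly f)" by (rule m.ring_map_poly)
 have "poly (map_poly (map_poly (map_poly f)) P) [:[:f a:]:] = map_poly (map_poly f) (poly P [:[:a:]:])"
  using mm.poly_map[of P "[:[:a:]:]"] by (simp add: map_pC m.map_pC)
 then show ?thesis by (simp add: poly3_def poly2_map[OF assms])
qed

subsection \<open>Divided differences of symmetric families\<close>

lemma ring_map_eval: "ring_map (\<lambda>q. poly q b)"
 by standard simp_all

lemma ring_map_poly2: "ring_map (\<lambda>q. poly2 q b c)"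
 by standard (simp_all add: poly2_def)

lemma ring_map_const: "ring_map (\<lambda>a. [:a:])"
 by standard (simp_all add: one_pCons)

text \<open>Two polynomials that differ by exchanging their variables.\<close>

definition transposed :: "'a::comm_ring_1 poly poly \<Rightarrow> 'a poly poly \<Rightarrow> bool"
 where "transposed A B \<longleftrightarrow> (\<forall>p q. coeff (coeff A p) q = coeff (coeff B q) p)"

lemma transposed_eval:
 assumes "transposed A B"
 shows "map_poly (\<lambda>q. poly q b) A = poly B [:b:]"
proof (rule poly_eqI)
 fix p
 let ?N = "max (degree (coeff A p)) (degree B)"
 have "poly (coeff A p) b = (\<Sum>q\<le>degree (coeff A p). coeff (coeff A p) q * b ^ q)"
  by (rule poly_altdef)
 also have "\<dots> = (\<Sum>q\<le>?N. coeff (coeff A p) q * b ^ q)"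
  by (rule sum.mono_neutral_left) (auto simp: coeff_eq_0)
 also have "\<dots> = (\<Sum>q\<le>?N. coeff (coeff B q) p * b ^ q)"
  using assms by (simp add: transposed_def)
 also have "\<dots> = (\<Sum>q\<le>degree B. coeff (coeff B q) p * b ^ q)"
  by (rule sum.mono_neutral_right) (auto simp: coeff_eq_0)
 also have "\<dots> = coeff (poly B [:b:]) p"
  by (simp add: poly_altdef coeff_sum poly_const_pow mult.commute)
 finally show "coeff (map_poly (\<lambda>q. poly q b) A) p = coeff (poly B [:b:]) p"
  by (simp add: coeff_map_poly)
qed

lemma transposed_poly2:
 assumes "transposed A B"
 shows "poly2 A a b = poly2 B b a"
proof -
 interpret ring_map "\<lambda>q. poly q b" by (rule ring_map_eval)
 show ?thesis using poly_map[of A "[:a:]"] by (simp add: poly2_def transposed_eval[OF assms])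
qed

text \<open>The left side is \<open>A(w, v)\<close>, obtained by putting the innermost variable
  \<open>w\<close> for the outermost \<open>u\<close>. This is the substitution at which the
  numerator of the divided difference has to vanish.\<close>

lemma transposed_root:
 fixes A B :: "'a::comm_ring_1 poly poly"
 assumes "transposed A B"
 shows "poly (map_poly (map_poly (\<lambda>a. [:a:])) A) [:[:0, 1:]:] = B"
proof (rule poly_eqI, rule poly_eqI)
 fix q p
 interpret ring_map "\<lambda>a::'a. [:a:]" by (rule ring_map_const)
 let ?A = "map_poly (map_poly (\<lambda>a. [:a:])) A"
 let ?N = "max (degree ?A) (max (degree A) p)"
 have "poly ?A [:[:0, 1:]:] = (\<Sum>i\<le>degree ?A. coeff ?A i * [:[:0, 1:]:] ^ i)"
  by (rule poly_altdef)
 also have "\<dots> = (\<Sum>i\<le>?N. coeff ?A i * [:[:0, 1:]:] ^ i)"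
  by (rule sum.mono_neutral_left) (auto simp: coeff_eq_0)
 finally have "coeff (poly ?A [:[:0, 1:]:]) q = (\<Sum>i\<le>?N. monom (coeff (coeff A i) q) i)"
  by (simp add: coeff_sum poly_const_pow coeff_map_poly monom_altdef mult.commute)
 then have "coeff (coeff (poly ?A [:[:0, 1:]:]) q) p
   = (\<Sum>i\<le>?N. if i = p then coeff (coeff A i) q else 0)"
  by (simp add: coeff_sum)
 also have "\<dots> = coeff (coeff A p) q" by simp
 finally show "coeff (coeff (poly ?A [:[:0, 1:]:]) q) p = coeff (coeff B q) p"
  using assms by (simp add: transposed_def)
qed

text \<open>The numerator vanishes at \<open>u = w\<close>, hence is divisible by
  \<open>u - w\<close>, and in a domain the quotient is unique; so the description in the definition
  has a value.\<close>

lemma Q3_spec: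
 fixes Q :: "nat \<Rightarrow> nat \<Rightarrow> 'a::idom poly poly"
 assumes t: "transposed (Q i j) (Q j i)"
 shows "[:- [:[:0, 1:]:], 1:] * Q3 Q i j i = map_poly (map_poly (\<lambda>a. [:a:])) (Q i j) - [:Q j i:]"
proof -
 let ?w = "[:[:0, 1:]:] :: 'a poly poly" and ?A = "map_poly (map_poly (\<lambda>a. [:a:])) (Q i j)"
 have "poly (?A - [:Q j i:]) ?w = 0" using transposed_root[OF t] by simp
 then have "[:- ?w, 1:] dvd ?A - [:Q j i:]" by (simp only: poly_eq_0_iff_dvd)
 then obtain P where P: "[:- ?w, 1:] * P = ?A - [:Q j i:]" by (auto simp: dvd_def)
 have w: "[:0, 1:] - [:?w:] = [:- ?w, 1:]" by simp
 have "(THE P. ([:0, 1:] - [:?w:]) * P = ?A - [:Q j i:]) = P"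
  unfolding w
 proof (rule the_equality, rule P)
  fix P' assume "[:- ?w, 1:] * P' = ?A - [:Q j i:]"
  then have "[:- ?w, 1:] * P' = [:- ?w, 1:] * P" using P by simp
  then show "P' = P" by (simp only: mult_cancel_left) simp
 qed
 then show ?thesis using P by (simp add: Q3_def)
qed

text \<open>Specialising \<open>v\<close> and \<open>w\<close> but not \<open>u\<close> leaves the
  factor \<open>u - c\<close> nonzero, so it can still be cancelled. Only this makes the value at
  \<open>u = w\<close> accessible.\<close>

lemma Q3_half_eval:
 fixes Q :: "nat \<Rightarrow> nat \<Rightarrow> 'a::idom poly poly"
 assumes t: "transposed (Q i j) (Q j i)"
 shows "[:- c, 1:] * map_poly (\<lambda>q. poly2 q b c) (Q3 Q i j i)
  = poly (Q j i) [:b:] - [:poly2 (Q j i) b c:]"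
proof -
 interpret ring_map "\<lambda>q. poly2 q b c" by (rule ring_map_poly2)
 interpret m: ring_map "map_poly (\<lambda>q::'a poly poly. poly2 q b c)" by (rule ring_map_poly)
 interpret k: ring_map "\<lambda>a::'a. [:a:]" by (rule ring_map_const)
 have "poly2 (map_poly (\<lambda>a. [:a:]) q) b c = poly q b" for q
  using k.poly_map[of q b] by (simp add: poly2_def)
 then have "map_poly (\<lambda>q. poly2 q b c) (map_poly (map_poly (\<lambda>a. [:a:])) (Q i j))
   = map_poly (\<lambda>q. poly q b) (Q i j)"
  by (simp add: map_poly_map_poly comp_def)
 moreover have "map_poly (\<lambda>q. poly2 q b c) ([:- [:[:0, 1:]:], 1:] * Q3 Q i j i)
   = [:- c, 1:] * map_poly (\<lambda>q. poly2 q b c) (Q3 Q i j i)"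
  by (simp only: m.map_mult map_pC) (simp add: poly2_def)
 ultimately show ?thesis
  unfolding Q3_spec[of Q i j, OF t] m.map_diff by (simp add: transposed_eval[OF t] map_pC)
qed

lemma poly3_half_eval: "poly (map_poly (\<lambda>q. poly2 q b c) P) a = poly3 P a b c"
proof -
 interpret ring_map "\<lambda>q. poly2 q b c" by (rule ring_map_poly2)
 show ?thesis using poly_map[of P "[:[:a:]:]"] by (simp add: poly3_def poly2_def)
qed

lemma Q3_eval:
 fixes Q :: "nat \<Rightarrow> nat \<Rightarrow> 'a::idom poly poly"
 assumes "transposed (Q i j) (Q j i)"
 shows "(a - c) * poly3 (Q3 Q i j i) a b c = poly2 (Q i j) a b - poly2 (Q j i) b c"
 using arg_cong[OF Q3_half_eval[of Q i j, OF assms, of c b], of "\<lambda>p. poly p a"]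
 by (simp add: poly3_half_eval transposed_poly2[OF assms] algebra_simps)
  (simp add: poly2_def algebra_simps)

text \<open>At a simple root the divided difference is, up to sign, the product of the other factors.\<close>

lemma Q3_diagonal:
 fixes Q :: "nat \<Rightarrow> nat \<Rightarrow> 'a::idom poly poly"
 assumes t: "transposed (Q i j) (Q j i)" and G: "poly (Q j i) [:b:] = [:c, -1:] * G"
 shows "poly3 (Q3 Q i j i) c b c = - poly G c"
proof -
 have "poly2 (Q j i) b c = 0" unfolding poly2_def G by simp
 then have "[:- c, 1:] * map_poly (\<lambda>q. poly2 q b c) (Q3 Q i j i) = [:- c, 1:] * (- G)"
  unfolding Q3_half_eval[of Q i j, OF t] G by simp
 then have "map_poly (\<lambda>q. poly2 q b c) (Q3 Q i j i) = - G"
  by (simp only: mult_cancel_left) simp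
 then show ?thesis using poly3_half_eval[of b c "Q3 Q i j i" c] by simp
qed

subsection \<open>Laurent polynomials\<close>

lemma to_laurent_extend:
 assumes "degree p \<le> N"
 shows "to_laurent p = (\<Sum>m\<le>N. single (int m) (to_fract (coeff p m)))"
 unfolding to_laurent_def
 by (rule sum.mono_neutral_left) (use assms in \<open>auto simp: coeff_eq_0\<close>)

lemma to_laurent_pCons:
 "to_laurent (pCons a p) = single 0 (to_fract a) + single 1 1 * to_laurent p"
proof -
 have "to_laurent (pCons a p) =
   (\<Sum>m\<le>Suc (degree p). single (int m) (to_fract (coeff (pCons a p) m)))"
  by (rule to_laurent_extend) (simp add: degree_pCons_le)
 also have "\<dots> = single 0 (to_fract a)
   + (\<Sum>m\<le>degree p. single (int (Suc m)) (to_fract (coeff p m)))"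
  by (simp only: sum.atMost_Suc_shift) simp
 also have "(\<Sum>m\<le>degree p. single (int (Suc m)) (to_fract (coeff p m)))
   = single 1 1 * to_laurent p"
  by (simp add: to_laurent_def sum_distrib_left mult_single add.commute)
 finally show ?thesis .
qed

lemma to_laurent_0 [simp]: "to_laurent 0 = 0"
 by (simp add: to_laurent_def)

lemma to_laurent_add: "to_laurent (p + q) = to_laurent p + to_laurent q"
proof -
 let ?N = "max (degree p) (degree q)"
 have "degree (p + q) \<le> ?N" by (rule degree_add_le) auto
 then show ?thesis
  by (simp add: to_laurent_extend[of _ ?N] single_add sum.distrib to_fract_add)
qed

lemma to_laurent_smult: "to_laurent (Polynomial.smult a p) = single 0 (to_fract a) * to_laurent p"
 by (induction p) (simp_all add: to_laurent_pCons distrib_left mult_single to_fract_mult mult.left_commute)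

lemma to_laurent_mult: "to_laurent (p * q) = to_laurent p * to_laurent q"
 by (induction p) (simp_all add: to_laurent_pCons to_laurent_add to_laurent_smult distrib_right mult.assoc)

lemma ring_map_laurent: "ring_map to_laurent"
 by standard (simp_all add: to_laurent_add to_laurent_mult one_pCons to_laurent_pCons)

lemma to_laurent_homogeneous:
 assumes "homogeneous_poly d p"
 obtains a where "to_laurent p = single d a" and "p \<noteq> 0 \<Longrightarrow> a \<noteq> 0"
proof (cases "p = 0")
 case True
 then show thesis using that[of 0] by simp
next
 case False
 let ?m = "degree p"
 have d: "int ?m = d" using assms False by (simp add: homogeneous_poly_def)
 have "coeff p m = 0" if "m \<noteq> ?m" for m
  using assms that d unfolding homogeneous_poly_def by (metis of_nat_eq_iff)
 then have "to_laurent p = (\<Sum>m\<le>?m. if m = ?m then single d (to_fract (coeff p ?m)) else 0)"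
  unfolding to_laurent_def using d by (intro sum.cong) auto
 then show thesis using that[of "to_fract (coeff p ?m)"] False by simp
qed

lemma single_laurent_unit:
 fixes a :: "'k::field"
 assumes "a \<noteq> 0" shows "single (d::int) a dvd 1"
proof
 show "1 = single d a * single (- d) (inverse a)"
  using assms by (simp add: mult_single)
qed

text \<open>The use of the grading for division: a nonzero homogeneous polynomial becomes a
  monomial.\<close>

lemma to_laurent_unit: "homogeneous_poly d p \<Longrightarrow> p \<noteq> 0 \<Longrightarrow> to_laurent p dvd 1"
 by (metis single_laurent_unit to_laurent_homogeneous)

lemma homogeneous_poly_diff:
 "homogeneous_poly d p \<Longrightarrow> homogeneous_poly d q \<Longrightarrow> homogeneous_poly d (p - q)"
 for p q :: "'a::comm_ring_1 poly"
 unfolding homogeneous_poly_def by (metis coeff_diff diff_self)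

lemma laurent_inverse_uinv: "laurent_inverse a = uinv a"
 by (simp add: laurent_inverse_def uinv_def)

subsection \<open>Cartan data\<close>

lemma root_form_sym:
 assumes "admissible_rank ty e" and "i < e" and "j < e"
 shows "root_form ty e i j = root_form ty e j i"
 using assms by (cases ty) (auto simp: root_form_def cartan_def symmetriser_def admissible_rank_def)

lemma symmetriser_pos: "1 \<le> symmetriser ty e i"
 by (cases ty) (auto simp: symmetriser_def)

lemma root_form_same: "root_form ty e i i = 2 * symmetriser ty e i"
 by (simp add: root_form_def cartan_def)

text \<open>Two neighbours, counted with multiplicity, account for all of them.\<close>

lemma cartan_neighbours:
 assumes ad: "admissible_rank ty e" and lt: "i < e" "j < e" "j1 < e" "j2 < e"
  and ne: "j \<noteq> i" "j1 \<noteq> i" "j2 \<noteq> i" "j \<noteq> j1" "j \<noteq> j2"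
  and same: "j1 = j2 \<Longrightarrow> cartan ty e j1 i = -2"
  and diff: "j1 \<noteq> j2 \<Longrightarrow> cartan ty e j1 i = -1 \<and> cartan ty e j2 i = -1"
 shows "cartan ty e i j = 0"
proof (cases ty)
 case TypeC
 then have e: "3 \<le> e" using ad by (simp add: admissible_rank_def)
 show ?thesis
 proof (rule ccontr)
  have adj: "b = a + 1 \<or> a = b + 1" if "cartan ty e a b \<noteq> 0" "a \<noteq> b" for a b
   using that e TypeC by (auto simp: cartan_def split: if_splits)
  assume "cartan ty e i j \<noteq> 0"
  then have j: "j = i + 1 \<or> i = j + 1" using adj[of i j] ne by simp
  show False
  proof (cases "j1 = j2")
   case True
   then have "(j1 = 1 \<and> i = 0) \<or> (j1 = e - 2 \<and> i = e - 1)"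
    using same TypeC ne e by (simp add: cartan_def split: if_splits)
   then show False using j ne lt e by arith
  next
   case False
   then have "cartan ty e j1 i \<noteq> 0" "cartan ty e j2 i \<noteq> 0" using diff by auto
   then have "i = j1 + 1 \<or> j1 = i + 1" "i = j2 + 1 \<or> j2 = i + 1" using adj ne by auto
   then show False using j ne False by arith
  qed
 qed
next
 case TypeA
 have e: "2 \<le> e" using ad TypeA by (simp add: admissible_rank_def)
 show ?thesis
 proof (cases "e = 2")
  case True
  then show ?thesis using lt ne by auto
 next
  case False
  have m: "Suc k mod e = (if Suc k = e then 0 else Suc k)" if "k < e" for k
   using that by auto
  let ?adj = "\<lambda>a b. Suc a = b \<or> Suc b = a \<or> (a = 0 \<and> Suc b = e) \<or> (b = 0 \<and> Suc a = e)"
  have adj: "?adj a b" if "cartan ty e a b \<noteq> 0" "a \<noteq> b" "a < e" "b < e" for a b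
   using that TypeA False by (auto simp: cartan_def m split: if_splits)
  have "cartan ty e j1 i \<noteq> -2" using False TypeA ne by (simp add: cartan_def)
  then have j12: "j1 \<noteq> j2" using same by blast
  have "?adj j1 i" by (rule adj) (use diff[OF j12] lt ne in simp_all)
  moreover have "?adj j2 i" by (rule adj) (use diff[OF j12] lt ne in simp_all)
  ultimately have "\<not> ?adj i j" using j12 ne lt by arith
  then show ?thesis using adj[of i j] ne lt by blast
 qed
qed

section \<open>From the graded content system to the abstract axioms\<close>

locale klr_setup =
 fixes ty :: cartan_type and e n :: nat
  and Q :: "nat \<Rightarrow> nat \<Rightarrow> 'k::idom poly poly poly"
  and W :: "nat \<Rightarrow> 'k poly poly" and \<rho> :: "nat \<Rightarrow> nat"
  and c :: "nat \<Rightarrow> int \<Rightarrow> 'k poly" and r :: "nat \<Rightarrow> int \<Rightarrow> nat"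
 assumes admissible: "admissible_rank ty e" and Qp: "Q_polynomials ty e Q"
  and content: "graded_content_system ty e n Q W \<rho> c r"
begin

abbreviation "lv \<equiv> level e W"
definition CC :: "nat \<times> int \<Rightarrow> 'k fract laurent" where "CC p = to_laurent (c (fst p) (snd p))"
definition RR :: "nat \<times> int \<Rightarrow> nat" where "RR p = r (fst p) (snd p)"
definition QQ :: "nat \<Rightarrow> nat \<Rightarrow> 'k fract laurent poly poly"
 where "QQ i j = map_poly (map_poly to_laurent) (Q i j)"
definition QQ3 :: "nat \<Rightarrow> nat \<Rightarrow> nat \<Rightarrow> 'k fract laurent poly poly poly"
 where "QQ3 i j k = map_poly (map_poly (map_poly to_laurent)) (Q3 Q i j k)"
definition WW :: "nat \<Rightarrow> 'k fract laurent poly" where "WW i = map_poly to_laurent (W i)"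

lemma content_props:
 shows r_less: "k \<in> {1..lv} \<Longrightarrow> r k a < e"
  and r_0: "k \<in> {1..lv} \<Longrightarrow> r k 0 = \<rho> k"
  and W_prod: "i < e \<Longrightarrow> W i = (\<Prod>l\<in>{l\<in>{1..lv}. \<rho> l = i}. [:- c l 0, 1:])"
  and Q_prod: "k \<in> {1..lv} \<Longrightarrow> j \<in> {r k (a - 1), r k (a + 1)} \<Longrightarrow> \<exists>\<epsilon>. \<epsilon> dvd 1 \<and>
    poly (Q (r k a) j) [:c k a:] =
     [:[:\<epsilon>:]:] * (\<Prod>b\<in>{b\<in>{a - 1, a + 1}. r k b = j}. [:c k b, - 1:])"
  and content_inject: "k \<in> {1..lv} \<Longrightarrow> m \<in> {1..lv} \<Longrightarrow> \<bar>a\<bar> < int n \<Longrightarrow> \<bar>b\<bar> < int n \<Longrightarrow>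
    r k a = r m b \<Longrightarrow> c k a = c m b \<Longrightarrow> (k, a) = (m, b)"
  and c_homogeneous: "k \<in> {1..lv} \<Longrightarrow> homogeneous_poly (2 * symmetriser ty e (r k a)) (c k a)"
proof -
 note * = content[unfolded graded_content_system_def Let_def]
 note A1 = *[THEN conjunct1] and A2 = *[THEN conjunct2, THEN conjunct1]
  and A3 = *[THEN conjunct2, THEN conjunct2, THEN conjunct1]
  and A4 = *[THEN conjunct2, THEN conjunct2, THEN conjunct2, THEN conjunct1]
  and A5 = *[THEN conjunct2, THEN conjunct2, THEN conjunct2, THEN conjunct2, THEN conjunct1]
  and A6 = *[THEN conjunct2, THEN conjunct2, THEN conjunct2, THEN conjunct2, THEN conjunct2]
 show "k \<in> {1..lv} \<Longrightarrow> r k a < e" "k \<in> {1..lv} \<Longrightarrow> r k 0 = \<rho> k"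
  "i < e \<Longrightarrow> W i = (\<Prod>l\<in>{l\<in>{1..lv}. \<rho> l = i}. [:- c l 0, 1:])"
  "k \<in> {1..lv} \<Longrightarrow> j \<in> {r k (a - 1), r k (a + 1)} \<Longrightarrow> \<exists>\<epsilon>. \<epsilon> dvd 1 \<and>
    poly (Q (r k a) j) [:c k a:] =
     [:[:\<epsilon>:]:] * (\<Prod>b\<in>{b\<in>{a - 1, a + 1}. r k b = j}. [:c k b, - 1:])"
  "k \<in> {1..lv} \<Longrightarrow> homogeneous_poly (2 * symmetriser ty e (r k a)) (c k a)"
  using A1 A2 A3 A6 A4[THEN bspec, THEN spec, THEN bspec, of k j a] by simp_all
 assume km: "k \<in> {1..lv}" "m \<in> {1..lv}" and ab: "\<bar>a\<bar> < int n" "\<bar>b\<bar> < int n"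
  and eq: "r k a = r m b" "c k a = c m b"
 from ab have "- int n < a \<and> a < int n \<and> - int n < b \<and> b < int n" by auto
 then have "(r k a, c k a) = (r m b, c m b) \<longleftrightarrow> (k, a) = (m, b)" using A5 km by blast
 then show "(k, a) = (m, b)" using eq by simp
qed

lemma Q_props:
 assumes "i < e" and "j < e"
 shows Q_transposed: "transposed (Q i j) (Q j i)"
  and Q_degree: "i \<noteq> j \<Longrightarrow> homogeneous_poly
    (- 2 * root_form ty e i j - int p * root_form ty e i i - int q * root_form ty e j j)
    (coeff (coeff (Q i j) p) q)"
  and Q_unit: "i \<noteq> j \<Longrightarrow> coeff (coeff (Q i j) (nat (- cartan ty e i j))) 0 dvd 1"
 using Qp assms by (auto simp: Q_polynomials_def transposed_def)

lemma Q_same: "i < e \<Longrightarrow> Q i i = 0"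
 using Qp by (simp add: Q_polynomials_def)

text \<open>The coefficient ring is \<open>k[x]\<close> with \<open>x\<close> in degree 1, which has
  nothing in negative degree.\<close>

lemma Q_coeff_zero:
 assumes "i < e" and "j < e" and "i \<noteq> j"
  and "- 2 * root_form ty e i j - int p * root_form ty e i i - int q * root_form ty e j j < 0"
 shows "coeff (coeff (Q i j) p) q = 0"
proof (rule poly_eqI)
 fix m
 show "coeff (coeff (coeff (Q i j) p) q) m = coeff 0 m"
  using Q_degree[OF assms(1,2,3), of p q] assms(4) unfolding homogeneous_poly_def by fastforce
qed

text \<open>Terms of higher degree in \<open>v\<close>, or of this degree but involving
  \<open>u\<close>, would have coefficients of negative degree. What remains at the top is the
  distinguished unit coefficient of \<open>Q j i\<close>, whatever \<open>a\<close> is.\<close>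

lemma degree_Q_eval:
 assumes ij: "i < e" "j < e" "i \<noteq> j"
 shows "degree (poly (Q i j) [:a:]) = nat (- cartan ty e j i)"
proof -
 let ?d = "nat (- cartan ty e j i)"
 have sym: "root_form ty e i j = symmetriser ty e j * cartan ty e j i"
  using root_form_sym[OF admissible ij(1,2)] by (simp add: root_form_def)
 have neg: "cartan ty e j i \<le> 0" using ij by (cases ty) (auto simp: cartan_def)
 have expr: "- 2 * root_form ty e i j - int p * root_form ty e i i - int q * root_form ty e j j
   = 2 * symmetriser ty e j * (int ?d - int q) - 2 * int p * symmetriser ty e i" for p q
  using neg by (simp add: sym root_form_same algebra_simps)
 have coeff: "coeff (poly (Q i j) [:a:]) q = (\<Sum>p\<le>degree (Q i j). coeff (coeff (Q i j) p) q * a ^ p)" for q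
  by (simp add: poly_altdef coeff_sum poly_const_pow mult.commute)
 have z: "coeff (coeff (Q i j) p) q = 0" if "?d < q \<or> (?d = q \<and> 0 < p)" for p q
 proof (rule Q_coeff_zero[OF ij])
  have "2 * symmetriser ty e j * (int ?d - int q) - 2 * int p * symmetriser ty e i < 0"
  proof (cases "?d < q")
   case True
   then have "symmetriser ty e j * (int ?d - int q) < 0"
    using symmetriser_pos[of ty e j] by (intro mult_pos_neg) auto
   moreover have "0 \<le> int p * symmetriser ty e i" using symmetriser_pos[of ty e i] by simp
   ultimately show ?thesis by linarith
  next
   case False
   then have "0 < int p * symmetriser ty e i" using that symmetriser_pos[of ty e i] by simp
   then show ?thesis using False that by simp
  qed
  then show "- 2 * root_form ty e i j - int p * root_form ty e i i - int q * root_form ty e j j < 0"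
   unfolding expr .
 qed
 have "coeff (poly (Q i j) [:a:]) ?d = (\<Sum>p\<le>degree (Q i j). if p = 0 then coeff (coeff (Q i j) 0) ?d else 0)"
  unfolding coeff using z by (intro sum.cong) auto
 also have "\<dots> = coeff (coeff (Q j i) ?d) 0"
  using Q_transposed[OF ij(1,2)] by (simp add: transposed_def)
 finally have "coeff (poly (Q i j) [:a:]) ?d \<noteq> 0" using Q_unit[OF ij(2,1)] ij(3) by auto
 moreover have "degree (poly (Q i j) [:a:]) \<le> ?d"
  by (rule degree_le) (use z in \<open>auto simp: coeff intro!: sum.neutral\<close>)
 ultimately show ?thesis using le_degree by (metis antisym)
qed

text \<open>Equal residues would make \<open>Q_ii = 0\<close> equal to a nonzero product of linear
  factors.\<close>

lemma r_adjacent: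
 assumes k: "k \<in> {1..lv}" and b: "b = a - 1 \<or> b = a + 1"
 shows "r k a \<noteq> r k b"
proof
 assume eq: "r k a = r k b"
 have "r k b \<in> {r k (a - 1), r k (a + 1)}" using b by auto
 from Q_prod[OF k this] obtain \<epsilon> where e: "\<epsilon> dvd 1" "poly (Q (r k a) (r k b)) [:c k a:] =
   [:[:\<epsilon>:]:] * (\<Prod>b'\<in>{b'\<in>{a - 1, a + 1}. r k b' = r k b}. [:c k b', - 1:])" by blast
 have "\<epsilon> \<noteq> 0" using e(1) by auto
 then show False using e(2) Q_same[OF r_less[OF k, of b]] eq by (simp add: prod_zero_iff)
qed

text \<open>Comparison of the degrees in \<open>v\<close> on both sides of the factorisation
  required of a content system.\<close>

lemma cartan_adjacent:
 assumes k: "k \<in> {1..lv}" and j: "j \<in> {r k (a - 1), r k (a + 1)}"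
 shows "- cartan ty e j (r k a) = int (card {b\<in>{a - 1, a + 1}. r k b = j})"
proof -
 obtain \<epsilon> where e: "\<epsilon> dvd 1" "poly (Q (r k a) j) [:c k a:] =
   [:[:\<epsilon>:]:] * (\<Prod>b\<in>{b\<in>{a - 1, a + 1}. r k b = j}. [:c k b, - 1:])"
  using Q_prod[OF k j] by blast
 have e0: "\<epsilon> \<noteq> 0" using e(1) by auto
 have ne: "r k a \<noteq> j" using r_adjacent[OF k, of _ a] j by auto
 have jl: "j < e" using j r_less[OF k] by auto
 have "degree (\<Prod>b\<in>B. [:c k b, - 1:]) = card B" if "finite B" for B
  using degree_prod_eq_sum_degree[of B "\<lambda>b. [:c k b, - 1:]"] by simp
 then have "nat (- cartan ty e j (r k a)) = card {b\<in>{a - 1, a + 1}. r k b = j}"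
  using degree_Q_eval[OF r_less[OF k] jl ne, of "c k a"] e0 unfolding e(2)
  by (simp add: degree_mult_eq prod_zero_iff)
 moreover have "cartan ty e j (r k a) \<le> 0" using ne by (cases ty) (auto simp: cartan_def)
 ultimately show ?thesis by simp
qed

text \<open>The residues on both sides of a content account for all neighbours of its residue in the
  quiver, so any further residue is orthogonal to it.\<close>

lemma cartan_far:
 assumes k: "k \<in> {1..lv}" and j: "j < e" "j \<noteq> r k a" "j \<notin> {r k (a - 1), r k (a + 1)}"
 shows "cartan ty e (r k a) j = 0"
proof (rule cartan_neighbours[OF admissible r_less[OF k] j(1) r_less[OF k] r_less[OF k]])
 have two: "{b\<in>{a - 1, a + 1}. r k b = r k (a - 1)} = (if r k (a - 1) = r k (a + 1) then {a - 1, a + 1} else {a - 1})"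
  "{b\<in>{a - 1, a + 1}. r k b = r k (a + 1)} = (if r k (a - 1) = r k (a + 1) then {a - 1, a + 1} else {a + 1})"
  by auto
 show "r k (a - 1) = r k (a + 1) \<Longrightarrow> cartan ty e (r k (a - 1)) (r k a) = -2"
  using cartan_adjacent[OF k, of "r k (a - 1)" a] two by simp
 show "r k (a - 1) \<noteq> r k (a + 1) \<Longrightarrow> cartan ty e (r k (a - 1)) (r k a) = -1 \<and> cartan ty e (r k (a + 1)) (r k a) = -1"
  using cartan_adjacent[OF k, of "r k (a - 1)" a] cartan_adjacent[OF k, of "r k (a + 1)" a] two by simp
qed (use j r_adjacent[OF k, of "a - 1" a] r_adjacent[OF k, of "a + 1" a] in auto)

lemma near_iff: "near p q \<and> q \<noteq> p \<longleftrightarrow> fst q = fst p \<and> (snd q = snd p - 1 \<or> snd q = snd p + 1)"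
 by (cases p; cases q) (auto simp: near_def)

lemma QQ_eval: "poly (QQ i j) [:CC p:] = map_poly to_laurent (poly (Q i j) [:c (fst p) (snd p):])"
proof -
 interpret t: ring_map to_laurent by (rule ring_map_laurent)
 interpret m: ring_map "map_poly to_laurent" by (rule t.ring_map_poly)
 show ?thesis using m.poly_map[of "Q i j" "[:c (fst p) (snd p):]"] by (simp add: t.map_pC QQ_def CC_def)
qed

lemma QQ_poly2: "poly2 (QQ i j) (CC p) (CC q) = to_laurent (poly2 (Q i j) (c (fst p) (snd p)) (c (fst q) (snd q)))"
 unfolding QQ_def CC_def by (rule poly2_map[OF ring_map_laurent])

lemma QQ3_poly3: "poly3 (QQ3 i j k) (CC p) (CC q) (CC s)
  = to_laurent (poly3 (Q3 Q i j k) (c (fst p) (snd p)) (c (fst q) (snd q)) (c (fst s) (snd s)))"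
 unfolding QQ3_def CC_def by (rule poly3_map[OF ring_map_laurent])

lemma content_diff_unit:
 assumes "k \<in> {1..lv}" and "m \<in> {1..lv}" and "\<bar>a\<bar> < int n" and "\<bar>b\<bar> < int n"
  and "r k a = r m b" and "(k, a) \<noteq> (m, b)"
 shows "c k a - c m b \<noteq> 0" and "homogeneous_poly (2 * symmetriser ty e (r k a)) (c k a - c m b)"
 using content_inject[OF assms(1-5)] assms(6) c_homogeneous[OF assms(1), of a]
  c_homogeneous[OF assms(2), of b] assms(5) by (auto intro: homogeneous_poly_diff)

text \<open>The divided difference removes from the value of \<open>Q\<close> the one factor that
  vanishes. The other factors are differences of separated contents, because the neighbours of
  \<open>b\<close> are still in range.\<close>

lemma Q3_adjacent_unit:
 assumes k: "k \<in> {1..lv}" and ab: "b = a - 1 \<or> b = a + 1" and n: "\<bar>a\<bar> < int n" "\<bar>b\<bar> + 1 < int n"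
 shows "to_laurent (poly3 (Q3 Q (r k a) (r k b) (r k a)) (c k a) (c k b) (c k a)) dvd 1"
proof -
 interpret t: ring_map to_laurent by (rule ring_map_laurent)
 have "r k a \<in> {r k (b - 1), r k (b + 1)}" using ab by auto
 from Q_prod[OF k this] obtain \<epsilon> where e: "\<epsilon> dvd 1" "poly (Q (r k b) (r k a)) [:c k b:] =
   [:[:\<epsilon>:]:] * (\<Prod>b'\<in>{b'\<in>{b - 1, b + 1}. r k b' = r k a}. [:c k b', - 1:])" by blast
 let ?B = "{b'\<in>{b - 1, b + 1}. r k b' = r k a}"
 have aB: "a \<in> ?B" using ab by auto
 have "poly (Q (r k b) (r k a)) [:c k b:] = [:c k a, -1:] * ([:[:\<epsilon>:]:] * (\<Prod>b'\<in>?B - {a}. [:c k b', - 1:]))"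
  unfolding e(2) using prod.remove[of ?B a "\<lambda>b'. [:c k b', - 1:]"] aB by (simp only: mult_ac) simp
 from Q3_diagonal[of Q "r k a" "r k b", OF Q_transposed[OF r_less[OF k] r_less[OF k]] this]
 have val: "poly3 (Q3 Q (r k a) (r k b) (r k a)) (c k a) (c k b) (c k a)
   = - ([:\<epsilon>:] * (\<Prod>b'\<in>?B - {a}. c k b' - c k a))"
  by (simp add: poly_prod)
 have "to_laurent [:\<epsilon>:] dvd 1" using e(1) t.map_dvd_1[of "[:\<epsilon>:]"] by (simp add: is_unit_const_poly_iff)
 moreover have "(\<Prod>b'\<in>?B - {a}. to_laurent (c k b' - c k a)) dvd (\<Prod>b'\<in>?B - {a}. 1)"
 proof (rule prod_dvd_prod)
  fix b' assume b': "b' \<in> ?B - {a}"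
  then have "\<bar>b'\<bar> < int n" "r k b' = r k a" "(k, b') \<noteq> (k, a)" using n by auto
  from content_diff_unit[OF k k this(1) n(1) this(2,3)]
  show "to_laurent (c k b' - c k a) dvd 1" using to_laurent_unit by blast
 qed
 ultimately have "to_laurent [:\<epsilon>:] * (\<Prod>b'\<in>?B - {a}. to_laurent (c k b' - c k a)) dvd 1 * (\<Prod>b'\<in>?B - {a}. 1)"
  by (rule mult_dvd_mono)
 then show ?thesis unfolding val t.map_uminus t.map_mult t.map_prod
  by (simp only: minus_dvd_iff prod.neutral_const mult_1_right)
qed

lemma unit_const_laurent: "(\<epsilon>::'k) dvd 1 \<Longrightarrow> to_laurent [:\<epsilon>:] dvd 1"
proof -
 interpret t: ring_map to_laurent by (rule ring_map_laurent)
 assume "\<epsilon> dvd 1"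
 then show ?thesis using t.map_dvd_1[of "[:\<epsilon>:]"] by (simp add: is_unit_const_poly_iff)
qed

text \<open>For a residue beside \<open>p\<close> this is the axiom of the content system. For any
  other residue the product is empty, and it has to be shown that \<open>Q\<close> is a constant
  unit.\<close>

lemma QQ_value:
 assumes p: "fst p \<in> {1..lv}" and j: "j < e" "j \<noteq> RR p"
 shows "\<exists>\<epsilon>. \<epsilon> dvd 1 \<and> poly (QQ (RR p) j) [:CC p:] =
  [:\<epsilon>:] * (\<Prod>q\<in>{q. near p q \<and> q \<noteq> p \<and> RR q = j}. [:CC q, -1:])"
proof -
 interpret t: ring_map to_laurent by (rule ring_map_laurent)
 interpret m: ring_map "map_poly to_laurent" by (rule t.ring_map_poly)
 obtain k a where ka: "p = (k, a)" by (cases p)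
 let ?B = "{b\<in>{a - 1, a + 1}. r k b = j}"
 have set: "{q. near p q \<and> q \<noteq> p \<and> RR q = j} = Pair k ` ?B"
 proof (rule Set.set_eqI)
  fix q show "q \<in> {q. near p q \<and> q \<noteq> p \<and> RR q = j} \<longleftrightarrow> q \<in> Pair k ` ?B"
   using near_iff[of p q] by (cases q) (auto simp: ka RR_def)
 qed
 show ?thesis
 proof (cases "j \<in> {r k (a - 1), r k (a + 1)}")
  case True
  then obtain \<epsilon> where e: "\<epsilon> dvd 1" "poly (Q (r k a) j) [:c k a:] =
    [:[:\<epsilon>:]:] * (\<Prod>b\<in>?B. [:c k b, - 1:])" using Q_prod[of k] p ka by auto
  have "poly (QQ (RR p) j) [:CC p:] = map_poly to_laurent ([:[:\<epsilon>:]:] * (\<Prod>b\<in>?B. [:c k b, - 1:]))"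
   unfolding QQ_eval using e(2) by (simp add: ka RR_def)
  also have "\<dots> = [:to_laurent [:\<epsilon>:]:] * (\<Prod>b\<in>?B. [:CC (k, b), -1:])"
   by (simp only: m.map_mult m.map_prod) (simp add: t.map_pC t.map_uminus t.map_1 CC_def)
  also have "(\<Prod>b\<in>?B. [:CC (k, b), -1:]) = (\<Prod>q\<in>Pair k ` ?B. [:CC q, -1:])"
   by (subst prod.reindex) (auto simp: inj_on_def)
  finally show ?thesis unfolding set using unit_const_laurent[OF e(1)] by blast
 next
  case False
  then have B: "?B = {}" by auto
  have k: "k \<in> {1..lv}" and ne: "r k a \<noteq> j" using p j ka by (auto simp: RR_def)
  have c0: "cartan ty e (r k a) j = 0" using cartan_far[OF k j(1)] False ne by auto
  have rf0: "root_form ty e (r k a) j = 0" using c0 by (simp add: root_form_def)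
  \<comment> \<open>With a vanishing bilinear form the constant term has degree 0 and every other
    coefficient would have negative degree.\<close>
  have z: "coeff (coeff (Q (r k a) j) p) q = 0" if "p \<noteq> 0 \<or> q \<noteq> 0" for p q
  proof (rule Q_coeff_zero[OF r_less[OF k] j(1) ne])
   have "0 < int p * symmetriser ty e (r k a) + int q * symmetriser ty e j"
    using that symmetriser_pos[of ty e "r k a"] symmetriser_pos[of ty e j]
    by (cases "p = 0") (auto intro: add_pos_nonneg)
   then show "- 2 * root_form ty e (r k a) j - int p * root_form ty e (r k a) (r k a)
     - int q * root_form ty e j j < 0"
    unfolding rf0 root_form_same mult.left_commute[of "int p" 2] mult.left_commute[of "int q" 2]
    by linarith
  qed
  have u: "coeff (coeff (Q (r k a) j) 0) 0 dvd 1"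
   using Q_unit[OF r_less[OF k, of a] j(1) ne] c0 by simp
  define t0 where "t0 = coeff (coeff (Q (r k a) j) 0) 0"
  have "coeff (coeff (Q (r k a) j) p) q = coeff (coeff [:[:t0:]:] p) q" for p q
  proof (cases "p = 0 \<and> q = 0")
   case False
   then show ?thesis using z[of p q] by (cases p; cases q) simp_all
  qed (simp add: t0_def)
  note c = this
  have "Q (r k a) j = [:[:t0:]:]" by (rule poly_eqI, rule poly_eqI) (rule c)
  then have "poly (Q (r k a) j) [:c k a:] = [:t0:]" by simp
  then have "poly (QQ (RR p) j) [:CC p:] = [:to_laurent t0:]"
   unfolding QQ_eval by (simp add: ka RR_def t.map_pC)
  then show ?thesis unfolding set B using t.map_dvd_1[OF u] by (auto simp: t0_def)
 qed
qed

lemma content_data: "content_data e n lv CC RR QQ QQ3 WW"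
proof
 interpret t: ring_map to_laurent by (rule ring_map_laurent)
 interpret m: ring_map "map_poly to_laurent" by (rule t.ring_map_poly)
 fix p q s :: "nat \<times> int" and i j k
 show "fst p \<in> {1..lv} \<Longrightarrow> RR p < e" by (simp add: RR_def r_less)
 show "CC p - CC q dvd 1" if "fst p \<in> {1..lv}" "fst q \<in> {1..lv}" "\<bar>snd p\<bar> < int n" "\<bar>snd q\<bar> < int n"
   "RR p = RR q" "p \<noteq> q"
  using content_diff_unit[OF that(1-4)] that(5,6) to_laurent_unit
  by (metis CC_def RR_def prod.collapse t.map_diff)
 show "RR p \<noteq> RR q" if "fst p \<in> {1..lv}" "near p q" "p \<noteq> q"
  using near_iff[of p q] r_adjacent[OF that(1), of "snd q" "snd p"] that by (auto simp: RR_def)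
 show "\<exists>\<epsilon>. \<epsilon> dvd 1 \<and> poly (QQ (RR p) j) [:CC p:] =
   [:\<epsilon>:] * (\<Prod>q\<in>{q. near p q \<and> q \<noteq> p \<and> RR q = j}. [:CC q, -1:])"
  if "fst p \<in> {1..lv}" "j < e" "j \<noteq> RR p" using QQ_value[OF that] .
 show "i < e \<Longrightarrow> QQ i i = 0" by (simp add: QQ_def Q_same)
 show "poly2 (QQ (RR p) (RR q)) (CC p) (CC q) = poly2 (QQ (RR q) (RR p)) (CC q) (CC p)"
  if "fst p \<in> {1..lv}" "fst q \<in> {1..lv}"
  unfolding QQ_poly2 using transposed_poly2[OF Q_transposed[OF r_less r_less]] that
  by (simp add: RR_def)
 show "i \<noteq> k \<Longrightarrow> QQ3 i j k = 0" by (simp add: QQ3_def Q3_def)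
 show "(CC p - CC s) * poly3 (QQ3 (RR p) (RR q) (RR p)) (CC p) (CC q) (CC s)
   = poly2 (QQ (RR p) (RR q)) (CC p) (CC q) - poly2 (QQ (RR q) (RR p)) (CC q) (CC s)"
  if "fst p \<in> {1..lv}" "fst q \<in> {1..lv}"
  unfolding QQ_poly2 QQ3_poly3 unfolding CC_def t.map_diff[symmetric] t.map_mult[symmetric]
  using Q3_eval[of Q "RR p" "RR q"] Q_transposed[OF r_less r_less] that by (simp add: RR_def)
 show "poly3 (QQ3 (RR p) (RR q) (RR p)) (CC p) (CC q) (CC p) dvd 1"
  if "fst p \<in> {1..lv}" "near p q" "p \<noteq> q" "\<bar>snd p\<bar> < int n" "\<bar>snd q\<bar> + 1 < int n"
  unfolding QQ3_poly3
  using Q3_adjacent_unit[OF that(1) _ that(4,5)] near_iff[of p q] that by (auto simp: RR_def)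
 show "WW i = (\<Prod>k\<in>{k\<in>{1..lv}. RR (k, 0) = i}. [:- CC (k, 0), 1:])" if "i < e"
 proof -
  have "{k\<in>{1..lv}. RR (k, 0) = i} = {k\<in>{1..lv}. \<rho> k = i}" using r_0 by (auto simp: RR_def)
  then show ?thesis
   by (simp add: WW_def W_prod[OF that] m.map_prod t.map_pC t.map_uminus t.map_1 CC_def)
 qed
qed

end

subsection \<open>Linear actions of a free algebra\<close>

definition scal :: "'a::comm_ring_1 \<Rightarrow> ('b \<Rightarrow>\<^sub>0 'a) \<Rightarrow> ('b \<Rightarrow>\<^sub>0 'a)"
 where "scal a = Poly_Mapping.map ((*) a)"

lemma lookup_scal [simp]: "lookup (scal a v) t = a * lookup v t"
 by (simp add: scal_def Poly_Mapping.map.rep_eq when_def)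

lemma scal_simps:
 shows scal_add: "scal a (v + w) = scal a v + scal a w"
  and scal_add_left: "scal (a + b) v = scal a v + scal b v"
  and scal_scal: "scal a (scal b v) = scal (a * b) v"
  and scal_1: "scal 1 v = v" and scal_0: "scal 0 v = 0" and scal_0_right: "scal a 0 = 0"
  and scal_diff: "scal a (v - w) = scal a v - scal a w"
  and scal_diff_left: "scal (a - b) v = scal a v - scal b v"
  and scal_single: "scal a (single t b) = single t (a * b)"
 by (rule poly_mapping_eqI,
   simp add: lookup_add lookup_minus lookup_single when_def algebra_simps)+

lemma keys_scal: "keys (scal a v) \<subseteq> keys v"
 by (auto simp: in_keys_iff)

definition linext :: "('c \<Rightarrow> 'b \<Rightarrow>\<^sub>0 'a::comm_ring_1) \<Rightarrow> ('c \<Rightarrow>\<^sub>0 'a) \<Rightarrow> 'b \<Rightarrow>\<^sub>0 'a"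
 where "linext b f = (\<Sum>k\<in>keys f. scal (lookup f k) (b k))"

lemma linext_extend:
 assumes "finite A" and "keys f \<subseteq> A"
 shows "linext b f = (\<Sum>k\<in>A. scal (lookup f k) (b k))"
 unfolding linext_def
 by (rule sum.mono_neutral_left) (use assms in \<open>auto simp: in_keys_iff scal_0\<close>)

lemma linext_0 [simp]: "linext b 0 = 0"
 by (simp add: linext_def)

lemma linext_add: "linext b (f + g) = linext b f + linext b g"
proof -
 let ?A = "keys f \<union> keys g"
 have "keys (f + g) \<subseteq> ?A" by (rule keys_add)
 then show ?thesis
  by (simp add: linext_extend[of ?A] lookup_add scal_add_left sum.distrib)
qed

lemma linext_scal:
 fixes b :: "'c \<Rightarrow> 'b \<Rightarrow>\<^sub>0 'a::comm_ring_1"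
 shows "linext b (scal a f) = scal a (linext b f)"
proof -
 have "scal a (\<Sum>k\<in>A. g k) = (\<Sum>k\<in>A. scal a (g k))" for A and g :: "'c \<Rightarrow> 'b \<Rightarrow>\<^sub>0 'a"
  by (induction A rule: infinite_finite_induct) (simp_all add: scal_add scal_0_right)
 then show ?thesis
  unfolding linext_extend[OF finite_keys keys_scal, of b a f] by (simp add: linext_def scal_scal)
qed

lemma linext_single [simp]: "linext b (single k a) = scal a (b k)"
 by (simp add: linext_def scal_0)

lemma linext_uminus: "linext b (- f) = - linext b f"
 using linext_add[of b f "- f"] by (simp add: eq_neg_iff_add_eq_0 add.commute)

lemma linext_diff: "linext b (f - g) = linext b f - linext b g"
 using linext_add[of b f "- g"] by (simp add: linext_uminus)

lemma linext_keys:
 assumes "\<And>k. k \<in> keys f \<Longrightarrow> keys (b k) \<subseteq> A"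
 shows "keys (linext b f) \<subseteq> A"
 unfolding linext_def using keys_sum keys_scal assms by fast

lemma linext_cong: "(\<And>k. k \<in> keys f \<Longrightarrow> b k = b' k) \<Longrightarrow> linext b f = linext b' f"
 by (simp add: linext_def)

text \<open>Letters act as linear operators and words as their composites. No relations are
  presupposed, so they can be tested afterwards on basis vectors.\<close>

definition act :: "('g \<Rightarrow> 'b \<Rightarrow> 'b \<Rightarrow>\<^sub>0 'a::comm_ring_1) \<Rightarrow> ('g word \<Rightarrow>\<^sub>0 'a) \<Rightarrow> ('b \<Rightarrow>\<^sub>0 'a) \<Rightarrow> 'b \<Rightarrow>\<^sub>0 'a"
 where "act op f v = linext (\<lambda>w. foldr (\<lambda>g. linext (op g)) (letters w) v) f"

lemma act_0 [simp]: "act op 0 v = 0"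
 and act_add: "act op (f + g) v = act op f v + act op g v"
 and act_uminus: "act op (- f) v = - act op f v"
 and act_diff: "act op (f - g) v = act op f v - act op g v"
 by (simp_all add: act_def linext_add linext_diff linext_uminus)

lemma act_fconst_mult: "act op (fconst a * f) v = scal a (act op f v)"
 by (induction f rule: poly_mapping_add_induct)
  (simp_all add: scal_0_right act_add distrib_left scal_add fconst_def mult_single, simp add: act_def scal_scal)

lemma act_gen_mult: "act op (fgen g * f) v = linext (op g) (act op f v)"
 by (induction f rule: poly_mapping_add_induct)
  (simp_all add: act_add distrib_left linext_add fgen_def mult_single,
   simp add: act_def linext_scal plus_word_def)

lemma act_1 [simp]: "act op 1 v = v"
 using single_one[symmetric] by (simp add: act_def zero_word_def scal_1 flip: single_one)

lemma act_mult: "act op (f * g) v = act op f (act op g v)"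
 by (induction f rule: free_alg_induct)
  (simp_all add: mult.assoc act_gen_mult act_fconst_mult act_add distrib_right)

lemma act_fconst: "act op (fconst a) v = scal a v"
 using act_fconst_mult[of op a 1 v] by simp

lemma act_gen: "act op (fgen g) v = linext (op g) v"
 using act_gen_mult[of op g 1 v] by simp

lemma act_add_right: "act op f (v + w) = act op f v + act op f w"
 by (induction f rule: free_alg_induct)
  (simp_all add: act_gen_mult act_fconst_mult act_add linext_add scal_add)

lemma act_scal: "act op f (scal a v) = scal a (act op f v)"
 by (induction f rule: free_alg_induct)
  (simp_all add: act_gen_mult act_fconst_mult act_add linext_scal scal_add scal_scal mult.commute)

lemma act_0_right [simp]: "act op f 0 = 0"
 using act_scal[of op f 0 0] by (simp add: scal_0)

lemma act_linext: "act op f v = linext (\<lambda>t. act op f (single t 1)) v"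
proof (induction v rule: poly_mapping_add_induct)
 case (single t a)
 then show ?case using act_scal[of op f a "single t 1"] by (simp add: scal_single)
qed (simp_all add: act_add_right linext_add)

lemma act_sum: "act op (sum f A) v = (\<Sum>x\<in>A. act op (f x) v)"
 by (induction A rule: infinite_finite_induct) (simp_all add: act_add)

lemma act_left_ideal: "left_ideal {f. act op f v = 0}"
 by standard (simp_all add: act_add act_mult)

lemma act_ann_iff: "f - g \<in> {f. act op f v = 0} \<longleftrightarrow> act op f v = act op g v"
 by (simp add: act_diff)

subsection \<open>Multipartitions and standard tableaux\<close>

lemma diagram_iff: "(k, r, c) \<in> diagram \<nu> \<longleftrightarrow> 1 \<le> k \<and> 1 \<le> r \<and> 1 \<le> c \<and> c \<le> \<nu> k r"
 by (simp add: diagram_def)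

lemma diagram_young:
 assumes "\<nu> \<in> multipartitions l n"
 shows "young l (diagram \<nu>)" and "card (diagram \<nu>) = n"
proof -
 have 0: "\<And>k r. k \<notin> {1..l} \<or> r = 0 \<Longrightarrow> \<nu> k r = 0" and fin: "\<And>k. finite {r. \<nu> k r \<noteq> 0}"
  and dec: "\<And>k r. 1 \<le> r \<Longrightarrow> \<nu> k (r + 1) \<le> \<nu> k r" and sum: "(\<Sum>k=1..l. component_size (\<nu> k)) = n"
  using assms by (auto simp: multipartitions_def)
 have eq: "diagram \<nu> = (SIGMA k:{1..l}. SIGMA r:{r. \<nu> k r \<noteq> 0}. {1..\<nu> k r})"
 proof (rule Set.set_eqI, safe)
  fix k r c assume "(k, r, c) \<in> diagram \<nu>"
  then show "k \<in> {1..l}" "0 < \<nu> k r" "c \<in> {1..\<nu> k r}" using 0[of k r] by (auto simp: diagram_iff)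
 next
  fix k r c assume "k \<in> {1..l}" "0 < \<nu> k r" "c \<in> {1..\<nu> k r}"
  then show "(k, r, c) \<in> diagram \<nu>" using 0[of k r] by (cases r) (auto simp: diagram_iff)
 qed
 have "finite (diagram \<nu>)" unfolding eq using fin by (intro finite_SigmaI) auto
 then show "young l (diagram \<nu>)" unfolding young_def
 proof (intro conjI allI impI)
  fix k r c assume A: "(k, r, c) \<in> diagram \<nu>"
  then show "1 \<le> k" "1 \<le> r" "1 \<le> c" by (auto simp: diagram_iff)
  show "k \<le> l" using A unfolding eq by auto
  show "(k, r - 1, c) \<in> diagram \<nu>" if "1 < r"
  proof -
   have "1 \<le> r - 1" "r - 1 + 1 = r" using that by auto
   then have "\<nu> k r \<le> \<nu> k (r - 1)" using dec[of "r - 1" k] by simp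
   then show ?thesis using A that by (auto simp: diagram_iff)
  qed
  show "(k, r, c - 1) \<in> diagram \<nu>" if "1 < c" using A that by (auto simp: diagram_iff)
 qed
 show "card (diagram \<nu>) = n"
  unfolding eq using fin sum by (simp add: card_SigmaI component_size_def)
qed

lemma diagram_inject:
 assumes "\<nu> \<in> multipartitions l n" and "\<mu> \<in> multipartitions l n" and "diagram \<nu> = diagram \<mu>"
 shows "\<nu> = \<mu>"
proof (intro ext)
 fix k r
 show "\<nu> k r = \<mu> k r"
 proof (cases "k \<in> {1..l} \<and> r \<noteq> 0")
  case True
  have "{c. (k, r, c) \<in> diagram \<nu>} = {1..\<nu> k r}" "{c. (k, r, c) \<in> diagram \<mu>} = {1..\<mu> k r}"
   using True by (auto simp: diagram_iff)
  then have "card {1..\<nu> k r} = card {1..\<mu> k r}" using assms(3) by metis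
  then show ?thesis by simp
 qed (use assms in \<open>auto simp: multipartitions_def\<close>)
qed

text \<open>In each row a diagram occupies an initial segment of the columns, so row lengths can be
  read off as cardinalities.\<close>

lemma young_diagram:
 assumes D: "young l D"
 shows "\<exists>\<nu>\<in>multipartitions l (card D). diagram \<nu> = D"
proof -
 define \<nu> where "\<nu> = (\<lambda>k r. card {c. (k, r, c) \<in> D})"
 have fin: "finite {c. (k, r, c) \<in> D}" for k r
  by (rule finite_subset[of _ "{..card D}"]) (use young_card(2)[OF D] in auto)
 have seg: "{c. (k, r, c) \<in> D} = {1..\<nu> k r}" for k r
 proof (cases "{c. (k, r, c) \<in> D} = {}")
  case True then show ?thesis by (simp add: \<nu>_def)
 next
  case False
  define m where "m = Max {c. (k, r, c) \<in> D}"
  have M: "(k, r, m) \<in> D" using Max_in[OF fin False] by (simp add: m_def)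
  have le: "c \<le> m" if "(k, r, c) \<in> D" for c using Max_ge[OF fin, of c] that by (simp add: m_def)
  have "{c. (k, r, c) \<in> D} = {1..m}"
  proof (rule Set.set_eqI)
   fix c show "c \<in> {c. (k, r, c) \<in> D} \<longleftrightarrow> c \<in> {1..m}"
    using le[of c] young_row[OF D M, of c] young_pos[OF D, of k r c] by auto
  qed
  then show ?thesis unfolding \<nu>_def by simp
 qed
 have mem: "(k, r, c) \<in> D \<longleftrightarrow> 1 \<le> c \<and> c \<le> \<nu> k r" for k r c
 proof -
  have "(k, r, c) \<in> D \<longleftrightarrow> c \<in> {c. (k, r, c) \<in> D}" by simp
  also have "\<dots> \<longleftrightarrow> c \<in> {1..\<nu> k r}" unfolding seg ..
  finally show ?thesis by simp
 qed
 have pos: "\<nu> k r \<noteq> 0 \<Longrightarrow> (k, r, 1) \<in> D" for k r using mem[of k r 1] by simp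
 have dia: "diagram \<nu> = D"
 proof (rule Set.set_eqI)
  fix A :: node
  obtain k r c where A: "A = (k, r, c)" by (cases A)
  show "A \<in> diagram \<nu> \<longleftrightarrow> A \<in> D"
   using mem[of k r c] young_pos[OF D, of k r c] unfolding A by (auto simp: diagram_iff)
 qed
 have "{r. \<nu> k r \<noteq> 0} \<subseteq> {..card D}" for k using young_card(1)[OF D pos] by blast
 then have finr: "finite {r. \<nu> k r \<noteq> 0}" for k by (rule finite_subset) simp
 have "\<nu> k (r + 1) \<le> \<nu> k r" if "1 \<le> r" for k r
 proof (cases "\<nu> k (r + 1) = 0")
  case False
  then have "(k, r + 1, \<nu> k (r + 1)) \<in> D" using mem by simp
  from young_col[OF D this that] show ?thesis using mem by simp
 qed simp
 moreover have "\<nu> k r = 0" if kr: "k \<notin> {1..l} \<or> r = 0" for k r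
 proof (rule ccontr)
  assume "\<nu> k r \<noteq> 0"
  from young_pos[OF D pos[OF this]] show False using kr by auto
 qed
 moreover have "(\<Sum>k=1..l. component_size (\<nu> k)) = card D"
 proof -
  have "D = (SIGMA k:{1..l}. SIGMA r:{r. \<nu> k r \<noteq> 0}. {1..\<nu> k r})"
  proof (rule Set.set_eqI)
   fix A :: node
   obtain k r c where A: "A = (k, r, c)" by (cases A)
   show "A \<in> D \<longleftrightarrow> A \<in> (SIGMA k:{1..l}. SIGMA r:{r. \<nu> k r \<noteq> 0}. {1..\<nu> k r})"
    using mem[of k r c] young_pos[OF D, of k r c] unfolding A by auto
  qed
  then have "card D = card (SIGMA k:{1..l}. SIGMA r:{r. \<nu> k r \<noteq> 0}. {1..\<nu> k r})" by simp
  also have "\<dots> = (\<Sum>k=1..l. component_size (\<nu> k))" using finr by (simp add: card_SigmaI component_size_def)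
  finally show ?thesis by simp
 qed
 ultimately have "\<nu> \<in> multipartitions l (card D)" using finr by (simp add: multipartitions_def)
 then show ?thesis using dia by blast
qed

definition place :: "'a list \<Rightarrow> 'a \<Rightarrow> nat"
 where "place s A = (THE i. i < length s \<and> s ! i = A)"

lemma place_nth: "distinct s \<Longrightarrow> i < length s \<Longrightarrow> place s (s ! i) = i"
 unfolding place_def by (rule the_equality) (auto simp: nth_eq_iff_index_eq)

lemma place_less: "distinct s \<Longrightarrow> A \<in> set s \<Longrightarrow> place s A < length s \<and> s ! place s A = A"
 by (auto simp: in_set_conv_nth place_nth)

text \<open>List positions start at 0 and entries at 1, hence the successor. The inverse translation
  is \<open>ls\<close>.\<close>

definition tb :: "multipartition \<Rightarrow> node list \<Rightarrow> tableau"
 where "tb \<nu> s = restrict (\<lambda>A. Suc (place s A)) (diagram \<nu>)"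

lemma tb_nth:
 assumes "stdl l s" and "set s = diagram \<nu>" and "i < length s"
 shows "tb \<nu> s (s ! i) = Suc i"
 using assms nth_mem[OF assms(3)] by (simp add: tb_def place_nth stdl_distinct)

lemma tb_inject:
 assumes s: "stdl l s" "set s = diagram \<nu>" and s': "stdl l s'" "set s' = diagram \<nu>" and eq: "tb \<nu> s = tb \<nu> s'"
 shows "s = s'"
proof (rule nth_equalityI)
 show len: "length s = length s'"
  using s s' by (metis distinct_card stdl_distinct)
 fix i assume i: "i < length s"
 have "s ! i \<in> set s'" using nth_mem[OF i] s s' by simp
 then obtain j where j: "j < length s'" "s' ! j = s ! i" by (auto simp: in_set_conv_nth)
 then have "Suc i = Suc j" using tb_nth[OF s i] tb_nth[OF s' j(1)] eq by simp
 then show "s ! i = s' ! i" using j by simp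
qed

lemma bij_tb:
 assumes s: "stdl l s" "set s = diagram \<nu>" "length s = n"
 shows "bij_betw (tb \<nu> s) (diagram \<nu>) {1..n}"
 unfolding bij_betw_def
proof
 have d: "distinct s" using s by (simp add: stdl_distinct)
 show "inj_on (tb \<nu> s) (diagram \<nu>)"
 proof (rule inj_onI)
  fix A B assume AB: "A \<in> diagram \<nu>" "B \<in> diagram \<nu>" "tb \<nu> s A = tb \<nu> s B"
  then have "s ! place s A = s ! place s B" by (simp add: tb_def)
  then show "A = B" using place_less[OF d] AB s by simp
 qed
 show "tb \<nu> s ` diagram \<nu> = {1..n}"
 proof
  show "tb \<nu> s ` diagram \<nu> \<subseteq> {1..n}" using place_less[OF d] s by (auto simp: tb_def Suc_le_eq)
  show "{1..n} \<subseteq> tb \<nu> s ` diagram \<nu>"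
  proof
   fix m assume m: "m \<in> {1..n}"
   then have m1: "m - 1 < length s" "Suc (m - 1) = m" using s(3) by auto
   have "tb \<nu> s (s ! (m - 1)) = m" using tb_nth[OF s(1,2) m1(1)] m1(2) by simp
   moreover have "s ! (m - 1) \<in> diagram \<nu>" using nth_mem[OF m1(1)] s(2) by simp
   ultimately show "m \<in> tb \<nu> s ` diagram \<nu>" by (rule image_eqI[OF sym])
  qed
 qed
qed

lemma stdl_order:
 assumes s: "stdl l s" and ij: "i < length s" "j < length s" and a: "adj (s ! i) (s ! j)"
 shows "i < j"
proof (rule ccontr)
 assume "\<not> i < j"
 moreover have "i \<noteq> j" using adj_near[OF a] by auto
 ultimately have "j < i" by simp
 then have jt: "s ! j \<in> set (take i s)" using ij nth_mem[of j "take i s"] by simp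
 have y: "young l (set (take i s))" using stdl_young[OF stdl_take[OF s]] .
 obtain k r c where i: "s ! i = (k, r, c)" by (cases "s ! i")
 have "1 \<le> r \<and> 1 \<le> c" using young_pos[OF stdl_young[OF s], of k r c] nth_mem[OF ij(1)] i by auto
 then have "s ! i \<in> set (take i s)"
  using a young_up[OF y, of k "r + 1" c] young_left[OF y, of k r "c + 1"] jt
  by (auto simp: adj_def i)
 then show False using stdl_nth[OF s ij(1)] by (simp add: addable_def)
qed

lemma tb_Std:
 assumes s: "stdl l s" "set s = diagram \<nu>" "length s = n"
 shows "tb \<nu> s \<in> Std n \<nu>"
proof -
 have lt: "tb \<nu> s A < tb \<nu> s B" if AB: "A \<in> diagram \<nu>" "B \<in> diagram \<nu>" "adj A B" for A B
 proof -
  obtain i j where "i < length s" "j < length s" "A = s ! i" "B = s ! j"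
   using AB s(2) by (metis in_set_conv_nth)
  then show ?thesis using tb_nth[OF s(1,2)] stdl_order[OF s(1)] AB(3) by simp
 qed
 have "tb \<nu> s \<in> extensional (diagram \<nu>)" by (simp add: tb_def)
 then show ?thesis unfolding Std_def using bij_tb[OF s] lt by (auto simp: adj_def)
qed

definition ls :: "nat \<Rightarrow> multipartition \<Rightarrow> tableau \<Rightarrow> node list"
 where "ls n \<nu> t = map (inv_into (diagram \<nu>) t) [1..<Suc n]"

lemma Std_ls:
 assumes y: "young l (diagram \<nu>)" and t: "t \<in> Std n \<nu>"
 shows "stdl l (ls n \<nu> t)" and "set (ls n \<nu> t) = diagram \<nu>" and "length (ls n \<nu> t) = n"
  and "tb \<nu> (ls n \<nu> t) = t"
proof -
 let ?D = "diagram \<nu>" and ?s = "ls n \<nu> t"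
 have bij: "bij_betw t ?D {1..n}" and ext: "t \<in> extensional ?D"
  and lt: "\<And>k r c. (k, r, c) \<in> ?D \<Longrightarrow> ((k, r, c + 1) \<in> ?D \<longrightarrow> t (k, r, c) < t (k, r, c + 1)) \<and>
   ((k, r + 1, c) \<in> ?D \<longrightarrow> t (k, r, c) < t (k, r + 1, c))"
  using t unfolding Std_def by auto
 show len: "length ?s = n" by (simp add: ls_def)
 have nth: "?s ! i = inv_into ?D t (Suc i)" if "i < n" for i
  using that by (simp add: ls_def del: upt_Suc)
 have img: "t ` ?D = {1..n}" using bij by (simp add: bij_betw_def)
 have tn: "t (?s ! i) = Suc i" "?s ! i \<in> ?D" if "i < n" for i
  using f_inv_into_f[of "Suc i" t ?D] inv_into_into[of "Suc i" t ?D] that img nth by auto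
 have place: "?s ! (t A - 1) = A" "t A - 1 < n" "1 \<le> t A" if "A \<in> ?D" for A
 proof -
  have "t A \<in> {1..n}" using that img by blast
  then show "t A - 1 < n" "1 \<le> t A" by auto
  then show "?s ! (t A - 1) = A" using nth[of "t A - 1"] inv_into_f_f[of t ?D A] bij that
   by (simp add: bij_betw_def)
 qed
 show set: "set ?s = ?D"
 proof
  show "set ?s \<subseteq> ?D"
  proof
   fix A assume "A \<in> set ?s"
   then obtain i where "i < n" "?s ! i = A" using len by (metis in_set_conv_nth)
   then show "A \<in> ?D" using tn(2)[of i] by simp
  qed
  show "?D \<subseteq> set ?s"
  proof
   fix A assume A: "A \<in> ?D"
   show "A \<in> set ?s" using place(1,2)[OF A] len nth_mem by metis
  qed
 qed
 have tk: "A \<in> set (take m ?s) \<longleftrightarrow> A \<in> ?D \<and> t A \<le> m" if "m \<le> n" for A m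
 proof
  assume "A \<in> set (take m ?s)"
  then obtain i where "i < m" "A = ?s ! i" using that len by (auto simp: in_set_conv_nth)
  then show "A \<in> ?D \<and> t A \<le> m" using tn[of i] that by simp
 next
  assume A: "A \<in> ?D \<and> t A \<le> m"
  then have i: "t A - 1 < m" using place(3)[of A] by linarith
  then have "take m ?s ! (t A - 1) = A" using place(1)[of A] A by simp
  then show "A \<in> set (take m ?s)" using i that len nth_mem[of "t A - 1" "take m ?s"] by simp
 qed
 have yt: "young l (set (take m ?s))" if m: "m \<le> n" for m
  unfolding young_def
 proof (intro conjI allI impI)
  show "finite (set (take m ?s))" by simp
  fix k r c assume A: "(k, r, c) \<in> set (take m ?s)"
  then have AD: "(k, r, c) \<in> ?D" "t (k, r, c) \<le> m" using tk[OF m] by auto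
  from young_pos[OF y AD(1)] show "1 \<le> k" "k \<le> l" "1 \<le> r" "1 \<le> c" by auto
  show "(k, r - 1, c) \<in> set (take m ?s)" if r: "1 < r"
  proof -
   have "(k, r - 1, c) \<in> ?D" using young_up[OF y AD(1) r] .
   moreover have "(k, r - 1 + 1, c) = (k, r, c)" using r by simp
   ultimately have "t (k, r - 1, c) < t (k, r, c)" using lt[of k "r - 1" c] AD(1) by metis
   then show ?thesis using \<open>(k, r - 1, c) \<in> ?D\<close> AD(2) tk[OF m] by auto
  qed
  show "(k, r, c - 1) \<in> set (take m ?s)" if c: "1 < c"
  proof -
   have "(k, r, c - 1) \<in> ?D" using young_left[OF y AD(1) c] .
   moreover have "(k, r, c - 1 + 1) = (k, r, c)" using c by simp
   ultimately have "t (k, r, c - 1) < t (k, r, c)" using lt[of k r "c - 1"] AD(1) by metis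
   then show ?thesis using \<open>(k, r, c - 1) \<in> ?D\<close> AD(2) tk[OF m] by auto
  qed
 qed
 show st: "stdl l ?s" unfolding stdl_def
 proof (intro allI impI)
  fix m assume "m < length ?s"
  then have m: "m < n" by (simp add: len)
  have "?s ! m \<notin> set (take m ?s)" using tk[of m] tn[OF m] m by simp
  moreover have "insert (?s ! m) (set (take m ?s)) = set (take (Suc m) ?s)"
   using m len by (simp add: take_Suc_conv_app_nth)
  ultimately show "?s ! m \<in> addable l (set (take m ?s))" using yt[of "Suc m"] m by (simp add: addable_def)
 qed
 show "tb \<nu> ?s = t"
 proof
  fix A show "tb \<nu> ?s A = t A"
  proof (cases "A \<in> ?D")
   case True
   then show ?thesis using tb_nth[OF st set, of "t A - 1"] place[OF True] len by simp
  next
   case False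
   then show ?thesis using extensional_arb[OF ext] by (simp add: tb_def)
  qed
 qed
qed

lemma on_content_tb:
 assumes s: "stdl l s" "set s = diagram \<nu>" "i < length s"
 shows "on_content f \<nu> (tb \<nu> s) (Suc i) = f (fst (cont (s ! i))) (snd (cont (s ! i)))"
proof -
 have "inv_into (diagram \<nu>) (tb \<nu> s) (tb \<nu> s (s ! i)) = s ! i"
  using bij_tb[OF s(1,2) refl] s nth_mem[OF s(3)] by (intro inv_into_f_f) (auto simp: bij_betw_def)
 then show ?thesis using tb_nth[OF s] by (cases "s ! i") (simp add: on_content_def)
qed

lemma swap_entries_tb:
 assumes s: "stdl l s" "set s = diagram \<nu>" "Suc p < length s"
 shows "swap_entries \<nu> (Suc p) (tb \<nu> s) = tb \<nu> (sw p s)"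
proof
 fix A
 have ds: "distinct (sw p s)" using stdl_distinct[OF s(1)] s(3) mset_sw[of p s] by (metis mset_eq_imp_distinct_iff)
 show "swap_entries \<nu> (Suc p) (tb \<nu> s) A = tb \<nu> (sw p s) A"
 proof (cases "A \<in> diagram \<nu>")
  case True
  then obtain i where i: "i < length s" "A = s ! i" using s(2) by (metis in_set_conv_nth)
  let ?j = "if i = p then Suc p else if i = Suc p then p else i"
  have j: "?j < length (sw p s)" "sw p s ! ?j = A" using i s(3) by (auto simp: nth_sw)
  have "tb \<nu> (sw p s) A = Suc ?j" using True place_nth[OF ds j(1)] j(2) by (simp add: tb_def)
  moreover have "tb \<nu> s A = Suc i" using tb_nth[OF s(1,2) i(1)] i(2) by simp
  ultimately show ?thesis using True by (simp add: swap_entries_def transpose_def)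
 qed (simp add: swap_entries_def tb_def)
qed

lemma tb_Std_iff:
 assumes y: "young l (diagram \<nu>)" and s: "stdl l s" "set s = diagram \<nu>" "Suc p < length s"
 shows "tb \<nu> (sw p s) \<in> Std (length s) \<nu> \<longleftrightarrow> stdl l (sw p s)"
proof
 assume "stdl l (sw p s)"
 then show "tb \<nu> (sw p s) \<in> Std (length s) \<nu>" using tb_Std[of l "sw p s" \<nu>] s by simp
next
 assume a: "tb \<nu> (sw p s) \<in> Std (length s) \<nu>"
 let ?s' = "ls (length s) \<nu> (tb \<nu> (sw p s))"
 note L = Std_ls[OF y a]
 have ds: "distinct (sw p s)" using stdl_distinct[OF s(1)] s(3) mset_sw[of p s] by (metis mset_eq_imp_distinct_iff)
 have "?s' = sw p s"
 proof (rule nth_equalityI)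
  show "length ?s' = length (sw p s)" using L by simp
  fix i assume "i < length ?s'"
  then have i: "i < length (sw p s)" "?s' ! i \<in> diagram \<nu>" using L nth_mem by auto
  have "tb \<nu> (sw p s) (?s' ! i) = Suc i" using tb_nth[OF L(1,2), of i] L(3,4) i by simp
  then have "place (sw p s) (?s' ! i) = i" using i by (simp add: tb_def)
  then show "?s' ! i = sw p s ! i" using place_less[OF ds, of "?s' ! i"] i s by simp
 qed
 then show "stdl l (sw p s)" using L(1) by simp
qed

subsection \<open>The dominance order on neighbouring tableaux\<close>

definition nlt :: "node \<Rightarrow> node \<Rightarrow> bool"
 where "nlt A B \<longleftrightarrow> fst A < fst B \<or> (fst A = fst B \<and> fst (snd A) < fst (snd B))"

text \<open>Both sides count the nodes of the components before \<open>k\<close> together with those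
  in the first \<open>s\<close> rows of component \<open>k\<close>. In this form adding one node
  changes the count visibly.\<close>

lemma dominates_card:
 assumes "finite Z" and pos: "\<And>k r c. (k, r, c) \<in> Z \<Longrightarrow> 1 \<le> k \<and> 1 \<le> r"
 shows "(\<Sum>j=1..<k. component_size (\<lambda>r. card {c. (j, r, c) \<in> Z})) + (\<Sum>r=1..s. card {c. (k, r, c) \<in> Z})
  = card {A \<in> Z. \<not> nlt (k, s, 0) A}"
proof -
 let ?f = "\<lambda>j r. card {c. (j, r, c) \<in> Z}"
 have fin: "finite {c. (j, r, c) \<in> Z}" for j r
  by (rule finite_subset[OF _ finite_imageI[OF assms(1), of "\<lambda>A. snd (snd A)"]]) force
 have ne: "?f j r \<noteq> 0 \<longleftrightarrow> (\<exists>c. (j, r, c) \<in> Z)" for j r using fin by auto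
 have finr: "finite {r. ?f j r \<noteq> 0}" for j
  by (rule finite_subset[OF _ finite_imageI[OF assms(1), of "\<lambda>A. fst (snd A)"]]) (use ne in force)
 have c1: "component_size (?f j) = card (SIGMA r:{r. ?f j r \<noteq> 0}. {c. (j, r, c) \<in> Z})" for j
  using finr fin by (simp add: component_size_def)
 have c2: "(\<Sum>j=1..<k. component_size (?f j))
   = card (SIGMA j:{1..<k}. SIGMA r:{r. ?f j r \<noteq> 0}. {c. (j, r, c) \<in> Z})"
  unfolding c1 using finr fin by (subst card_SigmaI) auto
 have c3: "(\<Sum>r=1..s. ?f k r) = card ({k} \<times> (SIGMA r:{1..s}. {c. (k, r, c) \<in> Z}))"
  using fin by (simp add: card_cartesian_product)
 have e: "{A \<in> Z. \<not> nlt (k, s, 0) A} = (SIGMA j:{1..<k}. SIGMA r:{r. ?f j r \<noteq> 0}. {c. (j, r, c) \<in> Z})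
   \<union> ({k} \<times> (SIGMA r:{1..s}. {c. (k, r, c) \<in> Z}))"
  using pos ne by (auto simp: nlt_def)
 have "card {A \<in> Z. \<not> nlt (k, s, 0) A} = card (SIGMA j:{1..<k}. SIGMA r:{r. ?f j r \<noteq> 0}. {c. (j, r, c) \<in> Z})
   + card ({k} \<times> (SIGMA r:{1..s}. {c. (k, r, c) \<in> Z}))"
  unfolding e by (rule card_Un_disjoint) (use finr fin in auto)
 then show ?thesis using c2 c3 by simp
qed

text \<open>The two tableaux differ only in the shape after \<open>p + 1\<close> nodes, where one
  node is exchanged for another. Both are addable to the same diagram, so they never share a row and
  \<open>nlt\<close> decides.\<close>

lemma tab_dominates_swap:
 assumes s: "stdl l s" "set s = diagram \<nu>" "Suc p < length s" and s': "stdl l (sw p s)"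
 shows "tab_strictly_dominates l \<nu> (tb \<nu> (sw p s)) (tb \<nu> s) \<longleftrightarrow> nlt (s ! Suc p) (s ! p)"
  and "nlt (s ! Suc p) (s ! p) \<longleftrightarrow> \<not> nlt (s ! p) (s ! Suc p)"
proof -
 let ?A = "s ! p" and ?B = "s ! Suc p" and ?X = "set (take p s)"
 have yX: "young l ?X" using stdl_young[OF stdl_take[OF s(1)]] .
 have A: "?A \<in> addable l ?X" using stdl_nth[OF s(1)] s(3) by simp
 have nadj: "\<not> adj ?A ?B" using stdl_sw_iff[OF s(1,3)] s' by simp
 have B: "?B \<in> addable l ?X" using addable_commute(1)[OF yX A stdl_nth_Suc[OF s(1,3)] nadj] .
 have AB: "?A \<noteq> ?B" using stdl_distinct[OF s(1)] s(3) by (simp add: nth_eq_iff_index_eq)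
 obtain k1 r1 c1 where A': "?A = (k1, r1, c1)" by (cases ?A)
 obtain k2 r2 c2 where B': "?B = (k2, r2, c2)" by (cases ?B)
 have yA: "young l (insert ?A ?X)" and yB: "young l (insert ?B ?X)" and nA: "?A \<notin> ?X" and nB: "?B \<notin> ?X"
  using A B by (auto simp: addable_def)
 have posA: "1 \<le> k1" "k1 \<le> l" "1 \<le> r1" "1 \<le> c1" and posB: "1 \<le> k2" "k2 \<le> l" "1 \<le> r2" "1 \<le> c2"
  using young_pos[OF yA, of k1 r1 c1] young_pos[OF yB, of k2 r2 c2] A' B' by auto
 have row: "\<not> (k1 = k2 \<and> r1 = r2)"
 proof
  assume eq: "k1 = k2 \<and> r1 = r2"
  then have "c1 \<noteq> c2" using AB A' B' by auto
  then consider "c1 < c2" | "c2 < c1" by linarith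
  then show False
  proof cases
   case 1 then show False using young_row[OF yB, of k2 r2 c2 c1] eq posA nA A' B' AB by auto
  next
   case 2 then show False using young_row[OF yA, of k1 r1 c1 c2] eq posB nB A' B' AB by auto
  qed
 qed
 show tot: "nlt ?B ?A \<longleftrightarrow> \<not> nlt ?A ?B" using row unfolding A' B' nlt_def by auto
 have shape: "shape_upto \<nu> (tb \<nu> u) m = (\<lambda>k r. card {c. (k, r, c) \<in> set (take m u)})"
  if u: "stdl l u" "set u = diagram \<nu>" for u m
 proof -
  have "(k, r, c) \<in> diagram \<nu> \<and> tb \<nu> u (k, r, c) \<le> m \<longleftrightarrow> (k, r, c) \<in> set (take m u)" for k r c
  proof
   assume a: "(k, r, c) \<in> diagram \<nu> \<and> tb \<nu> u (k, r, c) \<le> m"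
   then obtain i where i: "i < length u" "(k, r, c) = u ! i" using u(2) by (metis in_set_conv_nth)
   then have "i < m" using a tb_nth[OF u i(1)] by simp
   then show "(k, r, c) \<in> set (take m u)" using i nth_mem[of i "take m u"] by simp
  next
   assume a: "(k, r, c) \<in> set (take m u)"
   then obtain i where i: "i < m" "i < length u" "(k, r, c) = u ! i" by (auto simp: in_set_conv_nth)
   then show "(k, r, c) \<in> diagram \<nu> \<and> tb \<nu> u (k, r, c) \<le> m"
    using tb_nth[OF u i(2)] nth_mem[OF i(2)] u(2) by simp
  qed
  then show ?thesis by (simp add: shape_upto_def)
 qed
 let ?f = "\<lambda>m u k s. card {A \<in> set (take m u). \<not> nlt (k, s, 0) A}"
 have dom: "dominates l (shape_upto \<nu> (tb \<nu> u) m) (shape_upto \<nu> (tb \<nu> u') m)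
   \<longleftrightarrow> (\<forall>k\<in>{1..l}. \<forall>s. ?f m u' k s \<le> ?f m u k s)"
  if u: "stdl l u" "set u = diagram \<nu>" and u': "stdl l u'" "set u' = diagram \<nu>" for u u' m
 proof -
  have pos: "\<And>k r c. (k, r, c) \<in> set (take m x) \<Longrightarrow> 1 \<le> k \<and> 1 \<le> r" if "stdl l x" for x
   using young_pos[OF stdl_young[OF stdl_take[OF that]]] by blast
  show ?thesis unfolding dominates_def shape[OF u] shape[OF u']
   using dominates_card[OF _ pos[OF u(1)]] dominates_card[OF _ pos[OF u'(1)]] by simp
 qed
 have sw: "set (sw p s) = diagram \<nu>" using s by simp
 have other: "set (take m (sw p s)) = set (take m s)" if "m \<noteq> Suc p" for m
 proof (cases "m \<le> p")
  case True then show ?thesis by (simp add: take_sw_low)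
 next
  case False
  then have "Suc p < m" using that by simp
  then show ?thesis using s(3) by (simp add: take_sw)
 qed
 have tA: "set (take (Suc p) s) = insert ?A ?X" and tB: "set (take (Suc p) (sw p s)) = insert ?B ?X"
  using s(3) by (simp_all add: take_Suc_conv_app_nth nth_sw take_sw_low)
 have cnt: "card {A' \<in> insert A0 ?X. \<not> nlt (k, s, 0) A'}
   = card {A' \<in> ?X. \<not> nlt (k, s, 0) A'} + (if nlt (k, s, 0) A0 then 0 else 1)" if "A0 \<notin> ?X" for A0 k s
 proof -
  have "{A' \<in> insert A0 ?X. \<not> nlt (k, s, 0) A'} = (if nlt (k, s, 0) A0 then {A' \<in> ?X. \<not> nlt (k, s, 0) A'}
   else insert A0 {A' \<in> ?X. \<not> nlt (k, s, 0) A'})" by auto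
  then show ?thesis using that by simp
 qed
 have neq: "tb \<nu> (sw p s) \<noteq> tb \<nu> s"
 proof
  assume "tb \<nu> (sw p s) = tb \<nu> s"
  then have "sw p s = s" using tb_inject[OF s' sw s(1,2)] by simp
  then have "sw p s ! p = s ! p" by simp
  then show False using AB s(3) by (simp add: nth_sw)
 qed
 have "tab_strictly_dominates l \<nu> (tb \<nu> (sw p s)) (tb \<nu> s)
   \<longleftrightarrow> (\<forall>m. \<forall>k\<in>{1..l}. \<forall>x. ?f m s k x \<le> ?f m (sw p s) k x)"
  unfolding tab_strictly_dominates_def dom[OF s' sw s(1,2)] using neq by simp
 also have "\<dots> \<longleftrightarrow> (\<forall>k\<in>{1..l}. \<forall>x. ?f (Suc p) s k x \<le> ?f (Suc p) (sw p s) k x)"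
 proof (intro iffI allI ballI)
  fix m k x assume "\<forall>k\<in>{1..l}. \<forall>x. ?f (Suc p) s k x \<le> ?f (Suc p) (sw p s) k x" "k \<in> {1..l}"
  then show "?f m s k x \<le> ?f m (sw p s) k x" using other[of m] by (cases "m = Suc p") simp_all
 qed simp
 also have "\<dots> \<longleftrightarrow> (\<forall>k\<in>{1..l}. \<forall>x. nlt (k, x, 0) ?B \<longrightarrow> nlt (k, x, 0) ?A)"
  unfolding tA tB cnt[OF nA] cnt[OF nB] by auto
 also have "\<dots> \<longleftrightarrow> nlt ?B ?A"
 proof
  assume "\<forall>k\<in>{1..l}. \<forall>x. nlt (k, x, 0) ?B \<longrightarrow> nlt (k, x, 0) ?A"
  \<comment> \<open>Take \<open>k\<close> and \<open>x\<close> to be the component and row of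
    \<open>?A\<close>: that position is not before \<open>?A\<close>, hence not before
    \<open>?B\<close> either.\<close>
  then have "\<not> nlt ?A ?B" using posA unfolding A' B' nlt_def by auto
  then show "nlt ?B ?A" using tot by simp
 next
  assume "nlt ?B ?A"
  then show "\<forall>k\<in>{1..l}. \<forall>x. nlt (k, x, 0) ?B \<longrightarrow> nlt (k, x, 0) ?A"
   unfolding A' B' nlt_def by auto
 qed
 finally show "tab_strictly_dominates l \<nu> (tb \<nu> (sw p s)) (tb \<nu> s) \<longleftrightarrow> nlt ?B ?A" .
qed

section \<open>Base change of free algebras\<close>

definition mapL :: "('a::comm_ring_1 \<Rightarrow> 'b::comm_ring_1) \<Rightarrow> ('g word \<Rightarrow>\<^sub>0 'a) \<Rightarrow> ('g word \<Rightarrow>\<^sub>0 'b)"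
 where "mapL f x = (\<Sum>w\<in>keys x. single w (f (lookup x w)))"

context ring_map
begin

lemma lookup_mapL [simp]: "lookup (mapL f x) w = f (lookup x w)"
 by (auto simp: mapL_def lookup_sum lookup_single when_def in_keys_iff map_0)

lemma mapL_0 [simp]: "mapL f 0 = 0"
 by (simp add: mapL_def)

lemma mapL_add: "mapL f (x + y) = mapL f x + mapL f y"
 by (rule poly_mapping_eqI) (simp add: lookup_add map_add)

lemma mapL_diff: "mapL f (x - y) = mapL f x - mapL f y"
 by (rule poly_mapping_eqI) (simp add: lookup_minus map_diff)

lemma mapL_single: "mapL f (single w a) = single w (f a)"
 by (rule poly_mapping_eqI) (simp add: lookup_single when_def map_0)

lemma mapL_mult: "mapL f (x * y) = mapL f x * mapL f y"
proof (induction x rule: poly_mapping_add_induct)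
 case (single w a)
 show ?case
  by (induction y rule: poly_mapping_add_induct)
   (simp_all add: mapL_single mult_single map_mult mapL_add distrib_left)
qed (simp_all add: mapL_add distrib_right)

lemma mapL_gen [simp]: "mapL f (fgen g) = fgen g"
 by (simp add: fgen_def mapL_single map_1)

lemma mapL_fconst: "mapL f (fconst a) = fconst (f a)"
 by (simp add: fconst_def mapL_single)

lemma mapL_1 [simp]: "mapL f 1 = 1"
 using mapL_fconst[of 1] by (simp add: map_1)

lemma mapL_sum: "mapL f (sum g A) = (\<Sum>x\<in>A. mapL f (g x))"
 by (induction A rule: infinite_finite_induct) (simp_all add: mapL_add)

lemma mapL_fsubst1: "mapL f (fsubst1 P x) = fsubst1 (map_poly f P) (mapL f x)"
 by (induction P) (simp_all add: fsubst1_pCons map_pC mapL_add mapL_mult mapL_fconst)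

lemma mapL_fsubst2: "mapL f (fsubst2 P x y) = fsubst2 (map_poly (map_poly f) P) (mapL f x) (mapL f y)"
proof -
 interpret m: ring_map "map_poly f" by (rule ring_map_poly)
 show ?thesis
  by (induction P) (simp_all add: fsubst2_pCons m.map_pC mapL_add mapL_mult mapL_fsubst1)
qed

lemma mapL_fsubst3:
 "mapL f (fsubst3 P x y z) = fsubst3 (map_poly (map_poly (map_poly f)) P) (mapL f x) (mapL f y) (mapL f z)"
proof -
 interpret m: ring_map "map_poly f" by (rule ring_map_poly)
 interpret mm: ring_map "map_poly (map_poly f)" by (rule m.ring_map_poly)
 show ?thesis
  by (induction P) (simp_all add: fsubst3_pCons mm.map_pC mapL_add mapL_mult mapL_fsubst2)
qed

end

lemma swap_places_sw:
 assumes "Suc p < length i"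
 shows "swap_places (Suc p) i = sw p i"
proof -
 have "transpose p (Suc p) permutes {..<length i}" by (rule permutes_swap_id) (use assms in auto)
 then show ?thesis using assms
  by (intro nth_equalityI) (auto simp: swap_places_def permute_list_nth nth_sw transpose_def)
qed

lemma root_seqsD:
 assumes "i \<in> root_seqs \<alpha>"
 shows "set i = set_mset \<alpha>" and "length i = size \<alpha>"
proof -
 have "\<alpha> = mset i" using assms by (simp add: root_seqs_def)
 then show "set i = set_mset \<alpha>" "length i = size \<alpha>" by simp_all
qed

lemma uinv_power2: "a dvd 1 \<Longrightarrow> uinv (a ^ 2) = uinv a * uinv a"
 by (rule uinv_unique) (simp add: power2_eq_square uinv_mult mult.commute mult.left_commute)

lemma uinv_1 [simp]: "uinv 1 = 1"
 by (rule uinv_unique) simp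

sublocale klr_setup \<subseteq> content_data e n lv CC RR QQ QQ3 WW
 by (rule content_data)

section \<open>The KLR relations on V\<close>

locale klr_shape = klr_setup ty e n Q W \<rho> c r
 for ty e n and Q :: "nat \<Rightarrow> nat \<Rightarrow> 'k::idom poly poly poly" and W \<rho> c r +
 fixes \<nu> :: multipartition
 assumes \<nu>: "\<nu> \<in> multipartitions lv n"
begin

abbreviation "D \<equiv> diagram \<nu>"

lemma y_D: "young lv D" and card_D: "card D = n"
 using diagram_young[OF \<nu>] by auto

definition tabD :: "node list set"
 where "tabD = {s \<in> tabs. set s = D}"

text \<open>All orderings of the nodes, standard or not. With zero vectors at the others, the action
  formulas need no case distinction on standardness.\<close>

definition ordD :: "node list set"
 where "ordD = {s. length s = n \<and> set s = D}"

lemma tabD_ordD: "s \<in> tabD \<longleftrightarrow> s \<in> ordD \<and> stdl lv s"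
 by (auto simp: tabD_def ordD_def tabs_def)

lemma sw_ordD: "s \<in> ordD \<Longrightarrow> Suc p < n \<Longrightarrow> sw p s \<in> ordD"
 by (auto simp: ordD_def)

lemma finite_tabD: "finite tabD"
 using finite_tabs by (simp add: tabD_def)

lemma tb_image: "tb \<nu> ` tabD = Std n \<nu>"
proof
 show "tb \<nu> ` tabD \<subseteq> Std n \<nu>" using tb_Std[of lv _ \<nu> n] by (auto simp: tabD_def tabs_def)
 show "Std n \<nu> \<subseteq> tb \<nu> ` tabD"
 proof
  fix t assume "t \<in> Std n \<nu>"
  note L = Std_ls[OF y_D this]
  have "ls n \<nu> t \<in> tabD" using L by (simp add: tabD_def tabs_def)
  then show "t \<in> tb \<nu> ` tabD" using L(4)[symmetric] by (rule rev_image_eqI)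
 qed
qed

lemma tb_inj: "inj_on (tb \<nu>) tabD"
 by (rule inj_onI) (auto simp: tabD_def tabs_def intro: tb_inject)

text \<open>The coefficient \<open>beta_m\<close>, which depends only on the two nodes exchanged. It
  is set to 0 for adjacent nodes in either order, so that passing between standard and nonstandard
  orderings contributes nothing.\<close>

definition bb :: "node \<Rightarrow> node \<Rightarrow> 'k fract laurent"
 where "bb A B = (if adj A B \<or> adj B A then 0 else if nlt B A then 1 else Qc (cont B) (cont A))"

definition vv :: "node list \<Rightarrow> tableau \<Rightarrow>\<^sub>0 'k fract laurent"
 where "vv s = (if s \<in> tabD then single (tb \<nu> s) 1 else 0)"

text \<open>Generators out of range act by 0, in accordance with their vanishing in the quotient of
  the full free algebra.\<close>

definition opv :: "klr_gen \<Rightarrow> tableau \<Rightarrow> tableau \<Rightarrow>\<^sub>0 'k fract laurent"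
 where "opv g t = (if t \<notin> Std n \<nu> then 0 else case g of
   E is \<Rightarrow> if is = residue_seq n r \<nu> t then single t 1 else 0
  | Y m \<Rightarrow> if m \<in> {1..n} then single t (to_laurent (on_content c \<nu> t m)) else 0
  | Psi m \<Rightarrow> if m \<in> {1..<n} then
    (if swap_entries \<nu> m t \<in> Std n \<nu>
     then single (swap_entries \<nu> m t) (beta_coeff lv Q c r \<nu> t m) else 0)
    + single t (content_quotient 1 c r \<nu> t m) else 0)"

abbreviation "actV \<equiv> act opv"

lemma actV_vv:
 assumes "s \<in> tabD"
 shows "actV (fgen g) (vv s) = opv g (tb \<nu> s)"
 using assms by (simp add: act_gen vv_def scal_1)

lemma tabD_props:
 assumes "s \<in> tabD"
 shows "stdl lv s" "set s = D" "length s = n" "s \<in> tabs" "tb \<nu> s \<in> Std n \<nu>"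
 using assms tb_image by (auto simp: tabD_def tabs_def)

lemma on_content_C:
 assumes "s \<in> tabD" and "m < n"
 shows "to_laurent (on_content c \<nu> (tb \<nu> s) (Suc m)) = CC (cont (s ! m))"
  and "on_content r \<nu> (tb \<nu> s) (Suc m) = RR (cont (s ! m))"
 using on_content_tb[OF tabD_props(1,2)[OF assms(1)], of m c]
  on_content_tb[OF tabD_props(1,2)[OF assms(1)], of m r] tabD_props(3)[OF assms(1)] assms(2)
 by (simp_all add: CC_def RR_def)

lemma residue_seq_tb:
 assumes "s \<in> tabD"
 shows "residue_seq n r \<nu> (tb \<nu> s) = rs s"
proof (rule nth_equalityI)
 fix i assume "i < length (residue_seq n r \<nu> (tb \<nu> s))"
 then show "residue_seq n r \<nu> (tb \<nu> s) ! i = rs s ! i"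
  using on_content_C(2)[OF assms] tabD_props(3)[OF assms] by (simp add: residue_seq_def rs_def del: upt_Suc)
qed (simp add: residue_seq_def rs_def tabD_props(3)[OF assms] del: upt_Suc)

lemma content_quotient_tb:
 assumes s: "s \<in> tabD" and p: "Suc p < n"
 shows "content_quotient 1 c r \<nu> (tb \<nu> s) (Suc p) = dd (cont (s ! p)) (cont (s ! Suc p))"
  and "content_quotient 2 c r \<nu> (tb \<nu> s) (Suc p)
   = dd (cont (s ! p)) (cont (s ! Suc p)) * dd (cont (s ! p)) (cont (s ! Suc p))"
proof -
 have u: "RR (cont (s ! p)) = RR (cont (s ! Suc p)) \<Longrightarrow> CC (cont (s ! Suc p)) - CC (cont (s ! p)) dvd 1"
  using C_unit'[of "cont (s ! Suc p)" "cont (s ! p)"] tabs_okc[OF tabD_props(4)[OF s]] p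
   stdl_cont_neq(1)[OF tabD_props(1)[OF s], of p] tabD_props(3)[OF s] by auto
 show "content_quotient 1 c r \<nu> (tb \<nu> s) (Suc p) = dd (cont (s ! p)) (cont (s ! Suc p))"
  "content_quotient 2 c r \<nu> (tb \<nu> s) (Suc p)
   = dd (cont (s ! p)) (cont (s ! Suc p)) * dd (cont (s ! p)) (cont (s ! Suc p))"
  using on_content_C[OF s, of p] on_content_C[OF s, of "Suc p"] p u
  by (auto simp: content_quotient_def dd_def laurent_inverse_uinv uinv_power2)
qed

lemma Q_coeff_tb:
 assumes s: "s \<in> tabD" and p: "Suc p < n"
 shows "Q_coeff Q c r \<nu> (tb \<nu> s) (Suc p) = Qc (cont (s ! p)) (cont (s ! Suc p))"
proof -
 have "on_content c \<nu> (tb \<nu> s) (Suc m) = c (fst (cont (s ! m))) (snd (cont (s ! m)))" if "m < n" for m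
  using on_content_tb[OF tabD_props(1,2)[OF s], of m c] tabD_props(3)[OF s] that by simp
 then show ?thesis
  unfolding Q_coeff_def Qc_def QQ_poly2 content_quotient_tb(2)[OF s p]
  using on_content_C(2)[OF s, of p] on_content_C(2)[OF s, of "Suc p"] p by (simp add: poly2_def)
qed

lemma beta_tb:
 assumes s: "s \<in> tabD" and p: "Suc p < n" and st: "stdl lv (sw p s)"
 shows "beta_coeff lv Q c r \<nu> (tb \<nu> s) (Suc p) = bb (s ! p) (s ! Suc p)"
proof -
 note P = tabD_props[OF s]
 have swD: "sw p s \<in> tabD" using s st sw_ordD[OF _ p] by (simp add: tabD_ordD)
 have "\<not> adj (s ! p) (s ! Suc p)" using stdl_sw_iff[OF P(1)] st p P(3) by simp
 moreover have "\<not> adj (s ! Suc p) (s ! p)" using stdl_order[OF P(1), of "Suc p" p] p P(3) by auto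
 moreover have "swap_entries \<nu> (Suc p) (tb \<nu> s) = tb \<nu> (sw p s)"
  using swap_entries_tb[OF P(1,2)] p P(3) by simp
 ultimately show ?thesis
  using tab_dominates_swap(1)[OF P(1,2) _ st] Q_coeff_tb[OF swD p] p P(3)
  by (simp add: beta_coeff_def bb_def nth_sw)
qed

lemma E_vv:
 assumes "s \<in> ordD"
 shows "actV (ee i) (vv s) = (if i = rs s then vv s else 0)"
proof (cases "s \<in> tabD")
 case True
 then show ?thesis
  using tabD_props[OF True] residue_seq_tb[OF True] by (simp add: actV_vv opv_def) (simp add: vv_def True)
qed (simp add: vv_def)

lemma Y_vv:
 assumes "m < n"
 shows "actV (yy m) (vv s) = scal (CC (cont (s ! m))) (vv s)"
proof (cases "s \<in> tabD")
 case True
 then show ?thesis using tabD_props[OF True] on_content_C(1)[OF True assms] assms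
  by (simp add: actV_vv opv_def) (simp add: vv_def True scal_single)
qed (simp add: vv_def scal_0_right)

text \<open>If exactly one of \<open>s\<close> and its swap is standard, the exchanged nodes are
  adjacent and \<open>bb\<close> is 0; this is why the formula is also true at nonstandard
  orderings.\<close>

lemma Psi_vv:
 assumes s: "s \<in> ordD" and p: "Suc p < n"
 shows "actV (ps p) (vv s) = scal (bb (s ! p) (s ! Suc p)) (vv (sw p s))
  + scal (dd (cont (s ! p)) (cont (s ! Suc p))) (vv s)"
proof -
 have len: "length s = n" using s by (simp add: ordD_def)
 have swD: "sw p s \<in> tabD \<longleftrightarrow> stdl lv (sw p s)" using sw_ordD[OF s p] by (simp add: tabD_ordD)
 show ?thesis
 proof (cases "s \<in> tabD")
  case True
  note P = tabD_props[OF True]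
  have sws: "swap_entries \<nu> (Suc p) (tb \<nu> s) = tb \<nu> (sw p s)"
   using swap_entries_tb[OF P(1,2)] p P(3) by simp
  have iff: "tb \<nu> (sw p s) \<in> Std n \<nu> \<longleftrightarrow> stdl lv (sw p s)"
   using tb_Std_iff[OF y_D P(1,2)] p P(3) by simp
  have "actV (ps p) (vv s) = (if stdl lv (sw p s)
    then single (tb \<nu> (sw p s)) (beta_coeff lv Q c r \<nu> (tb \<nu> s) (Suc p)) else 0)
    + single (tb \<nu> s) (dd (cont (s ! p)) (cont (s ! Suc p)))"
   using P p by (simp add: actV_vv[OF True] opv_def sws iff content_quotient_tb(1)[OF True p, simplified])
  moreover have "\<not> stdl lv (sw p s) \<Longrightarrow> bb (s ! p) (s ! Suc p) = 0"
   using stdl_sw_iff[OF P(1)] p len by (simp add: bb_def)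
  ultimately show ?thesis using beta_tb[OF True p] swD True by (auto simp: vv_def scal_single scal_0)
 next
  case False
  have "bb (s ! p) (s ! Suc p) = 0" if "sw p s \<in> tabD"
  proof -
   note P = tabD_props[OF that]
   have "\<not> stdl lv (sw p (sw p s))" using False s p len by (simp add: tabD_ordD)
   then have "adj (sw p s ! p) (sw p s ! Suc p)" using stdl_sw_iff[OF P(1), of p] p len by simp
   then show ?thesis using p len by (simp add: nth_sw bb_def)
  qed
  then show ?thesis using False by (auto simp: vv_def scal_0 scal_0_right)
 qed
qed

text \<open>Exactly one of the two directions is an ascent in dominance and has coefficient 1; the
  other carries \<open>Qc\<close>. For adjacent nodes both sides vanish.\<close>

lemma bb_mult:
 assumes s: "s \<in> tabD" and p: "Suc p < n"
 shows "bb (s ! p) (s ! Suc p) * bb (s ! Suc p) (s ! p) = Qc (cont (s ! p)) (cont (s ! Suc p))"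
proof (cases "stdl lv (sw p s)")
 case True
 note P = tabD_props[OF s]
 have "\<not> adj (s ! p) (s ! Suc p)" using stdl_sw_iff[OF P(1)] True p P(3) by simp
 moreover have "\<not> adj (s ! Suc p) (s ! p)" using stdl_order[OF P(1), of "Suc p" p] p P(3) by auto
 moreover have "Qc (cont (s ! p)) (cont (s ! Suc p)) = Qc (cont (s ! Suc p)) (cont (s ! p))"
  by (rule Qc_sym) (use tabs_okc[OF P(4)] stdl_cont_neq(1)[OF P(1), of p] p P(3) in auto)
 moreover have "nlt (s ! Suc p) (s ! p) \<longleftrightarrow> \<not> nlt (s ! p) (s ! Suc p)"
  using tab_dominates_swap(2)[OF P(1,2) _ True] p P(3) by simp
 ultimately show ?thesis by (auto simp: bb_def)
next
 case False
 note P = tabD_props[OF s]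
 have "adj (s ! p) (s ! Suc p)" using stdl_sw_iff[OF P(1)] False p P(3) by simp
 then show ?thesis using Qc_zero_stdl[OF P(1), of p] p P(3) by (simp add: bb_def)
qed

lemma sw_nth: "s \<in> ordD \<Longrightarrow> Suc p < n \<Longrightarrow> i < n \<Longrightarrow>
  sw p s ! i = (if i = p then s ! Suc p else if i = Suc p then s ! p else s ! i)"
 by (simp add: ordD_def nth_sw)

lemma eigenV:
 assumes "s \<in> ordD"
 shows "p < n \<Longrightarrow> yy p - fconst (CC (cont (s ! p))) \<in> {f. actV f (vv s) = 0}"
 using Y_vv[of p s] by (simp add: act_diff act_fconst)

lemma fsubst1_V: "s \<in> ordD \<Longrightarrow> p < n \<Longrightarrow>
  actV (fsubst1 P (yy p)) (vv s) = scal (poly P (CC (cont (s ! p)))) (vv s)"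
 using left_ideal.fsubst1_value[OF act_left_ideal eigenV, of s p] by (simp add: act_diff act_fconst)

lemma fsubst2_V: "s \<in> ordD \<Longrightarrow> p < n \<Longrightarrow> q < n \<Longrightarrow>
  actV (fsubst2 P (yy p) (yy q)) (vv s) = scal (poly2 P (CC (cont (s ! p))) (CC (cont (s ! q)))) (vv s)"
 using left_ideal.fsubst2_value[OF act_left_ideal eigenV eigenV, of s p q] by (simp add: act_diff act_fconst)

lemma fsubst3_V: "s \<in> ordD \<Longrightarrow> p < n \<Longrightarrow> q < n \<Longrightarrow> m < n \<Longrightarrow>
  actV (fsubst3 P (yy p) (yy q) (yy m)) (vv s)
   = scal (poly3 P (CC (cont (s ! p))) (CC (cont (s ! q))) (CC (cont (s ! m)))) (vv s)"
 using left_ideal.fsubst3_value[OF act_left_ideal eigenV eigenV eigenV, of s p q m]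
 by (simp add: act_diff act_fconst)

lemmas V_simps = act_mult act_diff act_add act_add_right act_scal scal_simps

definition annV :: "('k fract laurent klr_free) set"
 where "annV = {f. \<forall>s\<in>tabD. actV f (vv s) = 0}"

lemma quad_V:
 assumes s: "s \<in> tabD" and p: "Suc p < n"
 shows "actV (ps p * ps p) (vv s)
  = scal (poly2 (QQ (RR (cont (s ! p))) (RR (cont (s ! Suc p)))) (CC (cont (s ! p))) (CC (cont (s ! Suc p)))) (vv s)"
proof -
 have o: "s \<in> ordD" using s by (simp add: tabD_ordD)
 have ss: "sw p (sw p s) = s" using p o by (simp add: ordD_def)
 let ?A = "cont (s ! p)" and ?B = "cont (s ! Suc p)"
 have dsym: "dd ?B ?A = - dd ?A ?B"
  using dd_sym[of ?A ?B] tabs_okc[OF tabD_props(4)[OF s]] p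
   stdl_cont_neq(1)[OF tabD_props(1)[OF s], of p] tabD_props(3)[OF s] by simp
 have "actV (ps p * ps p) (vv s) = scal (bb (s ! p) (s ! Suc p) * bb (s ! Suc p) (s ! p) + dd ?A ?B * dd ?A ?B) (vv s)
  + scal (bb (s ! p) (s ! Suc p) * (dd ?B ?A + dd ?A ?B)) (vv (sw p s))"
  using p o by (simp add: V_simps Psi_vv sw_ordD sw_nth ss algebra_simps)
 also have "bb (s ! p) (s ! Suc p) * bb (s ! Suc p) (s ! p) + dd ?A ?B * dd ?A ?B
   = poly2 (QQ (RR ?A) (RR ?B)) (CC ?A) (CC ?B)"
  unfolding bb_mult[OF s p] by (simp add: Qc_def)
 finally show ?thesis by (simp add: dsym scal_0)
qed

text \<open>The calculation runs parallel to that for the intertwiners: partial fractions remove the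
  vectors with one swap, and the multiple of \<open>vv s\<close> that remains is the value of the
  divided difference.\<close>

lemma braid_V:
 assumes s: "s \<in> tabD" and p: "Suc (Suc p) < n"
 shows "actV (ps (Suc p) * ps p * ps (Suc p) - ps p * ps (Suc p) * ps p) (vv s)
  = scal (poly3 (QQ3 (RR (cont (s ! p))) (RR (cont (s ! Suc p))) (RR (cont (s ! Suc (Suc p)))))
    (CC (cont (s ! p))) (CC (cont (s ! Suc p))) (CC (cont (s ! Suc (Suc p))))) (vv s)"
proof -
 note P = tabD_props[OF s]
 have o: "s \<in> ordD" using s by (simp add: tabD_ordD)
 have len: "length s = n" using P by simp
 let ?q = "Suc p"
 let ?A = "s ! p" and ?B = "s ! ?q" and ?C = "s ! Suc ?q"
 let ?a = "cont ?A" and ?b = "cont ?B" and ?c = "cont ?C"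
 have ok: "okc ?a" "okc ?b" "okc ?c" using tabs_okc[OF P(4)] p by auto
 have ne: "?a \<noteq> ?b" "?b \<noteq> ?c" "?a \<noteq> ?c"
  using stdl_cont_neq(1)[OF P(1), of p] stdl_cont_neq(1)[OF P(1), of ?q] stdl_cont_neq3[OF P(1), of p] p len by auto
 \<comment> \<open>The six orderings of three consecutive nodes; the longest one is reached along
   both sides of the braid relation.\<close>
 define v1 v2 v3 v4 v5 v6 where "v1 = vv s" and "v2 = vv (sw p s)" and "v3 = vv (sw ?q s)"
  and "v4 = vv (sw ?q (sw p s))" and "v5 = vv (sw p (sw ?q s))" and "v6 = vv (sw p (sw ?q (sw p s)))"
 have pq: "Suc p < n" "Suc ?q < n" "p < n" "?q < n" "Suc ?q < n" using p by auto
 note W = sw_ordD[OF _ pq(1)] sw_ordD[OF _ pq(2)]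
 have br: "sw ?q (sw p (sw ?q s)) = sw p (sw ?q (sw p s))" using sw_braid[of p s] p len by simp
 have inv: "sw p (sw p x) = x" "sw ?q (sw ?q x) = x" if "length x = n" for x using that p by auto
 have nth: "sw p x ! p = x ! ?q" "sw p x ! ?q = x ! p" "sw p x ! Suc ?q = x ! Suc ?q"
  "sw ?q x ! p = x ! p" "sw ?q x ! ?q = x ! Suc ?q" "sw ?q x ! Suc ?q = x ! ?q" if "length x = n" for x
  using that p by (auto simp: nth_sw)
 define bab bac bbc bba bcb where "bab = bb ?A ?B" and "bac = bb ?A ?C" and "bbc = bb ?B ?C"
  and "bba = bb ?B ?A" and "bcb = bb ?C ?B"
 define ab ac bc where "ab = dd ?a ?b" and "ac = dd ?a ?c" and "bc = dd ?b ?c"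
 have ds: "dd ?b ?a = - ab" "dd ?c ?b = - bc" "dd ?c ?a = - ac"
  using dd_sym[OF ok(1,2) ne(1)] dd_sym[OF ok(2,3) ne(2)] dd_sym[OF ok(1,3) ne(3)]
  by (simp_all add: ab_def bc_def ac_def)
 have p1: "actV (ps p) v1 = scal bab v2 + scal ab v1" "actV (ps ?q) v1 = scal bbc v3 + scal bc v1"
  using Psi_vv[OF o pq(1)] Psi_vv[OF o pq(2)]
  by (simp_all add: v1_def v2_def v3_def bab_def ab_def bbc_def bc_def)
 have p2: "actV (ps ?q) v2 = scal bac v4 + scal ac v2" "actV (ps p) v2 = scal bba v1 + scal (- ab) v2"
  using Psi_vv[OF W(1)[OF o] pq(2)] Psi_vv[OF W(1)[OF o] pq(1)] ds nth[OF len] inv[OF len]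
  by (simp_all add: v1_def v2_def v4_def bac_def ac_def bba_def)
 have p3: "actV (ps p) v3 = scal bac v5 + scal ac v3" "actV (ps ?q) v3 = scal bcb v1 + scal (- bc) v3"
  using Psi_vv[OF W(2)[OF o] pq(1)] Psi_vv[OF W(2)[OF o] pq(2)] ds nth[OF len] inv[OF len]
  by (simp_all add: v1_def v3_def v5_def bac_def ac_def bcb_def)
 have p4: "actV (ps p) v4 = scal bbc v6 + scal bc v4"
  using Psi_vv[OF W(2)[OF W(1)[OF o]] pq(1)] nth[of "sw p s"] nth[OF len] len
  by (simp add: v4_def v6_def bbc_def bc_def)
 have p5: "actV (ps ?q) v5 = scal bab v6 + scal ab v5"
  using Psi_vv[OF W(1)[OF W(2)[OF o]] pq(2)] nth[of "sw ?q s"] nth[OF len] len br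
  by (simp add: v5_def v6_def bab_def ab_def)
 have "actV (ps ?q * ps p * ps ?q - ps p * ps ?q * ps p) v1
  = scal (bab * (bc * ac + ac * ab - ab * bc)) v2 + scal (bbc * (ab * bc - ac * bc - ab * ac)) v3
   + scal (ac * (bbc * bcb) + bc * bc * ab - (ac * (bab * bba) + ab * ab * bc)) v1"
  by (rule poly_mapping_eqI)
   (simp add: act_mult act_diff act_add_right act_scal p1 p2 p3 p4 p5 lookup_add lookup_minus algebra_simps)
 moreover have br0: "ab * bc = ac * (ab + bc)"
  using dd_braid[OF ok ne] by (simp add: ab_def bc_def ac_def)
 have k2: "bc * ac + ac * ab - ab * bc = 0" "ab * bc - ac * bc - ab * ac = 0"
  unfolding br0 by (simp_all add: algebra_simps)
 let ?q1 = "poly2 (QQ (RR ?a) (RR ?b)) (CC ?a) (CC ?b)" and ?q2 = "poly2 (QQ (RR ?b) (RR ?c)) (CC ?b) (CC ?c)"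
 let ?q3 = "poly3 (QQ3 (RR ?a) (RR ?b) (RR ?c)) (CC ?a) (CC ?b) (CC ?c)"
 have m1: "bab * bba = ?q1 - ab * ab" and m2: "bbc * bcb = ?q2 - bc * bc"
  using bb_mult[OF s pq(1)] bb_mult[OF s pq(2)]
  by (simp_all add: Qc_def bab_def bba_def bbc_def bcb_def ab_def bc_def)
 have q3: "ac * (?q2 - ?q1) = ?q3"
 proof (cases "RR ?a = RR ?c")
  case True
  have "(CC ?a - CC ?c) * ?q3 = ?q1 - ?q2" using Q3_value[of ?a ?b ?c] ok True by (simp add: okc_def)
  then have "?q2 - ?q1 = - ((CC ?a - CC ?c) * ?q3)" by simp
  then have "ac * (?q2 - ?q1) = (ac * (CC ?c - CC ?a)) * ?q3" by (simp only:) (simp add: algebra_simps)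
  moreover have "ac * (CC ?c - CC ?a) = 1" using dd_mult[OF ok(1,3) ne(3)] True by (simp add: ac_def)
  ultimately show ?thesis by simp
 qed (simp add: Q3_diff ac_def dd_def poly3_def poly2_def)
 have "ac * (bbc * bcb) + bc * bc * ab - (ac * (bab * bba) + ab * ab * bc)
  = ac * (?q2 - ?q1) + (bc - ab) * (ab * bc - ac * (ab + bc))"
  unfolding m1 m2 by (simp add: algebra_simps)
 also have "\<dots> = ?q3" using q3 br0 by simp
 ultimately show ?thesis using k2 by (simp add: v1_def scal_0)
qed

lemma keys_opv: "keys (opv g t) \<subseteq> Std n \<nu>"
proof (cases g)
 case (Psi m)
 show ?thesis
  unfolding opv_def Psi using keys_add by (auto split: if_splits) (use keys_add in fastforce)+
qed (auto simp: opv_def)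

lemma keys_actV: "keys v \<subseteq> Std n \<nu> \<Longrightarrow> keys (actV f v) \<subseteq> Std n \<nu>"
proof (induction f rule: free_alg_induct)
 case (gen g f)
 show ?case unfolding act_gen_mult by (rule linext_keys[OF keys_opv])
next
 case (const a f)
 show ?case unfolding act_fconst_mult
  by (rule order_trans[OF keys_scal const.IH[OF const.prems]])
next
 case (add f g)
 show ?case unfolding act_add
  by (rule order_trans[OF keys_add Un_least[OF add.IH(1)[OF add.prems] add.IH(2)[OF add.prems]]])
qed simp

lemma annV_iff: "f \<in> annV \<longleftrightarrow> (\<forall>v. keys v \<subseteq> Std n \<nu> \<longrightarrow> actV f v = 0)"
proof
 assume f: "f \<in> annV"
 show "\<forall>v. keys v \<subseteq> Std n \<nu> \<longrightarrow> actV f v = 0"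
 proof (intro allI impI)
  fix v :: "tableau \<Rightarrow>\<^sub>0 'k fract laurent" assume v: "keys v \<subseteq> Std n \<nu>"
  have "actV f (single t 1) = 0" if "t \<in> keys v" for t
  proof -
   have "t \<in> tb \<nu> ` tabD" unfolding tb_image using that v by auto
   then obtain s where "t = tb \<nu> s" "s \<in> tabD" by (rule imageE)
   then show ?thesis using f by (auto simp: annV_def vv_def)
  qed
  then have "actV f v = linext (\<lambda>t. 0) v" unfolding act_linext[of opv f v] by (intro linext_cong)
  then show "actV f v = 0" by (simp add: linext_def scal_0_right)
 qed
next
 assume "\<forall>v. keys v \<subseteq> Std n \<nu> \<longrightarrow> actV f v = 0"
 then show "f \<in> annV" using tabD_props(5) by (auto simp: annV_def vv_def)
qed

lemma annV_ideal:
 shows "0 \<in> annV" and "f \<in> annV \<Longrightarrow> g \<in> annV \<Longrightarrow> f + g \<in> annV"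
  and "f \<in> annV \<Longrightarrow> h * f \<in> annV" and "f \<in> annV \<Longrightarrow> f * h \<in> annV" and "f \<in> annV \<Longrightarrow> - f \<in> annV"
 by (simp_all add: annV_iff act_add act_mult act_uminus keys_actV)

text \<open>The residues of the nodes do not depend on the tableau, so V lives in the single block
  of this multiset.\<close>

definition \<alpha>V :: "nat multiset"
 where "\<alpha>V = image_mset (\<lambda>A. RR (cont A)) (mset_set D)"

lemma mset_rs: "s \<in> tabD \<Longrightarrow> mset (rs s) = \<alpha>V"
proof -
 assume s: "s \<in> tabD"
 have "mset s = mset_set D"
  using mset_set_set[OF stdl_distinct[OF tabD_props(1)[OF s]]] tabD_props(2)[OF s] by simp
 then show ?thesis unfolding rs_def \<alpha>V_def mset_map by (simp add: image_mset.compositionality comp_def)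
qed

lemma \<alpha>V_Qplus: "\<alpha>V \<in> Qplus e n"
proof -
 obtain s where s: "s \<in> tabD" using stdl_exists[OF y_D] card_D
  by (metis (mono_tags, lifting) distinct_card mem_Collect_eq stdl_distinct tabD_def tabs_def)
 show ?thesis using rs_seqs[OF tabD_props(4)[OF s]] unfolding mset_rs[OF s, symmetric]
  by (simp add: Qplus_def seqs_def)
qed

lemma size_\<alpha>V: "size \<alpha>V = n"
 using \<alpha>V_Qplus by (simp add: Qplus_def)

lemma rs_root_seqs: "s \<in> tabD \<Longrightarrow> rs s \<in> root_seqs \<alpha>V"
 by (simp add: root_seqs_def mset_rs)

lemma rs_nth: "s \<in> tabD \<Longrightarrow> m < n \<Longrightarrow> rs s ! m = RR (cont (s ! m))"
 using tabD_props(3)[of s] by (simp add: rs_def)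

lemma fin_root_seqs: "finite (root_seqs \<alpha>V)"
proof -
 have "root_seqs \<alpha>V \<subseteq> {xs. set xs \<subseteq> set_mset \<alpha>V \<and> length xs = size \<alpha>V}" using root_seqsD by blast
 then show ?thesis by (rule finite_subset) (simp add: finite_lists_length_eq)
qed

text \<open>Every relation is tested on the vectors \<open>vv s\<close>; a right factor
  \<open>e_i\<close> limits the check to the tableaux of residue sequence \<open>i\<close>.\<close>

lemma rel_annV:
 assumes x: "x \<in> klr_rels Q W \<alpha>V"
 shows "mapL to_laurent x \<in> annV"
 unfolding annV_def
proof (intro CollectI ballI)
 interpret t: ring_map to_laurent by (rule ring_map_laurent)
 fix s assume s: "s \<in> tabD"
 note P = tabD_props[OF s]
 have o: "s \<in> ordD" using s by (simp add: tabD_ordD)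
 note E = E_vv[OF o]
 have W': "sw p s \<in> ordD" if "Suc p < n" for p using sw_ordD[OF o that] .
 have mulE: "actV (h * ee i) (vv s) = (if i = rs s then actV h (vv s) else 0)" for h i
  by (simp add: act_mult E)
 note t_simps = t.mapL_diff t.mapL_mult t.mapL_add t.mapL_sum t.mapL_fsubst1 t.mapL_fsubst2 t.mapL_fsubst3
 have dneq: "dd (cont (s ! p)) (cont (s ! Suc p)) * (CC (cont (s ! Suc p)) - CC (cont (s ! p)))
   = (if rs s ! p = rs s ! Suc p then 1 else 0)" if "Suc p < n" for p
  using dd_mult[of "cont (s ! p)" "cont (s ! Suc p)"] tabs_okc[OF P(4)] that rs_nth[OF s]
   stdl_cont_neq(1)[OF P(1), of p] P(3) by simp
 from x[unfolded klr_rels_def Let_def size_\<alpha>V] show "actV (mapL to_laurent x) (vv s) = 0"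
 proof (elim UnE)
  assume "x \<in> {fgen (E is) * fgen (E js) - (if is = js then fgen (E is) else 0) | is js.
   is \<in> root_seqs \<alpha>V \<and> js \<in> root_seqs \<alpha>V}"
  then show ?thesis by (auto simp: t_simps act_diff act_mult E)
 next
  assume "x \<in> {(\<Sum>is\<in>root_seqs \<alpha>V. fgen (E is)) - 1}"
  then show ?thesis using rs_root_seqs[OF s] fin_root_seqs
   by (simp add: t_simps act_diff act_sum E)
 next
  assume "x \<in> {fgen (Y k) * fgen (E is) - fgen (E is) * fgen (Y k) | k is. k \<in> {1..n} \<and> is \<in> root_seqs \<alpha>V}"
  then obtain k "is" where k: "x = fgen (Y k) * fgen (E is) - fgen (E is) * fgen (Y k)" "k \<in> {1..n}" by blast
  then obtain p where "k = Suc p" "p < n" by (cases k) auto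
  then show ?thesis using k by (simp add: t_simps act_diff act_mult E Y_vv act_scal scal_0_right)
 next
  assume "x \<in> {fgen (Y k) * fgen (Y m) - fgen (Y m) * fgen (Y k) | k m. k \<in> {1..n} \<and> m \<in> {1..n}}"
  then obtain k m where k: "x = fgen (Y k) * fgen (Y m) - fgen (Y m) * fgen (Y k)" "k \<in> {1..n}" "m \<in> {1..n}" by blast
  then obtain p q where "k = Suc p" "p < n" "m = Suc q" "q < n" by (cases k; cases m) auto
  then show ?thesis using k by (simp add: t_simps act_diff act_mult Y_vv act_scal scal_scal mult.commute)
 next
  assume "x \<in> {fgen (Psi k) * fgen (Y m) - fgen (Y m) * fgen (Psi k) | k m.
    k \<in> {1..<n} \<and> m \<in> {1..n} \<and> m \<noteq> k \<and> m \<noteq> k + 1}"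
  then obtain k m where k: "x = fgen (Psi k) * fgen (Y m) - fgen (Y m) * fgen (Psi k)"
   "k \<in> {1..<n}" "m \<in> {1..n}" "m \<noteq> k" "m \<noteq> k + 1" by blast
  then obtain p q where pq: "k = Suc p" "Suc p < n" "m = Suc q" "q < n" by (cases k; cases m) auto
  then have "actV (ps p) (vv s) = scal (bb (s ! p) (s ! Suc p)) (vv (sw p s))
   + scal (dd (cont (s ! p)) (cont (s ! Suc p))) (vv s)" using Psi_vv[OF o] by simp
  moreover have "sw p s ! q = s ! q" using sw_nth[OF o pq(2,4)] k pq by auto
  ultimately show ?thesis using k pq
   by (simp add: t_simps act_diff act_mult Y_vv act_scal act_add_right scal_simps mult.commute)
 next
  assume "x \<in> {fgen (Psi k) * fgen (Psi m) - fgen (Psi m) * fgen (Psi k) | k m.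
    k \<in> {1..<n} \<and> m \<in> {1..<n} \<and> 1 < \<bar>int k - int m\<bar>}"
  then obtain k m where k: "x = fgen (Psi k) * fgen (Psi m) - fgen (Psi m) * fgen (Psi k)"
   "k \<in> {1..<n}" "m \<in> {1..<n}" "1 < \<bar>int k - int m\<bar>" by blast
  then obtain p q where pq: "k = Suc p" "Suc p < n" "m = Suc q" "Suc q < n" by (cases k; cases m) auto
  have far: "Suc p < q \<or> Suc q < p" using k pq by auto
  have n1: "sw q s ! p = s ! p" "sw q s ! Suc p = s ! Suc p" "sw p s ! q = s ! q" "sw p s ! Suc q = s ! Suc q"
   using sw_nth[OF o] pq far by auto
  have c: "sw p (sw q s) = sw q (sw p s)" using sw_commute far pq P(3) by metis
  show ?thesis using Psi_vv[OF o pq(2)] Psi_vv[OF o pq(4)] Psi_vv[OF W'[OF pq(2)] pq(4)] Psi_vv[OF W'[OF pq(4)] pq(2)]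
   unfolding k(1) pq(1,3)
   by (simp add: t_simps act_diff act_mult act_scal act_add_right scal_simps n1 c algebra_simps)
 next
  assume "x \<in> {fgen (Psi k) * fgen (E is) - fgen (E (swap_places k is)) * fgen (Psi k) | k is.
    k \<in> {1..<n} \<and> is \<in> root_seqs \<alpha>V}"
  then obtain k "is" where k: "x = fgen (Psi k) * fgen (E is) - fgen (E (swap_places k is)) * fgen (Psi k)"
   "k \<in> {1..<n}" "is \<in> root_seqs \<alpha>V" by blast
  then obtain p where p: "k = Suc p" "Suc p < n" by (cases k) auto
  have li: "length is = n" using root_seqsD(2)[OF k(3)] size_\<alpha>V by simp
  have lr: "length (rs s) = n" using P(3) by (simp add: rs_def)
  have rsw: "rs (sw p s) = sw p (rs s)" using P(3) p by (simp add: rs_def map_sw)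
  have inj: "sw p is = sw p (rs s) \<longleftrightarrow> is = rs s" using li lr p(2) sw_sw by metis
  \<comment> \<open>The diagonal part of \<open>psi\<close> survives only for equal residues, and
    then the swap fixes the residue sequence.\<close>
  have same: "dd (cont (s ! p)) (cont (s ! Suc p)) \<noteq> 0 \<Longrightarrow> sw p (rs s) = rs s"
   using rs_nth[OF s, of p] rs_nth[OF s, of "Suc p"] p lr
   by (intro nth_equalityI) (auto simp: nth_sw dd_def split: if_splits)
  have "actV (ee (sw p is)) (actV (ps p) (vv s)) = (if is = rs s then actV (ps p) (vv s) else 0)"
  proof (cases "dd (cont (s ! p)) (cont (s ! Suc p)) = 0")
   case True
   then show ?thesis using E_vv[OF W'[OF p(2)], of "sw p is"] inj rsw
    by (simp add: Psi_vv[OF o p(2)] act_add_right act_scal scal_0 scal_0_right)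
  next
   case False
   then show ?thesis using E_vv[OF W'[OF p(2)], of "sw p is"] E[of "sw p is"] inj rsw same
    by (auto simp: Psi_vv[OF o p(2)] act_add_right act_scal scal_0_right)
  qed
  then show ?thesis using swap_places_sw[of p "is"] li p
   by (simp add: k(1) t_simps act_diff act_mult E)
 next
  assume "x \<in> {(fgen (Psi k) * fgen (Y (k + 1)) - fgen (Y k) * fgen (Psi k)) * fgen (E is)
    - (if entry is k = entry is (k + 1) then 1 else 0) * fgen (E is) | k is. k \<in> {1..<n} \<and> is \<in> root_seqs \<alpha>V}"
  then obtain k "is" where k: "x = (fgen (Psi k) * fgen (Y (k + 1)) - fgen (Y k) * fgen (Psi k)) * fgen (E is)
    - (if entry is k = entry is (k + 1) then 1 else 0) * fgen (E is)" "k \<in> {1..<n}" by blast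
  then obtain p where p: "k = Suc p" "Suc p < n" by (cases k) auto
  have "actV (ps p * yy (Suc p) - yy p * ps p) (vv s)
   = scal (dd (cont (s ! p)) (cont (s ! Suc p)) * (CC (cont (s ! Suc p)) - CC (cont (s ! p)))) (vv s)"
   using p sw_nth[OF o p(2), of p]
   by (simp add: act_diff act_mult Y_vv act_scal act_add_right Psi_vv[OF o p(2)] scal_simps algebra_simps)
  then show ?thesis using p dneq[OF p(2)]
   by (simp add: k(1) t_simps act_diff mulE entry_def scal_simps split: if_splits)
 next
  assume "x \<in> {(fgen (Y (k + 1)) * fgen (Psi k) - fgen (Psi k) * fgen (Y k)) * fgen (E is)
    - (if entry is k = entry is (k + 1) then 1 else 0) * fgen (E is) | k is. k \<in> {1..<n} \<and> is \<in> root_seqs \<alpha>V}"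
  then obtain k "is" where k: "x = (fgen (Y (k + 1)) * fgen (Psi k) - fgen (Psi k) * fgen (Y k)) * fgen (E is)
    - (if entry is k = entry is (k + 1) then 1 else 0) * fgen (E is)" "k \<in> {1..<n}" by blast
  then obtain p where p: "k = Suc p" "Suc p < n" by (cases k) auto
  have "actV (yy (Suc p) * ps p - ps p * yy p) (vv s)
   = scal (dd (cont (s ! p)) (cont (s ! Suc p)) * (CC (cont (s ! Suc p)) - CC (cont (s ! p)))) (vv s)"
   using p sw_nth[OF o p(2), of "Suc p"]
   by (simp add: act_diff act_mult Y_vv act_scal act_add_right Psi_vv[OF o p(2)] scal_simps algebra_simps)
  then show ?thesis using p dneq[OF p(2)]
   by (simp add: k(1) t_simps act_diff mulE entry_def scal_simps split: if_splits)
 next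
  assume "x \<in> {fgen (Psi k) * fgen (Psi k) * fgen (E is)
    - fsubst2 (Q (entry is k) (entry is (k + 1))) (fgen (Y k)) (fgen (Y (k + 1))) * fgen (E is) | k is.
    k \<in> {1..<n} \<and> is \<in> root_seqs \<alpha>V}"
  then obtain k "is" where k: "x = fgen (Psi k) * fgen (Psi k) * fgen (E is)
    - fsubst2 (Q (entry is k) (entry is (k + 1))) (fgen (Y k)) (fgen (Y (k + 1))) * fgen (E is)" "k \<in> {1..<n}" by blast
  then obtain p where p: "k = Suc p" "Suc p < n" by (cases k) auto
  show ?thesis using quad_V[OF s p(2)] fsubst2_V[OF o, of p "Suc p"] p rs_nth[OF s]
   by (simp add: k(1) t_simps act_diff mulE entry_def QQ_def del: mult.assoc)
 next
  assume "x \<in> {(fgen (Psi (k + 1)) * fgen (Psi k) * fgen (Psi (k + 1)) - fgen (Psi k) * fgen (Psi (k + 1)) * fgen (Psi k)) * fgen (E is)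
    - fsubst3 (Q3 Q (entry is k) (entry is (k + 1)) (entry is (k + 2)))
      (fgen (Y k)) (fgen (Y (k + 1))) (fgen (Y (k + 2))) * fgen (E is) | k is.
    1 \<le> k \<and> k + 1 < n \<and> is \<in> root_seqs \<alpha>V}"
  then obtain k "is" where k: "x = (fgen (Psi (k + 1)) * fgen (Psi k) * fgen (Psi (k + 1)) - fgen (Psi k) * fgen (Psi (k + 1)) * fgen (Psi k)) * fgen (E is)
    - fsubst3 (Q3 Q (entry is k) (entry is (k + 1)) (entry is (k + 2)))
      (fgen (Y k)) (fgen (Y (k + 1))) (fgen (Y (k + 2))) * fgen (E is)" "1 \<le> k" "k + 1 < n" by blast
  then obtain p where p: "k = Suc p" "Suc (Suc p) < n" by (cases k) auto
  show ?thesis using braid_V[OF s p(2)] fsubst3_V[OF o, of p "Suc p" "Suc (Suc p)"] p rs_nth[OF s]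
   by (simp add: k(1) t_simps act_diff mulE entry_def QQ3_def)
 next
  assume "x \<in> {fsubst1 (W (entry is 1)) (fgen (Y 1)) * fgen (E is) | is. 1 \<le> n \<and> is \<in> root_seqs \<alpha>V}"
  then obtain "is" where k: "x = fsubst1 (W (entry is 1)) (fgen (Y 1)) * fgen (E is)" "0 < n" by auto
  \<comment> \<open>The first node is the corner of some component \<open>m\<close>, and its content
    \<open>(m, 0)\<close> gives a root of the weight polynomial of its residue.\<close>
  have 0: "s ! 0 \<in> addable lv {}" using stdl_nth[OF P(1), of 0] k(2) P(3) by simp
  then have "cont (s ! 0) \<in> {1..lv} \<times> {0}" using addable_empty by blast
  then obtain m where m: "cont (s ! 0) = (m, 0)" "m \<in> {1..lv}" by auto
  have "poly (WW (RR (m, 0))) (CC (m, 0)) = 0"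
   unfolding WL_value[OF res_less[of "(m, 0)", simplified, OF m(2)[simplified]]] poly_prod
   by (rule prod_zero) (use m in \<open>auto intro!: bexI[of _ m]\<close>)
  then show ?thesis using fsubst1_V[OF o k(2)] m rs_nth[OF s k(2)] k(2)
   by (simp add: k(1) t_simps mulE entry_def WW_def[symmetric] scal_0)
 qed
qed

end

subsection \<open>Free algebras on a subset of the generators\<close>

text \<open>The retraction that sends all generators outside \<open>X\<close> to 0. It is a ring
  homomorphism, and through it every block becomes a quotient of one and the same free
  algebra.\<close>

definition restr :: "'g set \<Rightarrow> ('g word \<Rightarrow>\<^sub>0 'a::comm_ring_1) \<Rightarrow> ('g word \<Rightarrow>\<^sub>0 'a)"
 where "restr X f = (\<Sum>w\<in>{w\<in>keys f. set (letters w) \<subseteq> X}. single w (lookup f w))"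

lemma lookup_restr: "lookup (restr X f) w = (if set (letters w) \<subseteq> X then lookup f w else 0)"
 by (auto simp: restr_def lookup_sum lookup_single when_def in_keys_iff)

lemma restr_0 [simp]: "restr X 0 = 0"
 by (simp add: restr_def)

lemma restr_add: "restr X (f + g) = restr X f + restr X g"
 by (rule poly_mapping_eqI) (simp add: lookup_add lookup_restr)

lemma restr_diff: "restr X (f - g) = restr X f - restr X g"
 by (rule poly_mapping_eqI) (simp add: lookup_minus lookup_restr)

lemma restr_single: "restr X (single w a) = (if set (letters w) \<subseteq> X then single w a else 0)"
 by (rule poly_mapping_eqI) (auto simp: lookup_restr lookup_single when_def)

lemma restr_mult: "restr X (f * g) = restr X f * restr X g"
proof (induction f rule: poly_mapping_add_induct)
 case (single v a)
 show ?case
 proof (induction g rule: poly_mapping_add_induct)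
  case (single w b)
  then show ?case by (auto simp: mult_single restr_single plus_word_def)
 qed (simp_all add: restr_add distrib_left)
qed (simp_all add: restr_add distrib_right)

lemma restr_sum: "restr X (sum g A) = (\<Sum>x\<in>A. restr X (g x))"
 by (induction A rule: infinite_finite_induct) (simp_all add: restr_add)

lemma restr_fconst [simp]: "restr X (fconst a) = fconst a"
 by (simp add: fconst_def restr_single zero_word_def)

lemma restr_1 [simp]: "restr X 1 = 1"
 using restr_fconst[of X 1] by simp

lemma restr_gen: "restr X (fgen g) = (if g \<in> X then fgen g else 0)"
 by (simp add: fgen_def restr_single)

lemma restr_in: "restr X f \<in> carrier (free_alg X)"
 by (auto simp: free_alg_def in_keys_iff lookup_restr split: if_splits)

lemma restr_id: "f \<in> carrier (free_alg X) \<longleftrightarrow> restr X f = f"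
proof
 assume "f \<in> carrier (free_alg X)"
 then show "restr X f = f"
  by (intro poly_mapping_eqI) (auto simp: lookup_restr free_alg_def in_keys_iff)
qed (metis restr_in)

lemma free_alg_simps [simp]:
 "mult (free_alg X) = (*)" "one (free_alg X) = 1" "zero (free_alg X) = 0" "add (free_alg X) = (+)"
 "smult (free_alg X) = (\<lambda>c f. fconst c * f)"
 by (simp_all add: free_alg_def)

lemma free_alg_closed:
 shows "0 \<in> carrier (free_alg X)" and "1 \<in> carrier (free_alg X)" and "fconst a \<in> carrier (free_alg X)"
  and "f \<in> carrier (free_alg X) \<Longrightarrow> g \<in> carrier (free_alg X) \<Longrightarrow> f + g \<in> carrier (free_alg X)"
  and "f \<in> carrier (free_alg X) \<Longrightarrow> g \<in> carrier (free_alg X) \<Longrightarrow> f - g \<in> carrier (free_alg X)"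
  and "f \<in> carrier (free_alg X) \<Longrightarrow> g \<in> carrier (free_alg X) \<Longrightarrow> f * g \<in> carrier (free_alg X)"
  and "f \<in> carrier (free_alg X) \<Longrightarrow> - f \<in> carrier (free_alg X)"
  and "x \<in> X \<Longrightarrow> fgen x \<in> carrier (free_alg X)"
 using restr_diff[of X 0 f]
 by (simp_all add: restr_id restr_add restr_diff restr_mult restr_gen)

lemma free_alg_sum: "(\<And>x. x \<in> A \<Longrightarrow> g x \<in> carrier (free_alg X)) \<Longrightarrow> sum g A \<in> carrier (free_alg X)"
 by (induction A rule: infinite_finite_induct) (simp_all add: free_alg_closed)

lemma free_alg_fsubst1: "f \<in> carrier (free_alg X) \<Longrightarrow> fsubst1 P f \<in> carrier (free_alg X)"
 by (induction P) (simp_all add: fsubst1_pCons free_alg_closed)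

lemma free_alg_fsubst2:
 "f \<in> carrier (free_alg X) \<Longrightarrow> g \<in> carrier (free_alg X) \<Longrightarrow> fsubst2 P f g \<in> carrier (free_alg X)"
 by (induction P) (simp_all add: fsubst2_pCons free_alg_closed free_alg_fsubst1)

lemma free_alg_fsubst3:
 "f \<in> carrier (free_alg X) \<Longrightarrow> g \<in> carrier (free_alg X) \<Longrightarrow> h \<in> carrier (free_alg X) \<Longrightarrow>
  fsubst3 P f g h \<in> carrier (free_alg X)"
 by (induction P) (simp_all add: fsubst3_pCons free_alg_closed free_alg_fsubst2)

lemma ring_free_alg: "ring (free_alg X)"
proof (rule ringI)
 show "abelian_group (free_alg X)"
 proof (rule abelian_groupI)
  fix x assume "x \<in> carrier (free_alg X)"
  then show "\<exists>y\<in>carrier (free_alg X). y \<oplus>\<^bsub>free_alg X\<^esub> x = \<zero>\<^bsub>free_alg X\<^esub>"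
   by (intro bexI[of _ "- x"]) (simp_all add: free_alg_closed)
 qed (simp_all add: free_alg_closed add_ac)
 show "monoid (free_alg X)" by (rule monoidI) (simp_all add: free_alg_closed mult.assoc)
qed (simp_all add: distrib_left distrib_right)

subsection \<open>Cosets in additive groups that are types\<close>

definition cs :: "'a::ab_group_add set \<Rightarrow> 'a \<Rightarrow> 'a set"
 where "cs J x = {y. y - x \<in> J}"

locale add_subgroup =
 fixes J :: "'a::ab_group_add set"
 assumes S_0: "0 \<in> J" and S_add: "x \<in> J \<Longrightarrow> y \<in> J \<Longrightarrow> x + y \<in> J" and S_uminus: "x \<in> J \<Longrightarrow> - x \<in> J"
begin

lemma S_diff: "x \<in> J \<Longrightarrow> y \<in> J \<Longrightarrow> x - y \<in> J"
 using S_add[OF _ S_uminus] by fastforce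

lemma cs_eq_iff: "cs J x = cs J y \<longleftrightarrow> x - y \<in> J"
proof
 assume "cs J x = cs J y"
 moreover have "x \<in> cs J x" by (simp add: cs_def S_0)
 ultimately show "x - y \<in> J" by (simp add: cs_def)
next
 assume xy: "x - y \<in> J"
 have "z - x \<in> J \<longleftrightarrow> z - y \<in> J" for z
  using S_add[OF _ xy, of "z - x"] S_diff[OF _ xy, of "z - y"] by auto
 then show "cs J x = cs J y" by (simp add: cs_def)
qed

lemma self_cs: "x \<in> cs J x"
 by (simp add: cs_def S_0)

lemma cs_0: "cs J 0 = J"
 by (simp add: cs_def)

lemma r_coset_cs: "add A = (+) \<Longrightarrow> J +>\<^bsub>A\<^esub> x = cs J x"
proof -
 assume "add A = (+)"
 then have "J +>\<^bsub>A\<^esub> x = (\<Union>h\<in>J. {h + x})" by (simp add: a_r_coset_def r_coset_def)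
 also have "\<dots> = cs J x"
 proof (rule Set.set_eqI)
  fix y show "y \<in> (\<Union>h\<in>J. {h + x}) \<longleftrightarrow> y \<in> cs J x"
   by (auto simp: cs_def) (metis diff_add_cancel)
 qed
 finally show ?thesis .
qed

lemma set_add_cs: "add A = (+) \<Longrightarrow> cs J x <+>\<^bsub>A\<^esub> cs J y = cs J (x + y)"
proof -
 assume "add A = (+)"
 then have "cs J x <+>\<^bsub>A\<^esub> cs J y = (\<Union>a\<in>cs J x. \<Union>b\<in>cs J y. {a + b})"
  by (simp add: set_add_def set_mult_def)
 also have "\<dots> = cs J (x + y)"
 proof (rule Set.set_eqI)
  fix z
  show "z \<in> (\<Union>a\<in>cs J x. \<Union>b\<in>cs J y. {a + b}) \<longleftrightarrow> z \<in> cs J (x + y)"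
  proof
   assume "z \<in> (\<Union>a\<in>cs J x. \<Union>b\<in>cs J y. {a + b})"
   then obtain a b where "a - x \<in> J" "b - y \<in> J" "z = a + b" by (auto simp: cs_def)
   then show "z \<in> cs J (x + y)" using S_add[of "a - x" "b - y"] by (simp add: cs_def algebra_simps)
  next
   assume "z \<in> cs J (x + y)"
   then have "z - y \<in> cs J x" "y \<in> cs J y" "z = (z - y) + y"
    by (simp_all add: cs_def S_0 algebra_simps)
   then show "z \<in> (\<Union>a\<in>cs J x. \<Union>b\<in>cs J y. {a + b})" by blast
  qed
 qed
 finally show ?thesis .
qed

text \<open>The product of cosets is a union over representatives; independence of the
  representatives collapses the union to one coset.\<close>

lemma rcoset_mult_cs:
 assumes "add A = (+)" and "\<And>a b. a - x \<in> J \<Longrightarrow> b - y \<in> J \<Longrightarrow> a \<otimes>\<^bsub>A\<^esub> b - x \<otimes>\<^bsub>A\<^esub> y \<in> J"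
 shows "[mod J:] cs J x \<Otimes>\<^bsub>A\<^esub> cs J y = cs J (x \<otimes>\<^bsub>A\<^esub> y)"
proof -
 have "[mod J:] cs J x \<Otimes>\<^bsub>A\<^esub> cs J y = (\<Union>a\<in>cs J x. \<Union>b\<in>cs J y. cs J (a \<otimes>\<^bsub>A\<^esub> b))"
  by (simp add: rcoset_mult_def r_coset_cs[OF assms(1)])
 also have "\<dots> = (\<Union>a\<in>cs J x. \<Union>b\<in>cs J y. cs J (x \<otimes>\<^bsub>A\<^esub> y))"
  using assms(2) by (intro SUP_cong refl) (simp add: cs_eq_iff, simp add: cs_def)
 also have "\<dots> = cs J (x \<otimes>\<^bsub>A\<^esub> y)" using self_cs by auto
 finally show ?thesis .
qed

lemma smult_cs:
 assumes "add A = (+)" and "\<And>a. a - x \<in> J \<Longrightarrow> c \<odot>\<^bsub>A\<^esub> a - c \<odot>\<^bsub>A\<^esub> x \<in> J"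
 shows "(\<Union>a\<in>cs J x. J +>\<^bsub>A\<^esub> (c \<odot>\<^bsub>A\<^esub> a)) = cs J (c \<odot>\<^bsub>A\<^esub> x)"
proof -
 have "(\<Union>a\<in>cs J x. J +>\<^bsub>A\<^esub> (c \<odot>\<^bsub>A\<^esub> a)) = (\<Union>a\<in>cs J x. cs J (c \<odot>\<^bsub>A\<^esub> x))"
  using assms(2) by (intro SUP_cong refl) (simp add: r_coset_cs[OF assms(1)] cs_eq_iff, simp add: cs_def)
 also have "\<dots> = cs J (c \<odot>\<^bsub>A\<^esub> x)" using self_cs by auto
 finally show ?thesis .
qed

lemma quot_alg_carrier:
 assumes "add A = (+)"
 shows "carrier (quot_alg A J) = cs J ` carrier A"
 using r_coset_cs[OF assms] by (auto simp: quot_alg_def FactRing_def A_RCOSETS_def' a_r_coset_def r_coset_def)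

end

lemma quot_alg_simps:
 "mult (quot_alg A J) = rcoset_mult A J" "one (quot_alg A J) = J +>\<^bsub>A\<^esub> \<one>\<^bsub>A\<^esub>" "zero (quot_alg A J) = J"
 "add (quot_alg A J) = set_add A" "smult (quot_alg A J) = (\<lambda>c X. \<Union>x\<in>X. J +>\<^bsub>A\<^esub> (c \<odot>\<^bsub>A\<^esub> x))"
 by (simp_all add: quot_alg_def FactRing_def)

lemma klr_rels_closed:
 fixes Q :: "nat \<Rightarrow> nat \<Rightarrow> 'a::idom poly poly"
 shows "klr_rels Q W \<alpha> \<subseteq> carrier (free_alg (klr_gens \<alpha>))"
proof -
 let ?C = "carrier (free_alg (klr_gens \<alpha>)) :: (klr_gen word \<Rightarrow>\<^sub>0 'a) set"
 have e: "fgen (E i) \<in> ?C" if "i \<in> root_seqs \<alpha>" for i using that by (intro free_alg_closed) (simp add: klr_gens_def)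
 have p: "fgen (Psi k) \<in> ?C" if "k \<in> {1..<size \<alpha>}" for k using that by (intro free_alg_closed) (auto simp: klr_gens_def)
 have y: "fgen (Y k) \<in> ?C" if "k \<in> {1..size \<alpha>}" for k using that by (intro free_alg_closed) (auto simp: klr_gens_def)
 have sw: "swap_places k i \<in> root_seqs \<alpha>" if i: "i \<in> root_seqs \<alpha>" and k: "k \<in> {1..<size \<alpha>}" for i k
 proof -
  obtain m where m: "k = Suc m" "Suc m < length i" using k root_seqsD(2)[OF i] by (cases k) auto
  then show ?thesis using i swap_places_sw[of m i] by (simp add: root_seqs_def)
 qed
 show ?thesis unfolding klr_rels_def Let_def
  by (intro Un_least subsetI; clarify?)
   (auto intro!: free_alg_closed free_alg_sum free_alg_fsubst1 free_alg_fsubst2 free_alg_fsubst3 e p y sw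
    split: if_splits)
qed

section \<open>The direct sum of the blocks as an image of one free algebra\<close>

context klr_setup
begin

abbreviation "KI \<alpha> \<equiv> klr_ideal Q W \<alpha>"
abbreviation "re \<alpha> \<equiv> restr (klr_gens \<alpha>) :: ('k poly klr_free) \<Rightarrow> _"

lemma KI_ideal: "ideal (KI \<alpha>) (free_alg (klr_gens \<alpha>))"
 unfolding klr_ideal_def by (rule ring.genideal_ideal[OF ring_free_alg klr_rels_closed])

lemma KI_rels: "x \<in> klr_rels Q W \<alpha> \<Longrightarrow> x \<in> KI \<alpha>"
 unfolding klr_ideal_def using ring.genideal_self[OF ring_free_alg klr_rels_closed] by blast

lemma KI_props:
 shows KI_carrier: "x \<in> KI \<alpha> \<Longrightarrow> x \<in> carrier (free_alg (klr_gens \<alpha>))"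
  and KI_subgroup: "add_subgroup (KI \<alpha>)"
  and KI_lmult: "x \<in> KI \<alpha> \<Longrightarrow> a \<in> carrier (free_alg (klr_gens \<alpha>)) \<Longrightarrow> a * x \<in> KI \<alpha>"
  and KI_rmult: "x \<in> KI \<alpha> \<Longrightarrow> a \<in> carrier (free_alg (klr_gens \<alpha>)) \<Longrightarrow> x * a \<in> KI \<alpha>"
proof -
 interpret I: ideal "KI \<alpha>" "free_alg (klr_gens \<alpha>)" by (rule KI_ideal)
 show "x \<in> KI \<alpha> \<Longrightarrow> x \<in> carrier (free_alg (klr_gens \<alpha>))" using I.a_subset by blast
 show l: "x \<in> KI \<alpha> \<Longrightarrow> a \<in> carrier (free_alg (klr_gens \<alpha>)) \<Longrightarrow> a * x \<in> KI \<alpha>" for x a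
  using I.I_l_closed[of x a] by simp
 show "x \<in> KI \<alpha> \<Longrightarrow> a \<in> carrier (free_alg (klr_gens \<alpha>)) \<Longrightarrow> x * a \<in> KI \<alpha>"
  using I.I_r_closed[of x a] by simp
 show "add_subgroup (KI \<alpha>)"
 proof
  show "0 \<in> KI \<alpha>" using additive_subgroup.zero_closed[OF ideal.axioms(1)[OF KI_ideal]] by simp
  show "x + y \<in> KI \<alpha>" if "x \<in> KI \<alpha>" "y \<in> KI \<alpha>" for x y using additive_subgroup.a_closed[OF ideal.axioms(1)[OF KI_ideal] that] by simp
  show "- x \<in> KI \<alpha>" if "x \<in> KI \<alpha>" for x
   using l[OF that free_alg_closed(7)[OF free_alg_closed(2)]] by simp
 qed
qed

text \<open>\<open>S\<close> is taken stable inside the full free algebra, where closure is easy to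
  verify; it is intersected with the subalgebra only here.\<close>

lemma KI_minimal:
 assumes "\<And>x. x \<in> klr_rels Q W \<alpha> \<Longrightarrow> x \<in> S" and "0 \<in> S" and "\<And>x y. x \<in> S \<Longrightarrow> y \<in> S \<Longrightarrow> x + y \<in> S"
  and "\<And>x a. x \<in> S \<Longrightarrow> a * x \<in> S" and "\<And>x a. x \<in> S \<Longrightarrow> x * a \<in> S"
 shows "KI \<alpha> \<subseteq> S"
proof -
 let ?A = "free_alg (klr_gens \<alpha>) :: ('k poly, 'k poly klr_free) module"
 interpret A: ring ?A by (rule ring_free_alg)
 have "ideal (S \<inter> carrier ?A) ?A"
 proof (rule idealI[OF ring_free_alg])
  show "subgroup (S \<inter> carrier ?A) (add_monoid ?A)"
  proof (rule group.subgroupI)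
   show "group (add_monoid ?A)" using A.add.is_group .
   show "S \<inter> carrier ?A \<noteq> {}" using assms(2) free_alg_closed(1)[of "klr_gens \<alpha>"] by blast
   fix a assume a: "a \<in> S \<inter> carrier ?A"
   have "\<ominus>\<^bsub>?A\<^esub> a = - a"
    using A.minus_equality[of "- a" a] IntD2[OF a] free_alg_closed(7)[OF IntD2[OF a]] by simp
   then have "inv\<^bsub>add_monoid ?A\<^esub> a = - a" by (simp only: a_inv_def)
   moreover have "(-1) * a \<in> S" using assms(4) a by blast
   ultimately show "inv\<^bsub>add_monoid ?A\<^esub> a \<in> S \<inter> carrier ?A" using free_alg_closed(7)[OF IntD2[OF a]] by simp
  qed (use assms free_alg_closed in auto)
 qed (use assms free_alg_closed in auto)
 moreover have "klr_rels Q W \<alpha> \<subseteq> S \<inter> carrier ?A" using assms(1) klr_rels_closed by blast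
 ultimately show ?thesis unfolding klr_ideal_def using A.genideal_minimal by blast
qed

text \<open>The canonical map from the full free algebra over \<open>k[x]\<close> to the direct sum,
  block by block through \<open>restr\<close>.\<close>

definition \<kappa> :: "('k poly klr_free) \<Rightarrow> nat multiset \<Rightarrow> ('k poly klr_free) set"
 where "\<kappa> f = (\<lambda>\<alpha>\<in>Qplus e n. cs (KI \<alpha>) (re \<alpha> f))"

abbreviation "KA \<equiv> klr_alg e n Q W"

lemma KA_simps:
 "mult KA = (\<lambda>f g. \<lambda>\<alpha>\<in>Qplus e n. f \<alpha> \<otimes>\<^bsub>klr_block Q W \<alpha>\<^esub> g \<alpha>)" "one KA = (\<lambda>\<alpha>\<in>Qplus e n. \<one>\<^bsub>klr_block Q W \<alpha>\<^esub>)"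
 "zero KA = (\<lambda>\<alpha>\<in>Qplus e n. \<zero>\<^bsub>klr_block Q W \<alpha>\<^esub>)" "add KA = (\<lambda>f g. \<lambda>\<alpha>\<in>Qplus e n. f \<alpha> \<oplus>\<^bsub>klr_block Q W \<alpha>\<^esub> g \<alpha>)"
 "smult KA = (\<lambda>c f. \<lambda>\<alpha>\<in>Qplus e n. c \<odot>\<^bsub>klr_block Q W \<alpha>\<^esub> f \<alpha>)"
 "carrier KA = (\<Pi>\<^sub>E \<alpha>\<in>Qplus e n. cs (KI \<alpha>) ` carrier (free_alg (klr_gens \<alpha>)))"
proof -
 have "carrier (klr_block Q W \<alpha>) = cs (KI \<alpha>) ` carrier (free_alg (klr_gens \<alpha>))" for \<alpha>
  unfolding klr_block_def by (rule add_subgroup.quot_alg_carrier[OF KI_subgroup]) simp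
 then show "carrier KA = (\<Pi>\<^sub>E \<alpha>\<in>Qplus e n. cs (KI \<alpha>) ` carrier (free_alg (klr_gens \<alpha>)))"
  by (simp add: klr_alg_def prod_alg_def)
qed (simp_all add: klr_alg_def prod_alg_def)

lemma \<kappa>_mult: "\<kappa> (f * g) = \<kappa> f \<otimes>\<^bsub>KA\<^esub> \<kappa> g"
proof -
 have "cs (KI \<alpha>) (re \<alpha> f) \<otimes>\<^bsub>klr_block Q W \<alpha>\<^esub> cs (KI \<alpha>) (re \<alpha> g) = cs (KI \<alpha>) (re \<alpha> (f * g))" for \<alpha>
 proof -
  interpret S: add_subgroup "KI \<alpha>" by (rule KI_subgroup)
  have "a * b - re \<alpha> f * re \<alpha> g \<in> KI \<alpha>" if ab: "a - re \<alpha> f \<in> KI \<alpha>" "b - re \<alpha> g \<in> KI \<alpha>" for a b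
  proof -
   have b: "b \<in> carrier (free_alg (klr_gens \<alpha>))"
    using free_alg_closed(4)[OF KI_carrier[OF ab(2)] restr_in[of "klr_gens \<alpha>" g]] by simp
   have "(a - re \<alpha> f) * b + re \<alpha> f * (b - re \<alpha> g) \<in> KI \<alpha>"
    by (intro S.S_add KI_rmult KI_lmult ab b restr_in)
   then show ?thesis by (simp add: algebra_simps)
  qed
  then show ?thesis
   using S.rcoset_mult_cs[of "free_alg (klr_gens \<alpha>)" "re \<alpha> f" "re \<alpha> g"]
   by (simp add: klr_block_def quot_alg_simps restr_mult)
 qed
 then show ?thesis by (simp add: \<kappa>_def KA_simps restrict_def fun_eq_iff)
qed

lemma \<kappa>_add: "\<kappa> (f + g) = \<kappa> f \<oplus>\<^bsub>KA\<^esub> \<kappa> g"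
 using add_subgroup.set_add_cs[OF KI_subgroup, of "free_alg (klr_gens _)"]
 by (simp add: \<kappa>_def KA_simps restrict_def fun_eq_iff klr_block_def quot_alg_simps restr_add)

lemma \<kappa>_1: "\<kappa> 1 = \<one>\<^bsub>KA\<^esub>"
 using add_subgroup.r_coset_cs[OF KI_subgroup, of "free_alg (klr_gens _)"]
 by (simp add: \<kappa>_def KA_simps restrict_def fun_eq_iff klr_block_def quot_alg_simps)

lemma \<kappa>_0: "\<kappa> 0 = \<zero>\<^bsub>KA\<^esub>"
 using add_subgroup.cs_0[OF KI_subgroup]
 by (simp add: \<kappa>_def KA_simps restrict_def fun_eq_iff klr_block_def quot_alg_simps)

lemma \<kappa>_smult: "\<kappa> (fconst a * f) = a \<odot>\<^bsub>KA\<^esub> \<kappa> f"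
proof -
 have "a \<odot>\<^bsub>klr_block Q W \<alpha>\<^esub> cs (KI \<alpha>) (re \<alpha> f) = cs (KI \<alpha>) (re \<alpha> (fconst a * f))" for \<alpha>
 proof -
  interpret S: add_subgroup "KI \<alpha>" by (rule KI_subgroup)
  have "fconst a * x - fconst a * re \<alpha> f \<in> KI \<alpha>" if "x - re \<alpha> f \<in> KI \<alpha>" for x
   using KI_lmult[OF that free_alg_closed(3)[of a]] by (simp add: right_diff_distrib)
  then show ?thesis using S.smult_cs[of "free_alg (klr_gens \<alpha>)" "re \<alpha> f" a]
   by (simp add: klr_block_def quot_alg_simps restr_mult)
 qed
 then show ?thesis by (simp add: \<kappa>_def KA_simps restrict_def fun_eq_iff)
qed

lemma \<kappa>_eq_iff: "\<kappa> f = \<kappa> g \<longleftrightarrow> (\<forall>\<alpha>\<in>Qplus e n. re \<alpha> (f - g) \<in> KI \<alpha>)"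
 using add_subgroup.cs_eq_iff[OF KI_subgroup]
 by (auto simp: \<kappa>_def fun_eq_iff restrict_def restr_diff)

lemma \<kappa>_gen: "\<kappa> (fgen g) = klr_elt e n Q W g"
 using add_subgroup.cs_0[OF KI_subgroup] add_subgroup.r_coset_cs[OF KI_subgroup, of "free_alg (klr_gens _)"]
 by (auto simp: \<kappa>_def klr_elt_def restrict_def fun_eq_iff restr_gen klr_block_def quot_alg_simps)

lemma finite_seqs: "finite (seqs e n)"
 using finite_lists_length_eq[of "{..<e}" n] by (simp add: seqs_def)

lemma Qplus_root_seqs: "\<alpha> \<in> Qplus e n \<Longrightarrow> i \<in> root_seqs \<alpha> \<longleftrightarrow> i \<in> seqs e n \<and> mset i = \<alpha>"
 by (auto simp: Qplus_def root_seqs_def seqs_def)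

lemma finite_Qplus: "finite (Qplus e n)"
proof -
 have "\<alpha> \<in> mset ` seqs e n" if "\<alpha> \<in> Qplus e n" for \<alpha>
 proof -
  obtain i where "mset i = \<alpha>" using ex_mset by blast
  then show ?thesis using that by (auto simp: Qplus_def seqs_def)
 qed
 then show ?thesis using finite_surj[OF finite_seqs, of _ mset] by blast
qed

lemma re_ee: "\<alpha> \<in> Qplus e n \<Longrightarrow> re \<alpha> (ee i) = (if mset i = \<alpha> then ee i else 0)"
 by (auto simp: restr_gen klr_gens_def root_seqs_def)

lemma \<kappa>_carrier: "\<kappa> f \<in> carrier KA"
 using restr_in by (auto simp: \<kappa>_def KA_simps)

text \<open>Representatives of the components are glued by the block idempotents: in block
  \<open>\<alpha>\<close> the idempotents of the other blocks restrict to 0, and its own add up to 1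
  modulo the ideal.\<close>

lemma \<kappa>_surj:
 assumes "a \<in> carrier KA"
 shows "\<exists>f. a = \<kappa> f"
proof -
 have "\<exists>f. \<forall>\<alpha>\<in>Qplus e n. f \<alpha> \<in> carrier (free_alg (klr_gens \<alpha>)) \<and> a \<alpha> = cs (KI \<alpha>) (f \<alpha>)"
  using assms unfolding KA_simps by (intro bchoice) (auto simp: PiE_iff image_iff)
 then obtain f where f: "\<And>\<alpha>. \<alpha> \<in> Qplus e n \<Longrightarrow> f \<alpha> \<in> carrier (free_alg (klr_gens \<alpha>)) \<and> a \<alpha> = cs (KI \<alpha>) (f \<alpha>)"
  by blast
 let ?g = "\<Sum>\<beta>\<in>Qplus e n. f \<beta> * (\<Sum>i\<in>root_seqs \<beta>. ee i)"
 have "a = \<kappa> ?g"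
 proof
  fix \<alpha>
  show "a \<alpha> = \<kappa> ?g \<alpha>"
  proof (cases "\<alpha> \<in> Qplus e n")
   case True
   interpret S: add_subgroup "KI \<alpha>" by (rule KI_subgroup)
   have "re \<alpha> (\<Sum>i\<in>root_seqs \<beta>. ee i) = (if \<beta> = \<alpha> then \<Sum>i\<in>root_seqs \<alpha>. ee i else 0)" if "\<beta> \<in> Qplus e n" for \<beta>
    by (auto simp: restr_sum re_ee[OF True] root_seqs_def intro!: sum.neutral)
   then have "re \<alpha> ?g = (\<Sum>\<beta>\<in>Qplus e n. if \<beta> = \<alpha> then re \<alpha> (f \<alpha>) * (\<Sum>i\<in>root_seqs \<alpha>. ee i) else 0)"
    by (auto simp: restr_sum restr_mult intro!: sum.cong)
   also have "\<dots> = f \<alpha> * (\<Sum>i\<in>root_seqs \<alpha>. ee i)"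
    using True finite_Qplus iffD1[OF restr_id conjunct1[OF f[OF True]]] by simp
   finally have g: "re \<alpha> ?g = f \<alpha> * (\<Sum>i\<in>root_seqs \<alpha>. ee i)" .
   have "(\<Sum>i\<in>root_seqs \<alpha>. ee i) - 1 \<in> KI \<alpha>"
    by (rule KI_rels) (simp add: klr_rels_def Let_def)
   from KI_lmult[OF this, of "f \<alpha>"] f[OF True]
   have "re \<alpha> ?g - f \<alpha> \<in> KI \<alpha>" by (simp add: g right_diff_distrib)
   then have "cs (KI \<alpha>) (re \<alpha> ?g) = cs (KI \<alpha>) (f \<alpha>)" by (simp add: S.cs_eq_iff)
   then show ?thesis using f[OF True] True by (simp add: \<kappa>_def)
  next
   case False
   have "a \<alpha> = undefined" by (rule PiE_arb[OF assms[unfolded KA_simps] False])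
   then show ?thesis using False by (simp add: \<kappa>_def)
  qed
 qed
 then show ?thesis by blast
qed

end

section \<open>The tensor product as a quotient of a free abelian group\<close>

lemma frag_extend_add_fun: "frag_extend (\<lambda>p. b p + c p) f = frag_extend b f + frag_extend c f"
 by (simp add: frag_extend_def frag_cmul_distrib2 sum.distrib)

lemma frag_extend_diff_fun:
 fixes b c :: "'a \<Rightarrow> 'b \<Rightarrow>\<^sub>0 int"
 shows "frag_extend (\<lambda>p. b p - c p) f = frag_extend b f - frag_extend c f"
proof -
 have "frag_cmul k (x - y) = frag_cmul k x - frag_cmul k y" for k and x y :: "'b \<Rightarrow>\<^sub>0 int"
  by (rule poly_mapping_eqI) (simp add: lookup_minus right_diff_distrib)
 then show ?thesis by (simp add: frag_extend_def sum_subtractf)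
qed

context klr_setup
begin

abbreviation PA :: "('k fract laurent, ('k fract laurent \<times> (nat multiset \<Rightarrow> ('k poly klr_free) set)) \<Rightarrow>\<^sub>0 int) module"
 where "PA \<equiv> pair_alg KA"

abbreviation pr :: "'k fract laurent \<Rightarrow> _ \<Rightarrow> ('k fract laurent \<times> (nat multiset \<Rightarrow> ('k poly klr_free) set)) \<Rightarrow>\<^sub>0 int"
 where "pr l a \<equiv> single (l, a) 1"

definition Prd where "Prd f g = mult PA f g"

text \<open>Written as a twofold additive extension, the product is visibly additive in each
  argument.\<close>

lemma Prd_eq: "Prd f g = frag_extend (\<lambda>p. frag_extend (\<lambda>q. frag_of (fst p * fst q, snd p \<otimes>\<^bsub>KA\<^esub> snd q)) g) f"
proof -
 have s: "frag_cmul c (frag_of k) = single k c" for c :: int and k :: "'k fract laurent \<times> (nat multiset \<Rightarrow> ('k poly klr_free) set)"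
  by (rule poly_mapping_eqI) (simp add: lookup_single when_def)
 have "frag_cmul c (single k d) = single k (c * d)" for c d :: int and k :: "'k fract laurent \<times> (nat multiset \<Rightarrow> ('k poly klr_free) set)"
  by (rule poly_mapping_eqI) (simp add: lookup_single when_def)
 then show ?thesis by (simp add: Prd_def pair_alg_def Let_def frag_extend_def frag_cmul_sum s)
qed

lemma Prd_simps:
 shows Prd_add_left: "Prd (f + f') g = Prd f g + Prd f' g" and Prd_diff_left: "Prd (f - f') g = Prd f g - Prd f' g"
  and Prd_add_right: "Prd f (g + g') = Prd f g + Prd f g'" and Prd_diff_right: "Prd f (g - g') = Prd f g - Prd f g'"
  and Prd_0_left: "Prd 0 g = 0" and Prd_0_right: "Prd f 0 = 0"
  and Prd_pr: "Prd (pr l a) (pr l' b) = pr (l * l') (a \<otimes>\<^bsub>KA\<^esub> b)"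
 unfolding Prd_eq by (simp_all add: frag_extend_add frag_extend_diff frag_extend_add_fun frag_extend_diff_fun frag_extend_eq_0)

lemma PA_simps:
 "carrier PA = {f. \<forall>p\<in>keys f. snd p \<in> carrier KA}" "mult PA = Prd" "one PA = pr 1 \<one>\<^bsub>KA\<^esub>"
 "zero PA = 0" "add PA = (+)" "smult PA = (\<lambda>l f. Prd (pr l \<one>\<^bsub>KA\<^esub>) f)"
proof -
 show m: "mult PA = Prd" by (intro ext) (simp add: Prd_def)
 have "smult PA = (\<lambda>l f. mult PA (pr l \<one>\<^bsub>KA\<^esub>) f)" by (simp add: pair_alg_def Let_def)
 then show "smult PA = (\<lambda>l f. Prd (pr l \<one>\<^bsub>KA\<^esub>) f)" using m by simp
qed (simp_all add: pair_alg_def Let_def)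

lemma PA_closed:
 shows "pr l (\<kappa> f) \<in> carrier PA" and "0 \<in> carrier PA"
  and "x \<in> carrier PA \<Longrightarrow> y \<in> carrier PA \<Longrightarrow> x + y \<in> carrier PA"
  and "x \<in> carrier PA \<Longrightarrow> y \<in> carrier PA \<Longrightarrow> x - y \<in> carrier PA"
  and "x \<in> carrier PA \<Longrightarrow> - x \<in> carrier PA"
 using keys_add[of x y] keys_diff[of x y] by (auto simp: PA_simps \<kappa>_carrier)

lemma PA_induct [consumes 1, case_names zero pr diff]:
 assumes "x \<in> carrier PA" and "P 0" and "\<And>l f. P (pr l (\<kappa> f))" and "\<And>x y. P x \<Longrightarrow> P y \<Longrightarrow> P (x - y)"
 shows "P x"
proof (rule frag_induction[of x "UNIV \<times> carrier KA"])
 show "keys x \<subseteq> UNIV \<times> carrier KA" using assms(1) by (force simp: PA_simps)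
 show "P (frag_of y)" if "y \<in> UNIV \<times> carrier KA" for y
  using that assms(3) \<kappa>_surj by (cases y) fastforce
qed (use assms in auto)

definition TK where "TK = tensor_kernel to_laurent KA"

abbreviation "BR \<equiv> bilinear_rels to_laurent KA"

lemma BR_cases:
 assumes "h \<in> BR"
 obtains l l' f where "h = pr (l + l') (\<kappa> f) - pr l (\<kappa> f) - pr l' (\<kappa> f)"
  | l f g where "h = pr l (\<kappa> (f + g)) - pr l (\<kappa> f) - pr l (\<kappa> g)"
  | l s f where "h = pr (l * to_laurent s) (\<kappa> f) - pr l (\<kappa> (fconst s * f))"
proof -
 from assms[unfolded bilinear_rels_def Let_def] show thesis
 proof (elim UnE CollectE exE conjE)
  fix l l' a assume h: "h = pr (l + l') a - pr l a - pr l' a" and "a \<in> carrier KA"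
  then obtain f where "a = \<kappa> f" using \<kappa>_surj by blast
  then show thesis using that(1) h by simp
 next
  fix l a b assume h: "h = pr l (a \<oplus>\<^bsub>KA\<^esub> b) - pr l a - pr l b" and "a \<in> carrier KA" "b \<in> carrier KA"
  then obtain f g where "a = \<kappa> f" "b = \<kappa> g" using \<kappa>_surj by blast
  then show thesis using that(2) h by (simp add: \<kappa>_add)
 next
  fix l s a assume h: "h = pr (l * to_laurent s) a - pr l (s \<odot>\<^bsub>KA\<^esub> a)" and "a \<in> carrier KA"
  then obtain f where "a = \<kappa> f" using \<kappa>_surj by blast
  then show thesis using that(3) h by (simp add: \<kappa>_smult)
 qed
qed

lemma BR_intros:
 shows BR1: "pr (l + l') (\<kappa> f) - pr l (\<kappa> f) - pr l' (\<kappa> f) \<in> BR"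
  and BR2: "pr l (\<kappa> (f + g)) - pr l (\<kappa> f) - pr l (\<kappa> g) \<in> BR"
  and BR3: "pr (l * to_laurent s) (\<kappa> f) - pr l (\<kappa> (fconst s * f)) \<in> BR"
 unfolding bilinear_rels_def Let_def \<kappa>_add \<kappa>_smult using \<kappa>_carrier by blast+

lemma BR_carrier: "h \<in> BR \<Longrightarrow> h \<in> carrier PA"
 by (erule BR_cases) (simp_all add: PA_closed)

lemma PA_inv: "h \<in> carrier PA \<Longrightarrow> inv\<^bsub>add_monoid PA\<^esub> h = - h"
 unfolding m_inv_def
 by (rule the_equality) (auto simp: PA_simps(4,5) PA_closed intro: minus_unique[symmetric])

lemma TK_induct [consumes 1, case_names zero rel minus add]:
 assumes "x \<in> TK" and "P 0" and "\<And>h. h \<in> BR \<Longrightarrow> P h" and "\<And>h. h \<in> BR \<Longrightarrow> P (- h)"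
  and "\<And>x y. x \<in> TK \<Longrightarrow> y \<in> TK \<Longrightarrow> P x \<Longrightarrow> P y \<Longrightarrow> P (x + y)"
 shows "P x"
 using assms(1) unfolding TK_def tensor_kernel_def
proof (induction rule: generate.induct)
 case one then show ?case using assms(2) by (simp add: PA_simps)
next
 case (incl h) then show ?case by (rule assms(3))
next
 case (inv h) then show ?case using assms(4) PA_inv[OF BR_carrier] by simp
next
 case (eng x y) then show ?case using assms(5)[of x y] by (simp add: PA_simps TK_def tensor_kernel_def)
qed

lemma TK_base:
 shows TK_0: "0 \<in> TK" and TK_BR: "h \<in> BR \<Longrightarrow> h \<in> TK" and TK_BR': "h \<in> BR \<Longrightarrow> - h \<in> TK"
  and TK_add: "x \<in> TK \<Longrightarrow> y \<in> TK \<Longrightarrow> x + y \<in> TK"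
 using generate.one[of "add_monoid PA" BR] generate.incl[of h BR "add_monoid PA"]
  generate.inv[of h BR "add_monoid PA"] generate.eng[of x "add_monoid PA" BR y] PA_inv[OF BR_carrier]
 by (simp_all add: TK_def tensor_kernel_def PA_simps(4,5))

lemma TK_subgroup: "add_subgroup TK"
proof
 fix x assume "x \<in> TK"
 then show "- x \<in> TK"
 proof (induction rule: TK_induct)
  case (add x y)
  from TK_add[OF add(4,3)] show ?case by (simp add: add.commute)
 qed (simp_all add: TK_0 TK_BR TK_BR')
qed (rule TK_0, rule TK_add)

interpretation T: add_subgroup TK by (rule TK_subgroup)

lemma TK_carrier: "x \<in> TK \<Longrightarrow> x \<in> carrier PA"
 by (induction rule: TK_induct) (simp_all add: PA_closed BR_carrier)

text \<open>A bilinearity relation multiplied by a pure tensor is again a bilinearity relation; the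
  rest is additivity. This makes the subgroup an ideal.\<close>

lemma TK_lmult:
 assumes x: "x \<in> TK" and y: "y \<in> carrier PA"
 shows "Prd y x \<in> TK"
 using y
proof (induction rule: PA_induct)
 case (pr l a)
 have r: "Prd (pr l (\<kappa> a)) h \<in> TK" if "h \<in> BR" for h
  using that
 proof (rule BR_cases)
  fix l1 l2 f assume h: "h = pr (l1 + l2) (\<kappa> f) - pr l1 (\<kappa> f) - pr l2 (\<kappa> f)"
  show ?thesis unfolding h Prd_diff_right Prd_pr \<kappa>_mult[symmetric] distrib_left by (rule TK_BR[OF BR1])
 next
  fix l' f g assume h: "h = pr l' (\<kappa> (f + g)) - pr l' (\<kappa> f) - pr l' (\<kappa> g)"
  show ?thesis unfolding h Prd_diff_right Prd_pr \<kappa>_mult[symmetric] distrib_left by (rule TK_BR[OF BR2])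
 next
  fix l' s f assume h: "h = pr (l' * to_laurent s) (\<kappa> f) - pr l' (\<kappa> (fconst s * f))"
  show ?thesis unfolding h Prd_diff_right Prd_pr \<kappa>_mult[symmetric] fconst_left_commute mult.assoc[symmetric, of l]
   by (rule TK_BR[OF BR3])
 qed
 from x show ?case
 proof (induction rule: TK_induct)
  case (minus h)
  have "Prd (pr l (\<kappa> a)) (- h) = - Prd (pr l (\<kappa> a)) h"
   using Prd_diff_right[of "pr l (\<kappa> a)" 0 h] by (simp add: Prd_0_right)
  then show ?case using T.S_uminus r minus by simp
 qed (simp_all add: r Prd_simps T.S_0 T.S_add)
qed (simp_all add: Prd_simps T.S_0 T.S_diff)

lemma TK_rmult:
 assumes x: "x \<in> TK" and y: "y \<in> carrier PA"
 shows "Prd x y \<in> TK"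
 using y
proof (induction rule: PA_induct)
 case (pr l a)
 have r: "Prd h (pr l (\<kappa> a)) \<in> TK" if "h \<in> BR" for h
  using that
 proof (rule BR_cases)
  fix l1 l2 f assume h: "h = pr (l1 + l2) (\<kappa> f) - pr l1 (\<kappa> f) - pr l2 (\<kappa> f)"
  show ?thesis unfolding h Prd_diff_left Prd_pr \<kappa>_mult[symmetric] distrib_right by (rule TK_BR[OF BR1])
 next
  fix l' f g assume h: "h = pr l' (\<kappa> (f + g)) - pr l' (\<kappa> f) - pr l' (\<kappa> g)"
  show ?thesis unfolding h Prd_diff_left Prd_pr \<kappa>_mult[symmetric] distrib_right by (rule TK_BR[OF BR2])
 next
  fix l' s f assume h: "h = pr (l' * to_laurent s) (\<kappa> f) - pr l' (\<kappa> (fconst s * f))"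
  have "l' * to_laurent s * l = l' * l * to_laurent s" by (simp add: mult_ac)
  then show ?thesis unfolding h Prd_diff_left Prd_pr \<kappa>_mult[symmetric] mult.assoc[of "fconst s"]
   using TK_BR[OF BR3] by metis
 qed
 from x show ?case
 proof (induction rule: TK_induct)
  case (minus h)
  have "Prd (- h) (pr l (\<kappa> a)) = - Prd h (pr l (\<kappa> a))"
   using Prd_diff_left[of 0 h "pr l (\<kappa> a)"] by (simp add: Prd_0_left)
  then show ?case using T.S_uminus r minus by simp
 qed (simp_all add: r Prd_simps T.S_0 T.S_add)
qed (simp_all add: Prd_simps T.S_0 T.S_diff)

subsection \<open>The presentation of the scalar extension\<close>

text \<open>Each coefficient is placed in the scalar factor and each word in the algebra factor. As
  a map into the free abelian group this is not additive; it becomes additive modulo the bilinearity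
  relations.\<close>

definition Pm :: "('k fract laurent klr_free) \<Rightarrow> ('k fract laurent \<times> (nat multiset \<Rightarrow> ('k poly klr_free) set)) \<Rightarrow>\<^sub>0 int"
 where "Pm f = (\<Sum>w\<in>keys f. pr (lookup f w) (\<kappa> (single w 1)))"

definition teq (infix "\<doteq>" 50) where "x \<doteq> y \<longleftrightarrow> x - y \<in> TK"

lemma teq_refl [simp]: "x \<doteq> x"
 by (simp add: teq_def T.S_0)

lemma teq_sym: "x \<doteq> y \<Longrightarrow> y \<doteq> x"
 unfolding teq_def using T.S_uminus[of "x - y"] by simp

lemma teq_trans [trans]: "x \<doteq> y \<Longrightarrow> y \<doteq> z \<Longrightarrow> x \<doteq> z"
 unfolding teq_def using T.S_add[of "x - y" "y - z"] by simp

lemma teq_add: "x \<doteq> y \<Longrightarrow> x' \<doteq> y' \<Longrightarrow> x + x' \<doteq> y + y'"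
proof -
 assume "x \<doteq> y" "x' \<doteq> y'"
 then have "(x - y) + (x' - y') \<in> TK" unfolding teq_def by (rule T.S_add)
 also have "(x - y) + (x' - y') = x + x' - (y + y')" by simp
 finally show ?thesis by (simp add: teq_def)
qed

lemma teq_sum: "(\<And>i. i \<in> A \<Longrightarrow> g i \<doteq> h i) \<Longrightarrow> sum g A \<doteq> sum h A"
 by (induction A rule: infinite_finite_induct) (auto intro: teq_add)

lemma teq_Prd: "x \<doteq> x' \<Longrightarrow> y \<doteq> y' \<Longrightarrow> x' \<in> carrier PA \<Longrightarrow> y \<in> carrier PA \<Longrightarrow> Prd x y \<doteq> Prd x' y'"
 unfolding teq_def using T.S_add[OF TK_rmult[of "x - x'" y] TK_lmult[of "y - y'" x']]
 by (simp add: Prd_simps)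

lemma teq_pr:
 shows "pr (l + l') (\<kappa> f) \<doteq> pr l (\<kappa> f) + pr l' (\<kappa> f)"
  and "pr l (\<kappa> (f + g)) \<doteq> pr l (\<kappa> f) + pr l (\<kappa> g)"
  and "pr (l * to_laurent s) (\<kappa> f) \<doteq> pr l (\<kappa> (fconst s * f))"
  and "pr 0 (\<kappa> f) \<doteq> 0"
 using TK_BR[OF BR1[of l l' f]] TK_BR[OF BR2[of l f g]] TK_BR[OF BR3[of l s f]]
  T.S_uminus[OF TK_BR[OF BR1[of 0 0 f]]]
 by (simp_all add: teq_def algebra_simps)

lemma Pm_extend:
 assumes "finite A" and "keys f \<subseteq> A"
 shows "Pm f \<doteq> (\<Sum>w\<in>A. pr (lookup f w) (\<kappa> (single w 1)))"
proof -
 let ?g = "\<lambda>w. pr (lookup f w) (\<kappa> (single w 1))"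
 have "sum ?g A = sum ?g (keys f) + sum ?g (A - keys f)"
  using sum.subset_diff[OF assms(2,1), of ?g] by (simp add: add.commute)
 moreover have "sum ?g (A - keys f) \<doteq> (\<Sum>w\<in>A - keys f. 0)"
  by (rule teq_sum) (auto simp: in_keys_iff teq_pr(4))
 ultimately show ?thesis
  using teq_sym[OF teq_add[OF teq_refl[of "Pm f"]], of "sum ?g (A - keys f)" 0] by (simp add: Pm_def)
qed

lemma Pm_0 [simp]: "Pm 0 = 0"
 by (simp add: Pm_def)

lemma Pm_add: "Pm (f + g) \<doteq> Pm f + Pm g"
proof -
 let ?A = "keys f \<union> keys g"
 have "Pm (f + g) \<doteq> (\<Sum>w\<in>?A. pr (lookup (f + g) w) (\<kappa> (single w 1)))"
  by (rule Pm_extend) (simp_all add: keys_add)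
 also have "\<dots> \<doteq> (\<Sum>w\<in>?A. pr (lookup f w) (\<kappa> (single w 1))
   + pr (lookup g w) (\<kappa> (single w 1)))"
  by (rule teq_sum) (simp add: lookup_add teq_pr(1))
 also have "\<dots> \<doteq> Pm f + Pm g"
  unfolding sum.distrib by (intro teq_add teq_sym[OF Pm_extend]) simp_all
 finally show ?thesis .
qed

lemma Pm_carrier: "Pm f \<in> carrier PA"
proof -
 have "sum g A \<in> carrier PA" if "\<And>w. g w \<in> carrier PA" for g and A :: "klr_gen word set"
  by (induction A rule: infinite_finite_induct) (simp_all add: that PA_closed)
 then show ?thesis unfolding Pm_def using PA_closed(1) by presburger
qed

lemma Pm_single: "Pm (single w z) \<doteq> pr z (\<kappa> (single w 1))"
 using Pm_extend[of "{w}" "single w z"] by simp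

text \<open>The third bilinearity relation moves coefficients from \<open>k[x]\<close> across the
  tensor sign. Consequently every pure tensor is in the image of \<open>Pm\<close>.\<close>

lemma Pm_mapL: "Pm (fconst l * mapL to_laurent f) \<doteq> pr l (\<kappa> f)"
proof (induction f rule: poly_mapping_add_induct)
 interpret t: ring_map to_laurent by (rule ring_map_laurent)
 case zero
 have "pr l (\<kappa> 0) \<doteq> 0" using teq_pr(2)[of l 0 0] T.S_uminus by (fastforce simp: teq_def)
 then show ?case by (simp add: teq_sym)
next
 interpret t: ring_map to_laurent by (rule ring_map_laurent)
 case (single w c)
 have "Pm (single w (l * to_laurent c)) \<doteq> pr (l * to_laurent c) (\<kappa> (single w 1))"
  by (rule Pm_single)
 also have "\<dots> \<doteq> pr l (\<kappa> (fconst c * single w 1))" by (rule teq_pr(3))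
 finally show ?case by (simp add: t.mapL_single fconst_def mult_single)
next
 interpret t: ring_map to_laurent by (rule ring_map_laurent)
 case (add f g)
 have "Pm (fconst l * mapL to_laurent (f + g)) \<doteq> Pm (fconst l * mapL to_laurent f) + Pm (fconst l * mapL to_laurent g)"
  using Pm_add by (simp add: t.mapL_add distrib_left)
 also have "\<dots> \<doteq> pr l (\<kappa> f) + pr l (\<kappa> g)" by (intro teq_add add)
 also have "\<dots> \<doteq> pr l (\<kappa> (f + g))" by (rule teq_sym[OF teq_pr(2)])
 finally show ?case .
qed

lemma Pm_mult: "Pm (f * g) \<doteq> Prd (Pm f) (Pm g)"
proof (induction f rule: poly_mapping_add_induct)
 case (single v a)
 show ?case
 proof (induction g rule: poly_mapping_add_induct)
  case (single w b)
  have "Pm (single v a * single w b) \<doteq> pr (a * b) (\<kappa> (single (v + w) 1))"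
   unfolding mult_single by (rule Pm_single)
  also have "\<dots> = Prd (pr a (\<kappa> (single v 1))) (pr b (\<kappa> (single w 1)))"
   by (simp add: Prd_pr mult_single flip: \<kappa>_mult)
  finally have 1: "Pm (single v a * single w b)
   \<doteq> Prd (pr a (\<kappa> (single v 1))) (pr b (\<kappa> (single w 1)))" .
  show ?case by (rule teq_trans[OF 1]) (intro teq_Prd teq_sym[OF Pm_single] Pm_carrier PA_closed)
 next
  case (add g h)
  have "Pm (single v a * (g + h)) \<doteq> Prd (Pm (single v a)) (Pm g) + Prd (Pm (single v a)) (Pm h)"
   unfolding distrib_left by (rule teq_trans[OF Pm_add teq_add[OF add]])
  also have "\<dots> = Prd (Pm (single v a)) (Pm g + Pm h)" by (simp add: Prd_simps)
  finally have 1: "Pm (single v a * (g + h)) \<doteq> Prd (Pm (single v a)) (Pm g + Pm h)" .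
  show ?case by (rule teq_trans[OF 1]) (intro teq_Prd teq_refl teq_sym[OF Pm_add] Pm_carrier PA_closed)
 qed (simp add: Prd_simps)
next
 case (add f h)
 have "Pm ((f + h) * g) \<doteq> Prd (Pm f) (Pm g) + Prd (Pm h) (Pm g)"
  unfolding distrib_right by (rule teq_trans[OF Pm_add teq_add[OF add]])
 also have "\<dots> = Prd (Pm f + Pm h) (Pm g)" by (simp add: Prd_simps)
 finally have 1: "Pm ((f + h) * g) \<doteq> Prd (Pm f + Pm h) (Pm g)" .
 show ?case by (rule teq_trans[OF 1]) (intro teq_Prd teq_refl teq_sym[OF Pm_add] Pm_carrier PA_closed)
qed (simp add: Prd_simps)

lemma Pm_surj: "x \<in> carrier PA \<Longrightarrow> \<exists>f. x \<doteq> Pm f"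
proof (induction rule: PA_induct)
 case zero show ?case by (rule exI[of _ 0]) simp
next
 case (pr l f) show ?case using teq_sym[OF Pm_mapL] by blast
next
 case (diff x y)
 then obtain f g where fg: "x \<doteq> Pm f" "y \<doteq> Pm g" by blast
 have m: "Pm (- g) + Pm g \<doteq> 0" using teq_sym[OF Pm_add[of "- g" g]] by simp
 have "x - y - (Pm f + Pm (- g)) = (x - Pm f) - (y - Pm g) - (Pm (- g) + Pm g - 0)"
  by (simp add: algebra_simps)
 also have "\<dots> \<in> TK" by (intro T.S_diff fg[unfolded teq_def] m[unfolded teq_def])
 finally have "x - y \<doteq> Pm f + Pm (- g)" by (simp add: teq_def)
 from teq_trans[OF this teq_sym[OF Pm_add]] show ?case by blast
qed

abbreviation "RL \<equiv> klr_laurent e n Q W"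

text \<open>The surjection from the free algebra over Laurent polynomials onto the scalar extension.
  Through it the extended algebra is studied as a quotient by the kernel \<open>JJ\<close>.\<close>

definition \<Theta> :: "('k fract laurent klr_free) \<Rightarrow> 'k klr_laurent_elt"
 where "\<Theta> f = cs TK (Pm f)"

lemma RL_quot: "RL = quot_alg PA TK"
 by (simp add: klr_laurent_def tensor_alg_def TK_def)

lemma cs_teq: "cs TK x = cs TK y \<longleftrightarrow> x \<doteq> y"
 by (simp add: T.cs_eq_iff teq_def)

lemma \<Theta>_carrier: "carrier RL = range \<Theta>"
proof -
 have "carrier RL = cs TK ` carrier PA" unfolding RL_quot by (rule T.quot_alg_carrier) (simp add: PA_simps)
 also have "\<dots> = range \<Theta>"
  using Pm_surj Pm_carrier by (auto simp: \<Theta>_def image_iff cs_teq)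
 finally show ?thesis .
qed

lemma \<Theta>_add: "\<Theta> f \<oplus>\<^bsub>RL\<^esub> \<Theta> g = \<Theta> (f + g)"
 using T.set_add_cs[of PA] teq_sym[OF Pm_add] by (simp add: \<Theta>_def RL_quot quot_alg_simps PA_simps cs_teq)

lemma \<Theta>_mult: "\<Theta> f \<otimes>\<^bsub>RL\<^esub> \<Theta> g = \<Theta> (f * g)"
proof -
 have "Prd a b - Prd (Pm f) (Pm g) \<in> TK" if "a - Pm f \<in> TK" "b - Pm g \<in> TK" for a b
 proof -
  have "b \<in> carrier PA" using PA_closed(3)[OF TK_carrier[OF that(2)] Pm_carrier[of g]] by simp
  then show ?thesis using teq_Prd[of a "Pm f" b "Pm g"] that Pm_carrier by (simp add: teq_def)
 qed
 then show ?thesis using T.rcoset_mult_cs[of PA "Pm f" "Pm g"] teq_sym[OF Pm_mult]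
  by (simp add: \<Theta>_def RL_quot quot_alg_simps PA_simps(2,5) cs_teq)
qed

lemma \<Theta>_tensor: "tensor to_laurent KA l (\<kappa> f) = \<Theta> (fconst l * mapL to_laurent f)"
 using T.r_coset_cs[of PA] teq_sym[OF Pm_mapL]
 by (simp add: tensor_def \<Theta>_def TK_def[symmetric] PA_simps(5) cs_teq)

lemma mapL_1': "mapL to_laurent (1 :: 'k poly klr_free) = 1"
 and mapL_0': "mapL to_laurent (0 :: 'k poly klr_free) = 0"
 and mapL_gen': "mapL to_laurent (fgen g :: 'k poly klr_free) = fgen g"
 by (rule ring_map.mapL_1[OF ring_map_laurent], rule ring_map.mapL_0[OF ring_map_laurent], rule ring_map.mapL_gen[OF ring_map_laurent])

lemma \<Theta>_1: "\<one>\<^bsub>RL\<^esub> = \<Theta> 1"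
 using T.r_coset_cs[of PA] teq_sym[OF Pm_mapL[of 1 1]] mapL_1'
 by (simp add: RL_quot quot_alg_simps PA_simps(3,5) \<Theta>_def cs_teq flip: \<kappa>_1)

lemma \<Theta>_0: "\<zero>\<^bsub>RL\<^esub> = \<Theta> 0"
 using T.cs_0 by (simp add: RL_quot quot_alg_simps \<Theta>_def)

lemma \<Theta>_smult: "l \<odot>\<^bsub>RL\<^esub> \<Theta> f = \<Theta> (fconst l * f)"
proof -
 have 1: "Pm (fconst l) \<doteq> pr l \<one>\<^bsub>KA\<^esub>"
  using Pm_mapL[of l 1] mapL_1' by (simp flip: \<kappa>_1)
 have c: "pr l \<one>\<^bsub>KA\<^esub> \<in> carrier PA" using PA_closed(1)[of l 1] by (simp add: \<kappa>_1)
 have "Prd (pr l \<one>\<^bsub>KA\<^esub>) a - Prd (pr l \<one>\<^bsub>KA\<^esub>) (Pm f) \<in> TK" if "a - Pm f \<in> TK" for a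
  using TK_lmult[OF that c] by (simp add: Prd_simps)
 then have "l \<odot>\<^bsub>RL\<^esub> \<Theta> f = cs TK (Prd (pr l \<one>\<^bsub>KA\<^esub>) (Pm f))"
  using T.smult_cs[of PA "Pm f" l] by (simp add: \<Theta>_def RL_quot quot_alg_simps PA_simps(5,6))
 also have "Prd (pr l \<one>\<^bsub>KA\<^esub>) (Pm f) \<doteq> Pm (fconst l * f)"
  by (rule teq_trans[OF teq_Prd[OF teq_sym[OF 1] teq_refl] teq_sym[OF Pm_mult]]) (simp_all add: Pm_carrier)
 then have "cs TK (Prd (pr l \<one>\<^bsub>KA\<^esub>) (Pm f)) = \<Theta> (fconst l * f)" by (simp add: \<Theta>_def cs_teq)
 finally show ?thesis .
qed

lemma \<Theta>_gen: "klr_laurent_elt e n Q W g = \<Theta> (fgen g)"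
 using \<Theta>_tensor[of 1 "fgen g"] mapL_gen'
 by (simp add: klr_laurent_elt_def \<kappa>_gen)

definition JJ :: "('k fract laurent klr_free) set"
 where "JJ = {f. \<Theta> f = \<Theta> 0}"

lemma JJ_iff: "f \<in> JJ \<longleftrightarrow> Pm f \<in> TK"
 using cs_teq[of "Pm f" 0] by (simp add: JJ_def \<Theta>_def teq_def)

lemma \<Theta>_eq_iff: "\<Theta> f = \<Theta> g \<longleftrightarrow> f - g \<in> JJ"
proof -
 have "Pm f \<doteq> Pm (f - g) + Pm g" using Pm_add[of "f - g" g] by simp
 then have "Pm f - Pm g \<in> TK \<longleftrightarrow> Pm (f - g) \<in> TK"
  unfolding teq_def using T.S_diff T.S_add by (smt (verit) add_diff_cancel_right' diff_add_cancel diff_diff_eq2 add.commute diff_diff_eq)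
 then show ?thesis by (simp add: JJ_iff \<Theta>_def cs_teq teq_def)
qed

lemma JJ_closed:
 shows "0 \<in> JJ" and "f \<in> JJ \<Longrightarrow> g \<in> JJ \<Longrightarrow> f + g \<in> JJ"
  and "g \<in> JJ \<Longrightarrow> h * g \<in> JJ" and "f \<in> JJ \<Longrightarrow> f * h \<in> JJ"
 using \<Theta>_add[of f g] \<Theta>_add[of 0 0] \<Theta>_mult[of h g] \<Theta>_mult[of h 0] \<Theta>_mult[of f h] \<Theta>_mult[of 0 h]
 by (simp_all add: JJ_def)

text \<open>An element that vanishes in every block is killed by \<open>\<kappa>\<close>, hence also
  after extension of scalars.\<close>

lemma JJ_rel:
 assumes "\<And>\<alpha>. \<alpha> \<in> Qplus e n \<Longrightarrow> re \<alpha> x \<in> KI \<alpha>"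
 shows "mapL to_laurent x \<in> JJ"
proof -
 have k: "\<kappa> x = \<kappa> 0" using assms by (simp add: \<kappa>_eq_iff)
 have "Pm (fconst 1 * mapL to_laurent x) \<doteq> Pm (fconst 1 * mapL to_laurent 0)"
  using teq_trans[OF Pm_mapL[of 1 x, unfolded k] teq_sym[OF Pm_mapL[of 1 0]]] by simp
 then show ?thesis using mapL_0' by (simp add: JJ_iff teq_def)
qed

lemma JJ_rel_seq:
 assumes "x \<in> klr_rels Q W (mset i)" and "\<And>\<alpha>. \<alpha> \<in> Qplus e n \<Longrightarrow> \<alpha> \<noteq> mset i \<Longrightarrow> re \<alpha> x = 0"
 shows "mapL to_laurent x \<in> JJ"
proof (rule JJ_rel)
 fix \<alpha> assume a: "\<alpha> \<in> Qplus e n"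
 show "re \<alpha> x \<in> KI \<alpha>"
 proof (cases "\<alpha> = mset i")
  case True
  then show ?thesis using KI_rels[OF assms(1)] iffD1[OF restr_id KI_carrier[OF KI_rels[OF assms(1)]]] by simp
 next
  case False
  then show ?thesis using assms(2)[OF a] add_subgroup.S_0[OF KI_subgroup] by simp
 qed
qed

lemma JJ_rel_all:
 assumes "\<And>\<alpha>. \<alpha> \<in> Qplus e n \<Longrightarrow> x \<in> klr_rels Q W \<alpha>"
 shows "mapL to_laurent x \<in> JJ"
proof (rule JJ_rel)
 fix \<alpha> assume a: "\<alpha> \<in> Qplus e n"
 show "re \<alpha> x \<in> KI \<alpha>"
  using KI_rels[OF assms[OF a]] iffD1[OF restr_id KI_carrier[OF KI_rels[OF assms[OF a]]]] by simp
qed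

text \<open>A relation involving \<open>e_i\<close> is imposed in the block of \<open>i\<close>
  only, and its restriction to every other block is 0; a relation without idempotents is imposed in
  all blocks. The sum of all idempotents is treated separately.\<close>

lemma klr_quotient: "klr_quotient e n lv CC RR QQ QQ3 WW JJ"
proof -
 interpret t: ring_map to_laurent by (rule ring_map_laurent)
 note ts = t.mapL_diff t.mapL_mult t.mapL_add t.mapL_sum t.mapL_fsubst1 t.mapL_fsubst2 t.mapL_fsubst3
 have sz: "size \<alpha> = n" if "\<alpha> \<in> Qplus e n" for \<alpha> using that by (simp add: Qplus_def)
 have szi: "size (mset i) = n" "i \<in> root_seqs (mset i)" "length i = n" if "i \<in> seqs e n" for i
  using that by (auto simp: seqs_def root_seqs_def)
 have re0: "re \<alpha> (h * ee i) = 0" if "\<alpha> \<in> Qplus e n" "\<alpha> \<noteq> mset i" for \<alpha> h i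
  using that by (simp add: restr_mult re_ee)
 have rd: "(if b then 1 else 0 :: 'k poly klr_free) = fconst (if b then 1 else 0)" for b by simp
 show ?thesis
 proof unfold_locales
  show "0 \<in> JJ" "\<And>f g. f \<in> JJ \<Longrightarrow> g \<in> JJ \<Longrightarrow> f + g \<in> JJ" "\<And>g f. g \<in> JJ \<Longrightarrow> f * g \<in> JJ"
   "\<And>f g. f \<in> JJ \<Longrightarrow> f * g \<in> JJ" using JJ_closed by auto
  show "fgen x \<in> JJ" if "x \<notin> E ` seqs e n \<union> Psi ` {1..<n} \<union> Y ` {1..n}" for x
  proof -
   have "re \<alpha> (fgen x) = 0" if "\<alpha> \<in> Qplus e n" for \<alpha>
   proof -
    have "x \<notin> klr_gens \<alpha>" using \<open>x \<notin> _\<close> sz[OF that] Qplus_root_seqs[OF that] by (auto simp: klr_gens_def)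
    then show ?thesis by (simp add: restr_gen)
   qed
   then show ?thesis using JJ_rel[of "fgen x"] add_subgroup.S_0[OF KI_subgroup] by simp
  qed
  show "ee i * ee j - (if i = j then ee i else 0) \<in> JJ" if i: "i \<in> seqs e n" and j: "j \<in> seqs e n" for i j
  proof -
   let ?x = "ee i * ee j - (if i = j then ee i else 0) :: 'k poly klr_free"
   have "mapL to_laurent ?x \<in> JJ"
   proof (cases "mset i = mset j")
    case True
    have "?x \<in> klr_rels Q W (mset i)"
     unfolding klr_rels_def Let_def by (rule UnI1[OF UnI1[OF UnI1[OF UnI1[OF UnI1[OF UnI1[OF UnI1[OF UnI1[OF UnI1[OF UnI1[OF UnI1]]]]]]]]]], rule CollectI, rule exI[of _ i], rule exI[of _ j]) (simp add: szi[OF i] szi[OF j] True root_seqs_def)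
    then show ?thesis by (rule JJ_rel_seq) (auto simp: restr_diff restr_mult re_ee)
   next
    case False
    then have "re \<alpha> ?x = 0" if "\<alpha> \<in> Qplus e n" for \<alpha>
     using that by (auto simp: restr_diff restr_mult re_ee)
    then show ?thesis by (intro JJ_rel) (simp add: add_subgroup.S_0[OF KI_subgroup])
   qed
   then show ?thesis by (simp add: ts split: if_splits)
  qed
  show "(\<Sum>i\<in>seqs e n. ee i) - 1 \<in> JJ"
  proof -
   let ?x = "(\<Sum>i\<in>seqs e n. ee i) - 1 :: 'k poly klr_free"
   have "re \<alpha> ?x \<in> KI \<alpha>" if a: "\<alpha> \<in> Qplus e n" for \<alpha>
   proof -
    have "(\<Sum>i\<in>seqs e n. re \<alpha> (ee i)) = (\<Sum>i\<in>root_seqs \<alpha>. ee i)"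
     by (rule sum.mono_neutral_cong_right)
      (use finite_seqs Qplus_root_seqs[OF a] in \<open>auto simp: re_ee[OF a]\<close>)
    then have "re \<alpha> ?x = (\<Sum>i\<in>root_seqs \<alpha>. ee i) - 1" by (simp add: restr_diff restr_sum)
    also have "\<dots> \<in> KI \<alpha>" by (rule KI_rels) (simp add: klr_rels_def Let_def)
    finally show ?thesis .
   qed
   from JJ_rel[OF this] show ?thesis by (simp add: ts)
  qed
  fix p q :: nat and i :: "nat list"
  have S: "swap_places (Suc p) i = sw p i" if "Suc p < n" "i \<in> seqs e n"
   using swap_places_sw[of p i] szi[OF that(2)] that(1) by simp
  show "yy p * ee i - ee i * yy p \<in> JJ" if h: "p < n" "i \<in> seqs e n"
  proof -
   let ?x = "yy p * ee i - ee i * yy p :: 'k poly klr_free"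
   have "?x \<in> klr_rels Q W (mset i)"
    unfolding klr_rels_def Let_def szi[OF h(2)] by (rule UnI1[OF UnI1[OF UnI1[OF UnI1[OF UnI1[OF UnI1[OF UnI1[OF UnI1[OF UnI1[OF UnI2]]]]]]]]], rule CollectI, rule exI[of _ "Suc p"], rule exI[of _ i]) (use szi(2)[OF h(2)] h(1) in \<open>auto\<close>)
   then have "mapL to_laurent ?x \<in> JJ" by (rule JJ_rel_seq) (simp add: restr_diff restr_mult re_ee)
   then show ?thesis by (simp add: ts)
  qed
  show "yy p * yy q - yy q * yy p \<in> JJ" if h: "p < n" "q < n"
  proof -
   let ?x = "yy p * yy q - yy q * yy p :: 'k poly klr_free"
   have "?x \<in> klr_rels Q W \<alpha>" if "\<alpha> \<in> Qplus e n" for \<alpha>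
    unfolding klr_rels_def Let_def sz[OF that] by (rule UnI1[OF UnI1[OF UnI1[OF UnI1[OF UnI1[OF UnI1[OF UnI1[OF UnI1[OF UnI2]]]]]]]], rule CollectI, rule exI[of _ "Suc p"], rule exI[of _ "Suc q"]) (use h in \<open>auto\<close>)
   from JJ_rel_all[OF this] show ?thesis by (simp add: ts)
  qed
  show "ps p * yy q - yy q * ps p \<in> JJ" if h: "Suc p < n" "q < n" "q \<noteq> p" "q \<noteq> Suc p"
  proof -
   let ?x = "ps p * yy q - yy q * ps p :: 'k poly klr_free"
   have "?x \<in> klr_rels Q W \<alpha>" if "\<alpha> \<in> Qplus e n" for \<alpha>
    unfolding klr_rels_def Let_def sz[OF that] by (rule UnI1[OF UnI1[OF UnI1[OF UnI1[OF UnI1[OF UnI1[OF UnI1[OF UnI2]]]]]]], rule CollectI, rule exI[of _ "Suc p"], rule exI[of _ "Suc q"]) (use h in \<open>auto\<close>)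
   from JJ_rel_all[OF this] show ?thesis by (simp add: ts)
  qed
  show "ps p * ps q - ps q * ps p \<in> JJ" if h: "Suc p < n" "Suc q < n" "Suc p < q \<or> Suc q < p"
  proof -
   let ?x = "ps p * ps q - ps q * ps p :: 'k poly klr_free"
   have "?x \<in> klr_rels Q W \<alpha>" if "\<alpha> \<in> Qplus e n" for \<alpha>
    unfolding klr_rels_def Let_def sz[OF that] by (rule UnI1[OF UnI1[OF UnI1[OF UnI1[OF UnI1[OF UnI1[OF UnI2]]]]]], rule CollectI, rule exI[of _ "Suc p"], rule exI[of _ "Suc q"]) (use h in \<open>auto\<close>)
   from JJ_rel_all[OF this] show ?thesis by (simp add: ts)
  qed
  show "ps p * ee i - ee (sw p i) * ps p \<in> JJ" if h: "Suc p < n" "i \<in> seqs e n"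
  proof -
   let ?x = "ps p * ee i - ee (sw p i) * ps p :: 'k poly klr_free"
   have "?x \<in> klr_rels Q W (mset i)"
    unfolding klr_rels_def Let_def szi[OF h(2)] by (rule UnI1[OF UnI1[OF UnI1[OF UnI1[OF UnI1[OF UnI2]]]]], rule CollectI, rule exI[of _ "Suc p"], rule exI[of _ i]) (use szi(2)[OF h(2)] h(1) S[OF h] in \<open>auto\<close>)
   then have "mapL to_laurent ?x \<in> JJ"
    by (rule JJ_rel_seq) (use h szi[OF h(2)] in \<open>simp add: restr_diff restr_mult re_ee\<close>)
   then show ?thesis by (simp add: ts)
  qed
  show "(ps p * yy (Suc p) - yy p * ps p) * ee i - (if i ! p = i ! Suc p then 1 else 0) * ee i \<in> JJ"
   if h: "Suc p < n" "i \<in> seqs e n"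
  proof -
   let ?x = "(ps p * yy (Suc p) - yy p * ps p) * ee i - (if i ! p = i ! Suc p then 1 else 0) * ee i :: 'k poly klr_free"
   have "?x \<in> klr_rels Q W (mset i)"
    unfolding klr_rels_def Let_def szi[OF h(2)] by (rule UnI1[OF UnI1[OF UnI1[OF UnI1[OF UnI2]]]], rule CollectI, rule exI[of _ "Suc p"], rule exI[of _ i]) (use szi(2)[OF h(2)] h(1) in \<open>auto simp: entry_def\<close>)
   then have "mapL to_laurent ?x \<in> JJ" by (rule JJ_rel_seq) (simp only: restr_diff re0 diff_self not_False_eq_True simp_thms)
   then show ?thesis by (simp add: ts split: if_splits)
  qed
  show "(yy (Suc p) * ps p - ps p * yy p) * ee i - (if i ! p = i ! Suc p then 1 else 0) * ee i \<in> JJ"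
   if h: "Suc p < n" "i \<in> seqs e n"
  proof -
   let ?x = "(yy (Suc p) * ps p - ps p * yy p) * ee i - (if i ! p = i ! Suc p then 1 else 0) * ee i :: 'k poly klr_free"
   have "?x \<in> klr_rels Q W (mset i)"
    unfolding klr_rels_def Let_def szi[OF h(2)] by (rule UnI1[OF UnI1[OF UnI1[OF UnI2]]], rule CollectI, rule exI[of _ "Suc p"], rule exI[of _ i]) (use szi(2)[OF h(2)] h(1) in \<open>auto simp: entry_def\<close>)
   then have "mapL to_laurent ?x \<in> JJ" by (rule JJ_rel_seq) (simp only: restr_diff re0 diff_self not_False_eq_True simp_thms)
   then show ?thesis by (simp add: ts split: if_splits)
  qed
  show "ps p * ps p * ee i - fsubst2 (QQ (i ! p) (i ! Suc p)) (yy p) (yy (Suc p)) * ee i \<in> JJ"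
   if h: "Suc p < n" "i \<in> seqs e n"
  proof -
   let ?x = "ps p * ps p * ee i - fsubst2 (Q (i ! p) (i ! Suc p)) (yy p) (yy (Suc p)) * ee i :: 'k poly klr_free"
   have "?x \<in> klr_rels Q W (mset i)"
    unfolding klr_rels_def Let_def szi[OF h(2)] by (rule UnI1[OF UnI1[OF UnI2]], rule CollectI, rule exI[of _ "Suc p"], rule exI[of _ i]) (use szi(2)[OF h(2)] h(1) in \<open>auto simp: entry_def\<close>)
   then have "mapL to_laurent ?x \<in> JJ" by (rule JJ_rel_seq) (simp only: restr_diff re0 diff_self not_False_eq_True simp_thms)
   then show ?thesis by (simp add: ts QQ_def)
  qed
  show "(ps (Suc p) * ps p * ps (Suc p) - ps p * ps (Suc p) * ps p) * ee i
    - fsubst3 (QQ3 (i ! p) (i ! Suc p) (i ! Suc (Suc p))) (yy p) (yy (Suc p)) (yy (Suc (Suc p))) * ee i \<in> JJ"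
   if h: "Suc (Suc p) < n" "i \<in> seqs e n"
  proof -
   let ?x = "(ps (Suc p) * ps p * ps (Suc p) - ps p * ps (Suc p) * ps p) * ee i
    - fsubst3 (Q3 Q (i ! p) (i ! Suc p) (i ! Suc (Suc p))) (yy p) (yy (Suc p)) (yy (Suc (Suc p))) * ee i :: 'k poly klr_free"
   have "?x \<in> klr_rels Q W (mset i)"
    unfolding klr_rels_def Let_def szi[OF h(2)] by (rule UnI1[OF UnI2], rule CollectI, rule exI[of _ "Suc p"], rule exI[of _ i]) (use szi(2)[OF h(2)] h(1) in \<open>auto simp: entry_def\<close>)
   then have "mapL to_laurent ?x \<in> JJ" by (rule JJ_rel_seq) (simp only: restr_diff re0 diff_self not_False_eq_True simp_thms)
   then show ?thesis by (simp add: ts QQ3_def)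
  qed
  show "fsubst1 (WW (i ! 0)) (yy 0) * ee i \<in> JJ" if h: "0 < n" "i \<in> seqs e n"
  proof -
   let ?x = "fsubst1 (W (i ! 0)) (yy 0) * ee i :: 'k poly klr_free"
   have "?x \<in> klr_rels Q W (mset i)"
    unfolding klr_rels_def Let_def szi[OF h(2)] by (rule UnI2, rule CollectI, rule exI[of _ i]) (use szi(2)[OF h(2)] h(1) in \<open>auto simp: entry_def\<close>)
   then have "mapL to_laurent ?x \<in> JJ" by (rule JJ_rel_seq) (simp only: re0 not_False_eq_True simp_thms)
   then show ?thesis by (simp add: ts WW_def)
  qed
 qed
qed

end

sublocale klr_setup \<subseteq> klr_quotient e n lv CC RR QQ QQ3 WW JJ
 by (rule klr_quotient)

lemma ring_image:
 fixes h :: "'a::ring_1 \<Rightarrow> 'b" and R (structure)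
 assumes car: "carrier R = range h" and hom: "\<And>f g. h f \<oplus> h g = h (f + g)" "\<And>f g. h f \<otimes> h g = h (f * g)"
  and units: "\<one> = h 1" "\<zero> = h 0"
 shows ring_imageI: "ring R" and a_inv_image: "\<ominus> h f = h (- f)"
proof -
 have inv: "\<exists>y\<in>range h. y \<oplus> h g = \<zero>" for g by (rule bexI[of _ "h (- g)"]) (simp_all add: hom units)
 have ag: "abelian_group R"
  by (rule abelian_groupI) (use inv in \<open>auto simp: car hom units algebra_simps\<close>)
 have "monoid R" by (rule monoidI) (auto simp: car hom units algebra_simps)
 with ag show r: "ring R" by (intro ringI) (auto simp: car hom units algebra_simps)
 interpret ring R by (rule r)
 show "\<ominus> h f = h (- f)" by (rule minus_equality) (auto simp: car hom units)
qed

lemma finsum_eq_sum: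
 assumes "abelian_monoid M" and "add M = (+)" and "zero M = (0::'m::comm_monoid_add)" and "f \<in> A \<rightarrow> carrier M"
 shows "finsum M f A = sum f A"
 using assms(4)
proof (induction A rule: infinite_finite_induct)
 case (insert x A)
 then show ?case using abelian_monoid.finsum_insert[OF assms(1), of A x f] by (simp add: assms(2) Pi_iff)
qed (simp_all add: abelian_monoid.finsum_infinite[OF assms(1)] abelian_monoid.finsum_empty[OF assms(1)] assms(3))

section \<open>Homogeneous elements of the algebras\<close>

context klr_setup
begin

abbreviation "GR \<equiv> klr_grading ty e n Q W"
abbreviation "GL \<equiv> klr_laurent_grading ty e n Q W"

abbreviation ceq (infix "\<triangleq>" 50) where "f \<triangleq> g \<equiv> cg f g"

lemma cg_\<Theta>: "f \<triangleq> g \<longleftrightarrow> \<Theta> f = \<Theta> g"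
 by (simp add: cg_def \<Theta>_eq_iff)

lemma ring_RL: "ring RL" and a_inv_RL: "\<ominus>\<^bsub>RL\<^esub> \<Theta> f = \<Theta> (- f)"
 by (rule ring_image[OF \<Theta>_carrier \<Theta>_add \<Theta>_mult \<Theta>_1 \<Theta>_0])+

lemma KA_carrier: "carrier KA = range \<kappa>"
 using \<kappa>_surj \<kappa>_carrier by blast

lemma a_inv_KA: "\<ominus>\<^bsub>KA\<^esub> \<kappa> f = \<kappa> (- f)"
 by (rule a_inv_image[OF KA_carrier \<kappa>_add[symmetric] \<kappa>_mult[symmetric] \<kappa>_1[symmetric] \<kappa>_0[symmetric]])

lemma GL_closed:
 shows GL_0: "\<Theta> 0 \<in> GL d" and GL_1: "\<Theta> 1 \<in> GL 0"
  and GL_add: "\<Theta> f \<in> GL d \<Longrightarrow> \<Theta> g \<in> GL d \<Longrightarrow> \<Theta> (f + g) \<in> GL d"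
  and GL_mult: "\<Theta> f \<in> GL d \<Longrightarrow> \<Theta> g \<in> GL d' \<Longrightarrow> \<Theta> (f * g) \<in> GL (d + d')"
 unfolding klr_laurent_grading_def gen_grading_def mem_Collect_eq \<Theta>_0[symmetric] \<Theta>_1[symmetric]
  \<Theta>_add[symmetric] \<Theta>_mult[symmetric]
 by (fact homogeneous_elt.zero homogeneous_elt.one homogeneous_elt.add homogeneous_elt.mult)+

lemma GL_gen: "\<kappa> f \<in> GR d' \<Longrightarrow> \<Theta> (fconst (single d b) * mapL to_laurent f) \<in> GL (d + d')"
 unfolding klr_laurent_grading_def gen_grading_def mem_Collect_eq \<Theta>_tensor[symmetric]
 by (rule homogeneous_elt.gen) blast

lemma GR_gens:
 shows "\<kappa> 1 \<in> GR 0" and "\<kappa> (fgen g) \<in> GR d \<longleftrightarrow> klr_elt e n Q W g \<in> GR d"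
  and "i \<in> seqs e n \<Longrightarrow> \<kappa> (ee i) \<in> GR 0"
  and "p < n \<Longrightarrow> i \<in> seqs e n \<Longrightarrow> \<kappa> (yy p * ee i) \<in> GR (2 * symmetriser ty e (i ! p))"
  and "Suc p < n \<Longrightarrow> i \<in> seqs e n \<Longrightarrow> \<kappa> (ps p * ee i) \<in> GR (- root_form ty e (i ! p) (i ! Suc p))"
proof -
 have E: "x \<in> GR d" if "(x, d) \<in> {(p \<odot>\<^bsub>KA\<^esub> \<one>\<^bsub>KA\<^esub>, d) | p d. homogeneous_poly d p} \<union>
    {(klr_elt e n Q W (E is), 0) | is. is \<in> seqs e n} \<union>
    {(klr_elt e n Q W (Y m) \<otimes>\<^bsub>KA\<^esub> klr_elt e n Q W (E is), 2 * symmetriser ty e (entry is m)) | m is.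
     m \<in> {1..n} \<and> is \<in> seqs e n} \<union>
    {(klr_elt e n Q W (Psi k) \<otimes>\<^bsub>KA\<^esub> klr_elt e n Q W (E is), - root_form ty e (entry is k) (entry is (k + 1))) | k is.
     k \<in> {1..<n} \<and> is \<in> seqs e n}" for x d
  unfolding klr_grading_def Let_def gen_grading_def mem_Collect_eq by (rule homogeneous_elt.gen) (rule that)
 show "\<kappa> 1 \<in> GR 0" unfolding klr_grading_def Let_def gen_grading_def mem_Collect_eq \<kappa>_1 by (rule homogeneous_elt.one)
 show "\<kappa> (fgen g) \<in> GR d \<longleftrightarrow> klr_elt e n Q W g \<in> GR d" by (simp add: \<kappa>_gen)
 show "\<kappa> (ee i) \<in> GR 0" if "i \<in> seqs e n" by (rule E) (use that in \<open>auto simp: \<kappa>_gen\<close>)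
 show "\<kappa> (yy p * ee i) \<in> GR (2 * symmetriser ty e (i ! p))" if "p < n" "i \<in> seqs e n"
  by (rule E, rule UnI1, rule UnI2, rule CollectI, rule exI[of _ "Suc p"], rule exI[of _ i])
   (use that in \<open>auto simp: \<kappa>_mult \<kappa>_gen entry_def\<close>)
 show "\<kappa> (ps p * ee i) \<in> GR (- root_form ty e (i ! p) (i ! Suc p))" if "Suc p < n" "i \<in> seqs e n"
  by (rule E, rule UnI2, rule CollectI, rule exI[of _ "Suc p"], rule exI[of _ i])
   (use that in \<open>auto simp: \<kappa>_mult \<kappa>_gen entry_def\<close>)
qed

lemma GL_gens:
 shows GL_const: "\<Theta> (fconst (single d b)) \<in> GL d"
  and GL_e: "\<Theta> (ee i) \<in> GL 0"
  and GL_ye: "p < n \<Longrightarrow> i \<in> seqs e n \<Longrightarrow> \<Theta> (yy p * ee i) \<in> GL (2 * symmetriser ty e (i ! p))"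
  and GL_pe: "Suc p < n \<Longrightarrow> i \<in> seqs e n \<Longrightarrow> \<Theta> (ps p * ee i) \<in> GL (- root_form ty e (i ! p) (i ! Suc p))"
proof -
 interpret t: ring_map to_laurent by (rule ring_map_laurent)
 have c1: "fconst (single (0::int) (1::'k fract)) = (1 :: 'k fract laurent klr_free)"
  by (metis fconst_1 single_one)
 have G: "\<Theta> (mapL to_laurent f) \<in> GL d" if "\<kappa> f \<in> GR d" for f d
  using GL_gen[OF that, of 0 1] by (simp add: c1)
 show "\<Theta> (fconst (single d b)) \<in> GL d"
  using GL_gen[OF GR_gens(1), of d b] by simp
 show "\<Theta> (ee i) \<in> GL 0"
 proof (cases "i \<in> seqs e n")
  case True
  show ?thesis using G[OF GR_gens(3)[OF True]] by simp
 next
  case False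
  have "ee i \<in> JJ" by (rule rel_gen) (use False in auto)
  then have "\<Theta> (ee i) = \<Theta> 0" by (simp add: JJ_def)
  then show ?thesis using GL_0 by simp
 qed
 show "\<Theta> (yy p * ee i) \<in> GL (2 * symmetriser ty e (i ! p))" if "p < n" "i \<in> seqs e n"
  using G[OF GR_gens(4)[OF that]] by (simp add: t.mapL_mult)
 show "\<Theta> (ps p * ee i) \<in> GL (- root_form ty e (i ! p) (i ! Suc p))" if "Suc p < n" "i \<in> seqs e n"
  using G[OF GR_gens(5)[OF that]] by (simp add: t.mapL_mult)
qed

text \<open>Uniqueness of the components is left open: comparison of degrees takes place in graded
  modules, where it is part of the definition.\<close>

definition hspan :: "('k fract laurent klr_free) \<Rightarrow> bool"
 where "hspan f \<longleftrightarrow> (\<exists>D g. finite D \<and> (\<forall>d. \<Theta> (g d) \<in> GL d) \<and> f \<triangleq> (\<Sum>d\<in>D. g d))"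

lemma hspan_hom: "\<Theta> f \<in> GL d \<Longrightarrow> hspan f"
 unfolding hspan_def by (rule exI[of _ "{d}"], rule exI[of _ "\<lambda>d'. if d' = d then f else 0"]) (simp add: GL_0)

lemma hspan_cong: "f \<triangleq> g \<Longrightarrow> hspan g \<Longrightarrow> hspan f"
 unfolding hspan_def by (elim exE conjE) (intro exI conjI, assumption, assumption, rule cg_trans)

lemma hspan_add:
 assumes "hspan f" and "hspan f'" shows "hspan (f + f')"
proof -
 obtain D g where g: "finite D" "\<And>d. \<Theta> (g d) \<in> GL d" "f \<triangleq> (\<Sum>d\<in>D. g d)" using assms(1) hspan_def by blast
 obtain D' g' where g': "finite D'" "\<And>d. \<Theta> (g' d) \<in> GL d" "f' \<triangleq> (\<Sum>d\<in>D'. g' d)" using assms(2) hspan_def by blast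
 let ?h = "\<lambda>d. (if d \<in> D then g d else 0) + (if d \<in> D' then g' d else 0)"
 have "(\<Sum>d\<in>D \<union> D'. ?h d) = (\<Sum>d\<in>D. g d) + (\<Sum>d\<in>D'. g' d)"
  using g(1) g'(1) by (simp add: sum.distrib sum.If_cases Int_absorb1 Int_absorb2 Un_commute)
 then have "f + f' \<triangleq> (\<Sum>d\<in>D \<union> D'. ?h d)" using cg_add[OF g(3) g'(3)] by simp
 moreover have "\<Theta> (?h d) \<in> GL d" for d using g(2)[of d] g'(2)[of d] by (intro GL_add) (simp_all add: GL_0)
 ultimately show ?thesis unfolding hspan_def using g(1) g'(1) by (intro exI[of _ "D \<union> D'"] exI[of _ ?h]) simp
qed

lemma hspan_sum: "(\<And>x. x \<in> A \<Longrightarrow> hspan (g x)) \<Longrightarrow> hspan (sum g A)"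
 by (induction A rule: infinite_finite_induct) (auto intro: hspan_add hspan_hom[OF GL_0])

lemma hspan_lmult:
 assumes u: "\<Theta> u \<in> GL d0" and "hspan f" shows "hspan (u * f)"
proof -
 obtain D g where g: "finite D" "\<And>d. \<Theta> (g d) \<in> GL d" "f \<triangleq> (\<Sum>d\<in>D. g d)" using assms(2) hspan_def by blast
 have 1: "u * f \<triangleq> (\<Sum>d\<in>D. u * g d)" using cg_lmult[OF g(3), of u] by (simp add: sum_distrib_left)
 have "hspan (u * g d)" for d using hspan_hom[OF GL_mult[OF u g(2)]] .
 then have h: "hspan (\<Sum>d\<in>D. u * g d)" by (rule hspan_sum)
 show ?thesis by (rule hspan_cong[OF 1 h])
qed

lemma gen_split: "h * f \<triangleq> (\<Sum>i\<in>seqs e n. h * ee i * f)"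
proof -
 have "h * 1 * f \<triangleq> h * (\<Sum>i\<in>seqs e n. ee i) * f"
  by (intro cg_rmult cg_lmult cg_sym[OF J_cg[OF rel_sum]])
 then show ?thesis by (simp add: sum_distrib_left sum_distrib_right)
qed

text \<open>The degrees of \<open>y\<close> and \<open>psi\<close> depend on the residue sequence,
  so each generator is first cut up by the idempotents; scalars are cut into monomials.\<close>

lemma hspan_all: "hspan f"
proof (induction f rule: free_alg_induct)
 case one show ?case by (rule hspan_hom[OF GL_1])
next
 case (gen x f)
 show ?case
 proof (cases "x \<in> E ` seqs e n \<union> Psi ` {1..<n} \<union> Y ` {1..n}")
  case False
  have "fgen x * f \<triangleq> 0 * f" by (rule cg_rmult) (use rel_gen[OF False] in \<open>simp add: cg_def\<close>)
  then show ?thesis using hspan_cong hspan_hom[OF GL_0] by simp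
 next
  case True
  have "\<exists>d. \<Theta> (fgen x * ee i) \<in> GL d" if i: "i \<in> seqs e n" for i
  proof (cases x)
   case (E j) show ?thesis using GL_mult[OF GL_e GL_e] E by blast
  next
   case (Psi k)
   with True obtain p where "k = Suc p" "Suc p < n" by (cases k) auto
   then show ?thesis using GL_pe[OF _ i] Psi by blast
  next
   case (Y k)
   with True obtain p where "k = Suc p" "p < n" by (cases k) auto
   then show ?thesis using GL_ye[OF _ i] Y by blast
  qed
  then have "hspan (fgen x * ee i * f)" if "i \<in> seqs e n" for i using hspan_lmult[OF _ gen] that by meson
  then have "hspan (\<Sum>i\<in>seqs e n. fgen x * ee i * f)" by (rule hspan_sum)
  then show ?thesis by (rule hspan_cong[OF gen_split])
 qed
next
 case (const a f)
 have "fconst a * f = (\<Sum>d\<in>keys a. fconst (single d (lookup a d)) * f)"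
 proof -
  have "fconst (sum g A) = (\<Sum>x\<in>A. fconst (g x) :: 'k fract laurent klr_free)" for g :: "int \<Rightarrow> 'k fract laurent" and A
   by (induction A rule: infinite_finite_induct) (simp_all add: fconst_add)
  then show ?thesis by (subst poly_mapping_sum_single[of a]) (simp only: sum_distrib_right)
 qed
 then show ?case by (simp only:) (rule hspan_sum, rule hspan_lmult[OF GL_const const])
next
 case (add f g) then show ?case by (rule hspan_add)
qed

end

section \<open>The scalar extension acts on V\<close>

context klr_shape
begin

lemma actV_re:
 assumes v: "keys v \<subseteq> Std n \<nu>"
 shows "actV (mapL to_laurent (re \<alpha>V f)) v = actV (mapL to_laurent f) v"
proof -
 interpret t: ring_map to_laurent by (rule ring_map_laurent)
 show ?thesis
 proof (induction f rule: free_alg_induct)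
  case (gen g f)
  show ?case
  proof (cases "g \<in> klr_gens \<alpha>V")
   case False
   have "opv g t = 0" for t
   proof (cases "t \<in> Std n \<nu>")
    case True
    then obtain s where s: "s \<in> tabD" "t = tb \<nu> s" using tb_image by blast
    show ?thesis using False rs_root_seqs[OF s(1)] True size_\<alpha>V residue_seq_tb[OF s(1)]
     by (cases g) (auto simp: opv_def klr_gens_def s(2))
   qed (simp add: opv_def)
   then show ?thesis using False
    by (simp add: restr_mult restr_gen t.mapL_mult act_gen_mult) (simp add: linext_def scal_0_right)
  qed (simp add: restr_mult restr_gen t.mapL_mult act_mult gen)
 qed (simp_all add: restr_mult restr_add t.mapL_mult t.mapL_add t.mapL_fconst act_mult act_add act_fconst)
qed

lemma KI_annV: "f \<in> KI \<alpha>V \<Longrightarrow> mapL to_laurent f \<in> annV"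
proof -
 interpret t: ring_map to_laurent by (rule ring_map_laurent)
 have "KI \<alpha>V \<subseteq> {f. mapL to_laurent f \<in> annV}"
  by (rule KI_minimal) (simp_all add: rel_annV t.mapL_add t.mapL_mult annV_ideal)
 then show "f \<in> KI \<alpha>V \<Longrightarrow> mapL to_laurent f \<in> annV" by blast
qed

text \<open>The lower bound on the algebra. The rule sending a tensor of \<open>l\<close> and
  \<open>\<kappa> g\<close> to \<open>l\<close> times the action of \<open>g\<close> extends to the
  free abelian group and kills the bilinearity relations, so the kernel of \<open>\<Theta>\<close>
  acts by zero.\<close>

lemma JJ_annV: "JJ \<subseteq> annV"
proof
 interpret t: ring_map to_laurent by (rule ring_map_laurent)
 fix f assume f: "f \<in> JJ"
 have "actV f v = 0" if v: "keys v \<subseteq> Std n \<nu>" for v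
 proof -
  \<comment> \<open>An element of the direct sum acts through a representative of its component in
    the block of V; \<open>KI_annV\<close> makes the choice immaterial.\<close>
  define b where "b = (\<lambda>p::'k fract laurent \<times> (nat multiset \<Rightarrow> ('k poly klr_free) set).
   scal (fst p) (actV (mapL to_laurent (SOME y. y \<in> snd p \<alpha>V)) v))"
  \<comment> \<open>The integer coefficients are turned into Laurent polynomials in order to reuse
    the linear extension.\<close>
  define F where "F x = linext b (Poly_Mapping.map of_int x)"
   for x :: "('k fract laurent \<times> (nat multiset \<Rightarrow> ('k poly klr_free) set)) \<Rightarrow>\<^sub>0 int"
  have F_add: "F (x + y) = F x + F y" for x y
  proof -
   have "Poly_Mapping.map of_int (x + y) = (Poly_Mapping.map of_int x + Poly_Mapping.map of_int y :: _ \<Rightarrow>\<^sub>0 'k fract laurent)"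
    by (rule poly_mapping_eqI, simp add: Poly_Mapping.map.rep_eq lookup_add when_def) (metis of_int_0 of_int_add)
   then show ?thesis by (simp add: F_def linext_add)
  qed
  have F_0: "F 0 = 0" using F_add[of 0 0] by simp
  have F_uminus: "F (- x) = - F x" for x using F_add[of x "- x"] by (simp add: F_0 eq_neg_iff_add_eq_0 add.commute)
  have F_diff: "F (x - y) = F x - F y" for x y using F_add[of x "- y"] by (simp add: F_uminus)
  have F_sum: "F (sum g A) = (\<Sum>x\<in>A. F (g x))" for g and A :: "klr_gen word set"
   by (induction A rule: infinite_finite_induct) (simp_all add: F_0 F_add)
  have F_pr: "F (pr l (\<kappa> g)) = scal l (actV (mapL to_laurent g) v)" for l g
  proof -
   define y where "y = (SOME y. y \<in> \<kappa> g \<alpha>V)"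
   have k: "\<kappa> g \<alpha>V = cs (KI \<alpha>V) (re \<alpha>V g)" using \<alpha>V_Qplus by (simp add: \<kappa>_def)
   have "y \<in> \<kappa> g \<alpha>V" unfolding y_def using add_subgroup.self_cs[OF KI_subgroup] k by (metis someI)
   then have "mapL to_laurent (y - re \<alpha>V g) \<in> annV" using k KI_annV by (simp add: cs_def)
   then have "actV (mapL to_laurent y) v = actV (mapL to_laurent g) v"
    using annV_iff v actV_re[OF v] by (simp add: t.mapL_diff act_diff)
   moreover have "Poly_Mapping.map of_int (pr l (\<kappa> g)) = single (l, \<kappa> g) (1::'k fract laurent)"
    by (rule poly_mapping_eqI) (simp add: Poly_Mapping.map.rep_eq lookup_single when_def)
   ultimately show ?thesis by (simp add: F_def b_def scal_1 flip: y_def)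
  qed
  have F_BR: "F h = 0" if "h \<in> BR" for h
   using that
   by (rule BR_cases) (simp_all add: F_diff F_pr scal_add_left scal_add t.mapL_add t.mapL_mult act_add act_mult
    t.mapL_fconst act_fconst scal_scal)
  have F_TK: "F x = 0" if "x \<in> TK" for x
   using that by (induction rule: TK_induct) (simp_all add: F_0 F_BR F_uminus F_add)
  have "F (Pm f) = actV f v"
  proof -
   have "mapL to_laurent (single w 1 :: 'k poly klr_free) = single w 1" for w
    by (simp add: t.mapL_single t.map_1)
   then have "F (Pm f) = (\<Sum>w\<in>keys f. scal (lookup f w) (actV (single w 1) v))"
    by (simp add: Pm_def F_sum F_pr)
   also have "\<dots> = actV f v" unfolding act_def linext_def[of _ f] by (simp add: scal_1)
   finally show ?thesis .
  qed
  then show ?thesis using F_TK f JJ_iff by metis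
 qed
 then show "f \<in> annV" unfolding annV_iff by blast
qed

lemma actV_cg: "f \<triangleq> g \<Longrightarrow> keys v \<subseteq> Std n \<nu> \<Longrightarrow> actV f v = actV g v"
 using JJ_annV annV_iff[of "f - g"] by (auto simp: cg_def act_diff)

end

section \<open>The grading of V\<close>

definition homl :: "int \<Rightarrow> 'a::zero laurent \<Rightarrow> bool"
 where "homl d a \<longleftrightarrow> (\<exists>b. a = single d b)"

lemma homl_0 [simp]: "homl d 0"
 unfolding homl_def by (rule exI[of _ 0]) simp

lemma homl_1 [simp]: "homl 0 (1 :: 'a::zero_neq_one laurent)"
 unfolding homl_def by (rule exI[of _ 1]) simp

lemma homl_add: "homl d a \<Longrightarrow> homl d b \<Longrightarrow> homl d (a + b)"
 for a b :: "'a::monoid_add laurent"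
 unfolding homl_def by (auto simp flip: single_add)

lemma homl_uminus: "homl d a \<Longrightarrow> homl d (- a)" and homl_diff: "homl d a \<Longrightarrow> homl d b \<Longrightarrow> homl d (a - b)"
 for a b :: "'a::ab_group_add laurent"
 unfolding homl_def by (auto simp flip: single_uminus single_diff)

lemma homl_mult: "homl d a \<Longrightarrow> homl d' b \<Longrightarrow> homl (d + d') (a * b)"
 for a b :: "'a::comm_ring_1 laurent"
 unfolding homl_def by (auto simp: mult_single)

lemma homl_to_laurent: "homogeneous_poly d p \<Longrightarrow> homl d (to_laurent p)"
 unfolding homl_def by (erule to_laurent_homogeneous) blast

lemma homl_uinv:
 fixes a :: "'a::field laurent"
 assumes "homl d a" and "a dvd 1" shows "homl (- d) (uinv a)"
proof -
 obtain b where b: "a = single d b" using assms(1) homl_def by blast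
 with assms(2) have "b \<noteq> 0" by auto
 then have "a * single (- d) (inverse b) = 1" by (simp add: b mult_single)
 from uinv_unique[OF this] show ?thesis unfolding homl_def by blast
qed

lemma homl_poly:
 fixes P :: "'a::comm_ring_1 laurent poly"
 assumes b: "homl t b" and "\<And>q. homl (d - int q * t) (coeff P q)"
 shows "homl d (poly P b)"
 using assms(2)
proof (induction P arbitrary: d)
 case (pCons a P)
 have "homl (d - t - int q * t) (coeff P q)" for q
  using pCons.prems[of "Suc q"] by (simp add: algebra_simps)
 then have "homl (t + (d - t)) (b * poly P b)" by (intro homl_mult[OF b] pCons.IH)
 then show ?case using homl_add[of d a "b * poly P b"] pCons.prems[of 0] by simp
qed simp

lemma homl_poly2:
 fixes P :: "'a::comm_ring_1 laurent poly poly"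
 assumes a: "homl s a" and b: "homl t b" and "\<And>p q. homl (d - int p * s - int q * t) (coeff (coeff P p) q)"
 shows "homl d (poly2 P a b)"
 using assms(3)
proof (induction P arbitrary: d)
 case (pCons p P)
 have "homl (d - s - int i * s - int q * t) (coeff (coeff P i) q)" for i q
  using pCons.prems[of "Suc i" q] by (simp add: algebra_simps)
 then have "homl (s + (d - s)) (a * poly2 P a b)" by (intro homl_mult[OF a] pCons.IH)
 moreover have "homl d (poly p b)" using pCons.prems[of 0] by (intro homl_poly[OF b]) simp
 ultimately show ?case using homl_add[of d "poly p b" "a * poly2 P a b"] by (simp add: poly2_pCons)
qed simp

context klr_setup
begin

abbreviation "rf \<equiv> root_form ty e"

lemma homl_C: "okc p \<Longrightarrow> homl (rf (RR p) (RR p)) (CC p)"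
 unfolding CC_def root_form_same RR_def okc_def by (intro homl_to_laurent c_homogeneous) simp

lemma RR_less: "okc p \<Longrightarrow> RR p < e"
 using res_less by (simp add: okc_def)

lemma homl_dd:
 assumes "okc p" and "okc q" and "p \<noteq> q" shows "homl (- rf (RR p) (RR q)) (dd p q)"
proof (cases "RR p = RR q")
 case True
 have "homl (rf (RR q) (RR q)) (CC q - CC p)" using homl_C[OF assms(1)] homl_C[OF assms(2)] True by (simp add: homl_diff)
 from homl_uinv[OF this] show ?thesis using C_unit'[OF assms(2,1)] assms(3) True by (simp add: dd_def)
qed (simp add: dd_def)

lemma homl_Qc:
 assumes p: "okc p" and q: "okc q" and ne: "p \<noteq> q" shows "homl (- 2 * rf (RR p) (RR q)) (Qc p q)"
proof -
 have "homl (- 2 * rf (RR p) (RR q)) (poly2 (QQ (RR p) (RR q)) (CC p) (CC q))"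
 proof (cases "RR p = RR q")
  case True then show ?thesis using QL_same[OF RR_less[OF p]] by simp
 next
  case False
  interpret t: ring_map to_laurent by (rule ring_map_laurent)
  have "coeff (coeff (QQ (RR p) (RR q)) i) j = to_laurent (coeff (coeff (Q (RR p) (RR q)) i) j)" for i j
   by (simp add: QQ_def coeff_map_poly)
  then show ?thesis
   by (intro homl_poly2[OF homl_C[OF p] homl_C[OF q]])
    (simp only: homl_to_laurent[OF Q_degree[OF RR_less[OF p] RR_less[OF q] False]])
 qed
 moreover have "homl (- rf (RR p) (RR q) + - rf (RR p) (RR q)) (dd p q * dd p q)"
  by (intro homl_mult homl_dd assms)
 ultimately show ?thesis unfolding Qc_def by (intro homl_diff) simp_all
qed

end

context klr_shape
begin

abbreviation cf :: "node \<Rightarrow> node \<Rightarrow> int"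
 where "cf A B \<equiv> rf (RR (cont A)) (RR (cont B))"

text \<open>A swap has coefficient 1 in the direction of dominance and \<open>Qc\<close>, of degree
  \<open>-2 * cf\<close>, in the other, while \<open>psi\<close> has degree \<open>-cf\<close>
  throughout. So a swap must change the degree by \<open>cf\<close>, with sign according to
  \<open>nlt\<close>.\<close>

definition degT :: "tableau \<Rightarrow> int"
 where "degT t = (\<Sum>(A, B)\<in>D \<times> D. if t A < t B \<and> nlt B A then cf A B else 0)"

text \<open>Consecutive entries compare in the same way with all other entries, so only the pair
  exchanged changes its contribution.\<close>

lemma degT_swap:
 assumes s: "s \<in> tabD" and p: "Suc p < n" and st: "stdl lv (sw p s)"
 defines "x \<equiv> s ! p" and "y \<equiv> s ! Suc p"
 shows "degT (tb \<nu> (sw p s)) = degT (tb \<nu> s)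
  + (if nlt x y then cf y x else 0) - (if nlt y x then cf x y else 0)"
proof -
 note P = tabD_props[OF s]
 define t where "t = tb \<nu> s"
 define t' where "t' = tb \<nu> (sw p s)"
 have xy: "x \<in> D" "y \<in> D" "x \<noteq> y"
  using P p nth_mem[of p s] nth_mem[of "Suc p" s] nth_eq_iff_index_eq[OF stdl_distinct[OF P(1)], of p "Suc p"]
  by (auto simp: x_def y_def)
 have t: "t x = Suc p" "t y = Suc (Suc p)"
  using tb_nth[OF P(1,2)] p P(3) by (simp_all add: t_def x_def y_def)
 have inj: "inj_on t D" using bij_tb[OF P(1,2,3)] by (simp add: t_def bij_betw_def)
 have v: "(t A = Suc p \<longleftrightarrow> A = x) \<and> (t A = Suc (Suc p) \<longleftrightarrow> A = y)" if A: "A \<in> D" for A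
 proof (intro conjI iffI)
  show "A = x" if "t A = Suc p" using inj_onD[OF inj _ A xy(1)] t(1) that by simp
  show "A = y" if "t A = Suc (Suc p)" using inj_onD[OF inj _ A xy(2)] t(2) that by simp
 qed (simp_all add: t)
 have "t' = swap_entries \<nu> (Suc p) t" using swap_entries_tb[OF P(1,2)] p P(3) by (simp add: t_def t'_def)
 then have t'0: "t' A = transpose (Suc p) (Suc (Suc p)) (t A)" if "A \<in> D" for A
  using that by (simp add: swap_entries_def)
 have t': "t' A = (if A = x then Suc (Suc p) else if A = y then Suc p else t A)" if "A \<in> D" for A
  unfolding t'0[OF that] transpose_def using v[OF that] xy(3) by simp
 define g where "g = (\<lambda>t::tableau. \<lambda>(A, B). if t A < t B \<and> nlt B A then cf A B else 0)"
 have "(\<Sum>z\<in>D \<times> D. g t' z - g t z) = (\<Sum>z\<in>{(x, y), (y, x)}. g t' z - g t z)"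
 proof (rule sum.mono_neutral_right)
  show "finite (D \<times> D)" using P(2)[symmetric] by simp
  show "\<forall>z\<in>D \<times> D - {(x, y), (y, x)}. g t' z - g t z = 0"
  proof
   fix z assume z: "z \<in> D \<times> D - {(x, y), (y, x)}"
   obtain A B where AB0: "z = (A, B)" by (cases z)
   with z have AB: "A \<in> D" "B \<in> D" "(A, B) \<noteq> (y, x)" "(A, B) \<noteq> (x, y)" by auto
   have "t' A < t' B \<longleftrightarrow> t A < t B"
    unfolding t'[OF AB(1)] t'[OF AB(2)] using AB(3,4) v[OF AB(1)] v[OF AB(2)] t
    by (cases "A = x"; cases "A = y"; cases "B = x"; cases "B = y") auto
   then show "g t' z - g t z = 0" by (simp add: g_def AB0)
  qed
 qed (use xy in auto)
 also have "\<dots> = (if nlt x y then cf y x else 0) - (if nlt y x then cf x y else 0)"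
  using xy t t' by (simp add: g_def)
 finally show ?thesis by (simp add: degT_def g_def sum_subtractf t_def t'_def algebra_simps)
qed

definition hcV :: "int \<Rightarrow> (tableau \<Rightarrow>\<^sub>0 'k fract laurent) set"
 where "hcV d = {v. keys v \<subseteq> Std n \<nu> \<and> (\<forall>t. homl (d - degT t) (lookup v t))}"

lemma hcV_keys: "v \<in> hcV d \<Longrightarrow> keys v \<subseteq> Std n \<nu>"
 by (simp add: hcV_def)

lemma hcV_closed:
 shows hcV_0: "0 \<in> hcV d" and hcV_add: "v \<in> hcV d \<Longrightarrow> w \<in> hcV d \<Longrightarrow> v + w \<in> hcV d"
  and hcV_uminus: "v \<in> hcV d \<Longrightarrow> - v \<in> hcV d"
  and hcV_scal: "homl d' a \<Longrightarrow> v \<in> hcV d \<Longrightarrow> scal a v \<in> hcV (d' + d)"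
 using keys_add[of v w] keys_scal[of a v] homl_mult[of d' a "d - degT t" for t]
 by (auto simp: hcV_def lookup_add homl_add homl_uminus add_diff_eq)

lemma hcV_sum: "(\<And>x. x \<in> A \<Longrightarrow> g x \<in> hcV d) \<Longrightarrow> sum g A \<in> hcV d"
 by (induction A rule: infinite_finite_induct) (auto intro: hcV_0 hcV_add)

lemma vv_hcV: "s \<in> tabD \<Longrightarrow> vv s \<in> hcV (degT (tb \<nu> s))"
 using tabD_props(5)[of s] by (auto simp: vv_def hcV_def lookup_single when_def)

definition shifts :: "int \<Rightarrow> ('k fract laurent klr_free) \<Rightarrow> bool"
 where "shifts d f \<longleftrightarrow> (\<forall>d'. \<forall>v\<in>hcV d'. actV f v \<in> hcV (d + d'))"

lemma shifts_closed:
 shows "shifts d 0" and "shifts 0 1" and "shifts d f \<Longrightarrow> shifts d (- f)"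
  and "shifts d f \<Longrightarrow> shifts d g \<Longrightarrow> shifts d (f + g)"
  and "shifts d f \<Longrightarrow> shifts d' g \<Longrightarrow> shifts (d + d') (f * g)"
  and "homl d a \<Longrightarrow> shifts d (fconst a)"
 unfolding shifts_def
 by (auto simp: hcV_0 act_uminus hcV_uminus act_add hcV_add act_mult add.assoc act_fconst hcV_scal)

lemma shiftsI:
 assumes "\<And>s. s \<in> tabD \<Longrightarrow> actV f (vv s) \<in> hcV (d + degT (tb \<nu> s))"
 shows "shifts d f"
 unfolding shifts_def
proof (intro allI ballI)
 fix d' v assume v: "v \<in> hcV d'"
 have "scal (lookup v t) (actV f (single t 1)) \<in> hcV (d + d')" if t: "t \<in> keys v" for t
 proof -
  obtain s where s: "s \<in> tabD" "t = tb \<nu> s" using hcV_keys[OF v] t tb_image by blast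
  have "homl (d' - degT t) (lookup v t)" using v by (simp add: hcV_def)
  from hcV_scal[OF this assms[OF s(1)]] show ?thesis using s by (simp add: vv_def add.commute)
 qed
 then show "actV f v \<in> hcV (d + d')" unfolding act_linext[of opv f v] linext_def by (rule hcV_sum)
qed

lemma tabD_okc: "s \<in> tabD \<Longrightarrow> p < n \<Longrightarrow> okc (cont (s ! p))"
 using tabs_okc tabD_props(4) by blast

lemma shifts_gens:
 shows shifts_e: "shifts 0 (ee i)"
  and shifts_ye: "p < n \<Longrightarrow> shifts (2 * symmetriser ty e (i ! p)) (yy p * ee i)"
  and shifts_pe: "Suc p < n \<Longrightarrow> shifts (- rf (i ! p) (i ! Suc p)) (ps p * ee i)"
proof -
 have E: "actV (ee i) (vv s) = (if i = rs s then vv s else 0)" if "s \<in> tabD" for s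
  using E_vv that tabD_ordD by blast
 show "shifts 0 (ee i)" by (rule shiftsI) (simp add: E vv_hcV hcV_0)
 show "shifts (2 * symmetriser ty e (i ! p)) (yy p * ee i)" if p: "p < n"
 proof (rule shiftsI)
  fix s assume s: "s \<in> tabD"
  have "scal (CC (cont (s ! p))) (vv s) \<in> hcV (rf (RR (cont (s ! p))) (RR (cont (s ! p))) + degT (tb \<nu> s))"
   by (intro hcV_scal homl_C tabD_okc s p vv_hcV)
  then show "actV (yy p * ee i) (vv s) \<in> hcV (2 * symmetriser ty e (i ! p) + degT (tb \<nu> s))"
   using rs_nth[OF s p] by (simp add: act_mult E[OF s] Y_vv[OF p] hcV_0 root_form_same)
 qed
 show "shifts (- rf (i ! p) (i ! Suc p)) (ps p * ee i)" if p: "Suc p < n"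
 proof (rule shiftsI)
  fix s assume s: "s \<in> tabD"
  let ?x = "s ! p" and ?y = "s ! Suc p"
  have so: "s \<in> ordD" using s tabD_ordD by blast
  have ok: "okc (cont ?x)" "okc (cont ?y)" "cont ?x \<noteq> cont ?y"
   using tabD_okc[OF s] p tabs_cont_neq[OF tabD_props(4)[OF s] p] by simp_all
  have sym: "cf ?y ?x = cf ?x ?y" using root_form_sym[OF admissible RR_less RR_less] ok by blast
  have "scal (dd (cont ?x) (cont ?y)) (vv s) \<in> hcV (- cf ?x ?y + degT (tb \<nu> s))"
   by (intro hcV_scal homl_dd ok vv_hcV s)
  moreover have "scal (bb ?x ?y) (vv (sw p s)) \<in> hcV (- cf ?x ?y + degT (tb \<nu> s))"
  proof (cases "sw p s \<in> tabD")
   case True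
   note P = tabD_props[OF s]
   have st: "stdl lv (sw p s)" using tabD_props(1)[OF True] .
   have nlt: "nlt ?y ?x \<longleftrightarrow> \<not> nlt ?x ?y" using tab_dominates_swap(2)[OF P(1,2) _ st] p P(3) by simp
   have "homl (- cf ?x ?y + degT (tb \<nu> s) - degT (tb \<nu> (sw p s))) (bb ?x ?y)"
    using homl_Qc[OF ok(2,1) ok(3)[symmetric]] nlt sym
    by (auto simp: bb_def degT_swap[OF s p st])
   from hcV_scal[OF this vv_hcV[OF True]] show ?thesis by simp
  qed (simp add: vv_def scal_0_right hcV_0)
  ultimately show "actV (ps p * ee i) (vv s) \<in> hcV (- rf (i ! p) (i ! Suc p) + degT (tb \<nu> s))"
   using rs_nth[OF s, of p] rs_nth[OF s, of "Suc p"] p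
   by (simp add: act_mult E[OF s] Psi_vv[OF so p] hcV_0 hcV_add)
 qed
qed

text \<open>Homogeneous elements are given by an inductive definition; along it a preimage in the
  free algebra is built that acts with the right degree.\<close>

lemma GR_shifts:
 assumes "a \<in> GR d" shows "\<exists>f. a = \<kappa> f \<and> shifts d (mapL to_laurent f)"
proof -
 interpret t: ring_map to_laurent by (rule ring_map_laurent)
 from assms show ?thesis unfolding klr_grading_def Let_def gen_grading_def mem_Collect_eq
 proof (induction rule: homogeneous_elt.induct)
  case (zero d) show ?case by (rule exI[of _ 0]) (simp add: \<kappa>_0 shifts_closed)
 next
  case one show ?case by (rule exI[of _ 1]) (simp add: \<kappa>_1 shifts_closed)
 next
  case (minus d a)
  then obtain f where "a = \<kappa> f" "shifts d (mapL to_laurent f)" by blast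
  then show ?case
   using t.mapL_diff[of 0 f] by (intro exI[of _ "- f"]) (simp add: a_inv_KA shifts_closed)
 next
  case (add d a b)
  then obtain f g where "a = \<kappa> f" "shifts d (mapL to_laurent f)" "b = \<kappa> g" "shifts d (mapL to_laurent g)" by blast
  then show ?case by (intro exI[of _ "f + g"]) (simp add: \<kappa>_add t.mapL_add shifts_closed)
 next
  case (mult d a d' b)
  then obtain f g where "a = \<kappa> f" "shifts d (mapL to_laurent f)" "b = \<kappa> g" "shifts d' (mapL to_laurent g)" by blast
  then show ?case by (intro exI[of _ "f * g"]) (simp add: \<kappa>_mult t.mapL_mult shifts_closed)
 next
  case (gen a d)
  then show ?case
  proof (elim UnE CollectE exE conjE)
   fix p d' assume h: "(a, d) = (p \<odot>\<^bsub>KA\<^esub> \<one>\<^bsub>KA\<^esub>, d')" "homogeneous_poly d' p"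
   then show ?thesis using \<kappa>_smult[of p 1]
    by (intro exI[of _ "fconst p"]) (simp add: \<kappa>_1 t.mapL_fconst shifts_closed homl_to_laurent)
  next
   fix "is" assume "(a, d) = (klr_elt e n Q W (E is), 0)"
   then show ?thesis by (intro exI[of _ "ee is"]) (simp add: \<kappa>_gen shifts_e)
  next
   fix m "is" assume h: "(a, d) = (klr_elt e n Q W (Y m) \<otimes>\<^bsub>KA\<^esub> klr_elt e n Q W (E is), 2 * symmetriser ty e (entry is m))"
    "m \<in> {1..n}"
   then obtain p where p: "m = Suc p" "p < n" by (cases m) auto
   then show ?thesis using h shifts_ye[OF p(2)]
    by (intro exI[of _ "yy p * ee is"]) (simp add: \<kappa>_mult \<kappa>_gen t.mapL_mult entry_def)
  next
   fix m "is" assume h: "(a, d) = (klr_elt e n Q W (Psi m) \<otimes>\<^bsub>KA\<^esub> klr_elt e n Q W (E is), - rf (entry is m) (entry is (m + 1)))"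
    "m \<in> {1..<n}"
   then obtain p where p: "m = Suc p" "Suc p < n" by (cases m) auto
   then show ?thesis using h shifts_pe[OF p(2)]
    by (intro exI[of _ "ps p * ee is"]) (simp add: \<kappa>_mult \<kappa>_gen t.mapL_mult entry_def)
  qed
 qed
qed

lemma GL_shifts:
 assumes "\<xi> \<in> GL d" shows "\<exists>f. \<xi> = \<Theta> f \<and> shifts d f"
 using assms unfolding klr_laurent_grading_def gen_grading_def mem_Collect_eq
proof (induction rule: homogeneous_elt.induct)
 case (zero d) show ?case by (rule exI[of _ 0]) (simp add: \<Theta>_0 shifts_closed)
next
 case one show ?case by (rule exI[of _ 1]) (simp add: \<Theta>_1 shifts_closed)
next
 case (minus d a)
 then obtain f where "a = \<Theta> f" "shifts d f" by blast
 then show ?case by (intro exI[of _ "- f"]) (simp add: a_inv_RL shifts_closed)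
next
 case (add d a b)
 then obtain f g where "a = \<Theta> f" "shifts d f" "b = \<Theta> g" "shifts d g" by blast
 then show ?case by (intro exI[of _ "f + g"]) (simp add: \<Theta>_add shifts_closed)
next
 case (mult d a d' b)
 then obtain f g where "a = \<Theta> f" "shifts d f" "b = \<Theta> g" "shifts d' g" by blast
 then show ?case by (intro exI[of _ "f * g"]) (simp add: \<Theta>_mult shifts_closed)
next
 case (gen \<xi> d)
 then obtain d1 b d2 a where h: "\<xi> = tensor to_laurent KA (single d1 b) a" "d = d1 + d2" "a \<in> GR d2" by blast
 then obtain f where "a = \<kappa> f" "shifts d2 (mapL to_laurent f)" using GR_shifts by blast
 moreover have "homl d1 (single d1 b)" unfolding homl_def by blast
 ultimately show ?case using h by (intro exI[of _ "fconst (single d1 b) * mapL to_laurent f"])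
  (simp add: \<Theta>_tensor shifts_closed)
qed

text \<open>An algebra element acts through any preimage under \<open>\<Theta>\<close>; the choice
  is harmless because the kernel acts by zero. The product fields carry no meaning in a module
  record.\<close>

definition VM :: "('k klr_laurent_elt, tableau \<Rightarrow>\<^sub>0 'k fract laurent) gmodule"
 where "VM = \<lparr>carrier = {v. keys v \<subseteq> Std n \<nu>}, mult = (\<lambda>v w. 0), one = 0, zero = 0, add = (+),
  smult = (\<lambda>\<xi> v. actV (SOME g. \<Theta> g = \<xi>) v), hcomp = hcV\<rparr>"

lemma VM_simps:
 "carrier VM = {v. keys v \<subseteq> Std n \<nu>}" "zero VM = 0" "add VM = (+)" "hcomp VM = hcV"
 by (simp_all add: VM_def)

lemma VM_smult:
 assumes "keys v \<subseteq> Std n \<nu>" shows "\<Theta> f \<odot>\<^bsub>VM\<^esub> v = actV f v"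
proof -
 have "\<Theta> (SOME g. \<Theta> g = \<Theta> f) = \<Theta> f" by (rule someI[of "\<lambda>g. \<Theta> g = \<Theta> f"]) (rule refl)
 from actV_cg[OF iffD2[OF cg_\<Theta> this] assms] show ?thesis by (simp add: VM_def)
qed

lemma keys_add_Std: "keys v \<subseteq> Std n \<nu> \<Longrightarrow> keys w \<subseteq> Std n \<nu> \<Longrightarrow>
  keys (v + w) \<subseteq> Std n \<nu>" for v w :: "tableau \<Rightarrow>\<^sub>0 'k fract laurent"
 using keys_add[of v w] by blast

lemma VM_abelian_group: "abelian_group VM"
proof (rule abelian_groupI)
 show "\<exists>y\<in>carrier VM. y \<oplus>\<^bsub>VM\<^esub> x = \<zero>\<^bsub>VM\<^esub>" if "x \<in> carrier VM" for x
  using that by (intro bexI[of _ "- x"]) (simp_all add: VM_simps)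
qed (simp_all add: VM_simps keys_add_Std add.assoc add.commute)

lemma VM_decomposition:
 "homogeneous_decomposition VM f x \<longleftrightarrow> (\<forall>d. f d \<in> hcV d) \<and> finite {d. f d \<noteq> 0} \<and> x = (\<Sum>d\<in>{d. f d \<noteq> 0}. f d)"
proof -
 have "finsum VM f A = sum f A" if "\<forall>d. f d \<in> hcV d" for A
  using that hcV_keys by (intro finsum_eq_sum abelian_group.axioms(1)[OF VM_abelian_group]) (auto simp: VM_simps)
 then show ?thesis by (auto simp: homogeneous_decomposition_def VM_simps)
qed

text \<open>The component of degree \<open>d\<close> has at \<open>t\<close> the monomial of degree
  \<open>d - degT t\<close> of that coefficient. Comparing double coefficients gives existence and
  uniqueness together.\<close>

lemma VM_unique_decomposition:
 assumes x: "keys x \<subseteq> Std n \<nu>"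
 shows "\<exists>!f. homogeneous_decomposition VM f x"
proof -
 define T where "T = tb \<nu> ` tabD"
 have T: "finite T" "Std n \<nu> = T" using finite_tabD by (simp_all add: T_def tb_image[symmetric])
 define f where "f d = (\<Sum>t\<in>T. single t (single (d - degT t)
  (lookup (lookup x t) (d - degT t))))" for d
 have sup: "t \<notin> T \<Longrightarrow> lookup v t = 0" if "keys v \<subseteq> Std n \<nu>" for t and v :: "tableau \<Rightarrow>\<^sub>0 'k fract laurent"
  using that T(2) by (auto simp: in_keys_iff)
 have lf: "lookup (f d) t = single (d - degT t) (lookup (lookup x t) (d - degT t))" for d t
  using T(1) sup[OF x] by (auto simp: f_def lookup_sum lookup_single when_def sum.delta')
 have kf: "keys (f d) \<subseteq> Std n \<nu>" for d
  using sup[OF x] T(2) by (auto simp: in_keys_iff lf)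
 have fin: "finite {d. f d \<noteq> 0}"
 proof (rule finite_subset)
  show "{d. f d \<noteq> 0} \<subseteq> (\<Union>t\<in>T. (\<lambda>d. d + degT t) ` keys (lookup x t))"
  proof
   fix d assume "d \<in> {d. f d \<noteq> 0}"
   then obtain t where t: "lookup (f d) t \<noteq> 0" using poly_mapping_eqI[of "f d" 0] by auto
   then have "t \<in> T" using sup[OF kf] by blast
   moreover have "d - degT t \<in> keys (lookup x t)" using t by (auto simp: lf in_keys_iff)
   ultimately show "d \<in> (\<Union>t\<in>T. (\<lambda>d. d + degT t) ` keys (lookup x t))"
    by (intro UN_I image_eqI[of d _ "d - degT t"]) simp_all
  qed
 qed (use T(1) in simp)
 have dec: "x = (\<Sum>d\<in>{d. g d \<noteq> 0}. g d) \<longleftrightarrow> g = f"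
  if g: "\<And>d. g d \<in> hcV d" "finite {d. g d \<noteq> 0}" for g
 proof -
  have lg: "lookup (g d) t = single (d - degT t) (lookup (lookup (g d) t) (d - degT t))" for d t
  proof -
   have "homl (d - degT t) (lookup (g d) t)" using g(1)[of d] by (simp add: hcV_def)
   then show ?thesis by (auto simp: homl_def)
  qed
  have S: "lookup (lookup (\<Sum>d\<in>{d. g d \<noteq> 0}. g d) t) k
   = lookup (lookup (g (k + degT t)) t) k" for t k
  proof -
   have "lookup (lookup (\<Sum>d\<in>{d. g d \<noteq> 0}. g d) t) k
    = (\<Sum>d\<in>{d. g d \<noteq> 0}. lookup (lookup (g d) t) k)"
    by (simp add: lookup_sum)
   also have "\<dots> = (\<Sum>d\<in>{d. g d \<noteq> 0}. if d = k + degT t then lookup (lookup (g d) t) k else 0)"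
   proof (rule sum.cong[OF refl])
    fix d
    have "lookup (lookup (g d) t) k = 0" if "d \<noteq> k + degT t"
     using that by (subst lg) (auto simp: lookup_single when_def)
    then show "lookup (lookup (g d) t) k
     = (if d = k + degT t then lookup (lookup (g d) t) k else 0)" by simp
   qed
   finally show ?thesis using g(2) by (auto simp: sum.delta)
  qed
  have "x = (\<Sum>d\<in>{d. g d \<noteq> 0}. g d) \<longleftrightarrow>
   (\<forall>t k. lookup (lookup x t) k = lookup (lookup (g (k + degT t)) t) k)"
   by (subst S[symmetric]) (auto intro!: poly_mapping_eqI)
  also have "\<dots> \<longleftrightarrow> (\<forall>d t. lookup (lookup (g d) t) (d - degT t) = lookup (lookup x t) (d - degT t))"
  proof (intro iffI allI)
   fix d t assume "\<forall>t k. lookup (lookup x t) k = lookup (lookup (g (k + degT t)) t) k"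
   from this[rule_format, of t "d - degT t"]
   show "lookup (lookup (g d) t) (d - degT t) = lookup (lookup x t) (d - degT t)"
    by simp
  next
   fix t k assume "\<forall>d t. lookup (lookup (g d) t) (d - degT t) = lookup (lookup x t) (d - degT t)"
   from this[rule_format, of "k + degT t" t]
   show "lookup (lookup x t) k = lookup (lookup (g (k + degT t)) t) k"
    by simp
  qed
  also have "\<dots> \<longleftrightarrow> (\<forall>d t. lookup (g d) t = lookup (f d) t)"
  proof (intro iff_allI)
   fix d t
   show "lookup (lookup (g d) t) (d - degT t) = lookup (lookup x t) (d - degT t)
    \<longleftrightarrow> lookup (g d) t = lookup (f d) t" (is "?l = ?r \<longleftrightarrow> _")
   proof
    assume "?l = ?r"
    then show "lookup (g d) t = lookup (f d) t" unfolding lf by (subst lg) simp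
   next
    assume "lookup (g d) t = lookup (f d) t"
    then show "?l = ?r" unfolding lf by simp
   qed
  qed
  also have "\<dots> \<longleftrightarrow> g = f" by (auto simp: fun_eq_iff intro: poly_mapping_eqI)
  finally show ?thesis .
 qed
 have hf: "f d \<in> hcV d" for d using kf by (auto simp: hcV_def lf homl_def)
 show ?thesis unfolding VM_decomposition
 proof (rule ex1I[of _ f])
  show "(\<forall>d. f d \<in> hcV d) \<and> finite {d. f d \<noteq> 0} \<and> x = (\<Sum>d\<in>{d. f d \<noteq> 0}. f d)"
   using dec[OF hf fin] hf fin by blast
  show "g = f" if "(\<forall>d. g d \<in> hcV d) \<and> finite {d. g d \<noteq> 0} \<and> x = (\<Sum>d\<in>{d. g d \<noteq> 0}. g d)" for g
   using dec[of g] that by blast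
 qed
qed

lemma VM_graded: "graded_module RL GL VM"
proof -
 interpret abelian_group VM by (rule VM_abelian_group)
 have inv: "\<ominus>\<^bsub>VM\<^esub> x = - x" if "keys x \<subseteq> Std n \<nu>" for x
  using that by (intro minus_equality) (simp_all add: VM_simps)
 have "left_module RL VM"
  unfolding left_module_def \<Theta>_carrier
  using ring_RL VM_abelian_group keys_actV
  by (auto simp: VM_simps VM_smult \<Theta>_add \<Theta>_mult \<Theta>_1 keys_add_Std act_add act_add_right act_mult)
 moreover have "subgroup (hcV d) (add_monoid VM)" for d
 proof
  show "inv\<^bsub>add_monoid VM\<^esub> x \<in> hcV d" if "x \<in> hcV d" for x
   using inv[OF hcV_keys[OF that]] hcV_uminus[OF that] by (simp add: a_inv_def)
 qed (auto simp: VM_simps hcV_0 hcV_add dest: hcV_keys)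
 moreover have "a \<odot>\<^bsub>VM\<^esub> x \<in> hcV (d + d')" if "a \<in> GL d" "x \<in> hcV d'" for a d x d'
 proof -
  obtain f where "a = \<Theta> f" "shifts d f" using GL_shifts \<open>a \<in> GL d\<close> by blast
  then show ?thesis using \<open>x \<in> hcV d'\<close> by (simp add: VM_smult hcV_keys shifts_def)
 qed
 ultimately show ?thesis unfolding graded_module_def VM_simps using VM_unique_decomposition by blast
qed

lemma VM_is_V: "is_V ty e n Q W c r \<nu> VM"
proof -
 have A: "\<Theta> (fgen g) \<odot>\<^bsub>VM\<^esub> single t 1 = opv g t" if "t \<in> Std n \<nu>" for g t
  using that by (simp add: VM_smult act_gen scal_1)
 have d: "single t 1 \<in> hcV (degT t)" if "t \<in> Std n \<nu>" for t
  using that by (auto simp: hcV_def lookup_single when_def)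
 have S: "lookup ((a \<odot>\<^bsub>RL\<^esub> \<one>\<^bsub>RL\<^esub>) \<odot>\<^bsub>VM\<^esub> f) t = a * lookup f t"
  if "keys f \<subseteq> Std n \<nu>" for a f t
  using that by (simp add: \<Theta>_1 \<Theta>_smult VM_smult act_fconst)
 show ?thesis unfolding is_V_def Let_def
  using VM_graded S by (auto simp: VM_simps \<Theta>_gen A opv_def intro: d)
qed

end

lemma fconst_sum_single:
 "(fconst a :: 'g word \<Rightarrow>\<^sub>0 'a::comm_ring_1 laurent)
  = (\<Sum>d\<in>keys a. fconst (single d (lookup a d)))"
proof -
 have "fconst (sum g A) = (\<Sum>x\<in>A. fconst (g x) :: 'g word \<Rightarrow>\<^sub>0 'a laurent)" for g :: "int \<Rightarrow> 'a laurent" and A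
  by (induction A rule: infinite_finite_induct) (simp_all add: fconst_add)
 then show ?thesis by (subst poly_mapping_sum_single[of a]) simp
qed

lemma fconst_single_inverse:
 fixes b :: "'a::field"
 assumes "b \<noteq> 0"
 shows "fconst (single (- k) (inverse b)) * fconst (single k b) = (1 :: 'g word \<Rightarrow>\<^sub>0 'a laurent)"
proof -
 have "single (- k) (inverse b) * single k b = (1 :: 'a laurent)"
  using assms by (simp add: mult_single)
 then show ?thesis by (simp flip: fconst_mult)
qed

section \<open>The projections are homogeneous of degree zero\<close>

context klr_setup
begin

definition deg0 :: "nat list \<Rightarrow> ('k fract laurent klr_free) \<Rightarrow> bool"
 where "deg0 i h \<longleftrightarrow> \<Theta> h \<in> GL 0 \<and> ee i * h \<triangleq> h"

text \<open>Numerator and denominator of a Lagrange factor both have the degree of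
  \<open>y_m\<close> at this residue. The idempotent has to be carried along, since that degree
  depends on the residue.\<close>

lemma deg0_factor:
 assumes i: "i \<in> seqs e n" and m: "m < n" and q: "okc q" "okc q'" "q \<noteq> q'" "RR q = i ! m" "RR q' = i ! m" and h: "deg0 i h"
 shows "deg0 i (fsubst1 (Polynomial.smult (uinv (CC q - CC q')) [:- CC q', 1:]) (yy m) * h)"
proof -
 let ?u = "uinv (CC q - CC q')" and ?w = "(yy m - fconst (CC q')) * h"
 let ?r = "rf (i ! m) (i ! m)"
 have cu: "homl ?r (CC q)" "homl ?r (CC q')" using homl_C[OF q(1)] homl_C[OF q(2)] q by simp_all
 have G: "\<Theta> (fconst a) \<in> GL d" if "homl d a" for a d
  using that GL_const by (auto simp: homl_def)
 have 1: "yy m * ee i * h \<triangleq> yy m * h" using h cg_lmult[of "ee i * h" h "yy m"] by (simp add: deg0_def mult.assoc)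
 have "\<Theta> (yy m * ee i * h) \<in> GL (?r + 0)"
  unfolding root_form_same by (rule GL_mult[OF GL_ye[OF m i]]) (use h in \<open>simp add: deg0_def\<close>)
 then have Y: "\<Theta> (yy m * h) \<in> GL (?r + 0)" using 1 by (simp add: cg_\<Theta>)
 have "\<Theta> (fconst (- CC q') * h) \<in> GL (?r + 0)"
  using h by (intro GL_mult G homl_uminus cu) (simp add: deg0_def)
 from GL_add[OF Y this] have w: "\<Theta> ?w \<in> GL (?r + 0)" by (simp add: left_diff_distrib fconst_uminus)
 have "homl (- ?r) ?u" using C_unit'[OF q(1,2)] q cu by (intro homl_uinv homl_diff) auto
 from GL_mult[OF G[OF this] w] have "\<Theta> (fconst ?u * ?w) \<in> GL 0" by simp
 moreover have "ee i * (fconst ?u * ?w) \<triangleq> fconst ?u * ?w"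
 proof -
  have "ee i * yy m * h \<triangleq> yy m * ee i * h" by (intro cg_rmult cg_sym[OF J_cg[OF rel_ye[OF m i]]])
  from cg_trans[OF this 1] have "ee i * (yy m * h) \<triangleq> yy m * h" by (simp add: mult.assoc)
  moreover have "ee i * (fconst (CC q') * h) \<triangleq> fconst (CC q') * h"
   using h cg_lmult[of "ee i * h" h "fconst (CC q')"] by (simp add: deg0_def fconst_left_commute)
  ultimately have "ee i * ?w \<triangleq> ?w" using cg_diff by (simp add: left_diff_distrib right_diff_distrib)
  from cg_lmult[OF this, of "fconst ?u"] show ?thesis by (simp only: fconst_left_commute)
 qed
 moreover have "fsubst1 [:- CC q', 1:] (yy m) = yy m - fconst (CC q')"
  by (simp add: fsubst1_linear fconst_uminus)
 ultimately show ?thesis by (simp only: deg0_def fsubst1_smult mult.assoc simp_thms)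
qed

lemma deg0_FT:
 assumes xs: "xs \<in> tabs" shows "deg0 (rs xs) (FT xs)"
proof -
 let ?i = "rs xs"
 have i: "?i \<in> seqs e n" using rs_seqs[OF xs] .
 have L: "deg0 ?i (fsubst1 (Lag (cont (xs ! m))) (yy m) * h)" if m: "m < n" and h: "deg0 ?i h" for m h
 proof -
  let ?q = "cont (xs ! m)"
  have len: "length xs = n" using xs by (simp add: tabs_def)
  have q: "okc ?q" "RR ?q = ?i ! m" using tabs_okc[OF xs m] m len by (simp_all add: rs_def)
  have "deg0 ?i (fsubst1 (\<Prod>q'\<in>S. Polynomial.smult (uinv (CC ?q - CC q')) [:- CC q', 1:]) (yy m) * h)"
   if "finite S" "S \<subseteq> {q' \<in> Cset. q' \<noteq> ?q \<and> RR q' = RR ?q}" for S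
   using that
  proof (induction S rule: finite_induct)
   case (insert q' S)
   have "okc q'" "?q \<noteq> q'" "RR q' = ?i ! m" using insert.prems q by (auto simp: Cset_def)
   note F = deg0_factor[OF i m q(1) this(1,2) q(2) this(3)]
   show ?case unfolding prod.insert[OF insert.hyps(1,2)] fsubst1_mult mult.assoc
    by (rule F, rule insert.IH) (use insert.prems in blast)
  qed (use h in simp)
  from this[of "{q' \<in> Cset. q' \<noteq> ?q \<and> RR q' = RR ?q}"] show ?thesis
   unfolding Lag_def using finite_Cset by simp
 qed
 have "deg0 ?i (foldr (\<lambda>m f. fsubst1 (Lag (cont (xs ! m))) (yy m) * f) ms (ee ?i))" if "set ms \<subseteq> {..<n}" for ms
  using that
 proof (induction ms)
  case Nil
  show ?case using GL_e J_cg[OF rel_ee[OF i i]] by (simp add: deg0_def)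
 qed (simp add: L)
 from this[of "[0..<n]"] show ?thesis unfolding FT_def by (simp add: atLeast0LessThan)
qed

lemma FT_GL: "xs \<in> tabs \<Longrightarrow> \<Theta> (FT xs) \<in> GL 0"
 using deg0_FT by (simp add: deg0_def)

lemma FT_idem: "xs \<in> tabs \<Longrightarrow> FT xs * FT xs \<triangleq> FT xs"
 using FT_wtn[OF _ _ wtn_FT, of xs xs] by simp

end

section \<open>Arbitrary graded modules over the scalar extension\<close>

locale klr_module = klr_setup ty e n Q W \<rho> c r
 for ty e n and Q :: "nat \<Rightarrow> nat \<Rightarrow> 'k::idom poly poly poly" and W \<rho> c r +
 fixes M :: "('k klr_laurent_elt, 'm) gmodule"
 assumes gm: "graded_module RL GL M"
begin

definition ac :: "('k fract laurent klr_free) \<Rightarrow> 'm \<Rightarrow> 'm" (infixr "\<star>" 75)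
 where "f \<star> v = \<Theta> f \<odot>\<^bsub>M\<^esub> v"

abbreviation "H d \<equiv> hcomp M d"
abbreviation "oM \<equiv> zero M"

lemma abM: "abelian_group M"
 using gm by (simp add: graded_module_def left_module_def)

interpretation M: abelian_group M by (rule abM)

lemma ac_props:
 assumes v: "v \<in> carrier M"
 shows ac_closed: "f \<star> v \<in> carrier M"
  and ac_add: "(f + g) \<star> v = f \<star> v \<oplus>\<^bsub>M\<^esub> g \<star> v"
  and ac_mult: "(f * g) \<star> v = f \<star> g \<star> v"
  and ac_1: "1 \<star> v = v"
  and ac_add_right: "w \<in> carrier M \<Longrightarrow> f \<star> (v \<oplus>\<^bsub>M\<^esub> w) = f \<star> v \<oplus>\<^bsub>M\<^esub> f \<star> w"
proof -
 have L: "left_module RL M" using gm by (simp add: graded_module_def)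
 note L = this[unfolded left_module_def \<Theta>_carrier]
 show "f \<star> v \<in> carrier M" using L v by (simp add: ac_def)
 show "(f + g) \<star> v = f \<star> v \<oplus>\<^bsub>M\<^esub> g \<star> v" using L v unfolding ac_def \<Theta>_add[symmetric] by simp
 show "(f * g) \<star> v = f \<star> g \<star> v" using L v unfolding ac_def \<Theta>_mult[symmetric] by simp
 show "1 \<star> v = v" using L v unfolding ac_def \<Theta>_1[symmetric] by simp
 show "w \<in> carrier M \<Longrightarrow> f \<star> (v \<oplus>\<^bsub>M\<^esub> w) = f \<star> v \<oplus>\<^bsub>M\<^esub> f \<star> w" using L v by (simp add: ac_def)
qed

lemma ac_cong: "f \<triangleq> g \<Longrightarrow> f \<star> v = g \<star> v"
 by (simp add: ac_def cg_\<Theta>)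

lemma ac_0: assumes v: "v \<in> carrier M" shows "0 \<star> v = oM"
 using ac_add[OF v, of 0 0] ac_closed[OF v, of 0] M.add.r_cancel_one[of "0 \<star> v" "0 \<star> v"] by simp

lemma ac_0_right: "f \<star> oM = oM"
 using ac_add_right[of oM oM f] ac_closed[of oM f] M.add.r_cancel_one[of "f \<star> oM" "f \<star> oM"] by simp

lemma ac_uminus: assumes v: "v \<in> carrier M" shows "\<ominus>\<^bsub>M\<^esub> (f \<star> v) = (- f) \<star> v"
 using ac_add[OF v, of "- f" f] ac_0[OF v] by (intro M.minus_equality) (simp_all add: ac_closed v)

lemma ac_eq_iff: assumes v: "v \<in> carrier M" shows "f \<star> v = g \<star> v \<longleftrightarrow> (f - g) \<star> v = oM"
proof -
 have "f \<star> v = (f - g) \<star> v \<oplus>\<^bsub>M\<^esub> g \<star> v" using ac_add[OF v, of "f - g" g] by simp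
 then show ?thesis using ac_closed[OF v] M.add.r_cancel_one[of "g \<star> v" "(f - g) \<star> v"] by auto
qed

lemma ac_sum: assumes v: "v \<in> carrier M" shows "sum g A \<star> v = (\<Oplus>\<^bsub>M\<^esub>x\<in>A. g x \<star> v)"
proof (induction A rule: infinite_finite_induct)
 case (insert x A)
 then show ?case using M.finsum_insert[of A x "\<lambda>x. g x \<star> v"] by (simp add: ac_add v ac_closed)
qed (simp_all add: ac_0 v M.finsum_infinite)

lemma hc_props:
 shows hc_carrier: "v \<in> H d \<Longrightarrow> v \<in> carrier M" and hc_0: "oM \<in> H d"
  and hc_ac: "\<Theta> f \<in> GL d \<Longrightarrow> v \<in> H d' \<Longrightarrow> f \<star> v \<in> H (d + d')"
proof -
 have S: "subgroup (H d) (add_monoid M)" for d using gm by (simp add: graded_module_def)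
 show "v \<in> H d \<Longrightarrow> v \<in> carrier M" using subgroup.subset[OF S] by auto
 show "oM \<in> H d" using subgroup.one_closed[OF S] by simp
 show "\<Theta> f \<in> GL d \<Longrightarrow> v \<in> H d' \<Longrightarrow> f \<star> v \<in> H (d + d')"
  using gm by (simp add: graded_module_def ac_def)
qed

lemma FT_H: "xs \<in> tabs \<Longrightarrow> v \<in> H d \<Longrightarrow> FT xs \<star> v \<in> H d"
 using hc_ac[OF FT_GL] by fastforce

lemma shift_decomposition:
 assumes A: "finite A" and u: "\<And>a. a \<in> A \<Longrightarrow> u a \<in> H (a + d0)"
 shows "homogeneous_decomposition M (\<lambda>d. if d - d0 \<in> A then u (d - d0) else oM) (finsum M u A)"
proof -
 let ?f = "\<lambda>d. if d - d0 \<in> A then u (d - d0) else oM"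
 let ?B = "(\<lambda>a. a + d0) ` A"
 have H: "?f d \<in> H d" for d using u[of "d - d0"] hc_0 by simp
 then have C: "?f d \<in> carrier M" for d using hc_carrier by blast
 have sub: "{d. ?f d \<noteq> oM} \<subseteq> ?B" by (auto intro!: image_eqI[of _ _ "_ - d0"] split: if_splits)
 have "finsum M ?f {d. ?f d \<noteq> oM} = finsum M ?f ?B"
  by (rule M.add.finprod_mono_neutral_cong_left) (use A sub C in auto)
 also have "\<dots> = finsum M (\<lambda>a. ?f (a + d0)) A"
  by (rule M.add.finprod_reindex) (use C in \<open>auto simp: inj_on_def\<close>)
 also have "\<dots> = finsum M u A"
  by (rule M.finsum_cong') (use u hc_carrier in auto)
 finally show ?thesis
  unfolding homogeneous_decomposition_def using H finite_subset[OF sub] A by simp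
qed

text \<open>A homogeneous sum also has the decomposition with a single component; uniqueness forces
  all summands of other degrees to vanish.\<close>

lemma finsum_hom:
 assumes A: "finite A" and u: "\<And>a. a \<in> A \<Longrightarrow> u a \<in> H (a + d0)" and x: "finsum M u A \<in> H d1"
 shows "a \<in> A \<Longrightarrow> a + d0 \<noteq> d1 \<Longrightarrow> u a = oM"
  and "finsum M u A = (if d1 - d0 \<in> A then u (d1 - d0) else oM)"
proof -
 let ?f = "\<lambda>d. if d - d0 \<in> A then u (d - d0) else oM"
 let ?x = "finsum M u A"
 let ?g = "\<lambda>d. if d - d1 \<in> {0} then ?x else oM"
 have xc: "?x \<in> carrier M" using x hc_carrier by blast
 have "homogeneous_decomposition M ?g (finsum M (\<lambda>a. ?x) {0::int})"
  using shift_decomposition[of "{0}" "\<lambda>a. ?x" d1] x by simp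
 also have "finsum M (\<lambda>a. ?x) {0::int} = ?x" using xc M.finsum_insert[of "{}" "0::int" "\<lambda>a. ?x"] by simp
 finally have "?g = ?f" using shift_decomposition[OF A u] gm xc unfolding graded_module_def by blast
 note fg = fun_cong[OF this]
 show "u a = oM" if "a \<in> A" "a + d0 \<noteq> d1" using fg[of "a + d0"] that by simp
 show "?x = (if d1 - d0 \<in> A then u (d1 - d0) else oM)" using fg[of d1] by simp
qed

text \<open>\<open>f\<close> is replaced by its part of degree \<open>d1 - d0\<close>, since the
  other parts contribute nothing to a homogeneous result.\<close>

lemma ac_homogeneous:
 assumes v: "v \<in> H d0" and x: "f \<star> v \<in> H d1"
 obtains g where "\<Theta> g \<in> GL (d1 - d0)" and "f \<star> v = g \<star> v"
proof -
 obtain D g where g: "finite D" "\<And>d. \<Theta> (g d) \<in> GL d" "f \<triangleq> (\<Sum>d\<in>D. g d)" using hspan_all hspan_def by blast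
 have vc: "v \<in> carrier M" using v hc_carrier by blast
 have e: "f \<star> v = finsum M (\<lambda>d. g d \<star> v) D" using ac_cong[OF g(3)] ac_sum[OF vc] by simp
 have "f \<star> v = (if d1 - d0 \<in> D then g (d1 - d0) \<star> v else oM)"
  unfolding e by (rule finsum_hom(2)[OF g(1) hc_ac[OF g(2) v] x[unfolded e]])
 then show thesis using that[of "g (d1 - d0)"] that[of 0] g(2) GL_0 ac_0[OF vc] by (auto split: if_splits)
qed

text \<open>Each monomial of \<open>a\<close> acts invertibly. Hence a homogeneous multiple of a
  nonzero homogeneous vector comes from a single monomial, and the multiplication can be
  reversed.\<close>

lemma scalar_parts:
 assumes v: "v \<in> H d0" and x: "fconst a \<star> v \<in> H d1"
 shows "k \<in> keys a \<Longrightarrow> k + d0 \<noteq> d1 \<Longrightarrow> v = oM"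
  and "fconst a \<star> v \<noteq> oM \<Longrightarrow> \<exists>b. v = fconst b \<star> fconst a \<star> v"
proof -
 let ?u = "\<lambda>d. fconst (single d (lookup a d)) \<star> v"
 have vc: "v \<in> carrier M" using v hc_carrier by blast
 have e: "fconst a \<star> v = finsum M ?u (keys a)"
  by (subst fconst_sum_single) (rule ac_sum[OF vc])
 have inv: "fconst (single (- k) (inverse (lookup a k))) \<star> ?u k = v" if "k \<in> keys a" for k
  using that ac_mult[OF vc, symmetric] ac_1[OF vc] by (simp add: fconst_single_inverse in_keys_iff)
 note F = finsum_hom[OF finite_keys hc_ac[OF GL_const v] x[unfolded e]]
 show "v = oM" if k: "k \<in> keys a" and "k + d0 \<noteq> d1"
  using F(1)[OF k that(2)] inv[OF k] ac_0_right by simp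
 show "\<exists>b. v = fconst b \<star> fconst a \<star> v" if "fconst a \<star> v \<noteq> oM"
  using F(2) that inv[of "d1 - d0"] unfolding e by (metis (no_types, lifting))
qed

lemma torsion_free:
 assumes v: "v \<in> H d0" "v \<noteq> oM" and "fconst a \<star> v = oM" shows "a = 0"
proof (rule ccontr)
 assume "a \<noteq> 0"
 then obtain k where "k \<in> keys a" using keys_eq_empty by blast
 \<comment> \<open>Zero lies in every component, so the target degree may be chosen different from
   \<open>k + d0\<close>.\<close>
 from scalar_parts(1)[OF v(1) _ this, of "k + d0 + 1"] show False using assms hc_0 by simp
qed

lemma ac_FT: "FT xs \<star> v = v \<Longrightarrow> v \<in> carrier M \<Longrightarrow> (f * FT xs) \<star> v = f \<star> v"
 by (simp add: ac_mult)

text \<open>Expand \<open>f * FT xs\<close> in the spanning family of the projective module.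
  Applying \<open>FT s\<close> isolates one coefficient, the stored \<open>h\<close> leads back to
  \<open>FT xs\<close>, and torsion-freeness shows that the coefficient is 0. The answer does not
  mention \<open>M\<close>, which is what identifies modules later.\<close>

lemma annihilator:
 assumes v: "v \<in> H d0" "v \<noteq> oM" and xs: "xs \<in> tabs" and F: "FT xs \<star> v = v"
 shows "f \<star> v = oM \<longleftrightarrow> f * FT xs \<triangleq> 0"
proof
 have vc: "v \<in> carrier M" using v hc_carrier by blast
 show "f \<star> v = oM" if "f * FT xs \<triangleq> 0"
  using ac_cong[OF that, of v] ac_0[OF vc] ac_FT[OF F vc] by simp
 show "f * FT xs \<triangleq> 0" if f: "f \<star> v = oM"
 proof -
  obtain b where b: "\<And>s. s \<in> tabs \<Longrightarrow> set s = set xs \<Longrightarrow> wtn s (b s) \<and> (\<exists>g. b s = g * FT xs) \<and> (\<exists>h. h * b s \<triangleq> FT xs)"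
   and a: "\<And>x. \<exists>a. x * FT xs \<triangleq> (\<Sum>s\<in>{s\<in>tabs. set s = set xs}. fconst (a s) * b s)"
   by (rule projective_basis[OF xs]) blast
  let ?S = "{s\<in>tabs. set s = set xs}"
  obtain a where a: "f * FT xs \<triangleq> (\<Sum>s\<in>?S. fconst (a s) * b s)" using a by blast
  have "a s = 0" if s: "s \<in> ?S" for s
  proof -
   obtain h where h: "h * b s \<triangleq> FT xs" using b s by blast
   have "FT s * (\<Sum>s'\<in>?S. fconst (a s') * b s') = (\<Sum>s'\<in>?S. fconst (a s') * (FT s * b s'))"
    by (simp add: sum_distrib_left fconst_left_commute)
   also have "\<dots> \<triangleq> (\<Sum>s'\<in>?S. if s = s' then fconst (a s') * b s' else 0)"
   proof (rule cg_sum)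
    fix s' assume "s' \<in> ?S"
    then have "FT s * b s' \<triangleq> (if s = s' then b s' else 0)" using s b by (intro FT_wtn) auto
    from cg_lmult[OF this, of "fconst (a s')"]
    show "fconst (a s') * (FT s * b s') \<triangleq> (if s = s' then fconst (a s') * b s' else 0)" by (simp split: if_splits)
   qed
   also have "\<dots> = fconst (a s) * b s" using s finite_tabs by simp
   finally have "FT s * (f * FT xs) \<triangleq> fconst (a s) * b s" using cg_trans[OF cg_lmult[OF a]] by blast
   from cg_lmult[OF this, of h] have "h * (FT s * (f * FT xs)) \<triangleq> fconst (a s) * (h * b s)"
    by (simp only: fconst_left_commute)
   from cg_trans[OF this cg_lmult[OF h]] have "(h * FT s * f) * FT xs \<triangleq> fconst (a s) * FT xs"
    by (simp only: mult.assoc)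
   from ac_cong[OF this, of v] have "(h * FT s * f) \<star> v = fconst (a s) \<star> v"
    unfolding ac_FT[OF F vc] .
   then have "fconst (a s) \<star> v = oM" using f by (simp add: ac_mult[OF vc] ac_closed vc ac_0_right)
   then show ?thesis by (rule torsion_free[OF v])
  qed
  then have "(\<Sum>s\<in>?S. fconst (a s) * b s) = 0" by simp
  with a show ?thesis by simp
 qed
qed

lemma FT_piece:
 assumes v: "v \<in> H d" "v \<noteq> oM" shows "\<exists>xs\<in>tabs. FT xs \<star> v \<noteq> oM"
proof (rule ccontr)
 assume "\<not> ?thesis"
 then have z: "\<And>xs. xs \<in> tabs \<Longrightarrow> FT xs \<star> v = oM" by blast
 have vc: "v \<in> carrier M" using v hc_carrier by blast
 have "v = finsum M (\<lambda>xs. FT xs \<star> v) tabs"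
  using ac_cong[OF FT_sum, of v] unfolding ac_sum[OF vc] ac_1[OF vc] by (rule sym)
 also have "\<dots> = oM" using z by (intro M.add.finprod_one_eqI) simp
 finally show False using v by simp
qed

lemma FT_idem_ac: "xs \<in> tabs \<Longrightarrow> v \<in> carrier M \<Longrightarrow> FT xs \<star> FT xs \<star> v = FT xs \<star> v"
 using ac_cong[OF FT_idem, of xs v] by (simp add: ac_mult)

lemma homogeneous_nonzero:
 assumes x: "homogeneous_decomposition M f x" "x \<noteq> oM" shows "\<exists>d. f d \<noteq> oM \<and> f d \<in> H d"
proof (rule ccontr)
 assume "\<not> ?thesis"
 then have "{d. f d \<noteq> oM} = {}" using x(1) by (auto simp: homogeneous_decomposition_def)
 then have "x = oM" using x(1) by (simp add: homogeneous_decomposition_def)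
 then show False using x(2) by simp
qed

lemma nonzero_homogeneous:
 assumes "carrier M \<noteq> {oM}" shows "\<exists>v d. v \<in> H d \<and> v \<noteq> oM"
proof -
 obtain x where x: "x \<in> carrier M" "x \<noteq> oM" using assms M.zero_closed by blast
 then obtain f where "homogeneous_decomposition M f x" using gm unfolding graded_module_def by blast
 from homogeneous_nonzero[OF this x(2)] show ?thesis by blast
qed

text \<open>The submodule generated by a homogeneous vector is graded because every algebra element
  is a sum of homogeneous ones.\<close>

lemma irreducible_generated:
 assumes irr: "irreducible_graded_module RL GL M" and v: "v \<in> H d0" "v \<noteq> oM" and x: "x \<in> carrier M"
 shows "\<exists>f. x = f \<star> v"
proof -
 have vc: "v \<in> carrier M" using v hc_carrier by blast
 let ?N = "range (\<lambda>f. f \<star> v)"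
 have "graded_submodule RL M ?N"
  unfolding graded_submodule_def
 proof (intro conjI ballI)
  show "subgroup ?N (add_monoid M)"
  proof
   show "x \<otimes>\<^bsub>add_monoid M\<^esub> y \<in> ?N" if "x \<in> ?N" "y \<in> ?N" for x y
    using that by (auto simp flip: ac_add[OF vc])
   show "\<one>\<^bsub>add_monoid M\<^esub> \<in> ?N" by (simp flip: ac_0[OF vc])
   show "inv\<^bsub>add_monoid M\<^esub> x \<in> ?N" if "x \<in> ?N" for x
    using that ac_uminus[OF vc] by (auto simp: a_inv_def)
  qed (auto simp: ac_closed vc)
  show "a \<odot>\<^bsub>M\<^esub> x \<in> ?N" if a: "a \<in> carrier RL" and x: "x \<in> ?N" for a x
  proof -
   obtain f where "a = \<Theta> f" using a unfolding \<Theta>_carrier by blast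
   moreover obtain g where "x = g \<star> v" using x by blast
   ultimately have "a \<odot>\<^bsub>M\<^esub> x = (f * g) \<star> v" using ac_mult[OF vc, of f g] by (simp add: ac_def)
   then show ?thesis by blast
  qed
  show "\<exists>f. homogeneous_decomposition M f x \<and> (\<forall>d. f d \<in> ?N)" if x: "x \<in> ?N" for x
  proof -
   obtain f where f: "x = f \<star> v" using x by blast
   obtain D g where g: "finite D" "\<And>d. \<Theta> (g d) \<in> GL d" "f \<triangleq> (\<Sum>d\<in>D. g d)" using hspan_all hspan_def by blast
   have "x = finsum M (\<lambda>d. g d \<star> v) D" using ac_cong[OF g(3)] ac_sum[OF vc] f by simp
   moreover have "oM \<in> ?N" by (simp flip: ac_0[OF vc])
   ultimately show ?thesis using shift_decomposition[OF g(1) hc_ac[OF g(2) v(1)]]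
    by (intro exI[of _ "\<lambda>d. if d - d0 \<in> D then g (d - d0) \<star> v else oM"]) auto
  qed
 qed
 then have "?N = {oM} \<or> ?N = carrier M" using irr by (simp add: irreducible_graded_module_def)
 moreover have "v \<in> ?N" using ac_1[OF vc] by (metis rangeI)
 ultimately show ?thesis using v(2) x by blast
qed

end

context klr_setup
begin

text \<open>The generators have the same annihilator, so sending \<open>f v\<close> to
  \<open>f w\<close> is well defined and injective. It keeps degrees because a homogeneous
  \<open>f v\<close> is also \<open>g v\<close> with \<open>g\<close> homogeneous.\<close>

lemma cyclic_graded_isomorphic:
 assumes M: "klr_module ty e n Q W \<rho> c r M" and N: "klr_module ty e n Q W \<rho> c r N" and xs: "xs \<in> tabs"
  and v: "v \<in> hcomp M d" "v \<noteq> \<zero>\<^bsub>M\<^esub>" "\<Theta> (FT xs) \<odot>\<^bsub>M\<^esub> v = v" "\<And>x. x \<in> carrier M \<Longrightarrow> \<exists>f. x = \<Theta> f \<odot>\<^bsub>M\<^esub> v"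
  and w: "w \<in> hcomp N d" "w \<noteq> \<zero>\<^bsub>N\<^esub>" "\<Theta> (FT xs) \<odot>\<^bsub>N\<^esub> w = w" "\<And>x. x \<in> carrier N \<Longrightarrow> \<exists>f. x = \<Theta> f \<odot>\<^bsub>N\<^esub> w"
 shows "graded_isomorphic RL M N"
proof -
 interpret M: klr_module ty e n Q W \<rho> c r M by (rule M)
 interpret N: klr_module ty e n Q W \<rho> c r N by (rule N)
 note v = v[folded M.ac_def] and w = w[folded N.ac_def]
 have vc: "v \<in> carrier M" and wc: "w \<in> carrier N" using v w M.hc_carrier N.hc_carrier by blast+
 have eq: "M.ac f v = M.ac g v \<longleftrightarrow> N.ac f w = N.ac g w" for f g
  unfolding M.ac_eq_iff[OF vc] N.ac_eq_iff[OF wc]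
  by (simp add: M.annihilator[OF v(1,2) xs v(3)] N.annihilator[OF w(1,2) xs w(3)])
 define h where "h x = N.ac (SOME f. M.ac f v = x) w" for x
 have h: "h (M.ac f v) = N.ac f w" for f
  unfolding h_def using someI[of "\<lambda>g. M.ac g v = M.ac f v" f] by (simp add: eq)
 have cM: "carrier M = range (\<lambda>f. M.ac f v)" using v(4) M.ac_closed[OF vc] by blast
 have cN: "carrier N = range (\<lambda>f. N.ac f w)" using w(4) N.ac_closed[OF wc] by blast
 show ?thesis unfolding graded_isomorphic_def
 proof (intro exI[of _ h] conjI ballI allI subsetI)
  show "bij_betw h (carrier M) (carrier N)"
   unfolding bij_betw_def cM cN inj_on_def by (auto simp: h eq image_iff)
  show "h (x \<oplus>\<^bsub>M\<^esub> y) = h x \<oplus>\<^bsub>N\<^esub> h y" if "x \<in> carrier M" "y \<in> carrier M" for x y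
   using that unfolding cM by (auto simp: h simp flip: M.ac_add[OF vc] N.ac_add[OF wc])
  show "h (a \<odot>\<^bsub>M\<^esub> x) = a \<odot>\<^bsub>N\<^esub> h x" if a: "a \<in> carrier RL" and x: "x \<in> carrier M" for a x
  proof -
   obtain f g where fg: "a = \<Theta> f" "x = M.ac g v" using a x unfolding \<Theta>_carrier cM by blast
   have "a \<odot>\<^bsub>M\<^esub> x = M.ac (f * g) v" using M.ac_mult[OF vc, of f g] fg M.ac_def by simp
   moreover have "a \<odot>\<^bsub>N\<^esub> N.ac g w = N.ac (f * g) w" using N.ac_mult[OF wc, of f g] fg N.ac_def by simp
   ultimately show ?thesis by (simp add: h fg(2))
  qed
  fix d' y assume "y \<in> h ` hcomp M d'"
  then obtain x where x: "x \<in> hcomp M d'" "y = h x" by blast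
  obtain f where f: "x = M.ac f v" using v(4) M.hc_carrier[OF x(1)] by blast
  obtain g where g: "\<Theta> g \<in> GL (d' - d)" "M.ac f v = M.ac g v"
   using M.ac_homogeneous[OF v(1) x(1)[unfolded f]] by blast
  have "N.ac g w \<in> hcomp N (d' - d + d)" by (rule N.hc_ac[OF g(1) w(1)])
  then show "y \<in> hcomp N d'" using x(2) f g(2) h by simp
 qed
qed

end

section \<open>Generation of V by each basis vector\<close>

context klr_shape
begin

lemma vv_expand:
 assumes "keys x \<subseteq> Std n \<nu>"
 shows "x = (\<Sum>s\<in>tabD. scal (lookup x (tb \<nu> s)) (vv s))"
proof (rule poly_mapping_eqI)
 fix t
 have "lookup (\<Sum>s\<in>tabD. scal (lookup x (tb \<nu> s)) (vv s)) t
  = (\<Sum>s\<in>tabD. if tb \<nu> s = t then lookup x t else 0)"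
  unfolding lookup_sum by (rule sum.cong) (auto simp: vv_def lookup_single when_def)
 also have "\<dots> = (\<Sum>t'\<in>Std n \<nu>. if t' = t then lookup x t else 0)"
  unfolding tb_image[symmetric] by (simp add: sum.reindex[OF tb_inj])
 also have "\<dots> = lookup x t"
 proof -
  have "finite (Std n \<nu>)" using finite_tabD by (simp flip: tb_image)
  then show ?thesis using assms by (auto simp: in_keys_iff)
 qed
 finally show "lookup x t = lookup (\<Sum>s\<in>tabD. scal (lookup x (tb \<nu> s)) (vv s)) t" by simp
qed

lemma FT_vv:
 assumes s: "s \<in> tabs" and t: "t \<in> tabD"
 shows "actV (FT s) (vv t) = (if s = t then vv t else 0)"
proof -
 have to: "t \<in> ordD" using t tabD_ordD by blast
 have "FT s - (if s = t then 1 else 0) \<in> {f. actV f (vv t) = 0}"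
 proof (rule FT_value[OF act_left_ideal s tabD_props(4)[OF t]])
  show "yy m - fconst (CC (cont (t ! m))) \<in> {f. actV f (vv t) = 0}" if "m < n" for m
   using eigenV[OF to that] .
  show "ee (rs s) - (if rs s = rs t then 1 else 0) \<in> {f. actV f (vv t) = 0}"
   unfolding act_ann_iff by (simp add: E_vv[OF to])
 qed
 then show ?thesis unfolding act_ann_iff by simp
qed

lemma FT_actV:
 assumes s: "s \<in> tabs" and x: "keys x \<subseteq> Std n \<nu>"
 shows "actV (FT s) x = scal (lookup x (tb \<nu> s)) (vv s)"
proof -
 have R: "actV f (sum g A) = (\<Sum>x\<in>A. actV f (g x))" for f g and A :: "node list set"
  by (induction A rule: infinite_finite_induct) (simp_all add: act_add_right)
 have "actV (FT s) x = (\<Sum>t\<in>tabD. scal (lookup x (tb \<nu> t)) (actV (FT s) (vv t)))"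
  by (subst vv_expand[OF x]) (simp only: R act_scal)
 also have "\<dots> = (\<Sum>t\<in>tabD. if s = t then scal (lookup x (tb \<nu> t)) (vv t) else 0)"
  by (rule sum.cong) (simp_all add: FT_vv[OF s] scal_0_right)
 also have "\<dots> = scal (lookup x (tb \<nu> s)) (vv s)"
  using finite_tabD by (cases "s \<in> tabD") (simp_all add: vv_def scal_0_right)
 finally show ?thesis .
qed

lemma lookup_vv: "s \<in> tabD \<Longrightarrow> lookup (vv s) (tb \<nu> s) = 1"
 by (simp add: vv_def)

lemma keys_vv: "keys (vv s) \<subseteq> Std n \<nu>"
 using tabD_props(5)[of s] by (auto simp: vv_def)

text \<open>The member of the projective family at \<open>s\<close> takes \<open>vv t\<close> to a
  multiple \<open>a\<close> of \<open>vv s\<close>. Since \<open>h\<close> leads back to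
  \<open>vv t\<close>, the scalar \<open>a\<close> is a unit and can be divided out.\<close>

lemma vv_transitive:
 assumes s: "s \<in> tabD" and t: "t \<in> tabD" shows "\<exists>g. actV g (vv t) = vv s"
proof -
 note S = tabD_props[OF s] and T = tabD_props[OF t]
 obtain b where b: "\<And>s. s \<in> tabs \<Longrightarrow> set s = set t \<Longrightarrow> wtn s (b s) \<and> (\<exists>g. b s = g * FT t) \<and> (\<exists>h. h * b s \<triangleq> FT t)"
  by (rule projective_basis[OF T(4)]) blast
 obtain h where h: "h * b s \<triangleq> FT t" and w: "wtn s (b s)" using b[OF S(4)] S(2) T(2) by blast
 define y where "y = actV (b s) (vv t)"
 define a where "a = lookup y (tb \<nu> s)"
 have y: "y = scal a (vv s)"
 proof -
  have "FT s * b s \<triangleq> b s" using FT_wtn[OF S(4) S(4) w] by simp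
  from actV_cg[OF this keys_vv] have "actV (FT s) y = y" by (simp add: act_mult y_def)
  then show ?thesis using FT_actV[OF S(4) keys_actV[OF keys_vv]] by (simp add: y_def a_def)
 qed
 have "scal a (actV h (vv s)) = vv t"
  using actV_cg[OF h keys_vv[of t]] FT_vv[OF T(4) t] y by (simp add: act_mult act_scal flip: y_def)
 from arg_cong[OF this, of "\<lambda>x. lookup x (tb \<nu> t)"]
 have "a * lookup (actV h (vv s)) (tb \<nu> t) = 1" by (simp add: lookup_vv[OF t])
 then have "a dvd 1" by (metis dvd_triv_left)
 then have "actV (fconst (uinv a) * b s) (vv t) = vv s"
  using y by (simp add: act_mult act_fconst scal_scal uinv_mult_left scal_1 flip: y_def)
 then show ?thesis by blast
qed

lemma vv_generates:
 assumes t: "t \<in> tabD" and x: "keys x \<subseteq> Std n \<nu>" shows "\<exists>f. x = actV f (vv t)"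
proof -
 obtain g where g: "\<And>s. s \<in> tabD \<Longrightarrow> actV (g s) (vv t) = vv s" using vv_transitive[OF _ t] by metis
 have "actV (\<Sum>s\<in>tabD. fconst (lookup x (tb \<nu> s)) * g s) (vv t)
  = (\<Sum>s\<in>tabD. scal (lookup x (tb \<nu> s)) (vv s))"
  unfolding act_sum by (rule sum.cong) (simp_all add: act_mult act_fconst g)
 also have "\<dots> = x" by (rule vv_expand[OF x, symmetric])
 finally show ?thesis by (intro exI) (rule sym)
qed

lemma tabD_nonempty: "tabD \<noteq> {}"
proof -
 obtain s where s: "stdl lv s" "set s = D" using stdl_exists[OF y_D] by blast
 then have "length s = n" using card_D distinct_card[OF stdl_distinct[OF s(1)]] by simp
 then show ?thesis using s by (auto simp: tabD_def tabs_def)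
qed

end

section \<open>Arbitrary realisations of V\<close>

locale klr_V = klr_shape ty e n Q W \<rho> c r \<nu>
 for ty e n and Q :: "nat \<Rightarrow> nat \<Rightarrow> 'k::idom poly poly poly" and W \<rho> c r \<nu> +
 fixes M :: "('k klr_laurent_elt, tableau \<Rightarrow>\<^sub>0 'k fract laurent) gmodule"
 assumes isV: "is_V ty e n Q W c r \<nu> M"

sublocale klr_V \<subseteq> klr_module ty e n Q W \<rho> c r M
 by unfold_locales (use isV in \<open>simp add: is_V_def Let_def\<close>)

context klr_V
begin

lemma V_simps: "carrier M = {f. keys f \<subseteq> Std n \<nu>}" "add M = (+)" "zero M = 0"
 using isV by (simp_all add: is_V_def Let_def)

lemma ac_scal: assumes "keys v \<subseteq> Std n \<nu>" shows "fconst a \<star> v = scal a v"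
proof (rule poly_mapping_eqI)
 fix t
 have "lookup ((a \<odot>\<^bsub>RL\<^esub> \<one>\<^bsub>RL\<^esub>) \<odot>\<^bsub>M\<^esub> v) t = a * lookup v t"
  using isV assms by (simp add: is_V_def Let_def)
 then show "lookup (fconst a \<star> v) t = lookup (scal a v) t"
  by (simp add: ac_def \<Theta>_1 \<Theta>_smult)
qed

lemma ac_gen_basis:
 assumes t: "t \<in> Std n \<nu>" shows "fgen g \<star> single t 1 = opv g t"
proof (cases "g \<in> E ` seqs e n \<union> Psi ` {1..<n} \<union> Y ` {1..n}")
 case True
 have "(\<forall>is\<in>seqs e n. fgen (E is) \<star> single t 1 = (if is = residue_seq n r \<nu> t then single t 1 else 0)) \<and>
  (\<forall>m\<in>{1..n}. fgen (Y m) \<star> single t 1 = single t (to_laurent (on_content c \<nu> t m))) \<and>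
  (\<forall>m\<in>{1..<n}. fgen (Psi m) \<star> single t 1
     = (if swap_entries \<nu> m t \<in> Std n \<nu>
       then single (swap_entries \<nu> m t) (beta_coeff lv Q c r \<nu> t m)
       else 0)
      + single t (content_quotient 1 c r \<nu> t m))"
  using isV t unfolding is_V_def Let_def \<Theta>_gen ac_def by blast
 then show ?thesis using True t by (cases g) (auto simp: opv_def)
next
 case False
 then have "fgen g \<triangleq> 0" using rel_gen by (simp add: cg_0_iff)
 then have "fgen g \<star> single t 1 = 0"
  using ac_cong ac_0[of "single t 1"] t by (simp add: V_simps)
 moreover obtain s where s: "s \<in> tabD" "t = tb \<nu> s" using t tb_image by blast
 then have "opv g t = 0" using False rs_seqs[OF tabD_props(4)[OF s(1)]] residue_seq_tb[OF s(1)] t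
  by (cases g) (auto simp: opv_def)
 ultimately show ?thesis by simp
qed

text \<open>\<open>is_V\<close> fixes the module only on generators and basis vectors; scalars and
  additivity extend this to the whole action, so nothing depends on the realisation or on the
  degrees chosen.\<close>

lemma ac_V: assumes v: "keys v \<subseteq> Std n \<nu>" shows "f \<star> v = actV f v"
proof -
 have R: "f \<star> sum g A = (\<Sum>x\<in>A. f \<star> g x)" if "\<And>x. x \<in> A \<Longrightarrow> keys (g x) \<subseteq> Std n \<nu>"
  for f g and A :: "tableau set"
  using that
 proof (induction A rule: infinite_finite_induct)
  case (insert x A)
  have "keys (sum g A) \<subseteq> Std n \<nu>" using insert.prems keys_sum[of g A] by blast
  then show ?case using insert ac_add_right[of "g x" "sum g A" f] by (simp add: V_simps)
 qed (use ac_0_right V_simps in simp_all)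
 have G: "fgen g \<star> w = linext (opv g) w" if w: "keys w \<subseteq> Std n \<nu>" for g w
 proof -
  have "fgen g \<star> w = (\<Sum>t\<in>keys w. fgen g \<star> single t (lookup w t))"
   by (subst poly_mapping_sum_single[of w]) (rule R, use w in auto)
  also have "\<dots> = (\<Sum>t\<in>keys w. scal (lookup w t) (opv g t))"
  proof (rule sum.cong[OF refl])
   fix t assume "t \<in> keys w"
   then have t: "t \<in> Std n \<nu>" "single t 1 \<in> carrier M" using w by (auto simp: V_simps)
   let ?a = "lookup w t"
   have "single t ?a = fconst ?a \<star> single t 1" using t by (simp add: ac_scal scal_single)
   then have "fgen g \<star> single t ?a = fconst ?a \<star> fgen g \<star> single t 1"
    by (simp add: fconst_commute flip: ac_mult[OF t(2)])
   then show "fgen g \<star> single t ?a = scal ?a (opv g t)"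
    by (simp add: ac_gen_basis[OF t(1)] ac_scal[OF keys_opv])
  qed
  finally show ?thesis by (simp add: linext_def)
 qed
 have vc: "v \<in> carrier M" using v by (simp add: V_simps)
 show ?thesis
 proof (induction f rule: free_alg_induct)
  case one show ?case using ac_1[OF vc] by simp
 next
  case (gen g f) then show ?case by (simp add: ac_mult[OF vc] act_gen_mult G[OF keys_actV[OF v]])
 next
  case (const a f) then show ?case by (simp add: ac_mult[OF vc] act_fconst_mult ac_scal[OF keys_actV[OF v]])
 next
  case (add f g) then show ?case using ac_add[OF vc, of f g] by (simp add: act_add V_simps)
 qed
qed

lemma vv_carrier: "vv s \<in> carrier M"
 using keys_vv by (simp add: V_simps)

lemma vv_nonzero: "s \<in> tabD \<Longrightarrow> vv s \<noteq> oM"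
 using lookup_vv V_simps(3) by force

lemma vv_H: assumes "s \<in> tabD" shows "\<exists>d. vv s \<in> H d"
 using isV tabD_props(5)[OF assms] assms by (simp add: is_V_def Let_def vv_def)

lemma FT_ac_vv: "s \<in> tabD \<Longrightarrow> FT s \<star> vv s = vv s"
 using FT_vv[OF tabD_props(4)] by (simp add: ac_V[OF keys_vv])

lemma ac_generates: "s \<in> tabD \<Longrightarrow> x \<in> carrier M \<Longrightarrow> \<exists>f. x = f \<star> vv s"
 using vv_generates by (simp add: V_simps ac_V[OF keys_vv])

text \<open>A nonzero graded submodule contains a homogeneous vector, and some \<open>FT s\<close>
  turns it into a nonzero multiple of \<open>vv s\<close>. After division this vector generates
  everything.\<close>

lemma irreducible: "irreducible_graded_module RL GL M"
proof -
 obtain s where s: "s \<in> tabD" using tabD_nonempty by blast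
 have "N = {oM} \<or> N = carrier M" if N: "graded_submodule RL M N" for N
 proof (cases "N = {oM}")
  case False
  have sub: "N \<subseteq> carrier M" and z: "oM \<in> N"
   using N subgroup.subset[of N "add_monoid M"] subgroup.one_closed[of N "add_monoid M"] by (auto simp: graded_submodule_def)
  have act: "f \<star> y \<in> N" if "y \<in> N" for f y
   using N that \<Theta>_carrier by (auto simp: graded_submodule_def ac_def)
  obtain x where x: "x \<in> N" "x \<noteq> oM" using False z by blast
  then obtain f where f: "homogeneous_decomposition M f x" "\<And>d. f d \<in> N" using N by (auto simp: graded_submodule_def)
  then obtain d where d: "f d \<noteq> oM" "f d \<in> H d" using homogeneous_nonzero x by blast
  from FT_piece[OF d(2,1)] obtain s where s: "s \<in> tabs" "FT s \<star> f d \<noteq> oM" by blast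
  let ?a = "lookup (f d) (tb \<nu> s)"
  have "FT s \<star> f d = scal ?a (vv s)"
   using FT_actV[OF s(1)] ac_V hc_carrier[OF d(2)] by (simp add: V_simps)
  also have "\<dots> = fconst ?a \<star> vv s" by (simp add: ac_scal keys_vv)
  finally have e: "FT s \<star> f d = fconst ?a \<star> vv s" .
  have sD: "s \<in> tabD"
  proof (rule ccontr)
   assume "s \<notin> tabD"
   then have "vv s = oM" by (simp add: vv_def V_simps)
   then show False using e s(2) ac_0_right by simp
  qed
  obtain d0 where d0: "vv s \<in> H d0" using vv_H[OF sD] by blast
  \<comment> \<open>\<open>FT s\<close> has degree 0, so the multiple is homogeneous and therefore
    given by an invertible monomial.\<close>
  have "\<exists>b. vv s = fconst b \<star> fconst ?a \<star> vv s"
   using scalar_parts(2)[OF d0, of ?a d] FT_H[OF s(1) d(2)] s(2) unfolding e by blast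
  then have "vv s \<in> N" using act[OF act[OF f(2)[of d], of "FT s"]] e by metis
  then have "carrier M \<subseteq> N" using ac_generates[OF sD] act by blast
  then show ?thesis using sub by blast
 qed simp
 moreover have "carrier M \<noteq> {oM}" using vv_carrier vv_nonzero[OF s] by blast
 ultimately show ?thesis using gm by (simp add: irreducible_graded_module_def)
qed

end

section \<open>Classification of the irreducibles and the matrix algebras\<close>

context klr_setup
begin

abbreviation "PP \<equiv> multipartitions lv n"

lemma klr_shapeI: "\<nu> \<in> PP \<Longrightarrow> klr_shape ty e n Q W \<rho> c r \<nu>"
 by unfold_locales

lemma klr_VI: "\<nu> \<in> PP \<Longrightarrow> is_V ty e n Q W c r \<nu> M \<Longrightarrow> klr_V ty e n Q W \<rho> c r \<nu> M"
 by (intro klr_V.intro klr_shapeI klr_V_axioms.intro)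

text \<open>For \<open>s\<close> of shape \<open>\<nu>\<close>, the projection \<open>FT s\<close>
  fixes a basis vector of one module and kills the other module.\<close>

lemma V_not_isomorphic:
 assumes nu: "\<nu> \<in> PP" "is_V ty e n Q W c r \<nu> M" and mu: "\<mu> \<in> PP" "is_V ty e n Q W c r \<mu> N"
  and iso: "graded_isomorphic RL M N"
 shows "\<nu> = \<mu>"
proof (rule ccontr)
 assume "\<nu> \<noteq> \<mu>"
 then have ne: "diagram \<nu> \<noteq> diagram \<mu>" using diagram_inject nu(1) mu(1) by blast
 interpret A: klr_V ty e n Q W \<rho> c r \<nu> M by (rule klr_VI[OF nu])
 interpret B: klr_V ty e n Q W \<rho> c r \<mu> N by (rule klr_VI[OF mu])
 obtain h where bij: "bij_betw h (carrier M) (carrier N)"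
  and h: "\<And>a x. a \<in> carrier RL \<Longrightarrow> x \<in> carrier M \<Longrightarrow> h (a \<odot>\<^bsub>M\<^esub> x) = a \<odot>\<^bsub>N\<^esub> h x"
  using iso unfolding graded_isomorphic_def by blast
 obtain s where s: "s \<in> A.tabD" using A.tabD_nonempty by blast
 let ?v = "A.vv s"
 have hv: "h ?v \<in> carrier N" using bij A.vv_carrier bij_betwE by blast
 have H: "h (A.ac f ?v) = B.ac f (h ?v)" for f
  unfolding A.ac_def B.ac_def by (rule h) (simp_all add: \<Theta>_carrier A.vv_carrier)
 have "B.vv s = 0" using A.tabD_props(2)[OF s] ne by (simp add: B.vv_def B.tabD_def)
 moreover have k: "keys (h ?v) \<subseteq> Std n \<mu>" using hv by (simp add: B.V_simps)
 ultimately have "B.ac (FT s) (h ?v) = B.ac 0 (h ?v)"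
  using B.FT_actV[OF A.tabD_props(4)[OF s] k] by (simp add: B.ac_V[OF k] scal_0_right)
 then have "h (A.ac (FT s) ?v) = h (A.ac 0 ?v)" by (simp add: H)
 moreover have "A.ac (FT s) ?v \<in> carrier M" "A.ac 0 ?v \<in> carrier M" by (simp_all add: A.ac_closed A.vv_carrier)
 ultimately have "A.ac (FT s) ?v = A.ac 0 ?v" using bij unfolding bij_betw_def inj_on_def by blast
 then show False using A.FT_ac_vv[OF s] A.ac_0[OF A.vv_carrier] A.vv_nonzero[OF s] by simp
qed

lemma V_exists: assumes "\<nu> \<in> PP" shows "\<exists>M. is_V ty e n Q W c r \<nu> M"
proof -
 interpret B: klr_shape ty e n Q W \<rho> c r \<nu> by (rule klr_shapeI[OF assms])
 show ?thesis by (rule exI[of _ B.VM]) (rule B.VM_is_V)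
qed

lemma V_irreducible:
 assumes "\<nu> \<in> PP" and "is_V ty e n Q W c r \<nu> M" shows "irreducible_graded_module RL GL M"
proof -
 interpret B: klr_V ty e n Q W \<rho> c r \<nu> M by (rule klr_VI[OF assms])
 show ?thesis by (rule B.irreducible)
qed

lemma tabs_shape:
 assumes "xs \<in> tabs" obtains \<nu> where "\<nu> \<in> PP" and "diagram \<nu> = set xs"
proof -
 have xs: "stdl lv xs" "length xs = n" using assms by (simp_all add: tabs_def)
 have "card (set xs) = n" using distinct_card[OF stdl_distinct[OF xs(1)]] xs(2) by simp
 then show thesis using young_diagram[OF stdl_young[OF xs(1)]] that by auto
qed

text \<open>A nonzero homogeneous vector has a nonzero image under some \<open>FT xs\<close>. That
  image has the annihilator of \<open>vv xs\<close>, and it generates by irreducibility.\<close>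

lemma V_complete:
 fixes M :: "('k klr_laurent_elt, 'm) gmodule"
 assumes irr: "irreducible_graded_module RL GL M" and V: "\<And>\<nu>. \<nu> \<in> PP \<Longrightarrow> is_V ty e n Q W c r \<nu> (V \<nu>)"
 shows "\<exists>\<nu>\<in>PP. graded_isomorphic RL M (V \<nu>)"
proof -
 interpret A: klr_module ty e n Q W \<rho> c r M
  by unfold_locales (use irr in \<open>simp add: irreducible_graded_module_def\<close>)
 have "carrier M \<noteq> {\<zero>\<^bsub>M\<^esub>}" using irr by (simp add: irreducible_graded_module_def)
 then obtain v0 d where v0: "v0 \<in> A.H d" "v0 \<noteq> \<zero>\<^bsub>M\<^esub>" using A.nonzero_homogeneous by blast
 from A.FT_piece[OF v0] obtain xs where xs: "xs \<in> tabs" "A.ac (FT xs) v0 \<noteq> \<zero>\<^bsub>M\<^esub>" by blast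
 define v where "v = A.ac (FT xs) v0"
 have v: "v \<in> A.H d" "v \<noteq> \<zero>\<^bsub>M\<^esub>" "A.ac (FT xs) v = v"
  using A.FT_H[OF xs(1) v0(1)] xs(2) A.FT_idem_ac[OF xs(1) A.hc_carrier[OF v0(1)]] by (simp_all add: v_def)
 obtain \<nu> where nu: "\<nu> \<in> PP" "diagram \<nu> = set xs" using tabs_shape[OF xs(1)] by blast
 interpret B: klr_V ty e n Q W \<rho> c r \<nu> "V \<nu>" by (rule klr_VI[OF nu(1) V[OF nu(1)]])
 have xD: "xs \<in> B.tabD" using xs(1) nu(2) by (simp add: B.tabD_def)
 obtain d0 where d0: "B.vv xs \<in> B.H d0" using B.vv_H[OF xD] by blast
 \<comment> \<open>A power of \<open>x\<close> shifts the generator of V to the degree of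
   \<open>v\<close>, as an isomorphism of degree 0 requires; no degree shifts are therefore needed
   in the classification.\<close>
 let ?p = "fconst (single (d - d0) 1) :: 'k fract laurent klr_free"
 let ?q = "fconst (single (d0 - d) 1) :: 'k fract laurent klr_free"
 define w where "w = B.ac ?p (B.vv xs)"
 note vc = B.vv_carrier[of xs]
 have qp: "?q * ?p = 1" using fconst_single_inverse[of "1::'k fract" "d - d0"] by simp
 have qw: "B.ac ?q w = B.vv xs"
  unfolding w_def B.ac_mult[OF vc, symmetric] qp by (rule B.ac_1[OF vc])
 have w: "w \<in> B.H d" using B.hc_ac[OF GL_const d0, of "d - d0" 1] by (simp add: w_def)
 have "w \<noteq> \<zero>\<^bsub>V \<nu>\<^esub>" using qw B.ac_0_right B.vv_nonzero[OF xD] by auto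
 moreover have "B.ac (FT xs) w = w"
  unfolding w_def B.ac_mult[OF vc, symmetric] fconst_commute[of "FT xs"] by (simp add: B.ac_mult[OF vc] B.FT_ac_vv[OF xD])
 moreover have "\<exists>f. x = B.ac f w" if x: "x \<in> carrier (V \<nu>)" for x
 proof -
  obtain f where "x = B.ac f (B.vv xs)" using B.ac_generates[OF xD x] by blast
  then have "x = B.ac (f * ?q) w" using B.ac_mult[OF B.hc_carrier[OF w], of f ?q] qw by simp
  then show ?thesis by blast
 qed
 moreover have "\<exists>f. x = A.ac f v" if "x \<in> carrier M" for x
  by (rule A.irreducible_generated[OF irr v(1,2) that])
 ultimately have "graded_isomorphic RL M (V \<nu>)"
  unfolding A.ac_def B.ac_def
  using cyclic_graded_isomorphic[OF A.klr_module_axioms B.klr_module_axioms xs(1) v(1,2) v(3)[unfolded A.ac_def] _ w] by blast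
 with nu(1) show ?thesis by blast
qed

text \<open>The properties of the matrix coefficients of one V, stated without reference to its
  construction, so that all shapes can be used together. They comprise multiplicativity, detection
  of \<open>f * FT t\<close>, existence of matrix units, and vanishing on projections of other
  shapes.\<close>

definition coefficients :: "multipartition \<Rightarrow> (('k fract laurent klr_free) \<Rightarrow> node list \<Rightarrow> node list \<Rightarrow> 'k fract laurent) \<Rightarrow> bool"
 where "coefficients \<nu> co \<longleftrightarrow> (let T = {s \<in> tabs. set s = diagram \<nu>} in
  (\<forall>f g. f \<triangleq> g \<longrightarrow> co f = co g) \<and> (\<forall>f g s t. co (f + g) s t = co f s t + co g s t) \<and>
  (\<forall>f g. \<forall>s\<in>T. \<forall>t\<in>T. co (f * g) s t = (\<Sum>u\<in>T. co f s u * co g u t)) \<and>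
  (\<forall>s\<in>T. \<forall>t\<in>T. co 1 s t = (if s = t then 1 else 0)) \<and> (\<forall>a f s t. co (fconst a * f) s t = a * co f s t) \<and>
  (\<forall>f. \<forall>t\<in>T. (\<forall>s\<in>T. co f s t = 0) \<longrightarrow> f * FT t \<triangleq> 0) \<and>
  (\<forall>s\<in>T. \<forall>t\<in>T. \<exists>g. \<forall>s'\<in>T. \<forall>t'\<in>T. co (g * FT t) s' t' = (if s' = s \<and> t' = t then 1 else 0)) \<and>
  (\<forall>t\<in>tabs - T. \<forall>g s' t'. t' \<in> T \<longrightarrow> co (g * FT t) s' t' = 0))"

end

context klr_shape
begin

text \<open>Matrix entries are taken with respect to the basis \<open>vv\<close>. Detection of zero
  is \<open>annihilator\<close> applied to V itself, and the matrix units come from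
  \<open>vv_transitive\<close>.\<close>

lemma coefficients_exist: "\<exists>co. coefficients \<nu> co"
proof -
 interpret B: klr_V ty e n Q W \<rho> c r \<nu> VM by unfold_locales (rule VM_is_V)
 define co where "co f s t = lookup (actV f (vv t)) (tb \<nu> s)" for f s t
 have T: "{s \<in> tabs. set s = D} = tabD" by (simp add: tabD_def)
 have R: "actV f (sum g A) = (\<Sum>x\<in>A. actV f (g x))" for f g and A :: "node list set"
  by (induction A rule: infinite_finite_induct) (simp_all add: act_add_right)
 have lv: "lookup (vv s) (tb \<nu> t) = (if t = s then 1 else 0)" if "s \<in> tabD" "t \<in> tabD" for s t
  using that inj_onD[OF tb_inj, of s t] by (auto simp: vv_def lookup_single when_def)
 show ?thesis unfolding coefficients_def Let_def T
 proof (intro exI[of _ co] conjI allI ballI impI)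
  show "co f = co g" if "f \<triangleq> g" for f g
   unfolding co_def actV_cg[OF that keys_vv] ..
  show "co (f + g) s t = co f s t + co g s t" for f g s t by (simp add: co_def act_add lookup_add)
  show "co (f * g) s t = (\<Sum>u\<in>tabD. co f s u * co g u t)" for f g s t
  proof -
   have "actV (f * g) (vv t) = (\<Sum>u\<in>tabD. scal (co g u t) (actV f (vv u)))"
    unfolding act_mult co_def by (subst vv_expand[OF keys_actV[OF keys_vv]]) (simp only: R act_scal)
   then show ?thesis by (simp add: co_def lookup_sum mult.commute)
  qed
  show "co 1 s t = (if s = t then 1 else 0)" if "s \<in> tabD" "t \<in> tabD" for s t
   using lv[OF that(2,1)] by (simp add: co_def)
  show "co (fconst a * f) s t = a * co f s t" for a f s t by (simp add: co_def act_fconst_mult)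
  show "f * FT t \<triangleq> 0" if t: "t \<in> tabD" and z: "\<forall>s\<in>tabD. co f s t = 0" for f t
  proof -
   have "actV f (vv t) = 0"
    by (subst vv_expand[OF keys_actV[OF keys_vv]]) (use z in \<open>simp add: co_def scal_0\<close>)
   then have "B.ac f (vv t) = \<zero>\<^bsub>VM\<^esub>" by (simp add: B.ac_V[OF keys_vv] VM_simps)
   moreover obtain d0 where "vv t \<in> B.H d0" using B.vv_H[OF t] by blast
   ultimately show ?thesis
    using B.annihilator[OF _ B.vv_nonzero[OF t] tabD_props(4)[OF t] B.FT_ac_vv[OF t]] by blast
  qed
  show "\<exists>g. \<forall>s'\<in>tabD. \<forall>t'\<in>tabD. co (g * FT t) s' t' = (if s' = s \<and> t' = t then 1 else 0)"
   if s: "s \<in> tabD" and t: "t \<in> tabD" for s t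
  proof -
   obtain g where "actV g (vv t) = vv s" using vv_transitive[OF s t] by blast
   then show ?thesis using s FT_vv[OF tabD_props(4)[OF t]]
    by (intro exI[of _ g]) (auto simp: co_def act_mult lv)
  qed
  show "co (g * FT t) s' t' = 0" if "t \<in> tabs - tabD" "t' \<in> tabD" for t g s' t'
   using that FT_vv[of t t'] by (auto simp: co_def act_mult)
 qed
qed

end

context klr_setup
begin

lemma split_semisimple: "split_semisimple RL"
proof -
 define T where "T \<nu> = {s \<in> tabs. set s = diagram \<nu>}" for \<nu>
 have "\<exists>co. \<forall>\<nu>\<in>PP. coefficients \<nu> (co \<nu>)"
  using klr_shape.coefficients_exist[OF klr_shapeI] by (intro bchoice) blast
 then obtain co where co: "\<And>\<nu>. \<nu> \<in> PP \<Longrightarrow> coefficients \<nu> (co \<nu>)" by blast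
 note co = co[unfolded coefficients_def Let_def T_def[symmetric]]
 have co_cg: "f \<triangleq> g \<Longrightarrow> co \<nu> f = co \<nu> g" and co_add: "co \<nu> (f + g) s t = co \<nu> f s t + co \<nu> g s t"
  and co_mult: "s \<in> T \<nu> \<Longrightarrow> t \<in> T \<nu> \<Longrightarrow> co \<nu> (f * g) s t = (\<Sum>u\<in>T \<nu>. co \<nu> f s u * co \<nu> g u t)"
  and co_1: "s \<in> T \<nu> \<Longrightarrow> t \<in> T \<nu> \<Longrightarrow> co \<nu> 1 s t = (if s = t then 1 else 0)"
  and co_fconst: "co \<nu> (fconst a * f) s t = a * co \<nu> f s t"
  and co_zero: "t \<in> T \<nu> \<Longrightarrow> (\<And>s. s \<in> T \<nu> \<Longrightarrow> co \<nu> f s t = 0) \<Longrightarrow> f * FT t \<triangleq> 0"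
  and co_unit: "s \<in> T \<nu> \<Longrightarrow> t \<in> T \<nu> \<Longrightarrow> \<exists>g. \<forall>s'\<in>T \<nu>. \<forall>t'\<in>T \<nu>. co \<nu> (g * FT t) s' t' = (if s' = s \<and> t' = t then 1 else 0)"
  and co_other: "t \<in> tabs \<Longrightarrow> t \<notin> T \<nu> \<Longrightarrow> t' \<in> T \<nu> \<Longrightarrow> co \<nu> (g * FT t) s' t' = 0"
  if "\<nu> \<in> PP" for \<nu> f g s t s' t' a
 proof -
  note R1 = co[OF that]
  note R2 = conjunct2[OF R1] note R3 = conjunct2[OF R2] note R4 = conjunct2[OF R3] note R5 = conjunct2[OF R4]
  note R6 = conjunct2[OF R5] note R7 = conjunct2[OF R6]
  show "f \<triangleq> g \<Longrightarrow> co \<nu> f = co \<nu> g" by (rule conjunct1[OF R1, rule_format])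
  show "co \<nu> (f + g) s t = co \<nu> f s t + co \<nu> g s t" by (rule conjunct1[OF R2, rule_format])
  show "s \<in> T \<nu> \<Longrightarrow> t \<in> T \<nu> \<Longrightarrow> co \<nu> (f * g) s t = (\<Sum>u\<in>T \<nu>. co \<nu> f s u * co \<nu> g u t)"
   by (rule conjunct1[OF R3, rule_format])
  show "s \<in> T \<nu> \<Longrightarrow> t \<in> T \<nu> \<Longrightarrow> co \<nu> 1 s t = (if s = t then 1 else 0)" by (rule conjunct1[OF R4, rule_format])
  show "co \<nu> (fconst a * f) s t = a * co \<nu> f s t" by (rule conjunct1[OF R5, rule_format])
  show "t \<in> T \<nu> \<Longrightarrow> (\<And>s. s \<in> T \<nu> \<Longrightarrow> co \<nu> f s t = 0) \<Longrightarrow> f * FT t \<triangleq> 0"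
   by (rule conjunct1[OF R6, rule_format])
  show "\<exists>g. \<forall>s'\<in>T \<nu>. \<forall>t'\<in>T \<nu>. co \<nu> (g * FT t) s' t' = (if s' = s \<and> t' = t then 1 else 0)"
   if s: "s \<in> T \<nu>" and t: "t \<in> T \<nu>"
   using bspec[OF bspec[OF conjunct1[OF R7] s] t] .
  show "t \<in> tabs \<Longrightarrow> t \<notin> T \<nu> \<Longrightarrow> t' \<in> T \<nu> \<Longrightarrow> co \<nu> (g * FT t) s' t' = 0"
   by (rule conjunct2[OF R7, rule_format]) auto
 qed
 have co_sum: "co \<nu> (sum h A) s t = (\<Sum>x\<in>A. co \<nu> (h x) s t)" if nu: "\<nu> \<in> PP" for \<nu> s t h and A :: "node list set"
 proof (induction A rule: infinite_finite_induct)
  case (infinite A) then show ?case using co_fconst[OF nu, of 0 0 s t] by simp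
 next
  case empty then show ?case using co_fconst[OF nu, of 0 0 s t] by simp
 qed (simp add: co_add[OF nu])
 have Tne: "T \<nu> \<noteq> {}" if "\<nu> \<in> PP" for \<nu>
  using klr_shape.tabD_nonempty[OF klr_shapeI[OF that]] unfolding klr_shape.tabD_def[OF klr_shapeI[OF that]] T_def .
 have "finite PP"
 proof (rule finite_imageD)
  have "diagram ` PP \<subseteq> set ` tabs"
  proof
   fix X assume "X \<in> diagram ` PP"
   then obtain \<nu> where nu: "\<nu> \<in> PP" "X = diagram \<nu>" by blast
   obtain s where "s \<in> T \<nu>" using Tne[OF nu(1)] by blast
   then show "X \<in> set ` tabs" using nu(2) by (auto simp: T_def)
  qed
  then show "finite (diagram ` PP)" using finite_tabs finite_surj by blast
  show "inj_on diagram PP" using diagram_inject by (auto intro: inj_onI)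
 qed
 then obtain ns where ns: "set ns = PP" "distinct ns" using finite_distinct_list by blast
 have "\<forall>\<nu>. \<exists>l. set l = T \<nu> \<and> distinct l"
  by (intro allI finite_distinct_list) (simp add: T_def finite_tabs)
 then obtain ts where ts: "\<And>\<nu>. set (ts \<nu>) = T \<nu>" "\<And>\<nu>. distinct (ts \<nu>)" by metis
 define N where "N = length ns"
 define dm where "dm i = length (ts (ns ! i))" for i
 define ds where "ds = map dm [0..<N]"
 let ?S = "prod_alg {..<length ds} (\<lambda>i. module_mat TYPE('k fract laurent) (ds ! i) (ds ! i))"
 have ds: "length ds = N" "\<And>i. i < N \<Longrightarrow> ds ! i = dm i" by (simp_all add: ds_def)
 have nP: "ns ! i \<in> PP" if "i < N" for i using nth_mem[of i ns] that ns by (simp add: N_def)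
 have tT: "ts (ns ! i) ! a \<in> T (ns ! i)" if "a < dm i" for i a using nth_mem[of a "ts (ns ! i)"] that ts by (simp add: dm_def)
 define H where "H f = (\<lambda>i\<in>{..<N}. mat (dm i) (dm i) (\<lambda>(a, b). co (ns ! i) f (ts (ns ! i) ! a) (ts (ns ! i) ! b)))" for f
 have H_eqI: "H f = (\<lambda>i\<in>{..<N}. A i)"
  if "\<And>i. i < N \<Longrightarrow> A i \<in> carrier_mat (dm i) (dm i)"
   "\<And>i a b. i < N \<Longrightarrow> a < dm i \<Longrightarrow> b < dm i \<Longrightarrow> A i $$ (a, b) = co (ns ! i) f (ts (ns ! i) ! a) (ts (ns ! i) ! b)" for f A
  unfolding H_def
 proof (rule restrict_ext)
  fix i assume "i \<in> {..<N}"
  then have i: "i < N" by simp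
  show "mat (dm i) (dm i) (\<lambda>(a, b). co (ns ! i) f (ts (ns ! i) ! a) (ts (ns ! i) ! b)) = A i"
   using carrier_matD[OF that(1)[OF i]] that(2)[OF i] by (intro eq_matI) simp_all
 qed
 have H_cong: "H f = H g" if "f \<triangleq> g" for f g
  unfolding H_def by (rule restrict_ext) (simp add: co_cg[OF nP that])
 have entry: "H f i = mat (dm i) (dm i) (\<lambda>(a, b). co (ns ! i) f (ts (ns ! i) ! a) (ts (ns ! i) ! b))" if "i < N" for f i
  using that by (simp add: H_def)
 have H_carrier: "H f \<in> carrier ?S" for f
  by (auto simp: H_def prod_alg_def module_mat_def ds)
 have H_add: "H (f + g) = H f \<oplus>\<^bsub>?S\<^esub> H g" for f g
  unfolding prod_alg_def ds(1) by (simp, rule H_eqI) (simp_all add: module_mat_def ds entry co_add[OF nP])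
 have H_smult: "H (fconst a * f) = a \<odot>\<^bsub>?S\<^esub> H f" for a f
  unfolding prod_alg_def ds(1) by (simp, rule H_eqI) (simp_all add: module_mat_def ds entry co_fconst[OF nP])
 have H_1: "H 1 = \<one>\<^bsub>?S\<^esub>"
  unfolding prod_alg_def ds(1)
  by (simp, rule H_eqI) (simp_all add: module_mat_def ds co_1[OF nP] tT nth_eq_iff_index_eq[OF ts(2)] dm_def)
 have H_mult: "H (f * g) = H f \<otimes>\<^bsub>?S\<^esub> H g" for f g
 proof -
  have "(H f i * H g i) $$ (a, b) = co (ns ! i) (f * g) (ts (ns ! i) ! a) (ts (ns ! i) ! b)"
   if i: "i < N" and ab: "a < dm i" "b < dm i" for i a b
  proof -
   let ?l = "ts (ns ! i)"
   have "bij_betw (\<lambda>k. ?l ! k) {0..<dm i} (T (ns ! i))"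
    using bij_betw_nth[OF ts(2), of "{0..<dm i}" "ns ! i" "T (ns ! i)"] ts(1) by (simp add: dm_def lessThan_atLeast0)
   from sum.reindex_bij_betw[OF this, of "\<lambda>u. co (ns ! i) f (?l ! a) u * co (ns ! i) g u (?l ! b)"]
   show ?thesis using i ab by (simp add: entry scalar_prod_def co_mult[OF nP[OF i] tT tT])
  qed
  moreover have "H f i * H g i \<in> carrier_mat (dm i) (dm i)" if "i < N" for i
   using that by (intro mult_carrier_mat[of _ "dm i" "dm i"]) (simp_all add: entry)
  ultimately have "H (f * g) = (\<lambda>i\<in>{..<N}. H f i * H g i)" by (intro H_eqI)
  then show ?thesis by (simp add: prod_alg_def module_mat_def ds(1))
 qed
 have H_inj: "f \<triangleq> g" if eq: "H f = H g" for f g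
 proof -
  have z: "(f - g) * FT t \<triangleq> 0" if t: "t \<in> tabs" for t
  proof -
   obtain \<nu> where nu: "\<nu> \<in> PP" "diagram \<nu> = set t" using tabs_shape[OF t] by blast
   have tT': "t \<in> T \<nu>" using t nu(2) by (simp add: T_def)
   have "\<nu> \<in> set ns" using nu(1) ns(1) by simp
   then obtain i where i: "i < N" "ns ! i = \<nu>" unfolding in_set_conv_nth N_def by blast
   have tsn: "\<exists>a<dm i. ts \<nu> ! a = s" if "s \<in> T \<nu>" for s
   proof -
    have "s \<in> set (ts \<nu>)" using that ts(1) by simp
    then show ?thesis unfolding in_set_conv_nth dm_def i(2) by blast
   qed
   have "co \<nu> (f - g) s t = 0" if s: "s \<in> T \<nu>" for s
   proof -
    obtain a where a: "a < dm i" "ts \<nu> ! a = s" using tsn[OF s] by blast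
    obtain b where b: "b < dm i" "ts \<nu> ! b = t" using tsn[OF tT'] by blast
    have "H f i $$ (a, b) = H g i $$ (a, b)" using eq by simp
    then have "co \<nu> f s t = co \<nu> g s t" using a b i by (simp add: entry)
    then show ?thesis using co_add[OF nu(1), of "f - g" g s t] by simp
   qed
   then show ?thesis by (rule co_zero[OF nu(1) tT'])
  qed
  \<comment> \<open>Equal matrices give \<open>(f - g) * FT t = 0\<close> for each \<open>t\<close>,
    whatever its shape, and the projections sum to 1.\<close>
  have "(f - g) * 1 \<triangleq> (f - g) * (\<Sum>t\<in>tabs. FT t)" by (rule cg_lmult[OF cg_sym[OF FT_sum]])
  also have "\<dots> = (\<Sum>t\<in>tabs. (f - g) * FT t)" by (simp add: sum_distrib_left)
  also have "\<dots> \<triangleq> (\<Sum>t\<in>tabs. 0)" by (rule cg_sum[OF z])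
  finally show ?thesis by (simp add: cg_def)
 qed
 have H_surj: "\<exists>f. H f = F" if F: "F \<in> carrier ?S" for F
 proof -
  \<comment> \<open>The shape of a standard list is recovered from its set of nodes, so that the
    entries of \<open>F\<close> can be indexed by pairs of lists.\<close>
  define nu where "nu t = (THE \<nu>. \<nu> \<in> PP \<and> diagram \<nu> = set t)" for t
  have nu: "nu t = \<nu>" if "t \<in> T \<nu>" "\<nu> \<in> PP" for t \<nu>
   unfolding nu_def using that diagram_inject by (intro the_equality) (auto simp: T_def)
  define cc where "cc s t = F (place ns (nu t)) $$ (place (ts (nu t)) s, place (ts (nu t)) t)" for s t
  have cc: "cc (ts (ns ! i) ! a) (ts (ns ! i) ! b) = F i $$ (a, b)" if "i < N" "a < dm i" "b < dm i" for i a b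
   using that nu[OF tT[of b i] nP] place_nth[OF ns(2), of i] place_nth[OF ts(2), of _ "ns ! i"]
   by (simp add: cc_def N_def dm_def)
  have "\<exists>g. \<forall>\<nu>\<in>PP. \<forall>s'\<in>T \<nu>. \<forall>t'\<in>T \<nu>. co \<nu> (g * FT t) s' t' = (if s' = s \<and> t' = t then 1 else 0)"
   if st: "s \<in> tabs" "t \<in> tabs" "set s = set t" for s t
  proof -
   obtain \<mu> where mu: "\<mu> \<in> PP" "diagram \<mu> = set t" using tabs_shape[OF st(2)] by blast
   obtain g where g: "\<forall>s'\<in>T \<mu>. \<forall>t'\<in>T \<mu>. co \<mu> (g * FT t) s' t' = (if s' = s \<and> t' = t then 1 else 0)"
    using co_unit[OF mu(1), of s t] st mu(2) by (auto simp: T_def)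
   show ?thesis
   proof (intro exI[of _ g] ballI)
    fix \<nu> s' t' assume h: "\<nu> \<in> PP" "s' \<in> T \<nu>" "t' \<in> T \<nu>"
    show "co \<nu> (g * FT t) s' t' = (if s' = s \<and> t' = t then 1 else 0)"
    proof (cases "\<nu> = \<mu>")
     case True then show ?thesis using g h by blast
    next
     case False
     then have "t \<notin> T \<nu>" using diagram_inject[OF h(1) mu(1)] mu(2) by (auto simp: T_def)
     then show ?thesis using co_other[OF h(1) st(2) _ h(3)] h(3) by auto
    qed
   qed
  qed
  then obtain g where g: "\<And>s t \<nu> s' t'. s \<in> tabs \<Longrightarrow> t \<in> tabs \<Longrightarrow> set s = set t \<Longrightarrow> \<nu> \<in> PP \<Longrightarrow> s' \<in> T \<nu> \<Longrightarrow> t' \<in> T \<nu> \<Longrightarrow>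
    co \<nu> (g s t * FT t) s' t' = (if s' = s \<and> t' = t then 1 else 0)"
   by metis
  \<comment> \<open>A prescribed family of matrices is assembled from matrix units; the factor
    \<open>FT t\<close> keeps each summand from affecting the other shapes.\<close>
  define f where "f = (\<Sum>t\<in>tabs. \<Sum>s\<in>{s\<in>tabs. set s = set t}. fconst (cc s t) * (g s t * FT t))"
  have f: "co \<nu> f s' t' = cc s' t'" if h: "\<nu> \<in> PP" "s' \<in> T \<nu>" "t' \<in> T \<nu>" for \<nu> s' t'
  proof -
   have "co \<nu> f s' t' = (\<Sum>t\<in>tabs. \<Sum>s\<in>{s\<in>tabs. set s = set t}. if s' = s then if t' = t then cc s t else 0 else 0)"
    unfolding f_def co_sum[OF h(1)] co_fconst[OF h(1)]
    by (intro sum.cong refl) (use g h in auto)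
   also have "\<dots> = (\<Sum>t\<in>tabs. if t' = t then cc s' t else 0)"
    using finite_tabs h by (intro sum.cong refl) (auto simp: T_def)
   also have "\<dots> = cc s' t'" using finite_tabs h by (simp add: T_def)
   finally show ?thesis .
  qed
  have "H f = (\<lambda>i\<in>{..<N}. F i)"
  proof (rule H_eqI)
   show "F i \<in> carrier_mat (dm i) (dm i)" if "i < N" for i
    using F that by (auto simp: prod_alg_def module_mat_def ds PiE_iff)
  qed (simp add: f[OF nP tT tT] cc)
  also have "\<dots> = F" using F by (auto simp: prod_alg_def ds PiE_iff extensional_restrict)
  finally show ?thesis by blast
 qed
 define h where "h \<xi> = H (SOME f. \<Theta> f = \<xi>)" for \<xi>
 have h: "h (\<Theta> f) = H f" for f
  unfolding h_def by (rule H_cong) (simp add: cg_\<Theta>, rule someI[of "\<lambda>g. \<Theta> g = \<Theta> f"], rule refl)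
 have "h \<in> alg_iso RL ?S"
  unfolding alg_iso_def ring_iso_def
 proof (intro CollectI conjI allI ballI)
  show "h \<in> Ring.ring_hom RL ?S"
   by (rule ring_hom_memI) (auto simp: \<Theta>_carrier h H_carrier \<Theta>_mult \<Theta>_add \<Theta>_1 H_mult H_add H_1)
  show "bij_betw h (carrier RL) (carrier ?S)"
  proof (rule bij_betw_imageI)
   show "inj_on h (carrier RL)"
   proof (rule inj_onI)
    fix x y assume x: "x \<in> carrier RL" and y: "y \<in> carrier RL" and eq: "h x = h y"
    obtain f where f: "x = \<Theta> f" using x unfolding \<Theta>_carrier by blast
    obtain g where g: "y = \<Theta> g" using y unfolding \<Theta>_carrier by blast
    have "H f = H g" using eq unfolding f g h .
    then show "x = y" unfolding f g cg_\<Theta>[symmetric] by (rule H_inj)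
   qed
   show "h ` carrier RL = carrier ?S"
   proof
    show "h ` carrier RL \<subseteq> carrier ?S" using H_carrier by (auto simp: \<Theta>_carrier h)
    show "carrier ?S \<subseteq> h ` carrier RL"
    proof
     fix F assume "F \<in> carrier ?S"
     from H_surj[OF this] obtain f where "H f = F" by blast
     then have "F = h (\<Theta> f)" by (simp add: h)
     then show "F \<in> h ` carrier RL" using \<Theta>_carrier by blast
    qed
   qed
  qed
  show "h (a \<odot>\<^bsub>RL\<^esub> x) = a \<odot>\<^bsub>?S\<^esub> h x" if x: "x \<in> carrier RL" for a x
  proof -
   obtain f where "x = \<Theta> f" using x unfolding \<Theta>_carrier by blast
   then show ?thesis by (simp add: \<Theta>_smult h H_smult)
  qed
 qed
 moreover have "0 < d" if d: "d \<in> set ds" for d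
 proof -
  obtain i where i: "i < N" "d = dm i" using d by (auto simp: ds_def)
  have "set (ts (ns ! i)) \<noteq> {}" using Tne[OF nP[OF i(1)]] ts(1) by simp
  then show ?thesis by (simp add: i(2) dm_def)
 qed
 ultimately show ?thesis unfolding split_semisimple_def by blast
qed

end

theorem corollary3p7p6:
  fixes ty :: cartan_type and e n :: nat
    and Q :: "nat \<Rightarrow> nat \<Rightarrow> 'k::idom poly poly poly"
    and W :: "nat \<Rightarrow> 'k poly poly"
    and \<rho> :: "nat \<Rightarrow> nat"
    and c :: "nat \<Rightarrow> int \<Rightarrow> 'k poly" and r :: "nat \<Rightarrow> int \<Rightarrow> nat"
  assumes "admissible_rank ty e"
    and "Q_polynomials ty e Q"
    and "weight_polynomials ty e W"
    and "level e W \<ge> 1"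
    and "\<forall>l\<in>{1..level e W}. \<rho> l < e"
    and "\<forall>i<e. card {l\<in>{1..level e W}. \<rho> l = i} = degree (W i)"
    and "graded_content_system ty e n Q W \<rho> c r"
  shows "let R = klr_laurent e n Q W;
      G = klr_laurent_grading ty e n Q W;
      P = multipartitions (level e W) n
    in
    split_semisimple R \<and>
    (\<forall>\<nu>\<in>P. \<exists>M. is_V ty e n Q W c r \<nu> M) \<and>
    (\<forall>V. (\<forall>\<nu>\<in>P. is_V ty e n Q W c r \<nu> (V \<nu>)) \<longrightarrow>
      (\<forall>\<nu>\<in>P. irreducible_graded_module R G (V \<nu>)) \<and>
      (\<forall>\<nu>\<in>P. \<forall>\<mu>\<in>P. graded_isomorphic R (V \<nu>) (V \<mu>) \<longrightarrow> \<nu> = \<mu>) \<and>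
      (\<forall>M :: ('k klr_laurent_elt, 'm) gmodule. irreducible_graded_module R G M \<longrightarrow>
        (\<exists>\<nu>\<in>P. graded_isomorphic R M (V \<nu>))))"
proof -
  interpret klr_setup ty e n Q W \<rho> c r
    by (rule klr_setup.intro[OF assms(1,2,7)])
  show ?thesis
    unfolding Let_def
  proof (intro conjI allI ballI impI)
    show "split_semisimple RL" by (rule split_semisimple)
    show "\<exists>M. is_V ty e n Q W c r \<nu> M" if "\<nu> \<in> PP" for \<nu> by (rule V_exists[OF that])
    fix V assume "\<forall>\<nu>\<in>PP. is_V ty e n Q W c r \<nu> (V \<nu>)"
    then have V: "is_V ty e n Q W c r \<nu> (V \<nu>)" if "\<nu> \<in> PP" for \<nu> using that by (rule bspec)
    show "irreducible_graded_module RL GL (V \<nu>)" if "\<nu> \<in> PP" for \<nu>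
      by (rule V_irreducible[OF that V[OF that]])
    show "\<nu> = \<mu>" if nu: "\<nu> \<in> PP" and mu: "\<mu> \<in> PP" and iso: "graded_isomorphic RL (V \<nu>) (V \<mu>)" for \<nu> \<mu>
      by (rule V_not_isomorphic[OF nu V[OF nu] mu V[OF mu] iso])
    show "\<exists>\<nu>\<in>PP. graded_isomorphic RL M (V \<nu>)" if irr: "irreducible_graded_module RL GL M"
      for M :: "('k klr_laurent_elt, 'm) gmodule"
    proof (rule V_complete[where V = V and M = M])
      show "irreducible_graded_module RL GL M" by (rule irr)
      show "is_V ty e n Q W c r \<nu> (V \<nu>)" if "\<nu> \<in> PP" for \<nu> by (rule V[OF that])
    qed
  qed
qed

end
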